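(* There exist constants $C,C_0>0$, depending only on the fixed cutoff function $\varphi_1$, such that for every dyadic $N\ge2$, every $0<T\le1$ and every $f\in L^2(\mathbb R^2)$, $$\|U(t)P_Nf\|_{L^2_xL^\infty_{y,T}}+\|U(t)P_Nf\|_{L^2_yL^\infty_{x,T}}\le C\,N^{1/2}(1+\log N)^{C_0}\,\|P_Nf\|_{L^2}.$$ One may take $C_0=1$. Consequently, for every $\varepsilon>0$ the factor $CN^{1/2}(1+\log N)^{C_0}$ may be replaced by $C_\varepsilon N^{1/2+\varepsilon}$. The power $1/2$ is optimal: for no $\delta>0$ can the estimate hold, uniformly in $N$, with the factor $N^{1/2}(1+\log N)^{C_0}$ replaced by $N^{1/2-\delta}$.
   Context: With $\widehat f(\xi,\eta)=\int_{\mathbb R^2}e^{-i(x\xi+y\eta)}f(x,y)\,dx\,dy$, the group $U(t)$ is defined by $\widehat{U(t)f}(\xi,\eta)=e^{it\omega(\xi,\eta)}\widehat f(\xi,\eta)$, $\omega(\xi,\eta)=\xi(\eta^2-|\xi|)$. $P_N$ is the Fourier multiplier with symbol $\varphi_1(\zeta/N)$, $\zeta=(\xi,\eta)$, where $\varphi_1\in C_c^\infty(\mathbb R^2)$ is fixed, supported in $\{1/2\le|\zeta|\le2\}$ and equal to one on $\{3/4\le|\zeta|\le3/2\}$. Dyadic means a power of $2$. The mixed norms are $$\|g\|_{L^2_xL^\infty_{y,T}}=\Big(\int_{\mathbb R}\sup_{(y,t)\in\mathbb R\times[0,T]}|g(x,y,t)|^2\,dx\Big)^{1/2},$$ and $\|g\|_{L^2_yL^\infty_{x,T}}$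 is obtained by exchanging the roles of $x$ and $y$. *)

theory Defs
  imports "HOL-Analysis.Analysis"
begin

text \<open>The plane is \<^typ>\<open>real \<times> real\<close>, whose norm is Euclidean and whose inner product
  is \<open>(x, y) \<bullet> (\<xi>, \<eta>) = x * \<xi> + y * \<eta>\<close>.\<close>

primrec C_k :: "nat \<Rightarrow> (real \<times> real \<Rightarrow> complex) \<Rightarrow> bool" where
  "C_k 0 f \<longleftrightarrow> continuous_on UNIV f"
| "C_k (Suc k) f \<longleftrightarrow> f differentiable_on UNIV \<and> (\<forall>v. C_k k (\<lambda>p. frechet_derivative f (at p) v))"

definition smooth :: "(real \<times> real \<Rightarrow> complex) \<Rightarrow> bool" where
  "smooth f \<longleftrightarrow> (\<forall>k. C_k k f)"

definition cutoff :: "(real \<times> real \<Rightarrow> complex) \<Rightarrow> bool" where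
  "cutoff \<phi> \<longleftrightarrow> smooth \<phi> \<and>
     closure {\<zeta>. \<phi> \<zeta> \<noteq> 0} \<subseteq> {\<zeta>. 1/2 \<le> norm \<zeta> \<and> norm \<zeta> \<le> 2} \<and>
     (\<forall>\<zeta>. 3/4 \<le> norm \<zeta> \<and> norm \<zeta> \<le> 3/2 \<longrightarrow> \<phi> \<zeta> = 1)"

definition dyadic :: "real \<Rightarrow> bool" where
  "dyadic N \<longleftrightarrow> (\<exists>k::int. N = 2 powi k)"

definition ennsqrt :: "ennreal \<Rightarrow> ennreal" where
  "ennsqrt a = (if a = \<infinity> then \<infinity> else ennreal (sqrt (enn2real a)))"

definition L2_norm :: "(real \<times> real \<Rightarrow> complex) \<Rightarrow> ennreal" where
  "L2_norm f = ennsqrt (\<integral>\<^sup>+p. ennreal ((cmod (f p))\<^sup>2) \<partial>lborel)"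

definition in_L2 :: "(real \<times> real \<Rightarrow> complex) \<Rightarrow> bool" where
  "in_L2 f \<longleftrightarrow> f \<in> borel_measurable borel \<and> L2_norm f < \<infinity>"

definition fourier_integral :: "(real \<times> real \<Rightarrow> complex) \<Rightarrow> real \<times> real \<Rightarrow> complex" where
  "fourier_integral f \<zeta> = (\<integral>p. exp (- \<i> * complex_of_real (p \<bullet> \<zeta>)) * f p \<partial>lborel)"

text \<open>\<open>g\<close> represents the \<open>L\<^sup>2\<close> (Plancherel) Fourier transform of \<open>f\<close>: it is the \<open>L\<^sup>2\<close> limit of the
  Fourier integrals of the truncations of \<open>f\<close> to balls.\<close>

definition is_fourier_L2 :: "(real \<times> real \<Rightarrow> complex) \<Rightarrow> (real \<times> real \<Rightarrow> complex) \<Rightarrow> bool" where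
  "is_fourier_L2 f g \<longleftrightarrow> in_L2 g \<and>
     ((\<lambda>R::real. L2_norm (\<lambda>\<zeta>. fourier_integral (\<lambda>p. indicator (cball 0 R) p * f p) \<zeta> - g \<zeta>))
        \<longlongrightarrow> 0) at_top"

definition fourier_L2 :: "(real \<times> real \<Rightarrow> complex) \<Rightarrow> real \<times> real \<Rightarrow> complex" where
  "fourier_L2 f = (SOME g. is_fourier_L2 f g)"

text \<open>The inverse transform of an integrable function is taken pointwise, by the inversion
  integral. This picks the continuous representative, which the suprema in the mixed norms
  below need. Otherwise any representative of the inverse \<open>L\<^sup>2\<close> transform is taken.\<close>

definition inv_fourier_L2 :: "(real \<times> real \<Rightarrow> complex) \<Rightarrow> real \<times> real \<Rightarrow> complex" where
  "inv_fourier_L2 g =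
     (if integrable lborel g
      then (\<lambda>p. complex_of_real (1 / (2 * pi)\<^sup>2) *
                (\<integral>\<zeta>. exp (\<i> * complex_of_real (p \<bullet> \<zeta>)) * g \<zeta> \<partial>lborel))
      else (SOME f. in_L2 f \<and> is_fourier_L2 f g))"

definition fourier_multiplier ::
    "(real \<times> real \<Rightarrow> complex) \<Rightarrow> (real \<times> real \<Rightarrow> complex) \<Rightarrow> real \<times> real \<Rightarrow> complex" where
  "fourier_multiplier m f = inv_fourier_L2 (\<lambda>\<zeta>. m \<zeta> * fourier_L2 f \<zeta>)"

definition omega :: "real \<times> real \<Rightarrow> real" where
  "omega = (\<lambda>(\<xi>, \<eta>). \<xi> * (\<eta>\<^sup>2 - \<bar>\<xi>\<bar>))"

definition U :: "real \<Rightarrow> (real \<times> real \<Rightarrow> complex) \<Rightarrow> real \<times> real \<Rightarrow> complex" where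
  "U t = fourier_multiplier (\<lambda>\<zeta>. exp (\<i> * complex_of_real (t * omega \<zeta>)))"

definition P :: "(real \<times> real \<Rightarrow> complex) \<Rightarrow> real \<Rightarrow> (real \<times> real \<Rightarrow> complex) \<Rightarrow>
    real \<times> real \<Rightarrow> complex" where
  "P \<phi> N = fourier_multiplier (\<lambda>\<zeta>. \<phi> (\<zeta> /\<^sub>R N))"

definition norm_L2x_Linf_yT :: "real \<Rightarrow> (real \<Rightarrow> real \<Rightarrow> real \<Rightarrow> complex) \<Rightarrow> ennreal" where
  "norm_L2x_Linf_yT T g =
     ennsqrt (\<integral>\<^sup>+x. (SUP (y, t) \<in> UNIV \<times> {0..T}. ennreal ((cmod (g x y t))\<^sup>2)) \<partial>lborel)"

definition norm_L2y_Linf_xT :: "real \<Rightarrow> (real \<Rightarrow> real \<Rightarrow> real \<Rightarrow> complex) \<Rightarrow> ennreal" where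
  "norm_L2y_Linf_xT T g =
     ennsqrt (\<integral>\<^sup>+y. (SUP (x, t) \<in> UNIV \<times> {0..T}. ennreal ((cmod (g x y t))\<^sup>2)) \<partial>lborel)"

definition maximal_estimate :: "(real \<times> real \<Rightarrow> complex) \<Rightarrow> (real \<Rightarrow> real) \<Rightarrow> bool" where
  "maximal_estimate \<phi> A \<longleftrightarrow>
     (\<forall>N T f. dyadic N \<and> N \<ge> 2 \<and> 0 < T \<and> T \<le> 1 \<and> in_L2 f \<longrightarrow>
        norm_L2x_Linf_yT T (\<lambda>x y t. U t (P \<phi> N f) (x, y)) +
        norm_L2y_Linf_xT T (\<lambda>x y t. U t (P \<phi> N f) (x, y))
          \<le> ennreal (A N) * L2_norm (P \<phi> N f))"

end

theory Submission
  imports Defs "HOL-Probability.Probability" "HOL-Complex_Analysis.Complex_Analysis"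
begin

text \<open>
  On the frequency side \<open>U(t) P\<^sub>N f\<close> is an extension integral of a function supported in a disc of
  radius \<open>2 N\<close>. By the \<open>T T\<^sup>*\<close> method with linearised suprema and Schur's test, the square of the
  maximal norm in \<open>x\<close> is controlled by the \<open>L\<^sup>1\<close> norm in \<open>x\<close> of the supremum over \<open>y\<close> and
  \<open>\<bar>t\<bar> \<le> 1\<close> of a smoothed kernel (and symmetrically in \<open>y\<close>). With a Gaussian weight the
  \<open>\<eta>\<close>-integral in this kernel is explicit; what remains is a one-dimensional oscillatory integral in
  \<open>\<xi>\<close>, which van der Corput's lemma on dyadic pieces bounds by \<open>N (1 + log N) / \<bar>x\<bar>\<close>, uniformly in
  \<open>y\<close> and \<open>t\<close>. Together with the trivial bound \<open>N\<^sup>2\<close> near the origin and quadratic decay at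
  infinity, the \<open>L\<^sup>1\<close> norm is \<open>O(N (1 + log N)\<^sup>2)\<close>; the square root gives the estimate with
  exponent one on the logarithm. For optimality take the indicator of a square of side comparable to
  \<open>N\<close> on the frequency side and evaluate at \<open>t = 0\<close>.
\<close>

section \<open>Van der Corput estimates\<close>

text \<open>The two logarithms have separate sources. After rescaling, the Gaussian integral leaves
  \<open>osc_phase\<close>, whose natural variable is s = \<sigma> u with \<sigma> up to N^3; about
  log N dyadic blocks in s occur, each contributing O(1/|X|). The second logarithm is the integral
  of 1/|X| from 1 to N^6. The obstacle is uniformity in y and t: the y-dependent part of the phase
  can compete with the quadratic term \<kappa> u^2. What saves the argument is a sign: for s^2 > 3
  both contributions to the second derivative are negative, so no degenerate stationary point
  occurs, while for s \<le> 4 the damping exp (- q / (1 + s^2)), q = Y^2 / 4, makes large q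
  harmless. The nonsmooth |\<xi>| costs nothing, because after the Gaussian integration the
  integrand is Hermitian in u and folds to u \<ge> 0. Since \<open>U\<close> and \<open>P\<close>
  are defined through the L^2 Fourier transform, Plancherel's theorem and the existence and almost
  everywhere uniqueness of that transform have to be established before the kernel bound says
  anything about functions in the plane.\<close>

lemma cis_phase_has_vector_derivative:
  assumes "(\<Psi> has_real_derivative d) (at u within S)"
  shows "((\<lambda>u. cis (\<Psi> u)) has_vector_derivative \<i> * complex_of_real d * cis (\<Psi> u)) (at u within S)"
proof -
  have "((\<lambda>u. \<i> * complex_of_real (\<Psi> u)) has_vector_derivative \<i> * complex_of_real d) (at u within S)"
    using assms by (intro has_vector_derivative_mult_right has_vector_derivative_of_real)
      (simp add: has_real_derivative_iff_has_vector_derivative)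
  from field_vector_diff_chain_within[OF this DERIV_subset[OF DERIV_exp]]
  show ?thesis by (simp add: o_def cis_conv_exp)
qed

text \<open>Nonstationary phase: one integration by parts against \<open>a / (\<i> \<Psi>')\<close>.\<close>

lemma oscillatory_by_parts:
  fixes \<Psi> \<Psi>' \<Psi>'' :: "real \<Rightarrow> real" and a a' :: "real \<Rightarrow> complex"
  assumes ab: "\<alpha> \<le> \<beta>"
    and \<Psi>: "\<And>u. u \<in> {\<alpha>..\<beta>} \<Longrightarrow> (\<Psi> has_real_derivative \<Psi>' u) (at u within {\<alpha>..\<beta>})"
    and \<Psi>': "\<And>u. u \<in> {\<alpha>..\<beta>} \<Longrightarrow> (\<Psi>' has_real_derivative \<Psi>'' u) (at u within {\<alpha>..\<beta>})"
    and a: "\<And>u. u \<in> {\<alpha>..\<beta>} \<Longrightarrow> (a has_vector_derivative a' u) (at u within {\<alpha>..\<beta>})"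
    and "\<rho> > 0" and lam: "\<And>u. u \<in> {\<alpha>..\<beta>} \<Longrightarrow> \<rho> \<le> \<bar>\<Psi>' u\<bar>"
    and A: "\<And>u. u \<in> {\<alpha>..\<beta>} \<Longrightarrow> norm (a u) \<le> A"
    and A1: "\<And>u. u \<in> {\<alpha>..\<beta>} \<Longrightarrow> norm (a' u) \<le> A1"
    and I: "((\<lambda>u. \<bar>\<Psi>'' u\<bar> / (\<Psi>' u)\<^sup>2) has_integral I) {\<alpha>..\<beta>}"
  shows "norm (integral {\<alpha>..\<beta>} (\<lambda>u. a u * cis (\<Psi> u))) \<le> (2 * A + A1 * (\<beta> - \<alpha>)) / \<rho> + A * I"
proof -
  have nz: "\<Psi>' u \<noteq> 0" if "u \<in> {\<alpha>..\<beta>}" for u using lam[OF that] \<open>\<rho> > 0\<close> by auto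
  \<comment> \<open>\<open>F\<close> is the boundary term a e^(i \<Psi>) / (i \<Psi>'), and
    \<open>R\<close> collects what differentiating a / \<Psi>' leaves over, so that F' is the
    integrand plus \<open>R\<close>.\<close>
  define F where "F = (\<lambda>u. a u * cis (\<Psi> u) * (- \<i> * complex_of_real (inverse (\<Psi>' u))))"
  define R where "R = (\<lambda>u. - \<i> * cis (\<Psi> u) * (a' u * complex_of_real (inverse (\<Psi>' u))
        - a u * complex_of_real (\<Psi>'' u / (\<Psi>' u)\<^sup>2)))"
  have dinv: "((\<lambda>u. complex_of_real (inverse (\<Psi>' u))) has_vector_derivative
      complex_of_real (- (\<Psi>'' u / (\<Psi>' u)\<^sup>2))) (at u within {\<alpha>..\<beta>})" if "u \<in> {\<alpha>..\<beta>}" for u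
  proof -
    have "((\<lambda>u. inverse (\<Psi>' u)) has_real_derivative (- (\<Psi>'' u / (\<Psi>' u)\<^sup>2))) (at u within {\<alpha>..\<beta>})"
      using \<Psi>'[OF that] nz[OF that]
      by (auto intro!: derivative_eq_intros simp: field_simps power2_eq_square)
    then show ?thesis
      by (intro has_vector_derivative_of_real) (simp add: has_real_derivative_iff_has_vector_derivative)
  qed
  have dF: "(F has_vector_derivative (a u * cis (\<Psi> u) + R u)) (at u within {\<alpha>..\<beta>})" if u: "u \<in> {\<alpha>..\<beta>}" for u
    unfolding F_def R_def
    apply (rule has_vector_derivative_eq_rhs)
     apply (rule has_vector_derivative_mult[OF has_vector_derivative_mult[OF a[OF u] cis_phase_has_vector_derivative[OF \<Psi>[OF u]]]
          has_vector_derivative_mult_right[OF dinv[OF u]]])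
    using nz[OF u] by (simp add: field_simps power2_eq_square)
  have FI: "((\<lambda>u. a u * cis (\<Psi> u) + R u) has_integral (F \<beta> - F \<alpha>)) {\<alpha>..\<beta>}"
    using ab dF by (rule fundamental_theorem_of_calculus)
  have cont: "continuous_on {\<alpha>..\<beta>} (\<lambda>u. a u * cis (\<Psi> u))"
  proof -
    have "continuous_on {\<alpha>..\<beta>} a"
      using a by (meson continuous_on_eq_continuous_within has_vector_derivative_continuous)
    moreover have "continuous_on {\<alpha>..\<beta>} (\<lambda>u. cis (\<Psi> u))"
      using cis_phase_has_vector_derivative[OF \<Psi>]
      by (meson continuous_on_eq_continuous_within has_vector_derivative_continuous)
    ultimately show ?thesis by (rule continuous_on_mult)
  qed
  then have ig: "(\<lambda>u. a u * cis (\<Psi> u)) integrable_on {\<alpha>..\<beta>}" by (rule integrable_continuous_interval)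
  have RI: "(R has_integral (F \<beta> - F \<alpha> - integral {\<alpha>..\<beta>} (\<lambda>u. a u * cis (\<Psi> u)))) {\<alpha>..\<beta>}"
    using has_integral_diff[OF FI integrable_integral[OF ig]] by simp
  have Rb: "norm (R u) \<le> A1 / \<rho> + A * (\<bar>\<Psi>'' u\<bar> / (\<Psi>' u)\<^sup>2)" if u: "u \<in> {\<alpha>..\<beta>}" for u
  proof -
    have "norm (R u) \<le> norm (a' u) * \<bar>inverse (\<Psi>' u)\<bar> + norm (a u) * \<bar>\<Psi>'' u / (\<Psi>' u)\<^sup>2\<bar>"
      unfolding R_def norm_mult by (rule order_trans[OF _ order_trans[OF norm_triangle_ineq4]]) (auto simp: norm_mult norm_divide norm_inverse norm_power)
    also have "\<dots> \<le> A1 * (1 / \<rho>) + A * (\<bar>\<Psi>'' u\<bar> / (\<Psi>' u)\<^sup>2)"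
    proof (intro add_mono mult_mono)
      show "\<bar>inverse (\<Psi>' u)\<bar> \<le> 1 / \<rho>"
        using lam[OF u] \<open>\<rho> > 0\<close> nz[OF u] by (auto simp: field_simps abs_inverse)
    qed (use A[OF u] A1[OF u] in \<open>auto simp: order_trans[OF norm_ge_zero]\<close>)
    finally show ?thesis by simp
  qed
  have "((\<lambda>u. A1 / \<rho> + A * (\<bar>\<Psi>'' u\<bar> / (\<Psi>' u)\<^sup>2)) has_integral (A1 / \<rho> * (\<beta> - \<alpha>) + A * I)) {\<alpha>..\<beta>}"
    using has_integral_add[OF has_integral_const_real[of "A1 / \<rho>" \<alpha> \<beta>] has_integral_mult_right[OF I, of A]] ab
    by (simp add: mult.commute)
  from has_integral_norm_bound_integral_component[of R] this RI Rb
  have "norm (F \<beta> - F \<alpha> - integral {\<alpha>..\<beta>} (\<lambda>u. a u * cis (\<Psi> u))) \<le> A1 / \<rho> * (\<beta> - \<alpha>) + A * I"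
    by (metis (no_types, lifting) integral_norm_bound_integral integral_unique has_integral_integrable)
  moreover have Fb: "norm (F u) \<le> A / \<rho>" if u: "u \<in> {\<alpha>..\<beta>}" for u
  proof -
    have "norm (F u) = norm (a u) * (1 / \<bar>\<Psi>' u\<bar>)"
      unfolding F_def by (simp add: norm_mult norm_inverse divide_inverse)
    also have "\<dots> \<le> A * (1 / \<rho>)"
      using lam[OF u] \<open>\<rho> > 0\<close> A[OF u]
      by (intro mult_mono) (auto simp: field_simps order_trans[OF norm_ge_zero])
    finally show ?thesis by simp
  qed
  ultimately have "norm (integral {\<alpha>..\<beta>} (\<lambda>u. a u * cis (\<Psi> u))) \<le> A / \<rho> + A / \<rho> + (A1 / \<rho> * (\<beta> - \<alpha>) + A * I)"
    using Fb[of \<alpha>] Fb[of \<beta>] ab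
    by (smt (verit, best) atLeastAtMost_iff norm_triangle_ineq3 norm_triangle_ineq4)
  then show ?thesis by (simp add: add_divide_distrib diff_divide_distrib algebra_simps)
qed

text \<open>The crude evaluation of the free parameter \<open>I\<close> of
  \<open>oscillatory_by_parts\<close>: maximum of the integrand times length. It costs a bound on
  \<Psi>'' but allows either sign of it, which suits the regime where |X| dominates the phase
  derivative.\<close>

lemma van_der_Corput_nonstationary:
  fixes \<Psi> \<Psi>' \<Psi>'' :: "real \<Rightarrow> real" and a a' :: "real \<Rightarrow> complex"
  assumes ab: "\<alpha> \<le> \<beta>"
    and \<Psi>: "\<And>u. u \<in> {\<alpha>..\<beta>} \<Longrightarrow> (\<Psi> has_real_derivative \<Psi>' u) (at u within {\<alpha>..\<beta>})"
    and \<Psi>': "\<And>u. u \<in> {\<alpha>..\<beta>} \<Longrightarrow> (\<Psi>' has_real_derivative \<Psi>'' u) (at u within {\<alpha>..\<beta>})"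
    and c: "continuous_on {\<alpha>..\<beta>} \<Psi>''"
    and a: "\<And>u. u \<in> {\<alpha>..\<beta>} \<Longrightarrow> (a has_vector_derivative a' u) (at u within {\<alpha>..\<beta>})"
    and "\<rho> > 0" and lam: "\<And>u. u \<in> {\<alpha>..\<beta>} \<Longrightarrow> \<rho> \<le> \<bar>\<Psi>' u\<bar>"
    and A: "\<And>u. u \<in> {\<alpha>..\<beta>} \<Longrightarrow> norm (a u) \<le> A"
    and A1: "\<And>u. u \<in> {\<alpha>..\<beta>} \<Longrightarrow> norm (a' u) \<le> A1"
    and B: "\<And>u. u \<in> {\<alpha>..\<beta>} \<Longrightarrow> \<bar>\<Psi>'' u\<bar> \<le> B"
  shows "norm (integral {\<alpha>..\<beta>} (\<lambda>u. a u * cis (\<Psi> u)))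
     \<le> (2 * A + A1 * (\<beta> - \<alpha>)) / \<rho> + A * (B * (\<beta> - \<alpha>) / \<rho>\<^sup>2)"
proof -
  have nz: "\<Psi>' u \<noteq> 0" if "u \<in> {\<alpha>..\<beta>}" for u using lam[OF that] \<open>\<rho> > 0\<close> by auto
  have c': "continuous_on {\<alpha>..\<beta>} \<Psi>'"
    using \<Psi>' by (meson DERIV_continuous continuous_on_eq_continuous_within)
  have "continuous_on {\<alpha>..\<beta>} (\<lambda>u. \<bar>\<Psi>'' u\<bar> / (\<Psi>' u)\<^sup>2)"
    using nz by (intro continuous_intros c c') auto
  then have I: "((\<lambda>u. \<bar>\<Psi>'' u\<bar> / (\<Psi>' u)\<^sup>2) has_integral integral {\<alpha>..\<beta>} (\<lambda>u. \<bar>\<Psi>'' u\<bar> / (\<Psi>' u)\<^sup>2)) {\<alpha>..\<beta>}"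
    by (simp add: integrable_continuous_interval integrable_integral)
  have "\<bar>\<Psi>'' u\<bar> / (\<Psi>' u)\<^sup>2 \<le> B / \<rho>\<^sup>2" if u: "u \<in> {\<alpha>..\<beta>}" for u
  proof (rule frac_le)
    show "\<rho>\<^sup>2 \<le> (\<Psi>' u)\<^sup>2" using lam[OF u] \<open>\<rho> > 0\<close> by (metis abs_le_square_iff abs_of_pos)
  qed (use B[OF u] \<open>\<rho> > 0\<close> in auto)
  then have "integral {\<alpha>..\<beta>} (\<lambda>u. \<bar>\<Psi>'' u\<bar> / (\<Psi>' u)\<^sup>2) \<le> B / \<rho>\<^sup>2 * (\<beta> - \<alpha>)"
    using has_integral_le[OF I has_integral_const_real[of "B / \<rho>\<^sup>2" \<alpha> \<beta>]] ab by (simp add: mult.commute)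
  moreover have "A \<ge> 0" using A[of \<alpha>] ab by (meson atLeastAtMost_iff norm_ge_zero order_trans order_refl)
  ultimately show ?thesis
    using oscillatory_by_parts[OF ab \<Psi> \<Psi>' a \<open>\<rho> > 0\<close> lam A A1 I]
    by (smt (verit, best) mult_left_mono times_divide_eq_left)
qed

text \<open>When \<Psi>'' \<le> 0 the function |\<Psi>''| / \<Psi>'^2 is the derivative of 1 /
  \<Psi>', so \<open>I\<close> telescopes and is at most 1 / \<rho> however large \<Psi>'' becomes.
  The sign alternative in \<open>lam\<close> lets one of the two endpoint terms be
  discarded.\<close>

lemma van_der_Corput_monotone:
  fixes \<Psi> \<Psi>' \<Psi>'' :: "real \<Rightarrow> real" and a a' :: "real \<Rightarrow> complex"
  assumes ab: "\<alpha> \<le> \<beta>"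
    and \<Psi>: "\<And>u. u \<in> {\<alpha>..\<beta>} \<Longrightarrow> (\<Psi> has_real_derivative \<Psi>' u) (at u within {\<alpha>..\<beta>})"
    and \<Psi>': "\<And>u. u \<in> {\<alpha>..\<beta>} \<Longrightarrow> (\<Psi>' has_real_derivative \<Psi>'' u) (at u within {\<alpha>..\<beta>})"
    and neg: "\<And>u. u \<in> {\<alpha>..\<beta>} \<Longrightarrow> \<Psi>'' u \<le> 0"
    and a: "\<And>u. u \<in> {\<alpha>..\<beta>} \<Longrightarrow> (a has_vector_derivative a' u) (at u within {\<alpha>..\<beta>})"
    and "\<rho> > 0"
    and lam: "(\<forall>u \<in> {\<alpha>..\<beta>}. \<rho> \<le> \<Psi>' u) \<or> (\<forall>u \<in> {\<alpha>..\<beta>}. \<Psi>' u \<le> - \<rho>)"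
    and A: "\<And>u. u \<in> {\<alpha>..\<beta>} \<Longrightarrow> norm (a u) \<le> A"
    and A1: "\<And>u. u \<in> {\<alpha>..\<beta>} \<Longrightarrow> norm (a' u) \<le> A1"
  shows "norm (integral {\<alpha>..\<beta>} (\<lambda>u. a u * cis (\<Psi> u))) \<le> (3 * A + A1 * (\<beta> - \<alpha>)) / \<rho>"
proof -
  have lam': "\<rho> \<le> \<bar>\<Psi>' u\<bar>" if "u \<in> {\<alpha>..\<beta>}" for u using lam that \<open>\<rho> > 0\<close> by force
  have nz: "\<Psi>' u \<noteq> 0" if "u \<in> {\<alpha>..\<beta>}" for u using lam'[OF that] \<open>\<rho> > 0\<close> by auto
  have "((\<lambda>u. inverse (\<Psi>' u)) has_vector_derivative \<bar>\<Psi>'' u\<bar> / (\<Psi>' u)\<^sup>2) (at u within {\<alpha>..\<beta>})"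
    if "u \<in> {\<alpha>..\<beta>}" for u
    unfolding has_real_derivative_iff_has_vector_derivative[symmetric]
    using \<Psi>'[OF that] nz[OF that] neg[OF that]
    by (auto intro!: derivative_eq_intros simp: field_simps power2_eq_square)
  then have I: "((\<lambda>u. \<bar>\<Psi>'' u\<bar> / (\<Psi>' u)\<^sup>2) has_integral (inverse (\<Psi>' \<beta>) - inverse (\<Psi>' \<alpha>))) {\<alpha>..\<beta>}"
    using ab by (rule fundamental_theorem_of_calculus[rotated])
  have "inverse (\<Psi>' \<beta>) - inverse (\<Psi>' \<alpha>) \<le> 1 / \<rho>"
    using lam
  proof
    assume *: "\<forall>u \<in> {\<alpha>..\<beta>}. \<rho> \<le> \<Psi>' u"
    then have "inverse (\<Psi>' \<beta>) \<le> 1 / \<rho>" "inverse (\<Psi>' \<alpha>) \<ge> 0"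
      using ab \<open>\<rho> > 0\<close> by (auto simp: divide_inverse intro!: le_imp_inverse_le intro: order_trans[OF less_imp_le])
    then show ?thesis by linarith
  next
    assume *: "\<forall>u \<in> {\<alpha>..\<beta>}. \<Psi>' u \<le> - \<rho>"
    then have "inverse (- \<Psi>' \<alpha>) \<le> inverse \<rho>"
      using ab \<open>\<rho> > 0\<close> by (intro le_imp_inverse_le) force+
    moreover have "\<Psi>' \<beta> \<le> 0" using * ab \<open>\<rho> > 0\<close> by force
    ultimately show ?thesis by (simp add: divide_inverse) (smt (verit) inverse_nonpositive_iff_nonpositive)
  qed
  moreover have "A \<ge> 0" using A[of \<alpha>] ab by (meson atLeastAtMost_iff norm_ge_zero order_trans order_refl)
  ultimately have "A * (inverse (\<Psi>' \<beta>) - inverse (\<Psi>' \<alpha>)) \<le> A / \<rho>"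
    by (metis mult_left_mono times_divide_eq_right mult.right_neutral)
  with oscillatory_by_parts[OF ab \<Psi> \<Psi>' a \<open>\<rho> > 0\<close> lam' A A1 I]
  show ?thesis by (simp add: add_divide_distrib)
qed

text \<open>A window of half-width \<delta> around the zero of \<Psi>' is estimated by its length;
  outside it |\<Psi>'| \<ge> \<mu> \<delta> and the monotone case applies on each side. Two outer
  pieces at 3 A each and a middle piece at 2 A give the 8 A.\<close>

lemma van_der_Corput_second_derivative:
  fixes \<Psi> \<Psi>' \<Psi>'' :: "real \<Rightarrow> real" and a a' :: "real \<Rightarrow> complex"
  assumes ab: "\<alpha> \<le> \<beta>"
    and \<Psi>: "\<And>u. u \<in> {\<alpha>..\<beta>} \<Longrightarrow> (\<Psi> has_real_derivative \<Psi>' u) (at u within {\<alpha>..\<beta>})"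
    and \<Psi>': "\<And>u. u \<in> {\<alpha>..\<beta>} \<Longrightarrow> (\<Psi>' has_real_derivative \<Psi>'' u) (at u within {\<alpha>..\<beta>})"
    and "\<mu> > 0" and neg: "\<And>u. u \<in> {\<alpha>..\<beta>} \<Longrightarrow> \<Psi>'' u \<le> - \<mu>"
    and a: "\<And>u. u \<in> {\<alpha>..\<beta>} \<Longrightarrow> (a has_vector_derivative a' u) (at u within {\<alpha>..\<beta>})"
    and A: "\<And>u. u \<in> {\<alpha>..\<beta>} \<Longrightarrow> norm (a u) \<le> A"
    and A1: "\<And>u. u \<in> {\<alpha>..\<beta>} \<Longrightarrow> norm (a' u) \<le> A1"
  shows "norm (integral {\<alpha>..\<beta>} (\<lambda>u. a u * cis (\<Psi> u))) \<le> (8 * A + 2 * A1 * (\<beta> - \<alpha>)) / sqrt \<mu>"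
proof -
  \<comment> \<open>The choice \<delta> = 1 / sqrt \<mu> balances the window length 2 \<delta>
    against the outer bound 1 / (\<mu> \<delta>).\<close>
  define \<rho> where "\<rho> = sqrt \<mu>"
  define \<delta> where "\<delta> = \<rho> / \<mu>"
  have pos: "\<rho> > 0" "\<delta> > 0" and md: "\<mu> * \<delta> = \<rho>" and dl: "\<delta> = 1 / \<rho>"
    using \<open>\<mu> > 0\<close> by (auto simp: \<rho>_def \<delta>_def field_simps)
  have c': "continuous_on {\<alpha>..\<beta>} \<Psi>'"
    using \<Psi>' by (meson DERIV_continuous continuous_on_eq_continuous_within)
  have decr: "\<Psi>' v \<le> \<Psi>' u - \<mu> * (v - u)" if uv: "u \<in> {\<alpha>..\<beta>}" "v \<in> {\<alpha>..\<beta>}" "u \<le> v" for u v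
  proof -
    have "\<exists>y. ((\<lambda>u. \<Psi>' u + \<mu> * u) has_real_derivative y) (at x) \<and> y \<le> 0" if x: "u < x" "x < v" for x
    proof -
      have "(\<Psi>' has_real_derivative \<Psi>'' x) (at x)"
        using \<Psi>'[of x] x uv at_within_Icc_at[of \<alpha> x \<beta>] by auto
      then have "((\<lambda>u. \<Psi>' u + \<mu> * u) has_real_derivative (\<Psi>'' x + \<mu>)) (at x)"
        by (auto intro!: derivative_eq_intros)
      with neg[of x] x uv show ?thesis by force
    qed
    moreover have "continuous_on {u..v} (\<lambda>u. \<Psi>' u + \<mu> * u)"
      using uv by (intro continuous_intros continuous_on_subset[OF c']) auto
    ultimately have "\<Psi>' v + \<mu> * v \<le> \<Psi>' u + \<mu> * u"
      using \<open>u \<le> v\<close> by (rule DERIV_nonpos_imp_decreasing_open[rotated])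
    then show ?thesis by (simp add: algebra_simps)
  qed
  \<comment> \<open>\<open>c\<close> stands in for the zero of \<Psi>': it is the zero if there is
    one, and otherwise the endpoint where |\<Psi>'| is smallest, so that |\<Psi>'| still grows at
    least linearly away from \<open>c\<close>.\<close>
  obtain c where c: "c \<in> {\<alpha>..\<beta>}"
    and cl: "\<And>u. u \<in> {\<alpha>..\<beta>} \<Longrightarrow> u \<le> c - \<delta> \<Longrightarrow> \<rho> \<le> \<Psi>' u"
    and cr: "\<And>u. u \<in> {\<alpha>..\<beta>} \<Longrightarrow> u \<ge> c + \<delta> \<Longrightarrow> \<Psi>' u \<le> - \<rho>"
  proof (cases "\<Psi>' \<beta> \<ge> 0")
    case True
    show ?thesis
    proof (rule that[of \<beta>])
      fix u assume u: "u \<in> {\<alpha>..\<beta>}" "u \<le> \<beta> - \<delta>"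
      then have "\<mu> * (\<beta> - u) \<ge> \<rho>" using md \<open>\<mu> > 0\<close> by (smt (verit) mult_left_mono)
      then show "\<rho> \<le> \<Psi>' u" using decr[of u \<beta>] u True pos by auto
    qed (use ab pos in auto)
  next
    case b: False
    show ?thesis
    proof (cases "\<Psi>' \<alpha> \<le> 0")
      case True
      show ?thesis
      proof (rule that[of \<alpha>])
        fix u assume u: "u \<in> {\<alpha>..\<beta>}" "u \<ge> \<alpha> + \<delta>"
        then have "\<mu> * (u - \<alpha>) \<ge> \<rho>" using md \<open>\<mu> > 0\<close> by (smt (verit) mult_left_mono)
        then show "\<Psi>' u \<le> - \<rho>" using decr[of \<alpha> u] u True pos by auto
      qed (use ab pos in auto)
    next
      case False
      then obtain c where c: "c \<in> {\<alpha>..\<beta>}" "\<Psi>' c = 0"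
        using IVT2'[of \<Psi>' \<beta> 0 \<alpha>] b ab c' by auto
      show ?thesis
      proof (rule that[of c])
        fix u assume u: "u \<in> {\<alpha>..\<beta>}" "u \<le> c - \<delta>"
        then have "\<mu> * (c - u) \<ge> \<rho>" using md \<open>\<mu> > 0\<close> by (smt (verit) mult_left_mono)
        then show "\<rho> \<le> \<Psi>' u" using decr[of u c] u c pos by auto
      next
        fix u assume u: "u \<in> {\<alpha>..\<beta>}" "u \<ge> c + \<delta>"
        then have "\<mu> * (u - c) \<ge> \<rho>" using md \<open>\<mu> > 0\<close> by (smt (verit) mult_left_mono)
        then show "\<Psi>' u \<le> - \<rho>" using decr[of c u] u c pos by auto
      qed (use c in auto)
    qed
  qed
  define l where "l = max \<alpha> (c - \<delta>)"
  define r where "r = min \<beta> (c + \<delta>)"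
  have lr: "\<alpha> \<le> l" "l \<le> r" "r \<le> \<beta>" and rl: "r - l \<le> 2 * \<delta>"
    using c pos by (auto simp: l_def r_def)
  let ?f = "\<lambda>u. a u * cis (\<Psi> u)"
  have A0: "A \<ge> 0" using A[of \<alpha>] ab by (meson atLeastAtMost_iff norm_ge_zero order_trans order_refl)
  have A10: "A1 \<ge> 0" using A1[of \<alpha>] ab by (meson atLeastAtMost_iff norm_ge_zero order_trans order_refl)
  have cont: "continuous_on {\<alpha>..\<beta>} ?f"
  proof -
    have "continuous_on {\<alpha>..\<beta>} a"
      using a by (meson continuous_on_eq_continuous_within has_vector_derivative_continuous)
    moreover have "continuous_on {\<alpha>..\<beta>} (\<lambda>u. cis (\<Psi> u))"
      using cis_phase_has_vector_derivative[OF \<Psi>]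
      by (meson continuous_on_eq_continuous_within has_vector_derivative_continuous)
    ultimately show ?thesis by (rule continuous_on_mult)
  qed
  \<comment> \<open>The alternative p = q covers a window that sticks out of the interval: the outer
    piece is then a single point, where the derivative bound may fail.\<close>
  have piece: "norm (integral {p..q} ?f) \<le> (3 * A + A1 * (\<beta> - \<alpha>)) / \<rho>"
    if pq: "\<alpha> \<le> p" "p \<le> q" "q \<le> \<beta>" and
      "p = q \<or> (\<forall>u \<in> {p..q}. \<rho> \<le> \<Psi>' u) \<or> (\<forall>u \<in> {p..q}. \<Psi>' u \<le> - \<rho>)" for p q
  proof (cases "p = q")
    case True
    then show ?thesis using A0 A10 pos ab by simp
  next
    case False
    have sub: "{p..q} \<subseteq> {\<alpha>..\<beta>}" using pq by auto
    have "norm (integral {p..q} ?f) \<le> (3 * A + A1 * (q - p)) / \<rho>"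
    proof (rule van_der_Corput_monotone[where \<Psi>' = \<Psi>' and \<Psi>'' = \<Psi>'' and a' = a'])
      fix u assume "u \<in> {p..q}"
      then have u: "u \<in> {\<alpha>..\<beta>}" using sub by auto
      show "(\<Psi> has_real_derivative \<Psi>' u) (at u within {p..q})" using \<Psi>[OF u] sub by (rule DERIV_subset)
      show "(\<Psi>' has_real_derivative \<Psi>'' u) (at u within {p..q})" using \<Psi>'[OF u] sub by (rule DERIV_subset)
      show "(a has_vector_derivative a' u) (at u within {p..q})" using a[OF u] sub by (rule has_vector_derivative_within_subset)
      show "\<Psi>'' u \<le> 0" using neg[OF u] \<open>\<mu> > 0\<close> by simp
      show "norm (a u) \<le> A" "norm (a' u) \<le> A1" using A[OF u] A1[OF u] by auto
    qed (use pq that False pos in auto)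
    also have "\<dots> \<le> (3 * A + A1 * (\<beta> - \<alpha>)) / \<rho>"
      using pq A10 pos by (intro divide_right_mono add_left_mono mult_left_mono) auto
    finally show ?thesis .
  qed
  have left: "norm (integral {\<alpha>..l} ?f) \<le> (3 * A + A1 * (\<beta> - \<alpha>)) / \<rho>"
    using lr cl by (intro piece) (auto simp: l_def)
  have right: "norm (integral {r..\<beta>} ?f) \<le> (3 * A + A1 * (\<beta> - \<alpha>)) / \<rho>"
    using lr cr by (intro piece) (auto simp: r_def)
  have mid: "norm (integral {l..r} ?f) \<le> A * (r - l)"
  proof (rule integral_bound)
    show "continuous_on {l..r} ?f" using lr by (intro continuous_on_subset[OF cont]) auto
  qed (use lr A in \<open>auto simp: norm_mult\<close>)
  also have "\<dots> \<le> A * (2 / \<rho>)" using rl A0 dl by (intro mult_left_mono) auto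
  finally have mid: "norm (integral {l..r} ?f) \<le> 2 * A / \<rho>" by (simp add: mult.commute)
  have int: "?f integrable_on {p..q}" if "\<alpha> \<le> p" "q \<le> \<beta>" for p q
    using cont that by (intro integrable_continuous_interval continuous_on_subset[OF cont]) auto
  have "integral {\<alpha>..\<beta>} ?f = integral {\<alpha>..l} ?f + integral {l..r} ?f + integral {r..\<beta>} ?f"
    using Henstock_Kurzweil_Integration.integral_combine[of \<alpha> l \<beta> ?f]
      Henstock_Kurzweil_Integration.integral_combine[of l r \<beta> ?f] int lr by (auto simp: add.assoc)
  then have "norm (integral {\<alpha>..\<beta>} ?f) \<le> 2 * ((3 * A + A1 * (\<beta> - \<alpha>)) / \<rho>) + 2 * A / \<rho>"
    using left right mid by (smt (verit) norm_triangle_ineq)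
  also have "\<dots> = (8 * A + 2 * A1 * (\<beta> - \<alpha>)) / sqrt \<mu>"
    unfolding \<rho>_def times_divide_eq_right add_divide_distrib[symmetric] by (simp add: algebra_simps)
  finally show ?thesis .
qed

section \<open>Complex Gaussian integrals\<close>

lemma has_bochner_integral_gaussian:
  assumes "a > 0"
  shows "has_bochner_integral lborel (\<lambda>v::real. exp (- a * v\<^sup>2)) (sqrt (pi / a))"
proof -
  define \<sigma> where "\<sigma> = 1 / sqrt (2 * a)"
  have \<sigma>: "\<sigma> > 0" "\<sigma>\<^sup>2 = 1 / (2 * a)" using assms by (auto simp: \<sigma>_def power_divide)
  have "has_bochner_integral lborel (\<lambda>v. sqrt (pi / a) * normal_density 0 \<sigma> v) (sqrt (pi / a) * 1)"
    using \<sigma> by (intro has_bochner_integral_mult_right has_bochner_integral_integrable[THEN back_subst[of "has_bochner_integral _ _"]])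
      (auto simp: integral_normal_density)
  moreover have "sqrt (pi / a) * normal_density 0 \<sigma> v = exp (- a * v\<^sup>2)" for v
  proof -
    have "2 * pi * \<sigma>\<^sup>2 = pi / a" "v\<^sup>2 / (2 * \<sigma>\<^sup>2) = a * v\<^sup>2" using assms by (auto simp: \<sigma>)
    then show ?thesis using assms by (simp add: normal_density_def)
  qed
  ultimately show ?thesis by simp
qed

lemma integrable_complex_gaussian:
  fixes z :: complex and y :: real
  assumes "Re z > 0"
  shows "integrable lborel (\<lambda>v::real. exp (- z * (of_real v)\<^sup>2 + \<i> * of_real (y * v)))"
proof (rule Bochner_Integration.integrable_bound)
  show "integrable lborel (\<lambda>v::real. exp (- Re z * v\<^sup>2))"
    using has_bochner_integral_gaussian[OF assms] by (rule integrable.intros)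
qed (auto simp flip: of_real_power)

lemma gaussian_modulation_split:
  "exp (- complex_of_real a * (of_real v)\<^sup>2 + \<i> * of_real (y * v)) = complex_of_real (exp (- (a * v\<^sup>2))) * iexp (y * v)"
proof -
  have "- complex_of_real a * (of_real v)\<^sup>2 = complex_of_real (- (a * v\<^sup>2))" by simp
  then show ?thesis
    apply (simp only: exp_add)
    apply (simp only: exp_of_real)
    done
qed

text \<open>This is the characteristic function of the standard normal distribution after the
  substitution x = c v with c = sqrt (2 a). Stating it with \<open>csqrt\<close> and complex
  division prepares the analytic continuation in \<open>a\<close>.\<close>

lemma complex_gaussian_real:
  fixes a y :: real
  assumes "a > 0"
  shows "(\<integral>v. exp (- of_real a * (of_real v)\<^sup>2 + \<i> * of_real (y * v)) \<partial>lborel)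
     = csqrt (of_real pi / of_real a) * exp (- (of_real y)\<^sup>2 / (4 * of_real a))"
proof -
  define c where "c = sqrt (2 * a)"
  have c: "c > 0" "c\<^sup>2 = 2 * a" using assms by (auto simp: c_def)
  define t where "t = y / c"
  have "complex_of_real (exp (- (t\<^sup>2) / 2)) = (\<integral>x. std_normal_density x *\<^sub>R iexp (t * x) \<partial>lborel)"
    using fun_cong[OF char_std_normal_distribution, of t]
    unfolding char_def by (subst (asm) integral_density) auto
  also have "\<dots> = \<bar>c\<bar> *\<^sub>R (\<integral>v. std_normal_density (0 + c * v) *\<^sub>R iexp (t * (0 + c * v)) \<partial>lborel)"
    using c by (subst lborel_integral_real_affine[of c _ 0]) auto
  also have "\<dots> = c *\<^sub>R (\<integral>v. of_real (1 / sqrt (2 * pi)) * exp (- of_real a * (of_real v)\<^sup>2 + \<i> * of_real (y * v)) \<partial>lborel)"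
  proof -
    have "std_normal_density (0 + c * v) *\<^sub>R iexp (t * (0 + c * v)) =
        of_real (1 / sqrt (2 * pi)) * exp (- of_real a * (of_real v)\<^sup>2 + \<i> * of_real (y * v))" for v
    proof -
      have "(c * v)\<^sup>2 / 2 = a * v\<^sup>2" using c by (simp add: power_mult_distrib)
      then have "std_normal_density (0 + c * v) = 1 / sqrt (2 * pi) * exp (- (a * v\<^sup>2))"
        by (simp add: normal_density_def)
      moreover have "exp (- of_real a * (of_real v)\<^sup>2 + \<i> * of_real (y * v)) =
          complex_of_real (exp (- (a * v\<^sup>2))) * iexp (y * v)"
        by (rule gaussian_modulation_split)
      moreover have "t * (0 + c * v) = y * v" using c by (simp add: t_def)
      ultimately show ?thesis by (simp only: scaleR_conv_of_real of_real_mult mult.assoc)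
    qed
    then show ?thesis using c by simp
  qed
  also have "\<dots> = of_real (c / sqrt (2 * pi)) * (\<integral>v. exp (- of_real a * (of_real v)\<^sup>2 + \<i> * of_real (y * v)) \<partial>lborel)"
    by (simp add: scaleR_conv_of_real)
  finally have *: "complex_of_real (exp (- (t\<^sup>2) / 2)) = \<dots>" .
  have "csqrt (of_real pi / of_real a) = of_real (sqrt (pi / a))"
    using of_real_sqrt[of "pi / a"] assms by (simp only: of_real_divide) simp
  moreover have "sqrt (pi / a) * (c / sqrt (2 * pi)) = 1"
    using assms by (simp add: c_def real_sqrt_divide real_sqrt_mult)
  moreover have "exp (- (of_real y)\<^sup>2 / (4 * of_real a)) = complex_of_real (exp (- (t\<^sup>2) / 2))"
  proof -
    have "- (t\<^sup>2) / 2 = - (y\<^sup>2) / (4 * a)" using c by (simp add: t_def power_divide)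
    then have "- (of_real y)\<^sup>2 / (4 * of_real a) = complex_of_real (- (t\<^sup>2) / 2)" by simp
    then show ?thesis by (simp only: exp_of_real)
  qed
  ultimately have "of_real (sqrt (pi / a)) * (of_real (c / sqrt (2 * pi)) * (\<integral>v. exp (- of_real a * (of_real v)\<^sup>2 + \<i> * of_real (y * v)) \<partial>lborel))
      = csqrt (of_real pi / of_real a) * exp (- (of_real y)\<^sup>2 / (4 * of_real a))"
    using * by simp
  moreover have "complex_of_real (sqrt (pi / a)) * of_real (c / sqrt (2 * pi)) = 1"
    using \<open>sqrt (pi / a) * (c / sqrt (2 * pi)) = 1\<close> by (metis of_real_1 of_real_mult)
  ultimately show ?thesis by (simp only: mult.assoc[symmetric] mult_1)
qed

text \<open>Both sides are holomorphic in \<open>z\<close> on the right half-plane and agree on the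
  positive reals. Holomorphy of the left side comes from the integrals over [-n, n], which converge
  locally uniformly.\<close>

lemma complex_gaussian:
  fixes z :: complex and y :: real
  assumes "Re z > 0"
  shows "(\<integral>v. exp (- z * (of_real v)\<^sup>2 + \<i> * of_real (y * v)) \<partial>lborel)
     = csqrt (of_real pi / z) * exp (- (of_real y)\<^sup>2 / (4 * z))"
proof -
  define S where "S = {z. Re z > 0}"
  define g where "g = (\<lambda>z v. exp (- z * (of_real v)\<^sup>2 + \<i> * of_real (y * v)))"
  define F where "F = (\<lambda>z. \<integral>v. g z v \<partial>lborel)"
  define f where "f = (\<lambda>n z. integral {- real n..real n} (g z))"
  have openS: "open S" unfolding S_def by (rule open_halfspace_Re_gt)
  have convS: "convex S" unfolding S_def by (rule convex_halfspace_Re_gt)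
  have norm_g: "norm (g z v) = exp (- Re z * v\<^sup>2)" for z v
    unfolding g_def by (simp flip: of_real_power)
  have gi: "integrable lborel (g z)" if "z \<in> S" for z
    using integrable_complex_gaussian[of z y] that unfolding g_def S_def by simp
  have cg: "continuous_on A (g z)" for A z
    unfolding g_def by (intro continuous_intros)
  have f_hol: "f n holomorphic_on S" for n
    unfolding f_def cbox_interval[symmetric]
  proof (rule leibniz_rule_holomorphic[where fx = "\<lambda>z v. - (of_real v)\<^sup>2 * g z v"])
    show "((\<lambda>x. g x t) has_field_derivative - (complex_of_real t)\<^sup>2 * g x t) (at x within S)" for x t
      unfolding g_def by (auto intro!: derivative_eq_intros)
    show "g x integrable_on cbox (- real n) (real n)" for x
      by (intro integrable_continuous cg)
    show "continuous_on (S \<times> cbox (- real n) (real n)) (\<lambda>(x, t). - (complex_of_real t)\<^sup>2 * g x t)"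
      unfolding g_def split_def by (intro continuous_intros)
  qed (rule convS)
  have F_hol: "F holomorphic_on S"
  proof (rule holomorphic_uniform_sequence[OF openS f_hol])
    fix z assume z: "z \<in> S"
    \<comment> \<open>Half of Re z as radius keeps Re w \<ge> a on the closed disc, so one real
      Gaussian dominates every integrand and its tails \<open>h n\<close> control the convergence
      uniformly.\<close>
    define a where "a = Re z / 2"
    have a: "a > 0" using z by (simp add: a_def S_def)
    have re: "Re w \<ge> a" if "w \<in> cball z a" for w
    proof -
      have "\<bar>Re z - Re w\<bar> \<le> a" using that abs_Re_le_cmod[of "z - w"] by (simp add: dist_norm)
      then have "Re z - Re w \<le> a" by linarith
      then show ?thesis by (simp add: a_def)
    qed
    define h where "h = (\<lambda>n v. indicator (- {- real n..real n}) v * exp (- a * v\<^sup>2))"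
    have ia: "integrable lborel (\<lambda>v. exp (- a * v\<^sup>2))"
      using has_bochner_integral_gaussian[OF a] by (rule integrable.intros)
    have ih: "integrable lborel (h n)" for n
      unfolding h_def by (rule Bochner_Integration.integrable_bound[OF ia]) (auto simp: indicator_def)
    have "(\<lambda>n. \<integral>v. h n v \<partial>lborel) \<longlonglongrightarrow> (\<integral>v. 0 \<partial>(lborel :: real measure))"
    proof (rule integral_dominated_convergence[where w = "\<lambda>v. exp (- a * v\<^sup>2)"])
      show "AE v in lborel. (\<lambda>n. h n v) \<longlonglongrightarrow> 0"
      proof (rule AE_I2)
        fix v :: real
        have "eventually (\<lambda>n. real n \<ge> \<bar>v\<bar>) sequentially"
          by (rule eventually_sequentiallyI[of "nat \<lceil>\<bar>v\<bar>\<rceil>"]) linarith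
        then have "eventually (\<lambda>n. h n v = 0) sequentially"
          by eventually_elim (auto simp: h_def indicator_def)
        then show "(\<lambda>n. h n v) \<longlonglongrightarrow> 0" by (rule tendsto_eventually)
      qed
    qed (use ia in \<open>auto simp: h_def indicator_def\<close>)
    then have lim: "(\<lambda>n. \<integral>v. h n v \<partial>lborel) \<longlonglongrightarrow> 0" by simp
    have bnd: "dist (f n w) (F w) \<le> (\<integral>v. h n v \<partial>lborel)" if w: "w \<in> cball z a" for n w
    proof -
      have wS: "w \<in> S" using re[OF w] a by (simp add: S_def)
      have si: "set_integrable lborel {- real n..real n} (g w)"
        unfolding set_integrable_def using integrable_mult_indicator[of "{- real n..real n}" lborel "g w"] gi[OF wS] by simp
      have "f n w = (\<integral>v. indicator {- real n..real n} v *\<^sub>R g w v \<partial>lborel)"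
        unfolding f_def using set_borel_integral_eq_integral(2)[OF si] by (simp add: set_lebesgue_integral_def)
      then have "F w - f n w = (\<integral>v. g w v - indicator {- real n..real n} v *\<^sub>R g w v \<partial>lborel)"
        unfolding F_def using si gi[OF wS] by (simp add: set_integrable_def)
      also have "norm \<dots> \<le> (\<integral>v. norm (g w v - indicator {- real n..real n} v *\<^sub>R g w v) \<partial>lborel)"
        by (rule integral_norm_bound)
      also have "\<dots> \<le> (\<integral>v. h n v \<partial>lborel)"
      proof (rule integral_mono)
        fix v :: real
        have "exp (- Re w * v\<^sup>2) \<le> exp (- a * v\<^sup>2)" using re[OF w] by (simp add: mult_right_mono)
        then show "norm (g w v - indicator {- real n..real n} v *\<^sub>R g w v) \<le> h n v"
          unfolding h_def by (auto simp: indicator_def norm_g)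
      qed (use ih si gi[OF wS] in \<open>auto simp: set_integrable_def\<close>)
      finally show ?thesis by (simp add: dist_norm norm_minus_commute)
    qed
    have "uniform_limit (cball z a) f F sequentially"
    proof (rule uniform_limitI)
      fix e :: real assume "e > 0"
      then have "eventually (\<lambda>n. (\<integral>v. h n v \<partial>lborel) < e) sequentially"
        using lim by (auto simp: order_tendsto_iff)
      then show "\<forall>\<^sub>F n in sequentially. \<forall>w\<in>cball z a. dist (f n w) (F w) < e"
      proof eventually_elim
        case (elim n)
        then show ?case using bnd[of _ n] by (metis le_less_trans)
      qed
    qed
    moreover have "cball z a \<subseteq> S" using re a by (force simp: S_def)
    ultimately show "\<exists>d>0. cball z d \<subseteq> S \<and> uniform_limit (cball z d) f F sequentially"
      using a by blast
  qed
  define G where "G = (\<lambda>z. csqrt (of_real pi / z) * exp (- (of_real y)\<^sup>2 / (4 * z)))"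
  have G_hol: "G holomorphic_on S"
  proof -
    have "complex_of_real pi / z \<notin> \<real>\<^sub>\<le>\<^sub>0" "z \<noteq> 0" if "z \<in> S" for z
    proof -
      have "Re (of_real pi / z) > 0"
        using that by (auto simp: S_def Re_divide' intro!: divide_pos_pos sum_power2_gt_zero_iff[THEN iffD2])
      then show "complex_of_real pi / z \<notin> \<real>\<^sub>\<le>\<^sub>0" by (auto simp: complex_nonpos_Reals_iff)
      show "z \<noteq> 0" using that by (auto simp: S_def)
    qed
    then show ?thesis unfolding G_def by (intro holomorphic_intros) auto
  qed
  have "F z - G z = 0"
  proof (rule analytic_continuation[of "\<lambda>z. F z - G z" S "complex_of_real ` {0<..}" 1])
    show "(1::complex) islimpt complex_of_real ` {0<..}"
    proof (subst islimpt_sequential, intro exI conjI allI)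
      show "complex_of_real (1 + 1 / real (Suc n)) \<in> complex_of_real ` {0<..} - {1}" for n
        by (auto simp: add_pos_pos simp del: of_nat_Suc of_real_add)
      have "(\<lambda>n. complex_of_real (1 + 1 / real (Suc n))) \<longlonglongrightarrow> complex_of_real (1 + 0)"
        by (intro tendsto_of_real tendsto_add tendsto_const LIMSEQ_Suc[OF lim_1_over_n])
      then show "(\<lambda>n. complex_of_real (1 + 1 / real (Suc n))) \<longlonglongrightarrow> 1" by simp
    qed
    show "F w - G w = 0" if "w \<in> complex_of_real ` {0<..}" for w
      using that complex_gaussian_real[of _ y] by (auto simp: F_def G_def g_def)
  qed (use assms F_hol G_hol openS convS in \<open>auto simp: S_def intro!: holomorphic_intros convex_connected\<close>)
  then show ?thesis by (simp add: F_def G_def g_def)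
qed

section \<open>The one-dimensional oscillatory integral\<close>

text \<open>These absorb the powers of q, or of r = q / S^2, that the integrations by parts produce
  into the Gaussian damping exp (- q / (1 + s^2)); this is how bounds uniform in \<open>Y\<close>
  arise.\<close>

lemma mult_exp_neg_le:
  fixes r c :: real
  assumes "r \<ge> 0" "c > 0"
  shows "r * exp (- r / c) \<le> c" "r\<^sup>2 * exp (- r / c) \<le> 2 * c\<^sup>2"
proof -
  have "1 + r / c \<le> exp (r / c)" by (rule exp_ge_add_one_self)
  then have "r \<le> c * exp (r / c)" using assms by (simp add: field_simps)
  then show "r * exp (- r / c) \<le> c" by (simp add: exp_minus field_simps)
  have "1 + r / c + (r / c)\<^sup>2 / 2 \<le> exp (r / c)" using assms by (intro exp_lower_Taylor_quadratic) auto
  moreover have "r / c \<ge> 0" using assms by simp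
  ultimately have "(r / c)\<^sup>2 / 2 \<le> exp (r / c)" by linarith
  then have "r\<^sup>2 \<le> 2 * c\<^sup>2 * exp (r / c)" using assms by (simp add: field_simps)
  then show "r\<^sup>2 * exp (- r / c) \<le> 2 * c\<^sup>2" by (simp add: exp_minus field_simps)
qed

text \<open>With q = Y^2 / 4 and s = \<sigma> u, the last term is the imaginary part of - Y^2 / (4
  (1 - \<i> s)), the exponent produced by the Gaussian integral in v. Its real part - q / (1 + s^2)
  goes into \<open>osc_amp\<close>. Only u \<ge> 0 occurs, so u |u| is written as a square.\<close>

definition osc_phase :: "real \<Rightarrow> real \<Rightarrow> real \<Rightarrow> real \<Rightarrow> real \<Rightarrow> real" where
  "osc_phase X \<kappa> \<sigma> q u = X * u - \<kappa> * u\<^sup>2 - q * (\<sigma> * u / (1 + (\<sigma> * u)\<^sup>2))"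

definition osc_phase' :: "real \<Rightarrow> real \<Rightarrow> real \<Rightarrow> real \<Rightarrow> real \<Rightarrow> real" where
  "osc_phase' X \<kappa> \<sigma> q u = X - 2 * \<kappa> * u - q * \<sigma> * ((1 - (\<sigma> * u)\<^sup>2) / (1 + (\<sigma> * u)\<^sup>2)\<^sup>2)"

definition osc_phase'' :: "real \<Rightarrow> real \<Rightarrow> real \<Rightarrow> real \<Rightarrow> real" where
  "osc_phase'' \<kappa> \<sigma> q u = - 2 * \<kappa> - q * \<sigma>\<^sup>2 * (2 * (\<sigma> * u) * ((\<sigma> * u)\<^sup>2 - 3) / (1 + (\<sigma> * u)\<^sup>2) ^ 3)"

text \<open>The prefactor of the Gaussian integral at z = 1 - \<i> s. Its modulus, of order s^(-1/2)
  for large s, is the dispersive gain that pays for the second derivative test.\<close>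

definition gauss_root :: "real \<Rightarrow> complex" where
  "gauss_root s = csqrt (of_real pi / (1 - \<i> * of_real s))"

definition osc_amp :: "real \<Rightarrow> real \<Rightarrow> real \<Rightarrow> complex" where
  "osc_amp \<sigma> q u = of_real ((1 - u\<^sup>2 / 16)\<^sup>2 * exp (- q / (1 + (\<sigma> * u)\<^sup>2))) * gauss_root (\<sigma> * u)"

definition osc_amp' :: "real \<Rightarrow> real \<Rightarrow> real \<Rightarrow> complex" where
  "osc_amp' \<sigma> q u =
     of_real (- (u / 4) * (1 - u\<^sup>2 / 16) * exp (- q / (1 + (\<sigma> * u)\<^sup>2)) +
       (1 - u\<^sup>2 / 16)\<^sup>2 * (exp (- q / (1 + (\<sigma> * u)\<^sup>2)) * (2 * q * \<sigma> * (\<sigma> * u) / (1 + (\<sigma> * u)\<^sup>2)\<^sup>2)))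
       * gauss_root (\<sigma> * u) +
     of_real ((1 - u\<^sup>2 / 16)\<^sup>2 * exp (- q / (1 + (\<sigma> * u)\<^sup>2))) *
       (of_real \<sigma> * (gauss_root (\<sigma> * u) * (\<i> / (2 * (1 - \<i> * of_real (\<sigma> * u))))))"

section \<open>Derivatives and sizes of the phase and the amplitude\<close>

lemma one_plus_sq_pos [simp]: "1 + (x::real)\<^sup>2 > 0" by (smt (verit) zero_le_power2)

lemma one_plus_sq_nonzero [simp]: "1 + (x::real)\<^sup>2 \<noteq> 0" using one_plus_sq_pos[of x] by linarith

lemma osc_phase_deriv:
  "(osc_phase X \<kappa> \<sigma> q has_real_derivative osc_phase' X \<kappa> \<sigma> q u) (at u within S)"
proof -
  have nz: "1 + (\<sigma> * u)\<^sup>2 \<noteq> 0" by (rule one_plus_sq_nonzero)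
  have "((\<lambda>u. \<sigma> * u / (1 + (\<sigma> * u)\<^sup>2)) has_real_derivative
     (\<sigma> * (1 + (\<sigma> * u)\<^sup>2) - \<sigma> * u * (2 * (\<sigma> * u) * \<sigma>)) / (1 + (\<sigma> * u)\<^sup>2)\<^sup>2) (at u within S)"
    using nz by (auto intro!: derivative_eq_intros simp: power2_eq_square)
  also have "(\<sigma> * (1 + (\<sigma> * u)\<^sup>2) - \<sigma> * u * (2 * (\<sigma> * u) * \<sigma>)) / (1 + (\<sigma> * u)\<^sup>2)\<^sup>2
      = \<sigma> * ((1 - (\<sigma> * u)\<^sup>2) / (1 + (\<sigma> * u)\<^sup>2)\<^sup>2)"
    by (simp add: algebra_simps power2_eq_square)
  finally have *: "((\<lambda>u. \<sigma> * u / (1 + (\<sigma> * u)\<^sup>2)) has_real_derivative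
     \<sigma> * ((1 - (\<sigma> * u)\<^sup>2) / (1 + (\<sigma> * u)\<^sup>2)\<^sup>2)) (at u within S)" .
  have "((\<lambda>u. X * u - \<kappa> * u\<^sup>2) has_real_derivative X - 2 * \<kappa> * u) (at u within S)"
    by (auto intro!: derivative_eq_intros)
  from DERIV_diff[OF this DERIV_cmult[OF *, of q]] show ?thesis
    unfolding osc_phase_def[abs_def] osc_phase'_def by (simp only: mult.assoc)
qed

lemma osc_phase'_deriv:
  "(osc_phase' X \<kappa> \<sigma> q has_real_derivative osc_phase'' \<kappa> \<sigma> q u) (at u within S)"
proof -
  have nz: "1 + (\<sigma> * u)\<^sup>2 \<noteq> 0" by (rule one_plus_sq_nonzero)
  have "((\<lambda>u. (1 - (\<sigma> * u)\<^sup>2) / (1 + (\<sigma> * u)\<^sup>2)\<^sup>2) has_real_derivative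
     ((- (2 * (\<sigma> * u) * \<sigma>)) * (1 + (\<sigma> * u)\<^sup>2)\<^sup>2 - (1 - (\<sigma> * u)\<^sup>2) * (2 * (1 + (\<sigma> * u)\<^sup>2) * (2 * (\<sigma> * u) * \<sigma>)))
       / ((1 + (\<sigma> * u)\<^sup>2)\<^sup>2)\<^sup>2) (at u within S)"
    using nz by (auto intro!: derivative_eq_intros simp: power2_eq_square)
  also have "((- (2 * (\<sigma> * u) * \<sigma>)) * (1 + (\<sigma> * u)\<^sup>2)\<^sup>2 - (1 - (\<sigma> * u)\<^sup>2) * (2 * (1 + (\<sigma> * u)\<^sup>2) * (2 * (\<sigma> * u) * \<sigma>)))
       / ((1 + (\<sigma> * u)\<^sup>2)\<^sup>2)\<^sup>2 = \<sigma> * (2 * (\<sigma> * u) * ((\<sigma> * u)\<^sup>2 - 3) / (1 + (\<sigma> * u)\<^sup>2) ^ 3)" (is "?L / _ = \<sigma> * (?R / _)")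
  proof -
    have "?L = (1 + (\<sigma> * u)\<^sup>2) * (\<sigma> * ?R)" by (simp add: algebra_simps power2_eq_square)
    moreover have "((1 + (\<sigma> * u)\<^sup>2)\<^sup>2)\<^sup>2 = (1 + (\<sigma> * u)\<^sup>2) * (1 + (\<sigma> * u)\<^sup>2) ^ 3"
      by (simp add: power2_eq_square power3_eq_cube)
    ultimately show ?thesis using nz by simp
  qed
  finally have *: "((\<lambda>u. (1 - (\<sigma> * u)\<^sup>2) / (1 + (\<sigma> * u)\<^sup>2)\<^sup>2) has_real_derivative
     \<sigma> * (2 * (\<sigma> * u) * ((\<sigma> * u)\<^sup>2 - 3) / (1 + (\<sigma> * u)\<^sup>2) ^ 3)) (at u within S)" .
  have "((\<lambda>u. X - 2 * \<kappa> * u) has_real_derivative - 2 * \<kappa>) (at u within S)"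
    by (auto intro!: derivative_eq_intros)
  from DERIV_diff[OF this DERIV_cmult[OF *, of "q * \<sigma>"]] show ?thesis
    unfolding osc_phase'_def[abs_def] osc_phase''_def by (simp only: mult.assoc power2_eq_square)
qed

lemma continuous_on_osc_phase'': "continuous_on S (osc_phase'' \<kappa> \<sigma> q)"
proof -
  have "1 + (\<sigma> * u)\<^sup>2 \<noteq> 0" for u by (rule one_plus_sq_nonzero)
  then show ?thesis unfolding osc_phase''_def[abs_def] by (intro continuous_intros) auto
qed

lemma gauss_root_arg_not_nonpos: "of_real pi / (1 - \<i> * complex_of_real s) \<notin> \<real>\<^sub>\<le>\<^sub>0"
proof -
  have "Re (of_real pi / (1 - \<i> * complex_of_real s)) = pi / (1 + s\<^sup>2)"
    by (simp add: Re_divide power2_eq_square)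
  also have "\<dots> > 0" using one_plus_sq_pos[of s] by simp
  finally show ?thesis by (auto simp: complex_nonpos_Reals_iff)
qed

lemma one_minus_ii_nonzero: "1 - \<i> * complex_of_real s \<noteq> 0"
  by (auto simp: complex_eq_iff)

lemma norm_one_minus_ii: "norm (1 - \<i> * complex_of_real s) = sqrt (1 + s\<^sup>2)"
  by (simp add: cmod_def)

text \<open>The derivative is written as \<open>gauss_root\<close> times a logarithmic derivative of
  modulus 1 / (2 sqrt (1 + s^2)), so that bounds on the amplitude pass to its derivative by a mere
  factor.\<close>

lemma gauss_root_deriv:
  "(gauss_root has_vector_derivative gauss_root s * (\<i> / (2 * (1 - \<i> * of_real s)))) (at s within S)"
proof -
  let ?w = "of_real pi / (1 - \<i> * complex_of_real s)"
  have "((\<lambda>z. csqrt (of_real pi / (1 - \<i> * z))) has_field_derivative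
     (of_real pi * \<i> / (1 - \<i> * of_real s)\<^sup>2) / (2 * csqrt ?w)) (at (of_real s))"
    using gauss_root_arg_not_nonpos[of s] one_minus_ii_nonzero[of s]
    by (auto intro!: derivative_eq_intros simp: power2_eq_square field_simps)
  from has_vector_derivative_real_field[OF this]
  have "((\<lambda>x. csqrt (of_real pi / (1 - \<i> * of_real x))) has_vector_derivative
     (of_real pi * \<i> / (1 - \<i> * of_real s)\<^sup>2) / (2 * csqrt ?w)) (at s within S)"
    by (rule has_vector_derivative_at_within)
  moreover have "(of_real pi * \<i> / (1 - \<i> * of_real s)\<^sup>2) / (2 * csqrt ?w) = csqrt ?w * (\<i> / (2 * (1 - \<i> * of_real s)))"
  proof -
    have nz: "csqrt ?w \<noteq> 0" using one_minus_ii_nonzero[of s] by auto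
    have "csqrt ?w * csqrt ?w = ?w" by (metis power2_csqrt power2_eq_square)
    then have "csqrt ?w * (csqrt ?w * \<i> / (1 - \<i> * of_real s)) = of_real pi * \<i> / (1 - \<i> * of_real s)\<^sup>2"
      by (simp add: power2_eq_square mult.assoc[symmetric])
    then show ?thesis using nz by (simp add: field_simps)
  qed
  ultimately show ?thesis unfolding gauss_root_def[abs_def] by simp
qed

lemma norm_gauss_root: "norm (gauss_root s) = sqrt (pi / sqrt (1 + s\<^sup>2))"
  unfolding gauss_root_def norm_csqrt by (simp add: norm_divide norm_one_minus_ii)

lemma norm_gauss_root_le: "norm (gauss_root s) \<le> 2"
proof -
  have "sqrt (1 + s\<^sup>2) \<ge> 1" by simp
  then have "pi / sqrt (1 + s\<^sup>2) \<le> pi / 1" using one_plus_sq_pos[of s] by (intro divide_left_mono) auto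
  then have "pi / sqrt (1 + s\<^sup>2) \<le> 4" using pi_less_4 by linarith
  then have "sqrt (pi / sqrt (1 + s\<^sup>2)) \<le> sqrt 4" by (rule real_sqrt_le_mono)
  then show ?thesis by (simp add: norm_gauss_root)
qed

lemma norm_gauss_root_le_sqrt:
  assumes "S > 0" "S \<le> s"
  shows "norm (gauss_root s) \<le> 2 / sqrt S"
proof -
  have "S \<le> sqrt (1 + s\<^sup>2)" using assms by (intro real_le_rsqrt) (smt (verit) power_mono zero_le_power2)
  then have "pi / sqrt (1 + s\<^sup>2) \<le> 4 / S"
    using assms pi_less_4 by (intro frac_le) auto
  then have "sqrt (pi / sqrt (1 + s\<^sup>2)) \<le> sqrt (4 / S)" by (rule real_sqrt_le_mono)
  then show ?thesis by (simp add: norm_gauss_root real_sqrt_divide)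
qed

lemma osc_amp_deriv:
  "(osc_amp \<sigma> q has_vector_derivative osc_amp' \<sigma> q u) (at u within S)"
proof -
  have nz: "1 + (\<sigma> * u)\<^sup>2 \<noteq> 0" by (rule one_plus_sq_nonzero)
  have 1: "((\<lambda>u. (1 - u\<^sup>2 / 16)\<^sup>2 * exp (- q / (1 + (\<sigma> * u)\<^sup>2))) has_real_derivative
     (- (u / 4) * (1 - u\<^sup>2 / 16) * exp (- q / (1 + (\<sigma> * u)\<^sup>2)) +
       (1 - u\<^sup>2 / 16)\<^sup>2 * (exp (- q / (1 + (\<sigma> * u)\<^sup>2)) * (2 * q * \<sigma> * (\<sigma> * u) / (1 + (\<sigma> * u)\<^sup>2)\<^sup>2)))) (at u within S)"
  proof -
    have "((\<lambda>u. - q / (1 + (\<sigma> * u)\<^sup>2)) has_real_derivative (2 * q * \<sigma> * (\<sigma> * u) / (1 + (\<sigma> * u)\<^sup>2)\<^sup>2)) (at u within S)"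
      using nz by (auto intro!: derivative_eq_intros simp: power2_eq_square field_simps)
    note E = DERIV_chain2[OF DERIV_exp this]
    have "((\<lambda>u. (1 - u\<^sup>2 / 16)\<^sup>2) has_real_derivative - (u / 4) * (1 - u\<^sup>2 / 16)) (at u within S)"
      by (auto intro!: derivative_eq_intros simp: algebra_simps)
    from DERIV_mult[OF this E] show ?thesis by (simp only: mult.commute mult.left_commute)
  qed
  have 2: "((\<lambda>u. gauss_root (\<sigma> * u)) has_vector_derivative
      of_real \<sigma> * (gauss_root (\<sigma> * u) * (\<i> / (2 * (1 - \<i> * of_real (\<sigma> * u)))))) (at u within S)"
  proof -
    have "((*) \<sigma> has_vector_derivative \<sigma>) (at u within S)"
      unfolding has_real_derivative_iff_has_vector_derivative[symmetric] by (auto intro!: derivative_eq_intros)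
    from vector_diff_chain_within[OF this gauss_root_deriv]
    show ?thesis by (simp add: o_def scaleR_conv_of_real)
  qed
  have "((\<lambda>u. complex_of_real ((1 - u\<^sup>2 / 16)\<^sup>2 * exp (- q / (1 + (\<sigma> * u)\<^sup>2)))) has_vector_derivative
     complex_of_real (- (u / 4) * (1 - u\<^sup>2 / 16) * exp (- q / (1 + (\<sigma> * u)\<^sup>2)) +
       (1 - u\<^sup>2 / 16)\<^sup>2 * (exp (- q / (1 + (\<sigma> * u)\<^sup>2)) * (2 * q * \<sigma> * (\<sigma> * u) / (1 + (\<sigma> * u)\<^sup>2)\<^sup>2)))) (at u within S)"
    using 1 by (intro has_vector_derivative_of_real) (simp add: has_real_derivative_iff_has_vector_derivative)
  from has_vector_derivative_mult[OF this 2]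
  show ?thesis unfolding osc_amp_def[abs_def] osc_amp'_def by (simp only: add.commute)
qed

lemma norm_osc_amp_le:
  assumes "0 \<le> u" "u \<le> 4"
  shows "norm (osc_amp \<sigma> q u) \<le> exp (- q / (1 + (\<sigma> * u)\<^sup>2)) * norm (gauss_root (\<sigma> * u))"
proof -
  have "u\<^sup>2 \<le> 4\<^sup>2" using assms by (intro power_mono)
  then have "\<bar>1 - u\<^sup>2 / 16\<bar> \<le> 1" by (auto simp: abs_le_iff)
  then have "(1 - u\<^sup>2 / 16)\<^sup>2 \<le> 1" by (simp add: abs_square_le_1)
  then show ?thesis unfolding osc_amp_def norm_mult norm_of_real
    by (intro mult_right_mono) (auto simp: mult_le_cancel_right1)
qed

text \<open>The three summands in the bracket come from differentiating the polynomial cutoff, the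
  damping exponential and \<open>gauss_root\<close>, in this order; on [0, 4] the factor u / 4 of
  the first is at most 1.\<close>

lemma norm_osc_amp'_le:
  assumes u: "0 \<le> u" "u \<le> 4" and "\<sigma> \<ge> 0" "q \<ge> 0"
  shows "norm (osc_amp' \<sigma> q u) \<le> exp (- q / (1 + (\<sigma> * u)\<^sup>2)) * norm (gauss_root (\<sigma> * u)) *
      (1 + 2 * q * \<sigma> * (\<sigma> * u) / (1 + (\<sigma> * u)\<^sup>2)\<^sup>2 + \<sigma> / (2 * sqrt (1 + (\<sigma> * u)\<^sup>2)))"
    (is "_ \<le> ?E * ?G * (1 + ?Q + ?H)")
proof -
  have "u\<^sup>2 \<le> 4\<^sup>2" using assms by (intro power_mono)
  then have b1: "\<bar>1 - u\<^sup>2 / 16\<bar> \<le> 1" by (auto simp: abs_le_iff)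
  then have b: "(1 - u\<^sup>2 / 16)\<^sup>2 \<le> 1" by (simp add: abs_square_le_1)
  have "\<bar>- (u / 4) * (1 - u\<^sup>2 / 16)\<bar> \<le> 1 * 1"
    unfolding abs_mult using u b1 by (intro mult_mono) auto
  then have b': "\<bar>- (u / 4) * (1 - u\<^sup>2 / 16) * ?E\<bar> \<le> 1 * ?E"
    unfolding abs_mult[of _ ?E] by (intro mult_mono) auto
  have Q: "?Q \<ge> 0" using assms by simp
  have "\<bar>(1 - u\<^sup>2 / 16)\<^sup>2 * (?E * ?Q)\<bar> \<le> 1 * (?E * ?Q)"
    unfolding abs_mult[of "(1 - u\<^sup>2 / 16)\<^sup>2"] abs_of_nonneg[OF mult_nonneg_nonneg[OF exp_ge_zero Q]]
    using b mult_nonneg_nonneg[OF exp_ge_zero Q, of "- q / (1 + (\<sigma> * u)\<^sup>2)"] by (intro mult_right_mono) simp_all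
  with b' have 1: "\<bar>- (u / 4) * (1 - u\<^sup>2 / 16) * ?E + (1 - u\<^sup>2 / 16)\<^sup>2 * (?E * ?Q)\<bar> \<le> ?E * (1 + ?Q)"
    by (intro order_trans[OF abs_triangle_ineq]) (simp add: algebra_simps)
  have 2: "\<bar>(1 - u\<^sup>2 / 16)\<^sup>2 * ?E\<bar> \<le> ?E"
    using b by (simp add: abs_mult mult_le_cancel_right1)
  have "norm (osc_amp' \<sigma> q u) \<le> ?E * (1 + ?Q) * ?G + ?E * (\<sigma> * (?G * (1 / (2 * sqrt (1 + (\<sigma> * u)\<^sup>2)))))"
    unfolding osc_amp'_def
  proof (rule order_trans[OF norm_triangle_ineq add_mono])
    show "norm (complex_of_real (- (u / 4) * (1 - u\<^sup>2 / 16) * ?E + (1 - u\<^sup>2 / 16)\<^sup>2 * (?E * ?Q)) * gauss_root (\<sigma> * u))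
       \<le> ?E * (1 + ?Q) * ?G"
      unfolding norm_mult norm_of_real by (intro mult_right_mono 1) auto
    have "norm (\<i> / (2 * (1 - \<i> * complex_of_real (\<sigma> * u)))) = 1 / (2 * sqrt (1 + (\<sigma> * u)\<^sup>2))"
      by (simp only: norm_divide norm_mult norm_one_minus_ii norm_ii norm_numeral)
    then show "norm (complex_of_real ((1 - u\<^sup>2 / 16)\<^sup>2 * ?E) *
       (of_real \<sigma> * (gauss_root (\<sigma> * u) * (\<i> / (2 * (1 - \<i> * of_real (\<sigma> * u)))))))
      \<le> ?E * (\<sigma> * (?G * (1 / (2 * sqrt (1 + (\<sigma> * u)\<^sup>2)))))"
      unfolding norm_mult norm_of_real using 2 \<open>\<sigma> \<ge> 0\<close> by (intro mult_mono) auto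
  qed
  then show ?thesis by (simp add: algebra_simps)
qed

text \<open>For S \<ge> 2 the block [S, 2 S] stays beyond s^2 = 3, where the derivative of (1 - s^2)
  / (1 + s^2)^2 changes sign. That is why the last two bounds can pin this derivative between two
  positive multiples of S^(-3).\<close>

lemma osc_fraction_bounds:
  fixes s S :: real
  assumes "2 \<le> S" "S \<le> s" "s \<le> 2 * S"
  shows "1 + s\<^sup>2 \<le> 5 * S\<^sup>2"
    and "S \<le> sqrt (1 + s\<^sup>2)"
    and "s / (1 + s\<^sup>2)\<^sup>2 \<le> 1 / S ^ 3"
    and "\<bar>(1 - s\<^sup>2) / (1 + s\<^sup>2)\<^sup>2\<bar> \<le> 1 / S\<^sup>2"
    and "2 * s * (s\<^sup>2 - 3) / (1 + s\<^sup>2) ^ 3 \<le> 2 / S ^ 3"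
    and "1 / (32 * S ^ 3) \<le> 2 * s * (s\<^sup>2 - 3) / (1 + s\<^sup>2) ^ 3"
proof -
  have S: "S > 0" and s: "s > 0" "s \<ge> 2" using assms by auto
  have s2: "s\<^sup>2 \<ge> 4" using power_mono[of 2 s 2] s by simp
  have S2: "S\<^sup>2 \<le> s\<^sup>2" "S ^ 3 \<le> s ^ 3" using assms S by (auto intro!: power_mono)
  have "s\<^sup>2 \<le> (2 * S)\<^sup>2" using assms s by (intro power_mono) auto
  moreover have "S\<^sup>2 \<ge> 4" using power_mono[of 2 S 2] assms by simp
  ultimately show "1 + s\<^sup>2 \<le> 5 * S\<^sup>2" by (simp add: power_mult_distrib)
  show "S \<le> sqrt (1 + s\<^sup>2)" using S2 by (intro real_le_rsqrt) auto
  have "s / (1 + s\<^sup>2)\<^sup>2 \<le> s / (s\<^sup>2)\<^sup>2"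
    using s one_plus_sq_pos[of s] by (intro divide_left_mono power_mono mult_pos_pos zero_less_power) auto
  also have "\<dots> = 1 / s ^ 3" using s by (simp add: power2_eq_square power3_eq_cube)
  finally have a: "s / (1 + s\<^sup>2)\<^sup>2 \<le> 1 / s ^ 3" .
  have b: "1 / s ^ 3 \<le> 1 / S ^ 3" using S2 S s by (intro divide_left_mono mult_pos_pos zero_less_power) auto
  show "s / (1 + s\<^sup>2)\<^sup>2 \<le> 1 / S ^ 3" using a b by linarith
  have "\<bar>(1 - s\<^sup>2) / (1 + s\<^sup>2)\<^sup>2\<bar> = (s\<^sup>2 - 1) / (1 + s\<^sup>2)\<^sup>2"
    using s2 by (simp add: abs_divide)
  also have "\<dots> \<le> s\<^sup>2 / (s\<^sup>2)\<^sup>2" using s by (intro frac_le power_mono) auto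
  also have "\<dots> = 1 / s\<^sup>2" using s by (simp add: power2_eq_square)
  also have "\<dots> \<le> 1 / S\<^sup>2" using S2 S s by (intro divide_left_mono mult_pos_pos zero_less_power) auto
  finally show "\<bar>(1 - s\<^sup>2) / (1 + s\<^sup>2)\<^sup>2\<bar> \<le> 1 / S\<^sup>2" .
  have "2 * s * (s\<^sup>2 - 3) / (1 + s\<^sup>2) ^ 3 \<le> 2 * s * s\<^sup>2 / (s\<^sup>2) ^ 3"
    using s by (intro frac_le mult_left_mono power_mono) auto
  also have "\<dots> = 2 * (1 / s ^ 3)" using s by (simp add: power2_eq_square power3_eq_cube)
  finally show "2 * s * (s\<^sup>2 - 3) / (1 + s\<^sup>2) ^ 3 \<le> 2 / S ^ 3" using b by linarith
  define w where "w = s\<^sup>2"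
  have w: "w \<ge> 4" using s2 by (simp add: w_def)
  \<comment> \<open>Division of 8 w^2 (w - 3) - (1 + w)^3 by w - 4 gives this form with remainder 3,
    which is visibly nonnegative for w \<ge> 4.\<close>
  have "(w - 4) * (7 * w\<^sup>2 + w + 1) + 3 \<ge> 0" using w by (intro add_nonneg_nonneg mult_nonneg_nonneg) auto
  then have "(1 + w) ^ 3 \<le> 8 * w\<^sup>2 * (w - 3)" by (simp add: power2_eq_square power3_eq_cube algebra_simps)
  then have "(1 + s\<^sup>2) ^ 3 \<le> 4 * s ^ 3 * (2 * s * (s\<^sup>2 - 3))"
    unfolding w_def by (simp add: power2_eq_square power3_eq_cube algebra_simps)
  then have c: "1 / (4 * s ^ 3) \<le> 2 * s * (s\<^sup>2 - 3) / (1 + s\<^sup>2) ^ 3"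
    using s one_plus_sq_pos[of s] by (simp add: field_simps)
  have "s ^ 3 \<le> (2 * S) ^ 3" using assms s by (intro power_mono) auto
  then have "4 * s ^ 3 \<le> 32 * S ^ 3" by (simp add: power_mult_distrib)
  then have "1 / (32 * S ^ 3) \<le> 1 / (4 * s ^ 3)" using s S by (intro divide_left_mono) auto
  with c show "1 / (32 * S ^ 3) \<le> 2 * s * (s\<^sup>2 - 3) / (1 + s\<^sup>2) ^ 3" by linarith
qed

section \<open>Uniform bounds for the oscillatory integral over u \<ge> 0\<close>

definition osc_integrand :: "real \<Rightarrow> real \<Rightarrow> real \<Rightarrow> real \<Rightarrow> real \<Rightarrow> complex" where
  "osc_integrand X \<kappa> \<sigma> q u = osc_amp \<sigma> q u * cis (osc_phase X \<kappa> \<sigma> q u)"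

lemma continuous_on_osc_integrand: "continuous_on S (osc_integrand X \<kappa> \<sigma> q)"
proof -
  have "continuous_on S (osc_amp \<sigma> q)"
    using osc_amp_deriv by (meson continuous_on_eq_continuous_within has_vector_derivative_continuous)
  moreover have "continuous_on S (\<lambda>u. cis (osc_phase X \<kappa> \<sigma> q u))"
    using cis_phase_has_vector_derivative[OF osc_phase_deriv]
    by (meson continuous_on_eq_continuous_within has_vector_derivative_continuous)
  ultimately show ?thesis unfolding osc_integrand_def[abs_def] by (rule continuous_on_mult)
qed

text \<open>On the block, s = \<sigma> u is comparable to S \<ge> 2 and both terms of
  \<open>osc_phase''\<close> are negative, so its modulus is comparable to \<open>m\<close>. If |X|
  dominates m \<alpha>, the phase has no stationary point. Otherwise |X| is at most 8 m \<alpha> and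
  the second derivative test suffices: \<alpha> sqrt m is at most sqrt S up to a factor in
  \<open>r\<close>, and the amplitude has size S^(-1/2) exp (- r / 5). The constants depend on none
  of the parameters.\<close>

lemma osc_dyadic_piece:
  assumes \<kappa>: "0 < \<kappa>" "\<kappa> \<le> \<sigma>" and q: "q \<ge> 0" and \<alpha>: "0 < \<alpha>" "\<alpha> \<le> 2" "2 \<le> \<sigma> * \<alpha>"
  shows "\<bar>X\<bar> * norm (integral {\<alpha>..2 * \<alpha>} (osc_integrand X \<kappa> \<sigma> q)) \<le> 40000"
    and "sqrt q * norm (integral {\<alpha>..2 * \<alpha>} (osc_integrand X \<kappa> \<sigma> q)) \<le> 1000"
proof -
  define S where "S = \<sigma> * \<alpha>"
  define r where "r = q / S\<^sup>2"
  define m where "m = \<kappa> + q * \<sigma>\<^sup>2 / S ^ 3"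
  \<comment> \<open>The 5 comes from 1 + s^2 \<le> 5 S^2 on the block. The exponential in
    \<open>r\<close> is kept to absorb the powers of \<open>r\<close> that appear later.\<close>
  define A where "A = 2 / sqrt S * exp (- r / 5)"
  define A1 where "A1 = A * (1 + 2 * q * \<sigma> / S ^ 3 + \<sigma> / (2 * S))"
  define I where "I = norm (integral {\<alpha>..2 * \<alpha>} (osc_integrand X \<kappa> \<sigma> q))"
  have \<sigma>: "\<sigma> > 0" using \<kappa> by linarith
  have S: "S \<ge> 2" "S > 0" using \<alpha> by (auto simp: S_def)
  have r: "r \<ge> 0" using q by (simp add: r_def)
  have m: "m > 0" using \<kappa> q \<sigma> S by (auto simp: m_def intro!: add_pos_nonneg)
  have A: "A > 0" using S by (simp add: A_def)
  have I0: "I \<ge> 0" by (simp add: I_def)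
  have Sbd: "S \<le> \<sigma> * u" "\<sigma> * u \<le> 2 * S" if "u \<in> {\<alpha>..2 * \<alpha>}" for u
    using that \<sigma> by (auto simp: S_def)
  note fb = osc_fraction_bounds[OF S(1) Sbd]
  have EG: "exp (- q / (1 + (\<sigma> * u)\<^sup>2)) * norm (gauss_root (\<sigma> * u)) \<le> A" if u: "u \<in> {\<alpha>..2 * \<alpha>}" for u
  proof -
    have "q / (5 * S\<^sup>2) \<le> q / (1 + (\<sigma> * u)\<^sup>2)"
      using fb(1)[OF u u] q S one_plus_sq_pos[of "\<sigma> * u"] by (intro divide_left_mono mult_pos_pos) auto
    then have "exp (- q / (1 + (\<sigma> * u)\<^sup>2)) \<le> exp (- r / 5)" by (simp add: r_def field_simps)
    then have "exp (- q / (1 + (\<sigma> * u)\<^sup>2)) * norm (gauss_root (\<sigma> * u)) \<le> exp (- r / 5) * (2 / sqrt S)"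
      using norm_gauss_root_le_sqrt[of S "\<sigma> * u"] S Sbd[OF u] by (intro mult_mono) auto
    then show ?thesis by (simp add: A_def mult.commute)
  qed
  have bA: "norm (osc_amp \<sigma> q u) \<le> A" if u: "u \<in> {\<alpha>..2 * \<alpha>}" for u
    using norm_osc_amp_le[of u \<sigma> q] EG[OF u] u \<alpha> by auto
  have bA1: "norm (osc_amp' \<sigma> q u) \<le> A1" if u: "u \<in> {\<alpha>..2 * \<alpha>}" for u
  proof -
    have "2 * q * \<sigma> * (\<sigma> * u) / (1 + (\<sigma> * u)\<^sup>2)\<^sup>2 \<le> 2 * q * \<sigma> / S ^ 3"
      using mult_left_mono[OF fb(3)[OF u u], of "2 * q * \<sigma>"] q \<sigma> by simp
    moreover have "\<sigma> / (2 * sqrt (1 + (\<sigma> * u)\<^sup>2)) \<le> \<sigma> / (2 * S)"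
      using fb(2)[OF u u] \<sigma> S by (intro divide_left_mono mult_pos_pos) auto
    ultimately have "1 + 2 * q * \<sigma> * (\<sigma> * u) / (1 + (\<sigma> * u)\<^sup>2)\<^sup>2 + \<sigma> / (2 * sqrt (1 + (\<sigma> * u)\<^sup>2))
       \<le> 1 + 2 * q * \<sigma> / S ^ 3 + \<sigma> / (2 * S)" by linarith
    then have "exp (- q / (1 + (\<sigma> * u)\<^sup>2)) * norm (gauss_root (\<sigma> * u)) *
       (1 + 2 * q * \<sigma> * (\<sigma> * u) / (1 + (\<sigma> * u)\<^sup>2)\<^sup>2 + \<sigma> / (2 * sqrt (1 + (\<sigma> * u)\<^sup>2))) \<le> A1"
      unfolding A1_def using EG[OF u] A q \<sigma> u \<alpha> by (intro mult_mono) (auto intro!: add_nonneg_nonneg)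
    then show ?thesis using norm_osc_amp'_le[of u \<sigma> q] u \<alpha> \<sigma> q by auto
  qed
  \<comment> \<open>Over a block of length \<alpha> the derivative of the amplitude costs only a
    factor linear in \<open>r\<close>, because \<sigma> \<alpha> = S cancels the large factor
    \<sigma>.\<close>
  have A1\<alpha>: "A1 * \<alpha> \<le> A * (3 + 2 * r)"
  proof -
    have "\<alpha> * (2 * q * \<sigma> / S ^ 3) = 2 * r" "\<alpha> * (\<sigma> / (2 * S)) = 1 / 2"
      using S \<sigma> \<alpha> by (auto simp: r_def S_def field_simps power2_eq_square power3_eq_cube)
    moreover have "A * (1 + x + y) * \<alpha> = A * (\<alpha> + \<alpha> * x + \<alpha> * y)" for x y
      by (simp add: algebra_simps)
    ultimately have "A1 * \<alpha> = A * (\<alpha> + 2 * r + 1 / 2)" by (simp only: A1_def)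
    also have "\<dots> \<le> A * (3 + 2 * r)" using A \<alpha> by (intro mult_left_mono) auto
    finally show ?thesis .
  qed
  have d2: "osc_phase'' \<kappa> \<sigma> q u \<le> - (m / 32)" "\<bar>osc_phase'' \<kappa> \<sigma> q u\<bar> \<le> 2 * m" if u: "u \<in> {\<alpha>..2 * \<alpha>}" for u
  proof -
    define H where "H = 2 * (\<sigma> * u) * ((\<sigma> * u)\<^sup>2 - 3) / (1 + (\<sigma> * u)\<^sup>2) ^ 3"
    have "q * \<sigma>\<^sup>2 * (1 / (32 * S ^ 3)) \<le> q * \<sigma>\<^sup>2 * H" "q * \<sigma>\<^sup>2 * H \<le> q * \<sigma>\<^sup>2 * (2 / S ^ 3)"
      unfolding H_def using q by (intro mult_left_mono fb(5,6)[OF u u]; simp)+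
    moreover define W where "W = q * \<sigma>\<^sup>2 / S ^ 3"
    moreover define Z where "Z = q * \<sigma>\<^sup>2 * H"
    ultimately have "W / 32 \<le> Z" "Z \<le> 2 * W" by (simp_all add: field_simps)
    moreover have "osc_phase'' \<kappa> \<sigma> q u = - 2 * \<kappa> - Z" by (simp add: osc_phase''_def H_def Z_def)
    moreover have "m = \<kappa> + W" by (simp add: m_def W_def)
    moreover have "W \<ge> 0" using q S by (simp add: W_def)
    ultimately show "osc_phase'' \<kappa> \<sigma> q u \<le> - (m / 32)" "\<bar>osc_phase'' \<kappa> \<sigma> q u\<bar> \<le> 2 * m"
      using \<kappa>(1) by linarith+
  qed
  have d1: "\<bar>osc_phase' X \<kappa> \<sigma> q u - X\<bar> \<le> 4 * m * \<alpha>" if u: "u \<in> {\<alpha>..2 * \<alpha>}" for u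
  proof -
    define H where "H = (1 - (\<sigma> * u)\<^sup>2) / (1 + (\<sigma> * u)\<^sup>2)\<^sup>2"
    have "\<bar>q * \<sigma> * H\<bar> \<le> q * \<sigma> * (1 / S\<^sup>2)"
      unfolding abs_mult[of "q * \<sigma>"] using fb(4)[OF u u] q \<sigma> by (intro mult_mono) (auto simp: H_def)
    also have "\<dots> = q * \<sigma>\<^sup>2 / S ^ 3 * \<alpha>"
      using S \<sigma> \<alpha> by (simp add: S_def field_simps power2_eq_square power3_eq_cube)
    finally have "\<bar>q * \<sigma> * H\<bar> \<le> q * \<sigma>\<^sup>2 / S ^ 3 * \<alpha>" .
    moreover have "q * \<sigma>\<^sup>2 / S ^ 3 * \<alpha> \<ge> 0" using q S \<alpha> by simp
    moreover have "\<kappa> * u \<le> \<kappa> * (2 * \<alpha>)" "\<kappa> * u \<ge> 0" using u \<kappa> \<alpha> by (auto intro!: mult_left_mono)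
    moreover have "osc_phase' X \<kappa> \<sigma> q u - X = - 2 * (\<kappa> * u) - q * \<sigma> * H" by (simp add: osc_phase'_def H_def)
    moreover have "4 * m * \<alpha> = 4 * (\<kappa> * \<alpha>) + 4 * (q * \<sigma>\<^sup>2 / S ^ 3 * \<alpha>)" by (simp add: m_def algebra_simps)
    ultimately show ?thesis by linarith
  qed
  have \<alpha>2: "\<alpha> \<le> 2 * \<alpha>" "2 * \<alpha> - \<alpha> = \<alpha>" using \<alpha> by auto
  have "I \<le> (8 * A + 2 * A1 * (2 * \<alpha> - \<alpha>)) / sqrt (m / 32)"
    unfolding I_def osc_integrand_def[abs_def]
    by (rule van_der_Corput_second_derivative[OF \<alpha>2(1) osc_phase_deriv osc_phase'_deriv _ d2(1) osc_amp_deriv bA bA1])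
      (use m in auto)
  also have "\<dots> \<le> (A * (14 + 4 * r)) / sqrt (m / 32)"
    using A1\<alpha> m by (intro divide_right_mono) (auto simp: algebra_simps)
  also have "\<dots> = sqrt 32 * (A * (14 + 4 * r)) / sqrt m" by (simp add: real_sqrt_divide)
  also have "\<dots> \<le> 6 * (A * (14 + 4 * r)) / sqrt m"
    using A r m real_le_lsqrt[of 6 32] by (intro divide_right_mono mult_right_mono) auto
  finally have v2: "I \<le> 6 * (A * (14 + 4 * r)) / sqrt m" .
  have e: "exp (- r / 5) \<le> 1" "r * exp (- r / 5) \<le> 5" "r\<^sup>2 * exp (- r / 5) \<le> 50"
    using mult_exp_neg_le[of r 5] r by auto
  show "sqrt q * norm (integral {\<alpha>..2 * \<alpha>} (osc_integrand X \<kappa> \<sigma> q)) \<le> 1000"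
  proof -
    \<comment> \<open>Discarding \<kappa> from \<open>m\<close> leaves a lower bound for sqrt m
      proportional to sqrt q, which turns the m^(-1/2) of the second derivative test into decay in
      \<open>Y\<close>.\<close>
    have "sqrt (q * \<sigma>\<^sup>2 / S ^ 3) \<le> sqrt m" using \<kappa> by (simp add: m_def)
    moreover have "sqrt (q * \<sigma>\<^sup>2 / S ^ 3) = sqrt q * \<sigma> / (S * sqrt S)"
      using \<sigma> S by (simp add: real_sqrt_divide real_sqrt_mult power3_eq_cube)
    ultimately have "sqrt q * \<sigma> / (S * sqrt S) \<le> sqrt m" by simp
    then have qm: "sqrt q \<le> sqrt m * (S * sqrt S) / \<sigma>" using \<sigma> S by (simp add: field_simps)
    have "sqrt q * I \<le> (sqrt m * (S * sqrt S) / \<sigma>) * (6 * (A * (14 + 4 * r)) / sqrt m)"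
      using qm v2 I0 m \<sigma> S by (intro mult_mono) auto
    also have "\<dots> = (S * sqrt S) / \<sigma> * (6 * (A * (14 + 4 * r)))"
    proof -
      have "(c * x / s) * (y / c) = x / s * y" if "c \<noteq> 0" for c x s y :: real using that by simp
      from this[of "sqrt m"] m show ?thesis by simp
    qed
    also have "\<dots> = 12 * (S / \<sigma>) * ((14 + 4 * r) * exp (- r / 5))"
      using S by (simp add: A_def)
    also have "S / \<sigma> = \<alpha>" using \<sigma> by (simp add: S_def)
    also have "12 * \<alpha> * ((14 + 4 * r) * exp (- r / 5)) = 12 * \<alpha> * (14 * exp (- r / 5) + 4 * (r * exp (- r / 5)))"
      by (simp add: algebra_simps)
    also have "\<dots> \<le> 12 * 2 * 34"
    proof (rule mult_mono)
      show "14 * exp (- r / 5) + 4 * (r * exp (- r / 5)) \<le> 34"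
        using add_mono[OF mult_left_mono[OF e(1), of 14] mult_left_mono[OF e(2), of 4]] by simp
    qed (use \<alpha> r in auto)
    finally show ?thesis by (simp add: I_def)
  qed
  show "\<bar>X\<bar> * norm (integral {\<alpha>..2 * \<alpha>} (osc_integrand X \<kappa> \<sigma> q)) \<le> 40000"
  \<comment> \<open>The 8 is twice the 4 in \<open>d1\<close>, so that at least |X| / 2 survives in
    the first derivative.\<close>
  proof (cases "8 * m * \<alpha> \<le> \<bar>X\<bar>")
    case True
    have "m * \<alpha> > 0" using m \<alpha> by simp
    then have X: "\<bar>X\<bar> > 0" using True by linarith
    have "I \<le> (2 * A + A1 * (2 * \<alpha> - \<alpha>)) / (\<bar>X\<bar> / 2) + A * (2 * m * (2 * \<alpha> - \<alpha>) / (\<bar>X\<bar> / 2)\<^sup>2)"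
      unfolding I_def osc_integrand_def[abs_def]
    proof (rule van_der_Corput_nonstationary[OF \<alpha>2(1) osc_phase_deriv osc_phase'_deriv continuous_on_osc_phase'' osc_amp_deriv _ _ bA bA1 d2(2)])
      fix u assume "u \<in> {\<alpha>..2 * \<alpha>}"
      from d1[OF this] True show "\<bar>X\<bar> / 2 \<le> \<bar>osc_phase' X \<kappa> \<sigma> q u\<bar>" by linarith
    qed (use X in auto)
    also have "\<dots> \<le> (A * (5 + 2 * r)) / (\<bar>X\<bar> / 2) + A * (1 / \<bar>X\<bar>)"
    proof (intro add_mono divide_right_mono mult_left_mono)
      have "2 * m * (2 * \<alpha> - \<alpha>) / (\<bar>X\<bar> / 2)\<^sup>2 \<le> (\<bar>X\<bar> / 4) / (\<bar>X\<bar> / 2)\<^sup>2"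
        using True by (intro divide_right_mono) auto
      also have "\<dots> = 1 / \<bar>X\<bar>"
      proof -
        have "(x / 4) / (x / 2)\<^sup>2 = 1 / x" if "x > 0" for x :: real
          using that by (simp add: power2_eq_square field_simps)
        from this[OF X] show ?thesis .
      qed
      finally show "2 * m * (2 * \<alpha> - \<alpha>) / (\<bar>X\<bar> / 2)\<^sup>2 \<le> 1 / \<bar>X\<bar>" .
    qed (use A1\<alpha> A X in \<open>auto simp: algebra_simps\<close>)
    also have "\<dots> = A * (11 + 4 * r) / \<bar>X\<bar>" using X by (simp add: field_simps)
    finally have "\<bar>X\<bar> * I \<le> A * (11 + 4 * r)" using X by (simp add: field_simps)
    also have "\<dots> = 2 / sqrt S * (exp (- r / 5) * (11 + 4 * r))" by (simp add: A_def)
    also have "\<dots> \<le> 2 * 31"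
    proof (intro mult_mono)
      show "2 / sqrt S \<le> 2" using S by (simp add: field_simps)
      show "exp (- r / 5) * (11 + 4 * r) \<le> 31"
        using add_mono[OF mult_left_mono[OF e(1), of 11] mult_left_mono[OF e(2), of 4]]
        by (simp add: algebra_simps)
    qed (use e r S in \<open>auto simp: algebra_simps\<close>)
    finally show ?thesis by (simp add: I_def)
  next
    case False
    \<comment> \<open>Here \<kappa> \<le> \<sigma> enters: the dispersion in \<xi> alone adds at
      most 2 S to \<alpha>^2 m.\<close>
    have \<kappa>S: "\<kappa> * \<alpha>\<^sup>2 \<le> 2 * S"
    proof -
      have "\<kappa> * \<alpha>\<^sup>2 = (\<kappa> * \<alpha>) * \<alpha>" by (simp add: power2_eq_square)
      also have "\<dots> \<le> S * 2" unfolding S_def using \<kappa> \<alpha> \<sigma> by (intro mult_mono) auto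
      finally show ?thesis by simp
    qed
    have "\<alpha> * sqrt m = sqrt (\<alpha>\<^sup>2 * m)" using \<alpha> by (simp add: real_sqrt_mult)
    also have "\<alpha>\<^sup>2 * m = \<kappa> * \<alpha>\<^sup>2 + S * r"
      using S \<sigma> \<alpha> by (simp add: m_def r_def S_def field_simps power2_eq_square power3_eq_cube)
    also have "sqrt \<dots> \<le> sqrt (S * (2 + r)\<^sup>2)"
    proof (rule real_sqrt_le_mono)
      have "S * (2 + r) \<le> S * (2 + r)\<^sup>2"
        using S r by (intro mult_left_mono) (auto simp: power2_eq_square algebra_simps)
      then show "\<kappa> * \<alpha>\<^sup>2 + S * r \<le> S * (2 + r)\<^sup>2" using \<kappa>S by (simp add: algebra_simps)
    qed
    also have "\<dots> = sqrt S * (2 + r)" using r by (simp add: real_sqrt_mult)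
    finally have am: "\<alpha> * sqrt m \<le> sqrt S * (2 + r)" .
    have "\<bar>X\<bar> * I \<le> (8 * m * \<alpha>) * (6 * (A * (14 + 4 * r)) / sqrt m)"
      using False v2 I0 m \<alpha> by (intro mult_mono) auto
    also have "\<dots> = 48 * (A * (14 + 4 * r)) * (\<alpha> * (m / sqrt m))" by simp
    also have "\<dots> = 48 * (A * (14 + 4 * r)) * (\<alpha> * sqrt m)" using m by (simp only: real_div_sqrt[OF less_imp_le])
    also have "\<dots> \<le> 48 * (A * (14 + 4 * r)) * (sqrt S * (2 + r))"
      using A r am by (intro mult_left_mono) auto
    also have "\<dots> = 96 * ((14 + 4 * r) * (2 + r) * exp (- r / 5))" using S by (simp add: A_def)
    also have "(14 + 4 * r) * (2 + r) * exp (- r / 5) = 28 * exp (- r / 5) + 22 * (r * exp (- r / 5)) + 4 * (r\<^sup>2 * exp (- r / 5))"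
      by (simp add: algebra_simps power2_eq_square)
    also have "96 * \<dots> \<le> 40000"
    proof -
      have "96 * (28 * exp (- r / 5) + 22 * (r * exp (- r / 5)) + 4 * (r\<^sup>2 * exp (- r / 5)))
          \<le> 96 * (28 * 1 + 22 * 5 + 4 * 50)"
        using e by (intro mult_left_mono add_mono) auto
      then show ?thesis by simp
    qed
    finally show ?thesis by (simp add: I_def)
  qed
qed

lemma osc_initial_piece:
  assumes \<kappa>: "0 \<le> \<kappa>" "\<kappa> \<le> \<sigma>" and q: "q \<ge> 0" and \<beta>: "0 \<le> \<beta>" "\<beta> \<le> 4" "\<sigma> * \<beta> \<le> 4"
  shows "\<bar>X\<bar> * norm (integral {0..\<beta>} (osc_integrand X \<kappa> \<sigma> q)) \<le> 40000"
    and "sqrt q * norm (integral {0..\<beta>} (osc_integrand X \<kappa> \<sigma> q)) \<le> 1000"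
proof -
  \<comment> \<open>17 = 1 + 4^2 is the largest value of 1 + s^2 in this range, and 2 bounds
    \<open>gauss_root\<close>.\<close>
  define A where "A = 2 * exp (- q / 17)"
  define A1 where "A1 = A * (1 + 2 * q * \<sigma> + \<sigma> / 2)"
  define I where "I = norm (integral {0..\<beta>} (osc_integrand X \<kappa> \<sigma> q))"
  \<comment> \<open>Twice \<open>G\<close> bounds the part of the phase derivative that does not
    come from \<open>X\<close>.\<close>
  define G where "G = \<kappa> * \<beta> + q * \<sigma>"
  have \<sigma>: "\<sigma> \<ge> 0" using \<kappa> by linarith
  have A: "A > 0" by (simp add: A_def)
  have I0: "I \<ge> 0" by (simp add: I_def)
  have sb: "0 \<le> \<sigma> * u" "\<sigma> * u \<le> 4" if "u \<in> {0..\<beta>}" for u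
    using that \<sigma> \<beta> mult_left_mono[of u \<beta> \<sigma>] by auto
  have EG: "exp (- q / (1 + (\<sigma> * u)\<^sup>2)) * norm (gauss_root (\<sigma> * u)) \<le> A" if u: "u \<in> {0..\<beta>}" for u
  proof -
    have "(\<sigma> * u)\<^sup>2 \<le> 4\<^sup>2" using sb[OF u] by (intro power_mono)
    then have "q / 17 \<le> q / (1 + (\<sigma> * u)\<^sup>2)"
      using q by (intro divide_left_mono mult_pos_pos) auto
    then have "exp (- q / (1 + (\<sigma> * u)\<^sup>2)) \<le> exp (- q / 17)" by simp
    then have "exp (- q / (1 + (\<sigma> * u)\<^sup>2)) * norm (gauss_root (\<sigma> * u)) \<le> exp (- q / 17) * 2"
      using norm_gauss_root_le by (intro mult_mono) auto
    then show ?thesis by (simp add: A_def)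
  qed
  have bA: "norm (osc_amp \<sigma> q u) \<le> A" if u: "u \<in> {0..\<beta>}" for u
    using norm_osc_amp_le[of u \<sigma> q] EG[OF u] u \<beta> by auto
  have b3: "s / (1 + s\<^sup>2)\<^sup>2 \<le> 1" if "s \<ge> 0" for s :: real
  proof -
    have "(s - 1)\<^sup>2 \<ge> 0" by simp
    then have "s \<le> 1 + s\<^sup>2" using that by (simp add: power2_eq_square algebra_simps)
    also have "\<dots> \<le> (1 + s\<^sup>2)\<^sup>2" by (rule self_le_power) simp_all
    finally show ?thesis by (simp add: divide_le_eq_1)
  qed
  have bA1: "norm (osc_amp' \<sigma> q u) \<le> A1" if u: "u \<in> {0..\<beta>}" for u
  proof -
    have "2 * q * \<sigma> * (\<sigma> * u) / (1 + (\<sigma> * u)\<^sup>2)\<^sup>2 \<le> 2 * q * \<sigma>"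
      using mult_left_mono[OF b3[OF sb(1)[OF u]], of "2 * q * \<sigma>"] q \<sigma> by simp
    moreover have "\<sigma> / (2 * sqrt (1 + (\<sigma> * u)\<^sup>2)) \<le> \<sigma> / 2"
      using \<sigma> by (intro divide_left_mono mult_pos_pos) auto
    ultimately have "1 + 2 * q * \<sigma> * (\<sigma> * u) / (1 + (\<sigma> * u)\<^sup>2)\<^sup>2 + \<sigma> / (2 * sqrt (1 + (\<sigma> * u)\<^sup>2))
       \<le> 1 + 2 * q * \<sigma> + \<sigma> / 2" by linarith
    then have "exp (- q / (1 + (\<sigma> * u)\<^sup>2)) * norm (gauss_root (\<sigma> * u)) *
       (1 + 2 * q * \<sigma> * (\<sigma> * u) / (1 + (\<sigma> * u)\<^sup>2)\<^sup>2 + \<sigma> / (2 * sqrt (1 + (\<sigma> * u)\<^sup>2))) \<le> A1"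
      unfolding A1_def using EG[OF u] A q \<sigma> u by (intro mult_mono) (auto intro!: add_nonneg_nonneg)
    then show ?thesis using norm_osc_amp'_le[of u \<sigma> q] u \<beta> \<sigma> q by auto
  qed
  have A1\<beta>: "A1 * \<beta> \<le> A * (6 + 8 * q)"
  proof -
    have "A1 * \<beta> = A * (\<beta> + 2 * (q * (\<sigma> * \<beta>)) + \<sigma> * \<beta> / 2)" by (simp add: A1_def algebra_simps)
    moreover have "q * (\<sigma> * \<beta>) \<le> q * 4" using q \<beta> by (intro mult_left_mono)
    ultimately show ?thesis using A \<beta> by (simp add: mult_left_mono)
  qed
  have bs: "norm (osc_integrand X \<kappa> \<sigma> q u) \<le> A" if "u \<in> {0..\<beta>}" for u
    using bA[OF that] by (simp add: osc_integrand_def norm_mult)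
  have triv: "I \<le> \<beta> * A"
    using integral_bound[OF \<beta>(1) continuous_on_osc_integrand bs] by (simp add: I_def mult.commute)
  have e: "exp (- q / 17) \<le> 1" "q * exp (- q / 17) \<le> 17"
    using mult_exp_neg_le[of q 17] q by auto
  show "sqrt q * norm (integral {0..\<beta>} (osc_integrand X \<kappa> \<sigma> q)) \<le> 1000"
  proof -
    have "sqrt q \<le> 1 + q" using q by (intro real_le_lsqrt) (auto simp: power2_eq_square algebra_simps)
    then have "sqrt q * I \<le> (1 + q) * (\<beta> * A)" using q triv I0 by (intro mult_mono) auto
    also have "\<dots> = \<beta> * (2 * ((1 + q) * exp (- q / 17)))" by (simp add: A_def)
    also have "(1 + q) * exp (- q / 17) = exp (- q / 17) + q * exp (- q / 17)" by (simp add: algebra_simps)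
    also have "\<beta> * (2 * \<dots>) \<le> 4 * (2 * 18)"
    proof (rule mult_mono)
      show "2 * (exp (- q / 17) + q * exp (- q / 17)) \<le> 2 * 18"
        using mult_left_mono[OF add_mono[OF e], of 2] by simp
      show "0 \<le> 2 * (exp (- q / 17) + q * exp (- q / 17))" using q by (simp add: add_nonneg_nonneg)
    qed (use \<beta> in auto)
    finally show ?thesis by (simp add: I_def)
  qed
  have d2: "\<bar>osc_phase'' \<kappa> \<sigma> q u\<bar> \<le> 2 * \<kappa> + 6 * q * \<sigma>\<^sup>2" if u: "u \<in> {0..\<beta>}" for u
  proof -
    define s where "s = \<sigma> * u"
    have s: "s \<ge> 0" using sb[OF u] by (simp add: s_def)
    have "\<bar>2 * s * (s\<^sup>2 - 3) / (1 + s\<^sup>2) ^ 3\<bar> = 2 * (s / (1 + s\<^sup>2)\<^sup>2) * (\<bar>s\<^sup>2 - 3\<bar> / (1 + s\<^sup>2))"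
      using s by (simp add: abs_mult abs_divide power2_eq_square power3_eq_cube)
    also have "\<dots> \<le> 2 * 1 * 3"
    proof (intro mult_mono)
      have "\<bar>s\<^sup>2 - 3\<bar> \<le> 3 * (1 + s\<^sup>2)" using zero_le_power2[of s] by (simp add: abs_le_iff)
      then show "\<bar>s\<^sup>2 - 3\<bar> / (1 + s\<^sup>2) \<le> 3" by (simp add: divide_le_eq)
    qed (use b3[OF s] s in auto)
    finally have "\<bar>q * \<sigma>\<^sup>2 * (2 * s * (s\<^sup>2 - 3) / (1 + s\<^sup>2) ^ 3)\<bar> \<le> q * \<sigma>\<^sup>2 * 6"
      unfolding abs_mult[of "q * \<sigma>\<^sup>2"] using q by (intro mult_mono) auto
    then show ?thesis using \<kappa> unfolding osc_phase''_def s_def[symmetric] by linarith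
  qed
  have d1: "\<bar>osc_phase' X \<kappa> \<sigma> q u - X\<bar> \<le> 2 * G" if u: "u \<in> {0..\<beta>}" for u
  proof -
    define s where "s = \<sigma> * u"
    define H where "H = q * \<sigma> * ((1 - s\<^sup>2) / (1 + s\<^sup>2)\<^sup>2)"
    have "\<bar>1 - s\<^sup>2\<bar> \<le> 1 + s\<^sup>2" using zero_le_power2[of s] by (simp add: abs_le_iff)
    also have "\<dots> \<le> (1 + s\<^sup>2)\<^sup>2" by (rule self_le_power) simp_all
    finally have "\<bar>(1 - s\<^sup>2) / (1 + s\<^sup>2)\<^sup>2\<bar> \<le> 1" by (simp add: abs_divide divide_le_eq_1)
    then have "\<bar>H\<bar> \<le> q * \<sigma> * 1"
      unfolding H_def abs_mult[of "q * \<sigma>"] using q \<sigma> by (intro mult_mono) auto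
    moreover have "\<kappa> * u \<le> \<kappa> * \<beta>" "\<kappa> * u \<ge> 0" "\<kappa> * \<beta> \<ge> 0" "q * \<sigma> \<ge> 0" using u \<kappa> \<beta> q \<sigma> by (auto intro!: mult_left_mono)
    ultimately show ?thesis unfolding osc_phase'_def s_def[symmetric] H_def[symmetric] G_def by simp
  qed
  show "\<bar>X\<bar> * norm (integral {0..\<beta>} (osc_integrand X \<kappa> \<sigma> q)) \<le> 40000"
  proof (cases "X = 0 \<or> 16 * G > \<bar>X\<bar>")
    case False
    then have X: "\<bar>X\<bar> > 0" "16 * G \<le> \<bar>X\<bar>" by auto
    have G0: "G \<ge> 0" using \<kappa> \<beta> q \<sigma> by (simp add: G_def)
    have "I \<le> (2 * A + A1 * (\<beta> - 0)) / (\<bar>X\<bar> / 2) + A * ((2 * \<kappa> + 6 * q * \<sigma>\<^sup>2) * (\<beta> - 0) / (\<bar>X\<bar> / 2)\<^sup>2)"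
      unfolding I_def osc_integrand_def[abs_def]
    proof (rule van_der_Corput_nonstationary[OF \<beta>(1) osc_phase_deriv osc_phase'_deriv continuous_on_osc_phase'' osc_amp_deriv _ _ bA bA1 d2])
      fix u assume "u \<in> {0..\<beta>}"
      from d1[OF this] X(2) G0 show "\<bar>X\<bar> / 2 \<le> \<bar>osc_phase' X \<kappa> \<sigma> q u\<bar>" by linarith
    qed (use X in auto)
    also have "\<dots> \<le> (A * (8 + 8 * q)) / (\<bar>X\<bar> / 2) + A * (6 / \<bar>X\<bar>)"
    proof (intro add_mono divide_right_mono mult_left_mono)
      have "q * \<sigma>\<^sup>2 * \<beta> = (q * \<sigma>) * (\<sigma> * \<beta>)" by (simp add: power2_eq_square)
      also have "\<dots> \<le> (q * \<sigma>) * 4" using q \<sigma> \<beta> by (intro mult_left_mono) auto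
      finally have "(2 * \<kappa> + 6 * q * \<sigma>\<^sup>2) * \<beta> \<le> 2 * (\<kappa> * \<beta>) + 24 * (q * \<sigma>)" by (simp add: algebra_simps)
      also have "\<dots> \<le> 24 * G" using \<kappa> \<beta> by (simp add: G_def)
      also have "\<dots> \<le> 3 / 2 * \<bar>X\<bar>" using X by linarith
      finally have "(2 * \<kappa> + 6 * q * \<sigma>\<^sup>2) * (\<beta> - 0) / (\<bar>X\<bar> / 2)\<^sup>2 \<le> (3 / 2 * \<bar>X\<bar>) / (\<bar>X\<bar> / 2)\<^sup>2"
        by (intro divide_right_mono) auto
      also have "\<dots> = 6 / \<bar>X\<bar>"
      proof -
        have "(3 / 2 * x) / (x / 2)\<^sup>2 = 6 / x" if "x > 0" for x :: real
          using that by (simp add: power2_eq_square field_simps)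
        from this[OF X(1)] show ?thesis .
      qed
      finally show "(2 * \<kappa> + 6 * q * \<sigma>\<^sup>2) * (\<beta> - 0) / (\<bar>X\<bar> / 2)\<^sup>2 \<le> 6 / \<bar>X\<bar>" .
    qed (use A1\<beta> A X in \<open>auto simp: algebra_simps\<close>)
    also have "\<dots> = A * (22 + 16 * q) / \<bar>X\<bar>" using X by (simp add: field_simps)
    finally have "\<bar>X\<bar> * I \<le> A * (22 + 16 * q)" using X by (simp add: field_simps)
    also have "\<dots> = 44 * exp (- q / 17) + 32 * (q * exp (- q / 17))" by (simp add: A_def algebra_simps)
    also have "\<dots> \<le> 40000" using e by linarith
    finally show ?thesis by (simp add: I_def)
  next
    case True
    show ?thesis
    proof (cases "X = 0")
      case False
      have "\<bar>X\<bar> * I \<le> (16 * G) * (\<beta> * A)" using True False triv I0 by (intro mult_mono) auto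
      also have "\<dots> = 16 * ((G * \<beta>) * A)" by simp
      also have "\<dots> \<le> 16 * ((16 + 4 * q) * A)"
      proof (intro mult_left_mono mult_right_mono)
        have "\<kappa> * \<beta> * \<beta> \<le> 4 * 4" using \<kappa> \<beta> mult_right_mono[of \<kappa> \<sigma> \<beta>] by (intro mult_mono) auto
        moreover have "q * (\<sigma> * \<beta>) \<le> q * 4" using q \<beta> by (intro mult_left_mono)
        ultimately show "G * \<beta> \<le> 16 + 4 * q" by (simp add: G_def algebra_simps)
      qed (use A in auto)
      also have "\<dots> = 512 * exp (- q / 17) + 128 * (q * exp (- q / 17))" by (simp add: A_def algebra_simps)
      also have "\<dots> \<le> 40000" using e by linarith
      finally show ?thesis by (simp add: I_def)
    qed simp
  qed
qed

text \<open>Halving \<beta> peels off one dyadic block per step until \<sigma> \<beta> \<le> 4.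
  Every block costs the same constant, so the number of blocks becomes the first logarithm. The
  condition linking \<kappa> and \<sigma> guarantees \<kappa> > 0 whenever a block is peeled
  off.\<close>

lemma osc_integral_bound:
  assumes \<kappa>: "0 \<le> \<kappa>" "\<kappa> \<le> \<sigma>" "\<kappa> = 0 \<longrightarrow> \<sigma> = 0" and q: "q \<ge> 0"
    and \<beta>: "0 \<le> \<beta>" "\<beta> \<le> 4" "\<sigma> * \<beta> \<le> 2 ^ (n + 2)"
  shows "\<bar>X\<bar> * norm (integral {0..\<beta>} (osc_integrand X \<kappa> \<sigma> q)) \<le> 40000 * (real n + 1) \<and>
     sqrt q * norm (integral {0..\<beta>} (osc_integrand X \<kappa> \<sigma> q)) \<le> 1000 * (real n + 1)"
  using \<beta>
proof (induction n arbitrary: \<beta>)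
  case 0
  then show ?case using osc_initial_piece[OF \<kappa>(1,2) q, of \<beta> X] by auto
next
  case (Suc n)
  show ?case
  proof (cases "\<sigma> * \<beta> \<le> 4")
    case True
    have "(40000::real) \<le> 40000 * (real (Suc n) + 1)" "(1000::real) \<le> 1000 * (real (Suc n) + 1)" by auto
    then show ?thesis using osc_initial_piece[OF \<kappa>(1,2) q Suc.prems(1,2) True, of X] by linarith
  next
    case False
    define \<alpha> where "\<alpha> = \<beta> / 2"
    have "\<sigma> \<noteq> 0" using False by auto
    then have k: "0 < \<kappa>" using \<kappa> by auto
    have "\<beta> \<noteq> 0" using False by auto
    then have \<alpha>: "0 < \<alpha>" "\<alpha> \<le> 2" "2 \<le> \<sigma> * \<alpha>" "\<beta> = 2 * \<alpha>" "\<sigma> * \<alpha> \<le> 2 ^ (n + 2)"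
      using Suc.prems False by (auto simp: \<alpha>_def)
    let ?f = "osc_integrand X \<kappa> \<sigma> q"
    have "integral {0..\<beta>} ?f = integral {0..\<alpha>} ?f + integral {\<alpha>..2 * \<alpha>} ?f"
      using \<alpha> by (simp add: Henstock_Kurzweil_Integration.integral_combine integrable_continuous_interval continuous_on_osc_integrand)
    then have "norm (integral {0..\<beta>} ?f) \<le> norm (integral {0..\<alpha>} ?f) + norm (integral {\<alpha>..2 * \<alpha>} ?f)"
      by (simp add: norm_triangle_ineq)
    then have "\<bar>X\<bar> * norm (integral {0..\<beta>} ?f) \<le> \<bar>X\<bar> * norm (integral {0..\<alpha>} ?f) + \<bar>X\<bar> * norm (integral {\<alpha>..2 * \<alpha>} ?f)"
      "sqrt q * norm (integral {0..\<beta>} ?f) \<le> sqrt q * norm (integral {0..\<alpha>} ?f) + sqrt q * norm (integral {\<alpha>..2 * \<alpha>} ?f)"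
      using q by (auto simp: distrib_left[symmetric] intro!: mult_left_mono)
    with Suc.IH[of \<alpha>] \<alpha> osc_dyadic_piece[OF k \<kappa>(2) q \<alpha>(1-3), of X] show ?thesis
      by (auto simp: algebra_simps)
  qed
qed

section \<open>The rescaled kernel\<close>

text \<open>The weight \<open>bump u * exp (- v\<^sup>2)\<close> replaces the smooth cutoff: it is bounded below on the
  support of the frequencies, and being Gaussian in \<open>v\<close> it makes the inner integral explicit.\<close>

definition bump :: "real \<Rightarrow> real" where
  "bump u = (max 0 (1 - u\<^sup>2 / 16))\<^sup>2"

lemma bump_bounds: "0 \<le> bump u" "bump u \<le> 1"
proof -
  show "0 \<le> bump u" by (simp add: bump_def)
  have "max 0 (1 - u\<^sup>2 / 16) \<le> 1" by simp
  then show "bump u \<le> 1" unfolding bump_def by (intro power_le_one) auto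
qed

lemma bump_uminus [simp]: "bump (- u) = bump u"
  by (simp add: bump_def)

lemma bump_eq_0: "\<bar>u\<bar> > 4 \<Longrightarrow> bump u = 0"
proof -
  assume "\<bar>u\<bar> > 4"
  then have "4\<^sup>2 < \<bar>u\<bar>\<^sup>2" by (intro power_strict_mono) auto
  then show ?thesis by (simp add: bump_def max_def)
qed

lemma bump_eq: "0 \<le> u \<Longrightarrow> u \<le> 4 \<Longrightarrow> bump u = (1 - u\<^sup>2 / 16)\<^sup>2"
proof -
  assume "0 \<le> u" "u \<le> 4"
  then have "u\<^sup>2 \<le> 4\<^sup>2" by (intro power_mono)
  then show ?thesis by (simp add: bump_def max_def)
qed

lemma continuous_on_bump [continuous_intros]:
  "continuous_on S f \<Longrightarrow> continuous_on S (\<lambda>x. bump (f x))"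
  unfolding bump_def by (intro continuous_intros) auto

lemma borel_measurable_bump [measurable]: "bump \<in> borel_measurable borel"
  unfolding bump_def by measurable

lemma integrable_bump: "integrable lborel bump"
proof (rule Bochner_Integration.integrable_bound)
  show "integrable lborel (indicator {-4..4} :: real \<Rightarrow> real)"
    by (rule integrable_real_indicator) auto
  show "AE x in lborel. norm (bump x) \<le> norm (indicator {-4..4} x :: real)"
  proof (rule AE_I2)
    fix x :: real
    show "norm (bump x) \<le> norm (indicator {-4..4} x :: real)"
      using bump_bounds[of x] bump_eq_0[of x] by (cases "\<bar>x\<bar> > 4") (auto simp: indicator_def abs_le_iff)
  qed
qed auto

text \<open>Reflection in u folds the line onto [0, 4]. There u |u| is the smooth u^2, and passing
  to a real part later removes the boundary terms at 0.\<close>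

lemma integral_hermitian_bound:
  fixes f :: "real \<Rightarrow> complex"
  assumes f: "integrable lborel f" and sym: "\<And>u. f (- u) = cnj (f u)"
    and supp: "\<And>u. \<bar>u\<bar> > 4 \<Longrightarrow> f u = 0"
  shows "(\<integral>u. f u \<partial>lborel) = of_real (2 * Re (integral {0..4} f))"
proof -
  have [measurable]: "f \<in> borel_measurable borel" using borel_measurable_integrable[OF f] by simp
  define g where "g = (\<lambda>u. indicator {0..4} u *\<^sub>R f u)"
  have si: "set_integrable lborel {0..4} f"
    unfolding set_integrable_def using integrable_mult_indicator[of "{0..4}" lborel f] f by simp
  then have g: "integrable lborel g" by (simp add: g_def set_integrable_def)
  have ig: "integral\<^sup>L lborel g = integral {0..4} f"
    using set_borel_integral_eq_integral(2)[OF si] by (simp add: g_def set_lebesgue_integral_def)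
  have g': "integrable lborel (\<lambda>u. cnj (g (- u)))"
    using lborel_integrable_real_affine[OF g, of "-1" 0] by simp
  \<comment> \<open>At u = 0 both halves would count, so that point is discarded.\<close>
  have "AE u in lborel. u \<noteq> (0::real)" by (rule AE_lborel_singleton)
  then have "AE u in lborel. f u = g u + cnj (g (- u))"
  proof eventually_elim
    case (elim u)
    then show ?case using sym[of u] supp[of u] by (auto simp: g_def indicator_def)
  qed
  then have "(\<integral>u. f u \<partial>lborel) = (\<integral>u. g u + cnj (g (- u)) \<partial>lborel)"
    using borel_measurable_integrable[OF g] borel_measurable_integrable[OF g']
    by (intro integral_cong_AE) auto
  also have "\<dots> = (\<integral>u. g u \<partial>lborel) + (\<integral>u. cnj (g (- u)) \<partial>lborel)"
    using g g' by simp
  also have "(\<integral>u. cnj (g (- u)) \<partial>lborel) = cnj (\<integral>u. g u \<partial>lborel)"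
    using lborel_integral_real_affine[of "-1" "\<lambda>u. cnj (g u)" 0] by simp
  finally show ?thesis by (simp add: ig complex_add_cnj)
qed

text \<open>After rescaling the frequencies by \<open>N\<close> the time \<open>t\<close> enters through \<open>\<kappa> = t * N\<^sup>2\<close> and
  \<open>\<sigma> = t * N ^ 3 = \<kappa> * N\<close>.\<close>

definition kern_integrand :: "real \<Rightarrow> real \<Rightarrow> real \<Rightarrow> real \<Rightarrow> real \<times> real \<Rightarrow> complex" where
  "kern_integrand X Y \<kappa> \<sigma> = (\<lambda>(u, v). of_real (bump u * exp (- v\<^sup>2)) *
      cis (X * u + Y * v + \<sigma> * u * v\<^sup>2 - \<kappa> * u * \<bar>u\<bar>))"

definition kern :: "real \<Rightarrow> real \<Rightarrow> real \<Rightarrow> real \<Rightarrow> complex" where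
  "kern X Y \<kappa> \<sigma> = (\<integral>\<zeta>. kern_integrand X Y \<kappa> \<sigma> \<zeta> \<partial>lborel)"

section \<open>Integrability, symmetry and oscillatory form of the kernel\<close>

lemma integrable_gauss_sq: "integrable lborel (\<lambda>v::real. exp (- v\<^sup>2))"
  and integral_gauss_sq: "(\<integral>v. exp (- v\<^sup>2) \<partial>lborel) = sqrt pi"
  using has_bochner_integral_gaussian[of 1] by (auto simp: has_bochner_integral_iff)

lemma integrable_prod_mult:
  fixes f g :: "real \<Rightarrow> real"
  assumes "integrable lborel f" "integrable lborel g"
  shows "integrable lborel (\<lambda>(u, v). f u * g v)"
  unfolding lborel_prod[symmetric]
  by (rule lborel_pair.Fubini_integrable) (use assms in \<open>auto simp: abs_mult\<close>)

lemma integrable_weight: "integrable lborel (\<lambda>(u, v). bump u * exp (- v\<^sup>2))"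
  by (intro integrable_prod_mult integrable_bump integrable_gauss_sq)

lemma borel_measurable_kern_integrand [measurable]:
  "kern_integrand X Y \<kappa> \<sigma> \<in> borel_measurable borel"
proof -
  have [measurable]: "cis \<in> borel_measurable borel" by (intro borel_measurable_continuous_onI continuous_intros)
  show ?thesis unfolding kern_integrand_def borel_prod[symmetric] by measurable
qed

lemma norm_kern_integrand: "norm (kern_integrand X Y \<kappa> \<sigma> (u, v)) = bump u * exp (- v\<^sup>2)"
  using bump_bounds[of u] by (simp add: kern_integrand_def norm_mult)

lemma integrable_kern_integrand: "integrable lborel (kern_integrand X Y \<kappa> \<sigma>)"
  by (rule Bochner_Integration.integrable_bound[OF integrable_weight])
     (auto simp: norm_kern_integrand bump_bounds abs_mult)

text \<open>Differences of two times have either sign; conjugation reduces the kernel bounds to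
  \<kappa> \<ge> 0.\<close>

lemma kern_uminus: "kern (- X) (- Y) (- \<kappa>) (- \<sigma>) = cnj (kern X Y \<kappa> \<sigma>)"
proof -
  have "kern_integrand (- X) (- Y) (- \<kappa>) (- \<sigma>) \<zeta> = cnj (kern_integrand X Y \<kappa> \<sigma> \<zeta>)" for \<zeta>
    by (cases \<zeta>) (simp add: kern_integrand_def cis_cnj algebra_simps)
  then show ?thesis by (simp add: kern_def)
qed

lemma integral_weight_le: "(\<integral>\<zeta>. (case \<zeta> of (u, v) \<Rightarrow> bump u * exp (- v\<^sup>2)) \<partial>lborel) \<le> 16"
proof -
  have "(\<integral>\<zeta>. (case \<zeta> of (u, v) \<Rightarrow> bump u * exp (- v\<^sup>2)) \<partial>lborel) = (\<integral>u. (\<integral>v. bump u * exp (- v\<^sup>2) \<partial>lborel) \<partial>lborel)"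
    using lborel_pair.integral_fst[of "\<lambda>u v. bump u * exp (- v\<^sup>2)"] integrable_weight
    by (simp add: lborel_prod)
  also have "\<dots> = sqrt pi * (\<integral>u. bump u \<partial>lborel)" by (simp add: integral_gauss_sq)
  also have "(\<integral>u. bump u \<partial>lborel) \<le> (\<integral>u. indicator {-4..4} u \<partial>(lborel :: real measure))"
  proof (rule integral_mono[OF integrable_bump])
    show "bump u \<le> indicator {-4..4} u" for u
      using bump_bounds[of u] bump_eq_0[of u] by (cases "\<bar>u\<bar> > 4") (auto simp: indicator_def abs_le_iff)
  qed auto
  also have "\<dots> = 8" by simp
  also have "sqrt pi * 8 \<le> 2 * 8"
    using pi_less_4 real_sqrt_le_mono[of pi 4] by (intro mult_right_mono) auto
  finally show ?thesis by (simp add: mult_left_mono)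
qed

lemma norm_kern_le: "norm (kern X Y \<kappa> \<sigma>) \<le> 16"
proof -
  have "norm (kern X Y \<kappa> \<sigma>) \<le> (\<integral>\<zeta>. norm (kern_integrand X Y \<kappa> \<sigma> \<zeta>) \<partial>lborel)"
    unfolding kern_def by (rule integral_norm_bound)
  also have "\<dots> = (\<integral>\<zeta>. (case \<zeta> of (u, v) \<Rightarrow> bump u * exp (- v\<^sup>2)) \<partial>lborel)"
    by (intro Bochner_Integration.integral_cong refl) (auto simp: norm_kern_integrand)
  finally show ?thesis using integral_weight_le by linarith
qed

lemma gauss_root_uminus: "gauss_root (- s) = cnj (gauss_root s)"
proof -
  have "csqrt (cnj w) = cnj (csqrt w)" if "w \<notin> \<real>\<^sub>\<le>\<^sub>0" for w
    using that by (intro cnj_csqrt[symmetric]) (auto simp: complex_nonpos_Reals_iff)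
  from this[OF gauss_root_arg_not_nonpos[of s]] show ?thesis by (simp add: gauss_root_def)
qed

text \<open>Integrating in v first gives a complex Gaussian with z = 1 - \<i> \<sigma> u, explicit
  for every real \<open>Y\<close>; this is what makes uniformity in y accessible. The remaining
  function of u is Hermitian, so only [0, 4] survives.\<close>

lemma kern_eq_osc_integral:
  assumes "\<kappa> \<ge> 0"
  shows "kern X Y \<kappa> \<sigma> = of_real (2 * Re (integral {0..4} (osc_integrand X \<kappa> \<sigma> (Y\<^sup>2 / 4))))"
proof -
  define q where "q = Y\<^sup>2 / 4"
  define f where "f = (\<lambda>u. of_real (bump u * exp (- q / (1 + (\<sigma> * u)\<^sup>2))) * gauss_root (\<sigma> * u) *
     cis (X * u - \<kappa> * u * \<bar>u\<bar> - q * (\<sigma> * u / (1 + (\<sigma> * u)\<^sup>2))))"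
  have inner: "(\<integral>v. kern_integrand X Y \<kappa> \<sigma> (u, v) \<partial>lborel) = f u" for u
  proof -
    define s where "s = \<sigma> * u"
    define z where "z = 1 - \<i> * complex_of_real s"
    have z: "Re z > 0" by (simp add: z_def)
    have "kern_integrand X Y \<kappa> \<sigma> (u, v) = of_real (bump u) * cis (X * u - \<kappa> * u * \<bar>u\<bar>) *
        exp (- z * (of_real v)\<^sup>2 + \<i> * of_real (Y * v))" for v
    proof -
      have "X * u + Y * v + \<sigma> * u * v\<^sup>2 - \<kappa> * u * \<bar>u\<bar> = (X * u - \<kappa> * u * \<bar>u\<bar>) + (Y * v + s * v\<^sup>2)"
        by (simp add: s_def)
      then have "cis (X * u + Y * v + \<sigma> * u * v\<^sup>2 - \<kappa> * u * \<bar>u\<bar>) = cis (X * u - \<kappa> * u * \<bar>u\<bar>) * cis (Y * v + s * v\<^sup>2)"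
        by (simp only: cis_mult)
      then have 1: "kern_integrand X Y \<kappa> \<sigma> (u, v) = of_real (bump u) * cis (X * u - \<kappa> * u * \<bar>u\<bar>) *
          (of_real (exp (- v\<^sup>2)) * cis (Y * v + s * v\<^sup>2))"
        by (simp add: kern_integrand_def)
      have "- z * (of_real v)\<^sup>2 + \<i> * of_real (Y * v) = of_real (- v\<^sup>2) + \<i> * of_real (Y * v + s * v\<^sup>2)"
        by (simp add: z_def algebra_simps)
      then have "exp (- z * (of_real v)\<^sup>2 + \<i> * of_real (Y * v)) = of_real (exp (- v\<^sup>2)) * cis (Y * v + s * v\<^sup>2)"
        by (simp only: exp_add exp_of_real cis_conv_exp)
      with 1 show ?thesis by simp
    qed
    then have "(\<integral>v. kern_integrand X Y \<kappa> \<sigma> (u, v) \<partial>lborel) = of_real (bump u) * cis (X * u - \<kappa> * u * \<bar>u\<bar>) *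
        (csqrt (of_real pi / z) * exp (- (of_real Y)\<^sup>2 / (4 * z)))"
      using complex_gaussian[OF z, of Y] by simp
    \<comment> \<open>Multiplying 1 / z by the conjugate 1 + \<i> s separates damping from
      oscillation.\<close>
    also have "- (complex_of_real Y)\<^sup>2 / (4 * z) = of_real (- q / (1 + s\<^sup>2)) + \<i> * of_real (- (q * (s / (1 + s\<^sup>2))))"
    proof -
      have zz: "z * (1 + \<i> * of_real s) = of_real (1 + s\<^sup>2)"
        by (simp add: z_def algebra_simps power2_eq_square)
      have z0: "z \<noteq> 0" using z by auto
      have "1 / z = (1 + \<i> * of_real s) / of_real (1 + s\<^sup>2)"
      proof -
        have "complex_of_real (1 + s\<^sup>2) \<noteq> 0" by (simp only: of_real_eq_0_iff) simp
        from frac_eq_eq[OF z0 this, of 1 "1 + \<i> * of_real s"] zz show ?thesis by (simp add: mult.commute)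
      qed
      then have "- of_real q * (1 / z) = of_real (- q / (1 + s\<^sup>2)) + \<i> * of_real (- (q * (s / (1 + s\<^sup>2))))"
        by (simp add: add_divide_distrib ring_distribs)
      moreover have "- (complex_of_real Y)\<^sup>2 / (4 * z) = - of_real q * (1 / z)" by (simp add: q_def)
      ultimately show ?thesis by simp
    qed
    also have "exp \<dots> = of_real (exp (- q / (1 + s\<^sup>2))) * cis (- (q * (s / (1 + s\<^sup>2))))"
      by (simp only: exp_add exp_of_real cis_conv_exp)
    also have "csqrt (of_real pi / z) = gauss_root s" by (simp add: gauss_root_def z_def)
    also have "of_real (bump u) * cis (X * u - \<kappa> * u * \<bar>u\<bar>) * (gauss_root s *
        (of_real (exp (- q / (1 + s\<^sup>2))) * cis (- (q * (s / (1 + s\<^sup>2)))))) = f u"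
    proof -
      have "cis (X * u - \<kappa> * u * \<bar>u\<bar> - q * (s / (1 + s\<^sup>2))) = cis (X * u - \<kappa> * u * \<bar>u\<bar>) * cis (- (q * (s / (1 + s\<^sup>2))))"
        by (simp only: cis_mult) simp
      then show ?thesis by (simp only: f_def s_def of_real_mult mult.assoc mult.left_commute mult.commute)
    qed
    finally show ?thesis .
  qed
  have int: "integrable (lborel \<Otimes>\<^sub>M lborel) (\<lambda>(u, v). kern_integrand X Y \<kappa> \<sigma> (u, v))"
    using integrable_kern_integrand[of X Y \<kappa> \<sigma>] by (simp add: lborel_prod split_def)
  have "kern X Y \<kappa> \<sigma> = (\<integral>u. f u \<partial>lborel)"
    using lborel_pair.integral_fst[OF int] unfolding kern_def by (simp add: lborel_prod split_def inner)
  also have "\<dots> = of_real (2 * Re (integral {0..4} f))"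
  proof (rule integral_hermitian_bound)
    show "integrable lborel f"
      using lborel_pair.integrable_fst[OF int] by (simp add: inner)
    show "f (- u) = cnj (f u)" for u
      by (simp add: f_def gauss_root_uminus cis_cnj algebra_simps)
    show "\<bar>u\<bar> > 4 \<Longrightarrow> f u = 0" for u by (simp add: f_def bump_eq_0)
  qed
  also have "integral {0..4} f = integral {0..4} (osc_integrand X \<kappa> \<sigma> q)"
    by (intro Henstock_Kurzweil_Integration.integral_cong)
      (auto simp: f_def osc_integrand_def osc_amp_def osc_phase_def bump_eq power2_eq_square mult.assoc)
  finally show ?thesis by (simp add: q_def)
qed

text \<open>\<open>n\<close> is the number of doublings that lead from 4 to at least 4 N^3, the
  largest value of 4 \<sigma>. With ln 2 \<ge> 3/5 the three base-2 logarithms become 5 ln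
  N.\<close>

lemma dyadic_steps_bound:
  assumes "N \<ge> 1"
  obtains n where "4 * N ^ 3 \<le> 2 ^ (n + 2)" "real n + 1 \<le> 5 * (1 + ln N)"
proof -
  define n where "n = nat \<lceil>3 * log 2 N\<rceil>"
  have l0: "log 2 N \<ge> 0" using assms by simp
  have n: "3 * log 2 N \<le> real n" "real n \<le> 3 * log 2 N + 1" using l0 unfolding n_def by linarith+
  have "2 powr (log 2 N * 3) = (2 powr log 2 N) powr 3" by (simp only: powr_powr)
  also have "\<dots> = N ^ 3" using assms powr_realpow[of N 3] by simp
  finally have "N ^ 3 = 2 powr (3 * log 2 N)" by (simp only: mult.commute)
  also have "\<dots> \<le> 2 powr real n" using n by simp
  finally have "N ^ 3 \<le> 2 ^ n" by (simp add: powr_realpow)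
  moreover have "real n + 1 \<le> 5 * (1 + ln N)"
  proof -
    have "ln (2::real) \<ge> 3 / 5" using ln2_ge_two_thirds by simp
    then have "log 2 N \<le> ln N / (3 / 5)" unfolding log_def using assms by (intro divide_left_mono) auto
    then show ?thesis using n assms by (simp add: algebra_simps)
  qed
  ultimately show ?thesis by (intro that[of n]) auto
qed

lemma kern_log_bound_nonneg:
  assumes N: "N \<ge> 1" and \<kappa>: "0 \<le> \<kappa>" "\<kappa> \<le> N\<^sup>2"
  shows "\<bar>X\<bar> * norm (kern X Y \<kappa> (\<kappa> * N)) \<le> 400000 * (1 + ln N)"
    and "\<bar>Y\<bar> * norm (kern X Y \<kappa> (\<kappa> * N)) \<le> 400000 * (1 + ln N)"
proof -
  obtain n where n: "4 * N ^ 3 \<le> 2 ^ (n + 2)" "real n + 1 \<le> 5 * (1 + ln N)"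
    using dyadic_steps_bound[OF N] .
  define J where "J = integral {0..4} (osc_integrand X \<kappa> (\<kappa> * N) (Y\<^sup>2 / 4))"
  have "\<kappa> * N * 4 \<le> N\<^sup>2 * N * 4" using N \<kappa> by (intro mult_right_mono) auto
  also have "\<dots> = 4 * N ^ 3" by (simp add: power2_eq_square power3_eq_cube)
  finally have s: "\<kappa> * N * 4 \<le> 2 ^ (n + 2)" using n by linarith
  have k: "\<kappa> \<le> \<kappa> * N" using \<kappa> N mult_left_mono[of 1 N \<kappa>] by simp
  have J: "\<bar>X\<bar> * norm J \<le> 40000 * (real n + 1)" "sqrt (Y\<^sup>2 / 4) * norm J \<le> 1000 * (real n + 1)"
    using osc_integral_bound[OF \<kappa>(1) k _ _ _ _ s, of "Y\<^sup>2 / 4" X] by (auto simp: J_def)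
  have kJ: "norm (kern X Y \<kappa> (\<kappa> * N)) \<le> 2 * norm J"
    using kern_eq_osc_integral[OF \<kappa>(1), of X Y "\<kappa> * N"] abs_Re_le_cmod[of J]
    by (simp add: J_def norm_mult abs_mult)
  have "\<bar>X\<bar> * norm (kern X Y \<kappa> (\<kappa> * N)) \<le> 2 * (\<bar>X\<bar> * norm J)"
    using mult_left_mono[OF kJ, of "\<bar>X\<bar>"] by simp
  also have "\<dots> \<le> 80000 * (real n + 1)" using J by simp
  also have "\<dots> \<le> 400000 * (1 + ln N)" using n(2) by simp
  finally show "\<bar>X\<bar> * norm (kern X Y \<kappa> (\<kappa> * N)) \<le> 400000 * (1 + ln N)" .
  have "sqrt (Y\<^sup>2 / 4) = \<bar>Y\<bar> / 2" by (simp add: real_sqrt_divide)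
  from J(2)[unfolded this] have "\<bar>Y\<bar> * norm J \<le> 2000 * (real n + 1)" by simp
  moreover have "\<bar>Y\<bar> * norm (kern X Y \<kappa> (\<kappa> * N)) \<le> 2 * (\<bar>Y\<bar> * norm J)"
    using mult_left_mono[OF kJ, of "\<bar>Y\<bar>"] by simp
  ultimately show "\<bar>Y\<bar> * norm (kern X Y \<kappa> (\<kappa> * N)) \<le> 400000 * (1 + ln N)"
    using n(2) N by simp
qed

text \<open>No oscillation enters: exp (- q / (1 + (\<sigma> u)^2)) is at most exp (- q / L)
  throughout, with L of order N^6. The poor power N^6 is harmless, because it only decides where the
  tail of the majorant begins.\<close>

lemma kern_Y_decay_nonneg:
  assumes N: "N \<ge> 1" and \<kappa>: "0 \<le> \<kappa>" "\<kappa> \<le> N\<^sup>2"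
  shows "Y\<^sup>2 * norm (kern X Y \<kappa> (\<kappa> * N)) \<le> 1100 * N ^ 6"
proof -
  define q where "q = Y\<^sup>2 / 4"
  define \<sigma> where "\<sigma> = \<kappa> * N"
  define L where "L = 1 + 16 * \<sigma>\<^sup>2"
  define J where "J = integral {0..4} (osc_integrand X \<kappa> \<sigma> q)"
  have q: "q \<ge> 0" by (simp add: q_def)
  have L: "L > 0" by (simp add: L_def add_pos_nonneg)
  have "norm (osc_integrand X \<kappa> \<sigma> q u) \<le> 2 * exp (- q / L)" if u: "u \<in> {0..4}" for u
  proof -
    have "u\<^sup>2 \<le> 4\<^sup>2" using u by (intro power_mono) auto
    then have "\<sigma>\<^sup>2 * u\<^sup>2 \<le> \<sigma>\<^sup>2 * 16" by (intro mult_left_mono) auto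
    then have "1 + (\<sigma> * u)\<^sup>2 \<le> L" by (simp add: L_def power_mult_distrib)
    then have "q / L \<le> q / (1 + (\<sigma> * u)\<^sup>2)" using q L by (intro divide_left_mono mult_pos_pos) auto
    then have "exp (- q / (1 + (\<sigma> * u)\<^sup>2)) * norm (gauss_root (\<sigma> * u)) \<le> exp (- q / L) * 2"
      using norm_gauss_root_le by (intro mult_mono) auto
    then show ?thesis using norm_osc_amp_le[of u \<sigma> q] u by (simp add: osc_integrand_def norm_mult)
  qed
  then have "norm J \<le> 2 * exp (- q / L) * (4 - 0)"
    unfolding J_def by (intro integral_bound continuous_on_osc_integrand) auto
  then have "q * norm J \<le> 8 * (q * exp (- q / L))" using q mult_left_mono[of "norm J" "8 * exp (- q / L)" q] by simp
  also have "\<dots> \<le> 8 * L" using mult_exp_neg_le(1)[OF q L] by simp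
  finally have qJ: "q * norm J \<le> 8 * L" .
  have "norm (kern X Y \<kappa> \<sigma>) \<le> 2 * norm J"
    using kern_eq_osc_integral[OF \<kappa>(1), of X Y \<sigma>] abs_Re_le_cmod[of J]
    by (simp add: J_def q_def norm_mult abs_mult)
  then have "Y\<^sup>2 * norm (kern X Y \<kappa> \<sigma>) \<le> Y\<^sup>2 * (2 * norm J)" by (rule mult_left_mono) simp
  also have "\<dots> = 8 * (q * norm J)" by (simp add: q_def)
  also have "\<dots> \<le> 64 * L" using qJ by simp
  also have "\<dots> \<le> 64 * (17 * N ^ 6)"
  proof -
    have "\<sigma> \<le> N\<^sup>2 * N" unfolding \<sigma>_def using \<kappa> N by (intro mult_right_mono) auto
    then have "\<sigma>\<^sup>2 \<le> (N\<^sup>2 * N)\<^sup>2" using \<kappa> N by (intro power_mono) (auto simp: \<sigma>_def)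
    moreover have "(N\<^sup>2 * N)\<^sup>2 = N ^ 6" by (simp add: power_mult_distrib flip: power_mult power_add)
    moreover have "N ^ 6 \<ge> 1" using N by simp
    ultimately show ?thesis by (simp add: L_def)
  qed
  also have "\<dots> \<le> 1100 * N ^ 6" using N by simp
  finally show ?thesis by (simp add: \<sigma>_def)
qed

text \<open>Two integrations by parts; the boundary terms at \<open>0\<close> are purely imaginary, which is why only
  the real part decays quadratically.\<close>

lemma bump_oscillation_decay:
  fixes X D \<kappa> :: real
  shows "X\<^sup>2 * \<bar>Re (integral {0..4} (\<lambda>u. of_real ((1 - u\<^sup>2 / 16)\<^sup>2) * cis (X * u + (D * u - \<kappa> * u\<^sup>2))))\<bar>
     \<le> 8 * (1 + (\<bar>D\<bar> + 8 * \<bar>\<kappa>\<bar>))\<^sup>2"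
proof (cases "X = 0")
  case False
  define M where "M = \<bar>D\<bar> + 8 * \<bar>\<kappa>\<bar>"
  define B where "B = (\<lambda>u::real. (1 - u\<^sup>2 / 16)\<^sup>2)"
  define B1 where "B1 = (\<lambda>u::real. - (u / 4) * (1 - u\<^sup>2 / 16))"
  define B2 where "B2 = (\<lambda>u::real. - 1 / 4 + 3 * u\<^sup>2 / 64)"
  define t where "t = (\<lambda>u. D - 2 * \<kappa> * u)"
  define e where "e = (\<lambda>u. cis (X * u + (D * u - \<kappa> * u\<^sup>2)))"
  \<comment> \<open>\<open>g1\<close> and \<open>g2\<close> are the first and second derivatives of
    B(u) exp (\<i> (D u - \<kappa> u^2)) with the exponential divided out. Hence each integration by
    parts against exp (\<i> X u) moves from one to the next and gains a factor 1 / X.\<close>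
  define g where "g = (\<lambda>u. complex_of_real (B u))"
  define g1 where "g1 = (\<lambda>u. complex_of_real (B1 u) + \<i> * of_real (t u * B u))"
  define g2 where "g2 = (\<lambda>u. complex_of_real (B2 u - (t u)\<^sup>2 * B u) + \<i> * of_real (2 * t u * B1 u - 2 * \<kappa> * B u))"
  define F where "F = (\<lambda>u. (g u * (- \<i> / of_real X) + g1 u * (1 / of_real (X\<^sup>2))) * e u)"
  have dB: "(B has_real_derivative B1 u) (at u within S)" for u S
    unfolding B_def B1_def by (auto intro!: derivative_eq_intros simp: algebra_simps)
  have dB1: "(B1 has_real_derivative B2 u) (at u within S)" for u S
    unfolding B1_def B2_def by (auto intro!: derivative_eq_intros simp: power2_eq_square field_simps)
  have dt: "(t has_real_derivative - 2 * \<kappa>) (at u within S)" for u S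
    unfolding t_def by (auto intro!: derivative_eq_intros)
  have de: "(e has_vector_derivative \<i> * of_real (X + t u) * e u) (at u within S)" for u S
    unfolding e_def
    by (rule cis_phase_has_vector_derivative) (auto intro!: derivative_eq_intros simp: t_def)
  have dg: "(g has_vector_derivative of_real (B1 u)) (at u within S)" for u S
    unfolding g_def using dB by (intro has_vector_derivative_of_real) (simp add: has_real_derivative_iff_has_vector_derivative)
  have dg1: "(g1 has_vector_derivative of_real (B2 u) + \<i> * of_real (- 2 * \<kappa> * B u + B1 u * t u)) (at u within S)" for u S
    unfolding g1_def
    by (intro has_vector_derivative_add has_vector_derivative_mult_right has_vector_derivative_of_real)
      (use dB1 DERIV_mult[OF dt dB] in \<open>auto simp: has_real_derivative_iff_has_vector_derivative[symmetric]\<close>)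
  have dF: "(F has_vector_derivative (g u * e u + g2 u * e u * (1 / of_real (X\<^sup>2)))) (at u within S)" for u S
    unfolding F_def
    apply (rule has_vector_derivative_eq_rhs)
     apply (rule has_vector_derivative_mult[OF has_vector_derivative_add[OF
          has_vector_derivative_mult_left[OF dg] has_vector_derivative_mult_left[OF dg1]] de])
    using False by (simp add: g_def g1_def g2_def field_simps power2_eq_square)
  have FI: "((\<lambda>u. g u * e u + g2 u * e u * (1 / of_real (X\<^sup>2))) has_integral (F 4 - F 0)) {0..4}"
    by (intro fundamental_theorem_of_calculus dF) simp
  have ce: "continuous_on {0..4} e" unfolding e_def
    by (intro continuous_intros)
  have cg: "continuous_on {0..4} (\<lambda>u. g u * e u)"
    unfolding g_def B_def by (intro continuous_intros ce) auto
  have cg2: "continuous_on {0..4} (\<lambda>u. g2 u * e u)"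
    unfolding g2_def B_def B1_def B2_def t_def by (intro continuous_intros ce) auto
  have "integral {0..4} (\<lambda>u. g u * e u) + integral {0..4} (\<lambda>u. g2 u * e u) * (1 / of_real (X\<^sup>2)) = F 4 - F 0"
    using FI cg cg2
    by (subst integral_unique[OF FI, symmetric], subst Henstock_Kurzweil_Integration.integral_add)
      (auto intro!: integrable_continuous_interval continuous_intros simp: False)
  \<comment> \<open>Both \<open>B\<close> and \<open>B1\<close> vanish at 4: the square in
    \<open>bump\<close> makes the zero there double.\<close>
  moreover have "F 4 = 0" by (simp add: F_def g_def g1_def B_def B1_def)
  \<comment> \<open>\<open>B\<close> is even, so \<open>B1\<close> vanishes at 0 and each of the
    remaining boundary terms carries a factor \<i>.\<close>
  moreover have "Re (F 0) = 0"
    by (simp add: F_def g_def g1_def B_def B1_def e_def Re_divide Im_divide)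
  ultimately have "Re (integral {0..4} (\<lambda>u. g u * e u)) = - Re (integral {0..4} (\<lambda>u. g2 u * e u)) / X\<^sup>2"
    by (simp add: complex_eq_iff del: of_real_power)
  then have "X\<^sup>2 * \<bar>Re (integral {0..4} (\<lambda>u. g u * e u))\<bar> = \<bar>Re (integral {0..4} (\<lambda>u. g2 u * e u))\<bar>"
    using False by (simp add: abs_divide)
  also have "\<dots> \<le> norm (integral {0..4} (\<lambda>u. g2 u * e u))" by (rule abs_Re_le_cmod)
  also have "\<dots> \<le> 2 * (1 + M)\<^sup>2 * (4 - 0)"
  proof (rule integral_bound[OF _ cg2])
    fix u :: real assume u: "u \<in> {0..4}"
    have u2: "u\<^sup>2 \<le> 4\<^sup>2" using u by (intro power_mono) auto
    have M: "M \<ge> 0" by (simp add: M_def)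
    have b0: "\<bar>1 - u\<^sup>2 / 16\<bar> \<le> 1" using u2 by (auto simp: abs_le_iff)
    then have b: "\<bar>B u\<bar> \<le> 1" by (simp add: B_def abs_square_le_1)
    have b1: "\<bar>B1 u\<bar> \<le> 1 * 1" unfolding B1_def abs_mult using u b0 by (intro mult_mono) auto
    have "\<bar>- 1 / 4 + 3 * x / 64\<bar> \<le> 1" if "0 \<le> x" "x \<le> 4\<^sup>2" for x :: real
      using that by (auto simp: abs_le_iff)
    from this[OF zero_le_power2 u2] have b2: "\<bar>B2 u\<bar> \<le> 1" by (simp add: B2_def)
    have tM: "\<bar>t u\<bar> \<le> M"
    proof -
      have "\<bar>\<kappa> * u\<bar> \<le> \<bar>\<kappa>\<bar> * 4" unfolding abs_mult using u by (intro mult_left_mono) auto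
      then show ?thesis unfolding t_def M_def by linarith
    qed
    have t2: "\<bar>(t u)\<^sup>2 * B u\<bar> \<le> M\<^sup>2 * 1"
      unfolding abs_mult using tM b M by (intro mult_mono) (auto simp: abs_le_square_iff[symmetric])
    have t1: "\<bar>t u * B1 u\<bar> \<le> M * 1" unfolding abs_mult using tM b1 M by (intro mult_mono) auto
    have t0: "\<bar>\<kappa> * B u\<bar> \<le> \<bar>\<kappa>\<bar> * 1" unfolding abs_mult using b by (intro mult_mono) auto
    have "norm (g2 u) \<le> \<bar>B2 u - (t u)\<^sup>2 * B u\<bar> + \<bar>2 * t u * B1 u - 2 * \<kappa> * B u\<bar>"
      unfolding g2_def by (rule order_trans[OF norm_triangle_ineq]) (simp add: norm_mult del: of_real_diff of_real_mult)
    also have "\<dots> \<le> (1 + M\<^sup>2) + (2 * M + 2 * \<bar>\<kappa>\<bar>)"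
      using b2 t2 t1 t0 by (intro add_mono) (auto simp: abs_le_iff mult.assoc)
    also have "\<dots> \<le> 2 * (1 + M)\<^sup>2"
      by (simp add: power2_sum) (auto simp: M_def)
    finally show "norm (g2 u * e u) \<le> 2 * (1 + M)\<^sup>2" by (simp add: norm_mult e_def)
  qed simp
  finally show ?thesis by (simp add: M_def g_def e_def B_def)
qed simp

text \<open>Decay in \<open>X\<close> uses the opposite order of integration: with v frozen,
  \<sigma> v^2 is the linear coefficient \<open>D\<close> of \<open>bump_oscillation_decay\<close>.
  The resulting growth (1 + v^2)^2 is absorbed by the Gaussian, and |\<sigma>| \<le> N^3, squared,
  is the N^6.\<close>

lemma kern_X_decay:
  assumes N: "N \<ge> 1" and \<kappa>: "\<bar>\<kappa>\<bar> \<le> N\<^sup>2"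
  shows "X\<^sup>2 * norm (kern X Y \<kappa> (\<kappa> * N)) \<le> 80000 * N ^ 6"
proof -
  define \<sigma> where "\<sigma> = \<kappa> * N"
  define h where "h = (\<lambda>v u. of_real (bump u) * cis (X * u + (\<sigma> * v\<^sup>2 * u - \<kappa> * u * \<bar>u\<bar>)))"
  have k: "kern_integrand X Y \<kappa> \<sigma> (u, v) = of_real (exp (- v\<^sup>2)) * cis (Y * v) * h v u" for u v
  proof -
    have "cis (X * u + Y * v + \<sigma> * u * v\<^sup>2 - \<kappa> * u * \<bar>u\<bar>) = cis (Y * v) * cis (X * u + (\<sigma> * v\<^sup>2 * u - \<kappa> * u * \<bar>u\<bar>))"
      by (simp add: cis_mult algebra_simps)
    then show ?thesis by (simp add: kern_integrand_def h_def)
  qed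
  have hI: "X\<^sup>2 * norm (\<integral>u. h v u \<partial>lborel) \<le> 1600 * N ^ 6 * (1 + v\<^sup>2)\<^sup>2" for v
  proof -
    have "continuous_on UNIV (h v)"
      unfolding h_def by (intro continuous_intros)
    then have [measurable]: "h v \<in> borel_measurable borel" by (rule borel_measurable_continuous_onI)
    have "(\<integral>u. h v u \<partial>lborel) = of_real (2 * Re (integral {0..4} (h v)))"
    proof (rule integral_hermitian_bound)
      show "integrable lborel (h v)"
      proof (rule Bochner_Integration.integrable_bound[OF integrable_bump])
        show "AE u in lborel. norm (h v u) \<le> norm (bump u)" by (auto simp: h_def norm_mult)
      qed simp
      show "h v (- u) = cnj (h v u)" for u by (simp add: h_def cis_cnj algebra_simps)
      show "\<bar>u\<bar> > 4 \<Longrightarrow> h v u = 0" for u by (simp add: h_def bump_eq_0)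
    qed
    moreover have "integral {0..4} (h v) = integral {0..4} (\<lambda>u. of_real ((1 - u\<^sup>2 / 16)\<^sup>2) * cis (X * u + (\<sigma> * v\<^sup>2 * u - \<kappa> * u\<^sup>2)))"
      by (intro Henstock_Kurzweil_Integration.integral_cong) (auto simp: h_def bump_eq power2_eq_square mult.assoc)
    ultimately have "X\<^sup>2 * norm (\<integral>u. h v u \<partial>lborel) \<le> 2 * (8 * (1 + (\<bar>\<sigma> * v\<^sup>2\<bar> + 8 * \<bar>\<kappa>\<bar>))\<^sup>2)"
      using bump_oscillation_decay[of X "\<sigma> * v\<^sup>2" \<kappa>] by (simp add: norm_mult abs_mult)
    also have "\<dots> \<le> 2 * (8 * (10 * N ^ 3 * (1 + v\<^sup>2))\<^sup>2)"
    proof (intro mult_left_mono power_mono)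
      have N23: "N\<^sup>2 \<le> N ^ 3" "1 \<le> N ^ 3" using N by (auto intro: power_increasing)
      have "\<bar>\<sigma>\<bar> \<le> N\<^sup>2 * N" unfolding \<sigma>_def abs_mult using N \<kappa> by (intro mult_mono) auto
      then have "\<bar>\<sigma>\<bar> \<le> N ^ 3" by (simp add: power2_eq_square power3_eq_cube)
      then have "\<bar>\<sigma>\<bar> * v\<^sup>2 \<le> N ^ 3 * v\<^sup>2" by (intro mult_right_mono) auto
      moreover have "0 \<le> N ^ 3 * v\<^sup>2" using N by simp
      moreover have "10 * N ^ 3 * (1 + v\<^sup>2) = 10 * N ^ 3 + 10 * (N ^ 3 * v\<^sup>2)" by (simp add: algebra_simps)
      ultimately show "1 + (\<bar>\<sigma> * v\<^sup>2\<bar> + 8 * \<bar>\<kappa>\<bar>) \<le> 10 * N ^ 3 * (1 + v\<^sup>2)"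
        using \<kappa> N23 by (simp add: abs_mult)
    qed auto
    also have "\<dots> = 1600 * N ^ 6 * (1 + v\<^sup>2)\<^sup>2" by (simp add: power_mult_distrib flip: power_mult)
    finally show ?thesis .
  qed
  have int: "integrable (lborel \<Otimes>\<^sub>M lborel) (\<lambda>(u, v). kern_integrand X Y \<kappa> \<sigma> (u, v))"
    using integrable_kern_integrand[of X Y \<kappa> \<sigma>] by (simp add: lborel_prod split_def)
  have "kern X Y \<kappa> \<sigma> = (\<integral>v. (\<integral>u. kern_integrand X Y \<kappa> \<sigma> (u, v) \<partial>lborel) \<partial>lborel)"
    using lborel_pair.integral_snd[OF int] unfolding kern_def by (simp add: lborel_prod split_def)
  then have "X\<^sup>2 * norm (kern X Y \<kappa> \<sigma>) \<le> X\<^sup>2 * (\<integral>v. norm (\<integral>u. kern_integrand X Y \<kappa> \<sigma> (u, v) \<partial>lborel) \<partial>lborel)"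
    by (intro mult_left_mono) (simp_all add: integral_norm_bound)
  also have "\<dots> = (\<integral>v. X\<^sup>2 * norm (\<integral>u. kern_integrand X Y \<kappa> \<sigma> (u, v) \<partial>lborel) \<partial>lborel)" by simp
  also have "\<dots> \<le> (\<integral>v. 25600 * N ^ 6 * exp (- (1 / 2) * v\<^sup>2) \<partial>lborel)"
  proof (rule integral_mono)
    show "integrable lborel (\<lambda>v. X\<^sup>2 * norm (\<integral>u. kern_integrand X Y \<kappa> \<sigma> (u, v) \<partial>lborel))"
      using lborel_pair.integrable_snd[OF int] by (intro integrable_mult_right integrable_norm) simp
    show "integrable lborel (\<lambda>v. 25600 * N ^ 6 * exp (- (1 / 2) * v\<^sup>2))"
      using has_bochner_integral_gaussian[of "1/2"] by (intro integrable_mult_right) (auto simp: has_bochner_integral_iff)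
    fix v :: real
    have "X\<^sup>2 * norm (\<integral>u. kern_integrand X Y \<kappa> \<sigma> (u, v) \<partial>lborel) = exp (- v\<^sup>2) * (X\<^sup>2 * norm (\<integral>u. h v u \<partial>lborel))"
      by (simp add: k norm_mult)
    also have "\<dots> \<le> exp (- v\<^sup>2) * (1600 * N ^ 6 * (1 + v\<^sup>2)\<^sup>2)" by (intro mult_left_mono hI) auto
    also have "\<dots> \<le> exp (- v\<^sup>2) * (1600 * N ^ 6 * (4 * exp (v\<^sup>2 / 4))\<^sup>2)"
    proof (intro mult_left_mono power_mono)
      \<comment> \<open>Squaring spends v^2 / 2 of the exponent and leaves exp (- v^2 / 2) of the
        Gaussian.\<close>
      show "1 + v\<^sup>2 \<le> 4 * exp (v\<^sup>2 / 4)"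
        by (rule order_trans[OF _ mult_left_mono[OF exp_ge_add_one_self[of "v\<^sup>2 / 4"], of 4]]) simp_all
    qed (use N in auto)
    also have "(4 * exp (v\<^sup>2 / 4))\<^sup>2 = 16 * exp (v\<^sup>2 / 2)"
      by (simp add: power_mult_distrib flip: exp_double)
    also have "exp (- v\<^sup>2) * (1600 * N ^ 6 * (16 * exp (v\<^sup>2 / 2))) = 25600 * N ^ 6 * (exp (- v\<^sup>2) * exp (v\<^sup>2 / 2))" by simp
    also have "exp (- v\<^sup>2) * exp (v\<^sup>2 / 2) = exp (- (1 / 2) * v\<^sup>2)" by (simp flip: exp_add)
    finally show "X\<^sup>2 * norm (\<integral>u. kern_integrand X Y \<kappa> \<sigma> (u, v) \<partial>lborel) \<le> 25600 * N ^ 6 * exp (- (1 / 2) * v\<^sup>2)" .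
  qed
  also have "\<dots> = 25600 * N ^ 6 * sqrt (2 * pi)"
    using has_bochner_integral_gaussian[of "1/2"] by (simp add: has_bochner_integral_iff mult.commute)
  also have "\<dots> \<le> 25600 * N ^ 6 * 3"
    using N pi_less_4 by (intro mult_left_mono real_le_lsqrt) auto
  also have "\<dots> \<le> 80000 * N ^ 6" using N by simp
  finally show ?thesis by (simp add: \<sigma>_def)
qed

lemma kern_bounds:
  assumes N: "N \<ge> 1" and \<kappa>: "\<bar>\<kappa>\<bar> \<le> N\<^sup>2"
  shows "\<bar>X\<bar> * norm (kern X Y \<kappa> (\<kappa> * N)) \<le> 400000 * (1 + ln N)"
    and "\<bar>Y\<bar> * norm (kern X Y \<kappa> (\<kappa> * N)) \<le> 400000 * (1 + ln N)"
    and "X\<^sup>2 * norm (kern X Y \<kappa> (\<kappa> * N)) \<le> 80000 * N ^ 6"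
    and "Y\<^sup>2 * norm (kern X Y \<kappa> (\<kappa> * N)) \<le> 80000 * N ^ 6"
proof -
  show "X\<^sup>2 * norm (kern X Y \<kappa> (\<kappa> * N)) \<le> 80000 * N ^ 6" by (rule kern_X_decay[OF assms])
  have N6: "1100 * N ^ 6 \<le> 80000 * N ^ 6" using N by simp
  show "\<bar>X\<bar> * norm (kern X Y \<kappa> (\<kappa> * N)) \<le> 400000 * (1 + ln N)"
    "\<bar>Y\<bar> * norm (kern X Y \<kappa> (\<kappa> * N)) \<le> 400000 * (1 + ln N)"
    "Y\<^sup>2 * norm (kern X Y \<kappa> (\<kappa> * N)) \<le> 80000 * N ^ 6"
  \<comment> \<open>Induction over a truth value acts as one case split for three goals at
    once.\<close>
  proof (induction "\<kappa> \<ge> 0")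
    case True
    then have k: "0 \<le> \<kappa>" "\<kappa> \<le> N\<^sup>2" using \<kappa> by auto
    case 1 show ?case by (rule kern_log_bound_nonneg(1)[OF N k])
    case 2 show ?case by (rule kern_log_bound_nonneg(2)[OF N k])
    case 3 show ?case using kern_Y_decay_nonneg[OF N k, of Y X] N6 by linarith
  next
    case False
    then have k: "0 \<le> - \<kappa>" "- \<kappa> \<le> N\<^sup>2" using \<kappa> by auto
    have eq: "norm (kern X Y \<kappa> (\<kappa> * N)) = norm (kern (- X) (- Y) (- \<kappa>) (- \<kappa> * N))"
      using kern_uminus[of X Y \<kappa> "\<kappa> * N"] by simp
    case 1 show ?case unfolding eq using kern_log_bound_nonneg(1)[OF N k, of "- X" "- Y"] by simp
    case 2 show ?case unfolding eq using kern_log_bound_nonneg(2)[OF N k, of "- Y" "- X"] by simp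
    case 3 show ?case unfolding eq using order_trans[OF kern_Y_decay_nonneg[OF N k, of "- Y" "- X"] N6] by simp
  qed
qed

section \<open>The maximal \<open>T T\<^sup>*\<close> argument\<close>

lemma integrable_lborel_pair_mult:
  fixes f :: "'a::euclidean_space \<Rightarrow> real" and g :: "'b::euclidean_space \<Rightarrow> real"
  assumes "integrable lborel f" "integrable lborel g"
  shows "integrable (lborel \<Otimes>\<^sub>M lborel) (\<lambda>(u, v). f u * g v)"
  by (rule lborel_pair.Fubini_integrable) (use assms in \<open>auto simp: abs_mult\<close>)

lemma borel_measurable_cis [measurable (raw)]:
  "f \<in> borel_measurable M \<Longrightarrow> (\<lambda>x. cis (f x)) \<in> borel_measurable M"
  by (rule measurable_compose[of f M borel]) (auto intro!: borel_measurable_continuous_onI continuous_intros)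

lemma borel_measurable_cnj [measurable (raw)]:
  "f \<in> borel_measurable M \<Longrightarrow> (\<lambda>x. cnj (f x)) \<in> borel_measurable M"
  by (rule measurable_compose[of f M borel]) (auto intro!: borel_measurable_continuous_onI continuous_intros)

text \<open>The inequality a b \<le> (a^2 + b^2) / 2 splits the bilinear form into two halves; in
  each of them the integral of \<open>H\<close> factors out by translation invariance. With values
  in [0, \<infinity>] there is no integrability to check.\<close>

lemma schur_test_convolution:
  fixes V H :: "real \<Rightarrow> ennreal"
  assumes [measurable]: "V \<in> borel_measurable borel" "H \<in> borel_measurable borel"
  shows "(\<integral>\<^sup>+p. (case p of (x, x') \<Rightarrow> V x * V x' * H (x - x')) \<partial>lborel)
    \<le> (\<integral>\<^sup>+x. (V x)\<^sup>2 \<partial>lborel) * (\<integral>\<^sup>+x. H x \<partial>lborel)"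
proof -
  let ?h = "ennreal (1/2)"
  have amgm: "a * b \<le> ?h * (a\<^sup>2 + b\<^sup>2)" for a b :: ennreal
  proof (cases a; cases b)
    fix r s :: real assume rs: "0 \<le> r" "a = ennreal r" "0 \<le> s" "b = ennreal s"
    have "r * s \<le> 1 / 2 * (r\<^sup>2 + s\<^sup>2)" using sum_squares_bound[of r s] by simp
    then have "ennreal (r * s) \<le> ennreal (1 / 2 * (r\<^sup>2 + s\<^sup>2))" by (rule ennreal_leI)
    also have "\<dots> = ?h * (ennreal (r\<^sup>2) + ennreal (s\<^sup>2))" by (subst ennreal_mult) auto
    finally show ?thesis using rs by (simp only: ennreal_mult ennreal_power)
  qed (auto simp: ennreal_mult_top ennreal_top_mult top_power_ennreal)
  have h1: "(\<integral>\<^sup>+x'. H (x - x') \<partial>lborel) = (\<integral>\<^sup>+x. H x \<partial>lborel)" for x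
    using nn_integral_real_affine[of H "-1" x] by simp
  have h2: "(\<integral>\<^sup>+x. H (x - x') \<partial>lborel) = (\<integral>\<^sup>+x. H x \<partial>lborel)" for x'
    using nn_integral_real_affine[of H 1 "- x'"] by simp
  have e1: "(\<integral>\<^sup>+p. (case p of (x, x') \<Rightarrow> (V x)\<^sup>2 * H (x - x')) \<partial>lborel) = (\<integral>\<^sup>+x. (V x)\<^sup>2 \<partial>lborel) * (\<integral>\<^sup>+x. H x \<partial>lborel)"
  proof -
    have "(\<integral>\<^sup>+p. (case p of (x, x') \<Rightarrow> (V x)\<^sup>2 * H (x - x')) \<partial>lborel) = (\<integral>\<^sup>+x. (\<integral>\<^sup>+x'. (V x)\<^sup>2 * H (x - x') \<partial>lborel) \<partial>lborel)"
      unfolding lborel_prod[symmetric] by (subst lborel.nn_integral_fst[symmetric]) auto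
    also have "\<dots> = (\<integral>\<^sup>+x. (V x)\<^sup>2 * (\<integral>\<^sup>+x. H x \<partial>lborel) \<partial>lborel)" by (simp add: nn_integral_cmult h1)
    finally show ?thesis by (simp add: nn_integral_multc)
  qed
  have e2: "(\<integral>\<^sup>+p. (case p of (x, x') \<Rightarrow> (V x')\<^sup>2 * H (x - x')) \<partial>lborel) = (\<integral>\<^sup>+x. (V x)\<^sup>2 \<partial>lborel) * (\<integral>\<^sup>+x. H x \<partial>lborel)"
  proof -
    have "(\<integral>\<^sup>+p. (case p of (x, x') \<Rightarrow> (V x')\<^sup>2 * H (x - x')) \<partial>lborel) = (\<integral>\<^sup>+x'. (\<integral>\<^sup>+x. (V x')\<^sup>2 * H (x - x') \<partial>lborel) \<partial>lborel)"
      unfolding lborel_prod[symmetric] by (subst lborel_pair.nn_integral_snd[symmetric]) auto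
    also have "\<dots> = (\<integral>\<^sup>+x. (V x)\<^sup>2 * (\<integral>\<^sup>+x. H x \<partial>lborel) \<partial>lborel)" by (simp add: nn_integral_cmult h2)
    finally show ?thesis by (simp add: nn_integral_multc)
  qed
  have "(\<integral>\<^sup>+p. (case p of (x, x') \<Rightarrow> V x * V x' * H (x - x')) \<partial>lborel)
     \<le> (\<integral>\<^sup>+p. ?h * ((case p of (x, x') \<Rightarrow> (V x)\<^sup>2 * H (x - x')) + (case p of (x, x') \<Rightarrow> (V x')\<^sup>2 * H (x - x'))) \<partial>lborel)"
    using mult_right_mono[OF amgm]
    by (intro nn_integral_mono) (auto simp: distrib_right[symmetric] mult.assoc[symmetric])
  also have "\<dots> = ?h * ((\<integral>\<^sup>+x. (V x)\<^sup>2 \<partial>lborel) * (\<integral>\<^sup>+x. H x \<partial>lborel) + (\<integral>\<^sup>+x. (V x)\<^sup>2 \<partial>lborel) * (\<integral>\<^sup>+x. H x \<partial>lborel))"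
    unfolding lborel_prod[symmetric]
    by (subst nn_integral_cmult, (measurable)[1], subst nn_integral_add) (auto simp: e1[unfolded lborel_prod[symmetric]] e2[unfolded lborel_prod[symmetric]])
  also have "\<dots> = (?h * 2) * ((\<integral>\<^sup>+x. (V x)\<^sup>2 \<partial>lborel) * (\<integral>\<^sup>+x. H x \<partial>lborel))"
    by (simp only: mult_2[symmetric] mult.assoc)
  also have "?h * 2 = 1" using ennreal_mult[of "1/2" 2] by (simp flip: ennreal_numeral)
  finally show ?thesis by simp
qed

text \<open>The \<open>T T\<^sup>*\<close> argument for one measurable choice \<open>E\<close> of the phase.\<close>

lemma TT_star_fixed_phase:
  fixes E :: "real \<Rightarrow> 'a::euclidean_space \<Rightarrow> real" and g :: "'a \<Rightarrow> complex" and w :: "'a \<Rightarrow> real" and H :: "real \<Rightarrow> ennreal"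
  assumes E [measurable]: "(\<lambda>(x, \<zeta>). E x \<zeta>) \<in> borel_measurable (borel \<Otimes>\<^sub>M borel)"
    and g: "integrable lborel g"
    and w: "integrable lborel w" "\<And>\<zeta>. w \<zeta> \<ge> 0" "c > 0" "\<And>\<zeta>. g \<zeta> \<noteq> 0 \<Longrightarrow> c \<le> w \<zeta>"
    and H [measurable]: "H \<in> borel_measurable borel"
    and K: "\<And>x x'. ennreal (norm (\<integral>\<zeta>. of_real (w \<zeta>) * cis (E x \<zeta> - E x' \<zeta>) \<partial>lborel)) \<le> H (x - x')"
  shows "(\<integral>\<^sup>+x. indicator {-R..R} x * ennreal ((norm (\<integral>\<zeta>. cis (E x \<zeta>) * g \<zeta> \<partial>lborel))\<^sup>2) \<partial>lborel)
      \<le> ennreal (1 / c) * (\<integral>\<^sup>+x. H x \<partial>lborel) * (\<integral>\<^sup>+\<zeta>. ennreal ((norm (g \<zeta>))\<^sup>2) \<partial>lborel)"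
proof -
  have g_m [measurable]: "g \<in> borel_measurable borel" using borel_measurable_integrable[OF g] by simp
  have w_m [measurable]: "w \<in> borel_measurable borel" using borel_measurable_integrable[OF w(1)] by simp
  have E1 [measurable]: "E x \<in> borel_measurable borel" for x
    using measurable_compose[OF measurable_Pair1'[of x borel borel] E] by simp
  have E2 [measurable]: "(\<lambda>p. E (snd p) (fst p)) \<in> borel_measurable (borel \<Otimes>\<^sub>M borel)"
    using measurable_pair_swap[OF E] by (simp add: split_def)
  define S where "S = {-R..R}"
  have [measurable]: "S \<in> sets borel" by (simp add: S_def)
  define v where "v = (\<lambda>x. \<integral>\<zeta>. cis (E x \<zeta>) * g \<zeta> \<partial>lborel)"
  define G where "G = (\<integral>\<zeta>. norm (g \<zeta>) \<partial>lborel)"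
  have [measurable]: "v \<in> borel_measurable borel"
    unfolding v_def by (rule lborel.borel_measurable_lebesgue_integral) measurable
  have vG: "norm (v x) \<le> G" for x
    unfolding v_def G_def by (rule order_trans[OF integral_norm_bound]) (simp add: norm_mult)
  have G0: "G \<ge> 0" by (simp add: G_def)
  \<comment> \<open>Truncating to [-R, R] makes \<open>V\<close> integrable and \<open>I\<close>
    finite, so that Fubini applies and \<open>I\<close> can be cancelled at the end. The truncation
    disappears in the limit taken by \<open>maximal_TT_star\<close>.\<close>
  define V where "V = (\<lambda>x. indicator S x *\<^sub>R v x)"
  have [measurable]: "V \<in> borel_measurable borel" unfolding V_def by measurable
  have VG: "norm (V x) \<le> G * indicator S x" for x using vG[of x] by (auto simp: V_def indicator_def)
  have iS: "integrable lborel (\<lambda>x. G * indicator S x :: real)"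
    by (intro integrable_mult_right integrable_real_indicator) (auto simp: S_def emeasure_lborel_Icc_eq)
  have V_int: "integrable lborel V"
    by (rule Bochner_Integration.integrable_bound[OF iS]) (use VG G0 in \<open>auto simp: abs_mult\<close>)
  define I where "I = (\<integral>x. (norm (V x))\<^sup>2 \<partial>lborel)"
  have V2_int: "integrable lborel (\<lambda>x. (norm (V x))\<^sup>2)"
  proof (rule Bochner_Integration.integrable_bound[OF integrable_mult_right[OF iS, of G]])
    show "AE x in lborel. norm ((norm (V x))\<^sup>2) \<le> norm (G * (G * indicator S x))"
      using vG G0 by (intro AE_I2) (auto simp: V_def indicator_def power2_eq_square intro!: mult_mono)
  qed measurable
  have nnI: "(\<integral>\<^sup>+x. ennreal ((norm (V x))\<^sup>2) \<partial>lborel) = ennreal I"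
    unfolding I_def using V2_int by (intro nn_integral_eq_integral) auto
  have I0: "I \<ge> 0" unfolding I_def by simp
  \<comment> \<open>Up to conjugation this is the adjoint of the linearised operator applied to
    \<open>V\<close>; by duality \<open>I\<close> becomes the pairing of \<Phi> with
    \<open>g\<close>.\<close>
  define \<Phi> where "\<Phi> = (\<lambda>\<zeta>. \<integral>x. cnj (V x) * cis (E x \<zeta>) \<partial>lborel)"
  have [measurable]: "\<Phi> \<in> borel_measurable borel"
    unfolding \<Phi>_def by (rule lborel.borel_measurable_lebesgue_integral) measurable
  have \<Phi>_int: "integrable lborel (\<lambda>x. cnj (V x) * cis (E x \<zeta>))" for \<zeta>
    by (rule Bochner_Integration.integrable_bound[OF V_int]) (auto simp: norm_mult)
  have int1: "integrable (lborel \<Otimes>\<^sub>M lborel) (\<lambda>(x, \<zeta>). cnj (V x) * cis (E x \<zeta>) * g \<zeta>)"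
  proof (rule Bochner_Integration.integrable_bound[OF integrable_lborel_pair_mult[OF integrable_norm[OF V_int] integrable_norm[OF g]]])
    show "AE p in lborel \<Otimes>\<^sub>M lborel. norm (case p of (x, \<zeta>) \<Rightarrow> cnj (V x) * cis (E x \<zeta>) * g \<zeta>)
        \<le> norm (case p of (u, v) \<Rightarrow> norm (V u) * norm (g v))"
      by (intro AE_I2) (auto simp: norm_mult abs_mult split: prod.split)
  qed measurable
  have "complex_of_real I = (\<integral>x. cnj (V x) * V x \<partial>lborel)"
    unfolding I_def by (subst integral_complex_of_real[symmetric])
      (auto intro!: Bochner_Integration.integral_cong simp: complex_norm_square mult.commute simp del: of_real_power)
  also have "\<dots> = (\<integral>x. (\<integral>\<zeta>. cnj (V x) * cis (E x \<zeta>) * g \<zeta> \<partial>lborel) \<partial>lborel)"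
    by (intro Bochner_Integration.integral_cong refl) (auto simp: V_def v_def mult.assoc indicator_def)
  also have "\<dots> = (\<integral>\<zeta>. (\<integral>x. cnj (V x) * cis (E x \<zeta>) * g \<zeta> \<partial>lborel) \<partial>lborel)"
    by (rule lborel_pair.Fubini_integral[OF int1, symmetric])
  also have "\<dots> = (\<integral>\<zeta>. \<Phi> \<zeta> * g \<zeta> \<partial>lborel)" by (simp add: \<Phi>_def)
  finally have I_eq: "complex_of_real I = (\<integral>\<zeta>. \<Phi> \<zeta> * g \<zeta> \<partial>lborel)" .
  have "ennreal I = ennreal (norm (\<integral>\<zeta>. \<Phi> \<zeta> * g \<zeta> \<partial>lborel))" using I0 by (simp flip: I_eq)
  also have "\<dots> \<le> (\<integral>\<^sup>+\<zeta>. ennreal (norm (\<Phi> \<zeta> * g \<zeta>)) \<partial>lborel)"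
    by (cases "integrable lborel (\<lambda>\<zeta>. \<Phi> \<zeta> * g \<zeta>)")
      (auto intro: integral_norm_bound_ennreal simp: not_integrable_integral_eq)
  \<comment> \<open>The weight enters here. It is at least \<open>c\<close> wherever
    \<open>g\<close> is nonzero, so sqrt (w / c) may be inserted; the factor with \<Phi> is then
    integrated against \<open>w\<close> over all frequencies, where the kernel is the one bounded by
    \<open>K\<close>.\<close>
  also have "\<dots> \<le> (\<integral>\<^sup>+\<zeta>. ennreal (norm (g \<zeta>) / sqrt c) * ennreal (sqrt (w \<zeta>) * norm (\<Phi> \<zeta>)) \<partial>lborel)"
  proof (rule nn_integral_mono)
    fix \<zeta>
    show "ennreal (norm (\<Phi> \<zeta> * g \<zeta>)) \<le> ennreal (norm (g \<zeta>) / sqrt c) * ennreal (sqrt (w \<zeta>) * norm (\<Phi> \<zeta>))"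
    proof (cases "g \<zeta> = 0")
      case False
      then have "1 \<le> sqrt (w \<zeta>) / sqrt c" using w(3) w(4)[of \<zeta>] by simp
      then have "norm (\<Phi> \<zeta> * g \<zeta>) * 1 \<le> norm (\<Phi> \<zeta> * g \<zeta>) * (sqrt (w \<zeta>) / sqrt c)" by (intro mult_left_mono) auto
      also have "\<dots> = norm (g \<zeta>) / sqrt c * (sqrt (w \<zeta>) * norm (\<Phi> \<zeta>))" by (simp add: norm_mult)
      finally have "norm (\<Phi> \<zeta> * g \<zeta>) \<le> norm (g \<zeta>) / sqrt c * (sqrt (w \<zeta>) * norm (\<Phi> \<zeta>))" by simp
      then show ?thesis using w(2,3) by (subst ennreal_mult[symmetric]) (auto intro!: ennreal_leI)
    qed simp
  qed
  finally have "(ennreal I)\<^sup>2 \<le> (\<integral>\<^sup>+\<zeta>. ennreal (norm (g \<zeta>) / sqrt c) * ennreal (sqrt (w \<zeta>) * norm (\<Phi> \<zeta>)) \<partial>lborel)\<^sup>2"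
    by (rule power_mono) simp
  also have "\<dots> \<le> (\<integral>\<^sup>+\<zeta>. (ennreal (norm (g \<zeta>) / sqrt c))\<^sup>2 \<partial>lborel) * (\<integral>\<^sup>+\<zeta>. (ennreal (sqrt (w \<zeta>) * norm (\<Phi> \<zeta>)))\<^sup>2 \<partial>lborel)"
    by (rule Cauchy_Schwarz_nn_integral) measurable
  also have "(\<integral>\<^sup>+\<zeta>. (ennreal (norm (g \<zeta>) / sqrt c))\<^sup>2 \<partial>lborel) = ennreal (1 / c) * (\<integral>\<^sup>+\<zeta>. ennreal ((norm (g \<zeta>))\<^sup>2) \<partial>lborel)"
    using w(3) by (subst nn_integral_cmult[symmetric])
      (auto intro!: nn_integral_cong simp: ennreal_power power_divide ennreal_mult[symmetric])
  also have "(\<integral>\<^sup>+\<zeta>. (ennreal (sqrt (w \<zeta>) * norm (\<Phi> \<zeta>)))\<^sup>2 \<partial>lborel) = (\<integral>\<^sup>+\<zeta>. ennreal (w \<zeta> * (norm (\<Phi> \<zeta>))\<^sup>2) \<partial>lborel)"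
    using w(2) by (intro nn_integral_cong) (simp add: ennreal_power power_mult_distrib)
  also have "\<dots> \<le> ennreal I * (\<integral>\<^sup>+x. H x \<partial>lborel)"
  proof -
    define Q where "Q = (\<lambda>(x, x') \<zeta>. of_real (w \<zeta>) * (cnj (V x) * V x' * cis (E x \<zeta> - E x' \<zeta>)))"
    have VV: "integrable lborel (\<lambda>(x, x'). norm (V x) * norm (V x'))"
      using integrable_lborel_pair_mult[OF integrable_norm[OF V_int] integrable_norm[OF V_int]] by (simp add: lborel_prod)
    have int2: "integrable (lborel \<Otimes>\<^sub>M lborel) (\<lambda>(p, \<zeta>). Q p \<zeta>)"
    proof (rule Bochner_Integration.integrable_bound[OF integrable_lborel_pair_mult[OF VV w(1)]])
      show "(\<lambda>(p, \<zeta>). Q p \<zeta>) \<in> borel_measurable (lborel \<Otimes>\<^sub>M lborel)"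
      proof -
        let ?M = "(borel \<Otimes>\<^sub>M borel) \<Otimes>\<^sub>M borel :: ((real \<times> real) \<times> 'a) measure"
        have "(\<lambda>p. (fst (fst p), snd p)) \<in> measurable ?M (borel \<Otimes>\<^sub>M borel)"
          "(\<lambda>p. (snd (fst p), snd p)) \<in> measurable ?M (borel \<Otimes>\<^sub>M borel)"
          by measurable
        from this[THEN measurable_compose[OF _ E]]
        have [measurable]: "(\<lambda>p. E (fst (fst p)) (snd p)) \<in> borel_measurable ?M"
          "(\<lambda>p. E (snd (fst p)) (snd p)) \<in> borel_measurable ?M"
          by simp_all
        show ?thesis
          unfolding Q_def lborel_prod[symmetric] split_def by measurable
      qed
      show "AE p in lborel \<Otimes>\<^sub>M lborel. norm (case p of (p, \<zeta>) \<Rightarrow> Q p \<zeta>)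
          \<le> norm (case p of (p, \<zeta>) \<Rightarrow> (case p of (x, x') \<Rightarrow> norm (V x) * norm (V x')) * w \<zeta>)"
        using w(2) by (intro AE_I2) (auto simp: Q_def norm_mult abs_mult split: prod.split)
    qed
    have inner: "(\<integral>p. Q p \<zeta> \<partial>lborel) = of_real (w \<zeta> * (norm (\<Phi> \<zeta>))\<^sup>2)" for \<zeta>
    proof -
      have cq: "integrable (lborel \<Otimes>\<^sub>M lborel) (\<lambda>(x, x'). (cnj (V x) * cis (E x \<zeta>)) * (V x' * cis (- E x' \<zeta>)))"
        by (rule Bochner_Integration.integrable_bound[OF integrable_lborel_pair_mult[OF integrable_norm[OF V_int] integrable_norm[OF V_int]]])
          (auto simp: norm_mult abs_mult split: prod.split)
      have "(\<integral>p. (case p of (x, x') \<Rightarrow> (cnj (V x) * cis (E x \<zeta>)) * (V x' * cis (- E x' \<zeta>))) \<partial>lborel)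
          = (\<integral>x. (\<integral>x'. (cnj (V x) * cis (E x \<zeta>)) * (V x' * cis (- E x' \<zeta>)) \<partial>lborel) \<partial>lborel)"
        using lborel_pair.integral_fst[OF cq] by (simp add: lborel_prod)
      also have "\<dots> = \<Phi> \<zeta> * (\<integral>x'. V x' * cis (- E x' \<zeta>) \<partial>lborel)" by (simp add: \<Phi>_def)
      also have "(\<integral>x'. V x' * cis (- E x' \<zeta>) \<partial>lborel) = cnj (\<Phi> \<zeta>)"
        unfolding \<Phi>_def by (subst Bochner_Integration.integral_cnj[symmetric]) (simp add: cis_cnj)
      also have "\<Phi> \<zeta> * cnj (\<Phi> \<zeta>) = of_real ((norm (\<Phi> \<zeta>))\<^sup>2)" by (simp only: complex_norm_square)
      finally have A: "(\<integral>p. (case p of (x, x') \<Rightarrow> (cnj (V x) * cis (E x \<zeta>)) * (V x' * cis (- E x' \<zeta>))) \<partial>lborel) = of_real ((norm (\<Phi> \<zeta>))\<^sup>2)" .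
      have "Q p \<zeta> = of_real (w \<zeta>) * (case p of (x, x') \<Rightarrow> (cnj (V x) * cis (E x \<zeta>)) * (V x' * cis (- E x' \<zeta>)))" for p
      proof (cases p)
        case (Pair x x')
        have "cis (E x \<zeta> - E x' \<zeta>) = cis (E x \<zeta>) * cis (- E x' \<zeta>)" by (simp add: cis_mult)
        then show ?thesis by (simp add: Q_def Pair)
      qed
      then show ?thesis by (simp add: A del: of_real_power)
    qed
    have "integrable lborel (\<lambda>\<zeta>. w \<zeta> * (norm (\<Phi> \<zeta>))\<^sup>2)"
      using lborel_pair.integrable_snd[OF int2] by (simp only: inner complex_of_real_integrable_eq)
    then have "(\<integral>\<^sup>+\<zeta>. ennreal (w \<zeta> * (norm (\<Phi> \<zeta>))\<^sup>2) \<partial>lborel) = ennreal (\<integral>\<zeta>. w \<zeta> * (norm (\<Phi> \<zeta>))\<^sup>2 \<partial>lborel)"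
      using w(2) by (intro nn_integral_eq_integral) auto
    also have "\<dots> = ennreal (norm (\<integral>\<zeta>. (\<integral>p. Q p \<zeta> \<partial>lborel) \<partial>lborel))"
      using w(2) by (simp add: inner del: of_real_power of_real_mult)
    also have "(\<integral>\<zeta>. (\<integral>p. Q p \<zeta> \<partial>lborel) \<partial>lborel) = (\<integral>p. (\<integral>\<zeta>. Q p \<zeta> \<partial>lborel) \<partial>lborel)"
      by (rule lborel_pair.Fubini_integral[OF int2])
    also have "ennreal (norm \<dots>) \<le> (\<integral>\<^sup>+p. ennreal (norm (\<integral>\<zeta>. Q p \<zeta> \<partial>lborel)) \<partial>lborel)"
      by (rule integral_norm_bound_ennreal) (use lborel_pair.integrable_fst[OF int2] in simp)
    also have "\<dots> \<le> (\<integral>\<^sup>+p. (case p of (x, x') \<Rightarrow> ennreal (norm (V x)) * ennreal (norm (V x')) * H (x - x')) \<partial>lborel)"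
    proof (rule nn_integral_mono)
      fix p :: "real \<times> real"
      obtain x x' where p: "p = (x, x')" by (cases p)
      have "(\<integral>\<zeta>. Q p \<zeta> \<partial>lborel) = cnj (V x) * V x' * (\<integral>\<zeta>. of_real (w \<zeta>) * cis (E x \<zeta> - E x' \<zeta>) \<partial>lborel)"
        unfolding p Q_def by (simp add: mult.left_commute flip: integral_mult_right_zero)
      then have "ennreal (norm (\<integral>\<zeta>. Q p \<zeta> \<partial>lborel)) = ennreal (norm (V x)) * ennreal (norm (V x')) *
          ennreal (norm (\<integral>\<zeta>. of_real (w \<zeta>) * cis (E x \<zeta> - E x' \<zeta>) \<partial>lborel))"
        by (simp add: norm_mult ennreal_mult)
      also have "\<dots> \<le> ennreal (norm (V x)) * ennreal (norm (V x')) * H (x - x')"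
        by (intro mult_left_mono K) auto
      finally show "ennreal (norm (\<integral>\<zeta>. Q p \<zeta> \<partial>lborel)) \<le> (case p of (x, x') \<Rightarrow> ennreal (norm (V x)) * ennreal (norm (V x')) * H (x - x'))"
        by (simp add: p)
    qed
    also have "\<dots> \<le> (\<integral>\<^sup>+x. (ennreal (norm (V x)))\<^sup>2 \<partial>lborel) * (\<integral>\<^sup>+x. H x \<partial>lborel)"
      by (rule schur_test_convolution) measurable
    also have "(\<integral>\<^sup>+x. (ennreal (norm (V x)))\<^sup>2 \<partial>lborel) = ennreal I" by (simp add: ennreal_power nnI)
    finally show ?thesis .
  qed
  \<comment> \<open>\<open>I\<close> occurs squared on the left and once on the right; being finite,
    it can be cancelled unless it is zero.\<close>
  finally have key: "(ennreal I)\<^sup>2 \<le> ennreal (1 / c) * (\<integral>\<^sup>+\<zeta>. ennreal ((norm (g \<zeta>))\<^sup>2) \<partial>lborel) * (ennreal I * (\<integral>\<^sup>+x. H x \<partial>lborel))"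
    by (simp add: mult_left_mono)
  have "ennreal I \<le> ennreal (1 / c) * (\<integral>\<^sup>+x. H x \<partial>lborel) * (\<integral>\<^sup>+\<zeta>. ennreal ((norm (g \<zeta>))\<^sup>2) \<partial>lborel)" (is "_ \<le> ?B")
  proof (cases "I = 0")
    case False
    then have Ip: "ennreal I > 0" "ennreal I < \<infinity>" using I0 by auto
    have "ennreal I * ennreal I \<le> ennreal I * ?B" using key by (simp add: power2_eq_square mult_ac)
    then show ?thesis using Ip by (simp add: ennreal_mult_le_mult_iff)
  qed simp
  moreover have "(\<integral>\<^sup>+x. indicator {-R..R} x * ennreal ((norm (\<integral>\<zeta>. cis (E x \<zeta>) * g \<zeta> \<partial>lborel))\<^sup>2) \<partial>lborel) = ennreal I"
    unfolding nnI[symmetric] by (intro nn_integral_cong) (auto simp: V_def v_def S_def indicator_def)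
  ultimately show ?thesis by simp
qed

lemma SUP_ennreal_dense:
  fixes h :: "'z::metric_space \<Rightarrow> real"
  assumes h: "continuous_on Z h" and D: "D \<subseteq> Z" "Z \<subseteq> closure D"
  shows "(SUP z\<in>Z. ennreal (h z)) = (SUP z\<in>D. ennreal (h z))"
proof (rule antisym)
  show "(SUP z\<in>Z. ennreal (h z)) \<le> (SUP z\<in>D. ennreal (h z))"
  proof (rule SUP_least)
    fix z assume z: "z \<in> Z"
    then obtain d where d: "\<And>n. d n \<in> D" "d \<longlonglongrightarrow> z"
      using D closure_sequential by (metis subsetD)
    have "(\<lambda>n. h (d n)) \<longlonglongrightarrow> h z"
      using h d z D by (auto simp: continuous_on_sequentially o_def)
    then have "(\<lambda>n. ennreal (h (d n))) \<longlonglongrightarrow> ennreal (h z)" by (rule tendsto_ennrealI)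
    then show "ennreal (h z) \<le> (SUP z\<in>D. ennreal (h z))"
      by (rule LIMSEQ_le_const2) (auto intro!: SUP_upper d)
  qed
qed (intro SUP_subset_mono D order_refl)

text \<open>The supremum is linearised by a measurable selection. Among the first n + 1 points of a
  countable dense subset of \<open>Z\<close>, the index \<open>s n x\<close> attains the maximum and
  depends measurably on x, so \<open>TT_star_fixed_phase\<close> applies to the phase it selects.
  Since \<open>K\<close> is uniform in z and z', the bound does not see the selection, and monotone
  convergence removes n.\<close>

lemma maximal_TT_star:
  fixes E :: "real \<Rightarrow> 'z::{metric_space, second_countable_topology} \<Rightarrow> 'a::euclidean_space \<Rightarrow> real"
    and g :: "'a \<Rightarrow> complex" and w :: "'a \<Rightarrow> real" and H :: "real \<Rightarrow> ennreal"
  assumes E: "\<And>z. (\<lambda>(x, \<zeta>). E x z \<zeta>) \<in> borel_measurable (borel \<Otimes>\<^sub>M borel)"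
    and Ec: "\<And>x \<zeta>. continuous_on Z (\<lambda>z. E x z \<zeta>)"
    and Z: "Z \<noteq> {}"
    and g: "integrable lborel g"
    and w: "integrable lborel w" "\<And>\<zeta>. w \<zeta> \<ge> 0" "c > 0" "\<And>\<zeta>. g \<zeta> \<noteq> 0 \<Longrightarrow> c \<le> w \<zeta>"
    and H: "H \<in> borel_measurable borel"
    and K: "\<And>x x' z z'. z \<in> Z \<Longrightarrow> z' \<in> Z \<Longrightarrow>
      ennreal (norm (\<integral>\<zeta>. of_real (w \<zeta>) * cis (E x z \<zeta> - E x' z' \<zeta>) \<partial>lborel)) \<le> H (x - x')"
  shows "(\<integral>\<^sup>+x. (SUP z\<in>Z. ennreal ((norm (\<integral>\<zeta>. cis (E x z \<zeta>) * g \<zeta> \<partial>lborel))\<^sup>2)) \<partial>lborel)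
      \<le> ennreal (1 / c) * (\<integral>\<^sup>+x. H x \<partial>lborel) * (\<integral>\<^sup>+\<zeta>. ennreal ((norm (g \<zeta>))\<^sup>2) \<partial>lborel)"
proof -
  have g_m [measurable]: "g \<in> borel_measurable borel" using borel_measurable_integrable[OF g] by simp
  have E1 [measurable]: "E x z \<in> borel_measurable borel" for x z
    using measurable_compose[OF measurable_Pair1'[of x borel borel] E[of z]] by simp
  define u where "u = (\<lambda>x z. \<integral>\<zeta>. cis (E x z \<zeta>) * g \<zeta> \<partial>lborel)"
  define h where "h = (\<lambda>x z. (norm (u x z))\<^sup>2)"
  have u_m [measurable]: "(\<lambda>x. u x z) \<in> borel_measurable borel" for z
    unfolding u_def
    by (rule lborel.borel_measurable_lebesgue_integral) (use E[of z] in measurable)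
  have hc: "continuous_on Z (h x)" for x
  proof -
    have "continuous_on Z (u x)"
      unfolding continuous_on_sequentially o_def
    proof (intro allI ballI impI)
      fix d z assume "z \<in> Z" and d: "(\<forall>n. d n \<in> Z) \<and> d \<longlonglongrightarrow> z"
      show "(\<lambda>n. u x (d n)) \<longlonglongrightarrow> u x z"
        unfolding u_def
      proof (rule integral_dominated_convergence[where w = "\<lambda>\<zeta>. norm (g \<zeta>)"])
        show "AE \<zeta> in lborel. (\<lambda>n. cis (E x (d n) \<zeta>) * g \<zeta>) \<longlonglongrightarrow> cis (E x z \<zeta>) * g \<zeta>"
        proof (rule AE_I2)
          fix \<zeta>
          have "(\<lambda>n. E x (d n) \<zeta>) \<longlonglongrightarrow> E x z \<zeta>"
            using Ec[of x \<zeta>] d \<open>z \<in> Z\<close> by (auto simp: continuous_on_sequentially o_def)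
          then show "(\<lambda>n. cis (E x (d n) \<zeta>) * g \<zeta>) \<longlonglongrightarrow> cis (E x z \<zeta>) * g \<zeta>"
            by (intro tendsto_intros)
        qed
      qed (use g in \<open>auto simp: norm_mult\<close>)
    qed
    then show ?thesis unfolding h_def by (intro continuous_intros)
  qed
  obtain D where D: "countable D" "D \<subseteq> Z" "Z \<subseteq> closure D"
    using separable[of Z] by blast
  then have "D \<noteq> {}" using Z by auto
  define d where "d = from_nat_into D"
  have dD: "range d = D" using D \<open>D \<noteq> {}\<close> by (simp add: d_def range_from_nat_into)
  \<comment> \<open>A running index of the maximum: each step compares the current record with one
    new point, so measurability follows by induction on n.\<close>
  define s where "s = rec_nat (\<lambda>x::real. 0::nat) (\<lambda>n s x. if h x (d (s x)) < h x (d (Suc n)) then Suc n else s x)"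
  have s_Suc: "s (Suc n) x = (if h x (d (s n x)) < h x (d (Suc n)) then Suc n else s n x)" for n x
    by (simp add: s_def)
  have h_m [measurable]: "(\<lambda>x. h x z) \<in> borel_measurable borel" for z
    unfolding h_def by measurable
  have s_m [measurable]: "s n \<in> measurable borel (count_space UNIV)" for n
  proof (induction n)
    case 0
    then show ?case by (simp add: s_def)
  next
    case (Suc n)
    note [measurable] = Suc.IH
    have [measurable]: "(\<lambda>x. h x (d (s n x))) \<in> borel_measurable borel"
      by (rule measurable_compose_countable[where f = "\<lambda>i x. h x (d i)"]) measurable
    show ?case unfolding s_Suc[abs_def] by measurable
  qed
  have ge: "i \<le> n \<Longrightarrow> h x (d i) \<le> h x (d (s n x))" for i n x
  proof (induction n)
    case 0 then show ?case by (simp add: s_def)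
  next
    case (Suc n) then show ?case by (cases "i = Suc n") (auto simp: s_Suc)
  qed
  have mono: "h x (d (s n x)) \<le> h x (d (s (Suc n) x))" for n x by (auto simp: s_Suc)
  \<comment> \<open>The window and the number of competing points grow together, so a single index
    controls both limits.\<close>
  define F where "F = (\<lambda>n x. indicator {- real n..real n} x * ennreal (h x (d (s n x))))"
  have Fm [measurable]: "F n \<in> borel_measurable borel" for n
  proof -
    have [measurable]: "(\<lambda>x. h x (d (s n x))) \<in> borel_measurable borel"
      by (rule measurable_compose_countable[where f = "\<lambda>i x. h x (d i)"]) measurable
    show ?thesis unfolding F_def by measurable
  qed
  have Finc: "incseq F"
  proof (rule incseq_SucI, rule le_funI)
    fix n x
    show "F n x \<le> F (Suc n) x" unfolding F_def
      using mono[of x n] by (intro mult_mono) (auto simp: indicator_def intro!: ennreal_leI)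
  qed
  have sup: "(SUP z\<in>Z. ennreal (h x z)) \<le> (SUP n. F n x)" for x
    unfolding SUP_ennreal_dense[OF hc D(2,3)] dD[symmetric] image_image
  proof (rule SUP_least)
    fix i :: nat
    define n where "n = max i (nat \<lceil>\<bar>x\<bar>\<rceil>)"
    have "x \<in> {- real n..real n}" unfolding n_def by (auto simp: abs_le_iff) linarith+
    then have "ennreal (h x (d i)) \<le> F n x"
      using ge[of i n x] by (auto simp: F_def n_def intro!: ennreal_leI)
    also have "\<dots> \<le> (SUP n. F n x)" by (rule SUP_upper) simp
    finally show "ennreal (h x (d i)) \<le> (SUP n. F n x)" .
  qed
  have "(\<integral>\<^sup>+x. (SUP z\<in>Z. ennreal (h x z)) \<partial>lborel) \<le> (\<integral>\<^sup>+x. (SUP n. F n x) \<partial>lborel)"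
    by (intro nn_integral_mono sup)
  also have "\<dots> = (SUP n. \<integral>\<^sup>+x. F n x \<partial>lborel)"
    by (rule nn_integral_monotone_convergence_SUP[OF Finc]) simp
  also have "\<dots> \<le> ennreal (1 / c) * (\<integral>\<^sup>+x. H x \<partial>lborel) * (\<integral>\<^sup>+\<zeta>. ennreal ((norm (g \<zeta>))\<^sup>2) \<partial>lborel)"
  proof (rule SUP_least)
    fix n
    have dZ: "d i \<in> Z" for i using dD D by auto
    have "(\<integral>\<^sup>+x. indicator {- real n..real n} x * ennreal ((norm (\<integral>\<zeta>. cis (E x (d (s n x)) \<zeta>) * g \<zeta> \<partial>lborel))\<^sup>2) \<partial>lborel)
       \<le> ennreal (1 / c) * (\<integral>\<^sup>+x. H x \<partial>lborel) * (\<integral>\<^sup>+\<zeta>. ennreal ((norm (g \<zeta>))\<^sup>2) \<partial>lborel)"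
    proof (rule TT_star_fixed_phase[where w = w])
      have [measurable]: "(\<lambda>p. s n (fst p)) \<in> measurable (borel \<Otimes>\<^sub>M (borel :: 'a measure)) (count_space UNIV)"
        by measurable
      have "(\<lambda>p. case p of (x, \<zeta>) \<Rightarrow> E x (d (s n (fst p))) \<zeta>) \<in> borel_measurable (borel \<Otimes>\<^sub>M borel)"
        by (rule measurable_compose_countable[where f = "\<lambda>i p. case p of (x, \<zeta>) \<Rightarrow> E x (d i) \<zeta>"]) (use E in measurable)
      then show "(\<lambda>(x, \<zeta>). E x (d (s n x)) \<zeta>) \<in> borel_measurable (borel \<Otimes>\<^sub>M borel)"
        by (simp add: split_def)
      show "ennreal (norm (\<integral>\<zeta>. of_real (w \<zeta>) * cis (E x (d (s n x)) \<zeta> - E x' (d (s n x')) \<zeta>) \<partial>lborel)) \<le> H (x - x')" for x x'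
        by (intro K dZ)
    qed (use g w H in auto)
    then show "(\<integral>\<^sup>+x. F n x \<partial>lborel) \<le> ennreal (1 / c) * (\<integral>\<^sup>+x. H x \<partial>lborel) * (\<integral>\<^sup>+\<zeta>. ennreal ((norm (g \<zeta>))\<^sup>2) \<partial>lborel)"
      by (simp add: F_def h_def u_def)
  qed
  finally show ?thesis by (simp add: h_def u_def)
qed

section \<open>Plancherel's theorem\<close>

lemma nn_integral_lborel_translate:
  fixes f :: "'a::euclidean_space \<Rightarrow> ennreal"
  assumes [measurable]: "f \<in> borel_measurable borel"
  shows "(\<integral>\<^sup>+p. f (p + z) \<partial>lborel) = (\<integral>\<^sup>+p. f p \<partial>lborel)"
proof -
  have "(\<integral>\<^sup>+p. f p \<partial>lborel) = (\<integral>\<^sup>+p. f p \<partial>distr lborel borel ((+) z))" by (simp add: lborel_distr_plus)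
  also have "\<dots> = (\<integral>\<^sup>+p. f (z + p) \<partial>lborel)" by (rule nn_integral_distr) auto
  finally show ?thesis by (simp add: add.commute)
qed

text \<open>A is squeezed between a compact K and an open U whose difference is small. A shift short
  enough to keep K inside U changes the indicator only on U - K and on a translate of it.\<close>

lemma indicator_translate_small:
  fixes A :: "'a::euclidean_space set"
  assumes A: "A \<in> sets lborel" "emeasure lborel A < \<infinity>" and e: "e > 0"
  shows "\<exists>d>0. \<forall>z. norm z < d \<longrightarrow> (\<integral>\<^sup>+p. ennreal \<bar>indicator A (p + z) - indicator A p\<bar> \<partial>lborel) \<le> ennreal e"
proof -
  have As: "A \<in> sets lebesgue" and Am [measurable]: "A \<in> sets borel" using A by auto
  have e8: "0 < e / 8" using e by simp
  obtain U where U: "open U" "A \<subseteq> U" "U - A \<in> lmeasurable" "emeasure lebesgue (U - A) < ennreal (e / 8)"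
    by (rule sets_lebesgue_outer_open[OF As e8])
  \<comment> \<open>Inner regularity gives only a closed set; intersecting it with a large ball
    makes it compact at the price of another e / 4.\<close>
  obtain C where C: "closed C" "C \<subseteq> A" "A - C \<in> lmeasurable" "emeasure lebesgue (A - C) < ennreal (e / 8)"
    by (rule sets_lebesgue_inner_closed[OF As e8])
  have "(\<lambda>n. emeasure lborel (A - cball 0 (real n))) \<longlonglongrightarrow> emeasure lborel (\<Inter>n. A - cball 0 (real n))"
  proof (rule Lim_emeasure_decseq)
    show "decseq (\<lambda>n. A - cball 0 (real n))" by (intro decseq_SucI Diff_mono subset_cball) auto
    show "emeasure lborel (A - cball 0 (real i)) \<noteq> \<infinity>" for i
    proof -
      have "emeasure lborel (A - cball 0 (real i)) \<le> emeasure lborel A" by (rule emeasure_mono) auto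
      also note A(2)
      finally show ?thesis by simp
    qed
  qed auto
  moreover have "(\<Inter>n. A - cball 0 (real n)) = {}"
  proof -
    have "\<exists>n. p \<in> cball 0 (real n)" for p :: 'a using real_arch_simple[of "norm p"] by simp
    then show ?thesis by blast
  qed
  ultimately have "(\<lambda>n. emeasure lborel (A - cball 0 (real n))) \<longlonglongrightarrow> 0" by (simp only: emeasure_empty)
  then have "eventually (\<lambda>n. emeasure lborel (A - cball 0 (real n)) < ennreal (e / 4)) sequentially"
    using e by (auto simp: order_tendsto_iff)
  then obtain n where n: "emeasure lborel (A - cball 0 (real n)) < ennreal (e / 4)"
    by (auto simp: eventually_sequentially)
  define K where "K = C \<inter> cball 0 (real n)"
  have K: "compact K" "K \<subseteq> A" using C by (auto simp: K_def)
  have Cm [measurable]: "C \<in> sets borel" "U \<in> sets borel" using C U by auto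
  have "emeasure lborel (U - K) \<le> emeasure lborel ((U - A) \<union> ((A - C) \<union> (A - cball 0 (real n))))"
    by (rule emeasure_mono) (auto simp: K_def)
  also have "\<dots> \<le> emeasure lborel (U - A) + emeasure lborel ((A - C) \<union> (A - cball 0 (real n)))"
    by (rule emeasure_subadditive) auto
  also have "\<dots> \<le> emeasure lborel (U - A) + (emeasure lborel (A - C) + emeasure lborel (A - cball 0 (real n)))"
    by (intro add_left_mono emeasure_subadditive) auto
  also have "\<dots> \<le> ennreal (e / 8) + (ennreal (e / 8) + ennreal (e / 4))"
    using U(4) C(4) n by (intro add_mono) (auto intro: less_imp_le)
  also have "\<dots> = ennreal (e / 2)" using e by (simp flip: ennreal_plus)
  finally have em: "emeasure lborel (U - K) \<le> ennreal (e / 2)" .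
  have UKm [measurable]: "U - K \<in> sets borel" using U(1) K(1) by (simp add: open_Diff compact_imp_closed borel_open)
  have "K \<subseteq> U" using U K by auto
  then obtain d where d: "d > 0" "(\<Union>x\<in>K. ball x d) \<subseteq> U"
    using compact_subset_open_imp_ball_epsilon_subset[OF K(1) U(1)] by auto
  have "(\<integral>\<^sup>+p. ennreal \<bar>indicator A (p + z) - indicator A p\<bar> \<partial>lborel) \<le> ennreal e" if z: "norm z < d" for z
  proof -
    have pw: "ennreal \<bar>indicator A (p + z) - indicator A p\<bar> \<le> indicator (U - K) p + indicator (U - K) (p + z)" for p
    proof -
      have "p \<in> K \<Longrightarrow> p + z \<in> U"
      proof -
        assume "p \<in> K"
        moreover have "p + z \<in> ball p d" using z by (simp add: dist_norm)
        ultimately show "p + z \<in> U" using d by blast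
      qed
      moreover have "p + z \<in> K \<Longrightarrow> p \<in> U"
      proof -
        assume "p + z \<in> K"
        moreover have "p \<in> ball (p + z) d" using z by (simp add: dist_norm)
        ultimately show "p \<in> U" using d by blast
      qed
      ultimately have "p \<in> A \<Longrightarrow> p + z \<notin> A \<Longrightarrow> p \<in> U - K \<or> p + z \<in> U - K"
        "p \<notin> A \<Longrightarrow> p + z \<in> A \<Longrightarrow> p \<in> U - K \<or> p + z \<in> U - K"
        using U(2) K(2) by blast+
      then show ?thesis by (cases "p \<in> A"; cases "p + z \<in> A") (auto split: split_indicator)
    qed
    have "(\<integral>\<^sup>+p. ennreal \<bar>indicator A (p + z) - indicator A p\<bar> \<partial>lborel)
       \<le> (\<integral>\<^sup>+p. indicator (U - K) p + indicator (U - K) (p + z) \<partial>lborel)"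
      by (intro nn_integral_mono pw)
    also have "\<dots> = (\<integral>\<^sup>+p. indicator (U - K) p \<partial>lborel) + (\<integral>\<^sup>+p. indicator (U - K) (p + z) \<partial>lborel)"
      by (rule nn_integral_add) measurable
    also have "(\<integral>\<^sup>+p. indicator (U - K) (p + z) \<partial>lborel) = (\<integral>\<^sup>+p. indicator (U - K) p \<partial>lborel)"
      by (rule nn_integral_lborel_translate) measurable
    also have "(\<integral>\<^sup>+p. indicator (U - K) p \<partial>lborel) + (\<integral>\<^sup>+p. indicator (U - K) p \<partial>lborel) \<le> ennreal (e / 2) + ennreal (e / 2)"
      using em by (intro add_mono) simp_all
    also have "\<dots> = ennreal e" using e by (simp flip: ennreal_plus)
    finally show ?thesis .
  qed
  then show ?thesis using d by blast
qed

text \<open>Density in the form of an induction over integrable functions: multiples of indicators,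
  sums, and pointwise limits of functions bounded by twice |f|. In the last case translation
  invariance makes the approximation error the same before and after the shift.\<close>

lemma translation_continuous_L1:
  fixes f :: "'a::euclidean_space \<Rightarrow> complex"
  assumes "integrable lborel f" "z \<longlonglongrightarrow> 0"
  shows "(\<lambda>n. \<integral>\<^sup>+p. ennreal (norm (f (p + z n) - f p)) \<partial>lborel) \<longlonglongrightarrow> 0"
  using assms(1)
proof (induction rule: integrable_induct)
  case (base A c)
  have [measurable]: "A \<in> sets borel" using base by simp
  have eq: "(\<integral>\<^sup>+p. ennreal (norm (indicat_real A (p + z n) *\<^sub>R c - indicat_real A p *\<^sub>R c)) \<partial>lborel)
     = ennreal (norm c) * (\<integral>\<^sup>+p. ennreal \<bar>indicator A (p + z n) - indicator A p\<bar> \<partial>lborel)" for n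
  proof -
    have "ennreal (norm (indicat_real A (p + z n) *\<^sub>R c - indicat_real A p *\<^sub>R c))
        = ennreal (norm c) * ennreal \<bar>indicator A (p + z n) - indicator A p\<bar>" for p
    proof -
      have "norm (indicat_real A (p + z n) *\<^sub>R c - indicat_real A p *\<^sub>R c)
          = norm c * \<bar>indicator A (p + z n) - indicator A p\<bar>"
        unfolding scaleR_diff_left[symmetric] norm_scaleR by (rule mult.commute)
      then show ?thesis by (simp only: ennreal_mult norm_ge_zero abs_ge_zero)
    qed
    then show ?thesis by (simp add: nn_integral_cmult)
  qed
  have "(\<lambda>n. \<integral>\<^sup>+p. ennreal \<bar>indicator A (p + z n) - indicator A p\<bar> \<partial>lborel) \<longlonglongrightarrow> 0"
  proof (rule tendsto_zero_ennreal)
    fix e :: real assume "0 < e"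
    then obtain d where d: "d > 0" "\<And>z. norm z < d \<Longrightarrow> (\<integral>\<^sup>+p. ennreal \<bar>indicator A (p + z) - indicator A p\<bar> \<partial>lborel) \<le> ennreal (e / 2)"
      using indicator_translate_small[of A "e / 2"] base by auto
    from assms(2) d(1) have "eventually (\<lambda>n. norm (z n) < d) sequentially"
      by (simp add: tendsto_iff dist_norm)
    then show "\<forall>\<^sub>F n in sequentially. (\<integral>\<^sup>+p. ennreal \<bar>indicator A (p + z n) - indicator A p\<bar> \<partial>lborel) < ennreal e"
    proof eventually_elim
      case (elim n)
      then show ?case using le_less_trans[OF d(2)[OF elim], where z = "ennreal e"] \<open>0 < e\<close> by (simp add: ennreal_less_iff)
    qed
  qed
  then have "(\<lambda>n. ennreal (norm c) * (\<integral>\<^sup>+p. ennreal \<bar>indicator A (p + z n) - indicator A p\<bar> \<partial>lborel)) \<longlonglongrightarrow> ennreal (norm c) * 0"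
    by (intro ennreal_tendsto_cmult) auto
  then show ?case by (simp add: eq)
next
  case (add f g)
  have [measurable]: "f \<in> borel_measurable borel" "g \<in> borel_measurable borel"
    using add by (auto dest: borel_measurable_integrable)
  have U: "(\<lambda>n. (\<integral>\<^sup>+p. ennreal (norm (f (p + z n) - f p)) \<partial>lborel) + (\<integral>\<^sup>+p. ennreal (norm (g (p + z n) - g p)) \<partial>lborel)) \<longlonglongrightarrow> 0 + 0"
    by (intro tendsto_add add.IH)
  have le: "(\<integral>\<^sup>+p. ennreal (norm (f (p + z n) + g (p + z n) - (f p + g p))) \<partial>lborel)
     \<le> (\<integral>\<^sup>+p. ennreal (norm (f (p + z n) - f p)) \<partial>lborel) + (\<integral>\<^sup>+p. ennreal (norm (g (p + z n) - g p)) \<partial>lborel)" for n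
  proof -
    have "ennreal (norm (f (p + z n) + g (p + z n) - (f p + g p)))
       \<le> ennreal (norm (f (p + z n) - f p)) + ennreal (norm (g (p + z n) - g p))" for p
      using ennreal_leI[OF norm_diff_triangle_ineq[of "f (p + z n)" "g (p + z n)" "f p" "g p"]]
      by (simp only: ennreal_plus norm_ge_zero)
    then have "(\<integral>\<^sup>+p. ennreal (norm (f (p + z n) + g (p + z n) - (f p + g p))) \<partial>lborel)
       \<le> (\<integral>\<^sup>+p. ennreal (norm (f (p + z n) - f p)) + ennreal (norm (g (p + z n) - g p)) \<partial>lborel)"
      by (rule nn_integral_mono)
    then show ?thesis by (simp add: nn_integral_add)
  qed
  show ?case
  proof (rule tendsto_sandwich[where f = "\<lambda>_. 0"])
    show "\<forall>\<^sub>F n in sequentially. (\<integral>\<^sup>+p. ennreal (norm (f (p + z n) + g (p + z n) - (f p + g p))) \<partial>lborel)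
       \<le> (\<integral>\<^sup>+p. ennreal (norm (f (p + z n) - f p)) \<partial>lborel) + (\<integral>\<^sup>+p. ennreal (norm (g (p + z n) - g p)) \<partial>lborel)"
      using le by (intro always_eventually allI)
  qed (use U in simp_all)
next
  case (lim f s)
  have [measurable]: "f \<in> borel_measurable borel" "\<And>i. s i \<in> borel_measurable borel"
    using lim by (auto dest: borel_measurable_integrable)
  have "(\<lambda>i. \<integral>\<^sup>+p. ennreal (norm (f p - s i p)) \<partial>lborel) \<longlonglongrightarrow> (\<integral>\<^sup>+(p::'a). 0 \<partial>lborel)"
  proof (rule nn_integral_dominated_convergence[where w = "\<lambda>p. ennreal (3 * norm (f p))"])
    show "AE p in lborel. ennreal (norm (f p - s j p)) \<le> ennreal (3 * norm (f p))" for j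
    proof (intro AE_I2 ennreal_leI)
      fix p :: 'a
      show "norm (f p - s j p) \<le> 3 * norm (f p)"
        using norm_triangle_ineq4[of "f p" "s j p"] lim(3)[of p j] by simp
    qed
    show "(\<integral>\<^sup>+p. ennreal (3 * norm (f p)) \<partial>lborel) < \<infinity>"
      using lim(4) by (simp add: integrable_iff_bounded ennreal_mult nn_integral_cmult ennreal_mult_less_top)
    show "AE p in lborel. (\<lambda>i. ennreal (norm (f p - s i p))) \<longlonglongrightarrow> 0"
    proof (rule AE_I2)
      fix p :: 'a
      have "(\<lambda>i. norm (f p - s i p)) \<longlonglongrightarrow> norm (f p - f p)"
        using lim(2)[of p] by (intro tendsto_intros) auto
      then show "(\<lambda>i. ennreal (norm (f p - s i p))) \<longlonglongrightarrow> 0" by (simp add: ennreal_tendsto_0_iff)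
    qed
  qed measurable
  then have L: "(\<lambda>i. \<integral>\<^sup>+p. ennreal (norm (f p - s i p)) \<partial>lborel) \<longlonglongrightarrow> 0" by simp
  show ?case
  proof (rule tendsto_zero_ennreal)
    fix e :: real assume "0 < e"
    then have e3: "0 < ennreal (e / 3)" by simp
    then have "eventually (\<lambda>i. (\<integral>\<^sup>+p. ennreal (norm (f p - s i p)) \<partial>lborel) < ennreal (e / 3)) sequentially"
      using L by (auto simp: order_tendsto_iff)
    then obtain i where i: "(\<integral>\<^sup>+p. ennreal (norm (f p - s i p)) \<partial>lborel) < ennreal (e / 3)"
      by (auto simp: eventually_sequentially)
    have "eventually (\<lambda>n. (\<integral>\<^sup>+p. ennreal (norm (s i (p + z n) - s i p)) \<partial>lborel) < ennreal (e / 3)) sequentially"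
      using lim.IH[of i] e3 by (auto simp: order_tendsto_iff)
    then show "\<forall>\<^sub>F n in sequentially. (\<integral>\<^sup>+p. ennreal (norm (f (p + z n) - f p)) \<partial>lborel) < ennreal e"
    proof eventually_elim
      case (elim n)
      have tr: "(\<integral>\<^sup>+p. ennreal (norm (f (p + z n) - s i (p + z n))) \<partial>lborel) = (\<integral>\<^sup>+p. ennreal (norm (f p - s i p)) \<partial>lborel)"
        by (rule nn_integral_lborel_translate) measurable
      have "(\<integral>\<^sup>+p. ennreal (norm (f (p + z n) - f p)) \<partial>lborel)
        \<le> (\<integral>\<^sup>+p. ennreal (norm (f (p + z n) - s i (p + z n))) + (ennreal (norm (s i (p + z n) - s i p)) + ennreal (norm (f p - s i p))) \<partial>lborel)"
      proof (rule nn_integral_mono)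
        fix p :: 'a
        have "norm (f (p + z n) - f p) \<le> norm (f (p + z n) - s i (p + z n)) + (norm (s i (p + z n) - s i p) + norm (f p - s i p))"
          using norm_triangle_ineq[of "f (p + z n) - s i (p + z n)" "(s i (p + z n) - s i p) + (s i p - f p)"]
            norm_triangle_ineq[of "s i (p + z n) - s i p" "s i p - f p"]
          by (simp add: norm_minus_commute)
        then show "ennreal (norm (f (p + z n) - f p)) \<le> ennreal (norm (f (p + z n) - s i (p + z n))) + (ennreal (norm (s i (p + z n) - s i p)) + ennreal (norm (f p - s i p)))"
          using ennreal_leI by (simp only: ennreal_plus[symmetric] norm_ge_zero add_nonneg_nonneg)
      qed
      also have "\<dots> = (\<integral>\<^sup>+p. ennreal (norm (f (p + z n) - s i (p + z n))) \<partial>lborel) +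
         ((\<integral>\<^sup>+p. ennreal (norm (s i (p + z n) - s i p)) \<partial>lborel) + (\<integral>\<^sup>+p. ennreal (norm (f p - s i p)) \<partial>lborel))"
        by (simp add: nn_integral_add)
      also have "\<dots> < ennreal (e / 3) + (ennreal (e / 3) + ennreal (e / 3))"
        unfolding tr using i elim by (intro add_strict_mono)
      also have "\<dots> = ennreal e" using \<open>0 < e\<close> by (simp flip: ennreal_plus)
      finally show ?case .
    qed
  qed
qed

text \<open>Plancherel and the limit arguments are linear in the squared norm, so the root is taken
  only at the end; \<open>sq_norm_add_le\<close> takes the place of the triangle inequality.\<close>

definition sq_norm :: "('a::euclidean_space \<Rightarrow> complex) \<Rightarrow> ennreal" where
  "sq_norm f = (\<integral>\<^sup>+p. ennreal ((norm (f p))\<^sup>2) \<partial>lborel)"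

lemma norm_add_sq_le: "(norm (a + b))\<^sup>2 \<le> 2 * (norm a)\<^sup>2 + 2 * (norm (b::complex))\<^sup>2"
proof -
  have "(norm (a + b))\<^sup>2 \<le> (norm a + norm b)\<^sup>2" by (intro power_mono norm_triangle_ineq) auto
  also have "\<dots> \<le> 2 * (norm a)\<^sup>2 + 2 * (norm b)\<^sup>2"
    using sum_squares_bound[of "norm a" "norm b"] by (simp add: power2_sum)
  finally show ?thesis .
qed

lemma sq_norm_add_le:
  assumes [measurable]: "f \<in> borel_measurable borel" "g \<in> borel_measurable borel"
  shows "sq_norm (\<lambda>p. f p + g p) \<le> 2 * sq_norm f + 2 * sq_norm g"
proof -
  have "sq_norm (\<lambda>p. f p + g p) \<le> (\<integral>\<^sup>+p. 2 * ennreal ((norm (f p))\<^sup>2) + 2 * ennreal ((norm (g p))\<^sup>2) \<partial>lborel)"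
    unfolding sq_norm_def
  proof (rule nn_integral_mono)
    fix p :: 'a
    have "ennreal ((norm (f p + g p))\<^sup>2) \<le> ennreal (2 * (norm (f p))\<^sup>2 + 2 * (norm (g p))\<^sup>2)"
      by (intro ennreal_leI norm_add_sq_le)
    then show "ennreal ((norm (f p + g p))\<^sup>2) \<le> 2 * ennreal ((norm (f p))\<^sup>2) + 2 * ennreal ((norm (g p))\<^sup>2)"
      by (simp add: ennreal_mult)
  qed
  also have "\<dots> = 2 * sq_norm f + 2 * sq_norm g"
    unfolding sq_norm_def by (simp add: nn_integral_add nn_integral_cmult)
  finally show ?thesis .
qed

lemma sq_norm_uminus [simp]: "sq_norm (\<lambda>p. - f p) = sq_norm f"
  by (simp add: sq_norm_def)

lemma sq_norm_translate:
  assumes [measurable]: "f \<in> borel_measurable borel"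
  shows "sq_norm (\<lambda>p. f (p + z)) = sq_norm f"
  unfolding sq_norm_def by (rule nn_integral_lborel_translate) measurable

text \<open>Truncation in both height and support gives bounded integrable \<open>t k\<close>, whose
  squared L^2 modulus of continuity is at most 2 k times the L^1 modulus. The remainder is small in
  L^2, and translation preserves its norm.\<close>

lemma translation_continuous_L2:
  fixes f :: "'a::euclidean_space \<Rightarrow> complex"
  assumes f [measurable]: "f \<in> borel_measurable borel" and fin: "sq_norm f < \<infinity>" and z: "z \<longlonglongrightarrow> 0"
  shows "(\<lambda>n. sq_norm (\<lambda>p. f (p + z n) - f p)) \<longlonglongrightarrow> 0"
proof -
  define t where "t = (\<lambda>k p. if norm (f p) \<le> real k \<and> norm p \<le> real k then f p else 0)"
  have [measurable]: "t k \<in> borel_measurable borel" for k unfolding t_def by measurable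
  have tk: "norm (t k p) \<le> real k" for k p by (simp add: t_def)
  have "(\<lambda>k. sq_norm (\<lambda>p. f p - t k p)) \<longlonglongrightarrow> (\<integral>\<^sup>+(p::'a). 0 \<partial>lborel)"
    unfolding sq_norm_def
  proof (rule nn_integral_dominated_convergence[where w = "\<lambda>p. ennreal ((norm (f p))\<^sup>2)"])
    show "AE p in lborel. ennreal ((norm (f p - t j p))\<^sup>2) \<le> ennreal ((norm (f p))\<^sup>2)" for j
      by (intro AE_I2 ennreal_leI power_mono) (auto simp: t_def)
    show "(\<integral>\<^sup>+p. ennreal ((norm (f p))\<^sup>2) \<partial>lborel) < \<infinity>" using fin by (simp add: sq_norm_def)
    show "AE p in lborel. (\<lambda>i. ennreal ((norm (f p - t i p))\<^sup>2)) \<longlonglongrightarrow> 0"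
    proof (rule AE_I2)
      fix p :: 'a
      have "eventually (\<lambda>k. ennreal ((norm (f p - t k p))\<^sup>2) = 0) sequentially"
      proof (rule eventually_sequentiallyI)
        fix k assume "nat \<lceil>max (norm (f p)) (norm p)\<rceil> \<le> k"
        then have "max (norm (f p)) (norm p) \<le> real k" by linarith
        then show "ennreal ((norm (f p - t k p))\<^sup>2) = 0" by (simp add: t_def)
      qed
      then show "(\<lambda>k. ennreal ((norm (f p - t k p))\<^sup>2)) \<longlonglongrightarrow> 0" by (rule tendsto_eventually)
    qed
  qed measurable
  then have T: "(\<lambda>k. sq_norm (\<lambda>p. f p - t k p)) \<longlonglongrightarrow> 0" by simp
  show ?thesis
  proof (rule tendsto_zero_ennreal)
    fix e :: real assume "0 < e"
    \<comment> \<open>Two uses of \<open>sq_norm_add_le\<close> put a factor 8 in front of the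
      remainder, hence e / 16.\<close>
    then have "0 < ennreal (e / 16)" by simp
    then have "eventually (\<lambda>k. sq_norm (\<lambda>p. f p - t k p) < ennreal (e / 16)) sequentially"
      using T by (auto simp: order_tendsto_iff)
    then obtain k where k: "sq_norm (\<lambda>p. f p - t k p) < ennreal (e / 16)"
      by (auto simp: eventually_sequentially)
    define r where "r = (\<lambda>p. f p - t k p)"
    have [measurable]: "r \<in> borel_measurable borel" unfolding r_def by measurable
    have ti: "integrable lborel (t k)"
    proof (rule Bochner_Integration.integrable_bound)
      show "integrable lborel (\<lambda>p::'a. real k * indicator (cball 0 (real k)) p :: real)"
        by (intro integrable_mult_right integrable_real_indicator) (use emeasure_bounded_finite[OF bounded_cball, of "0::'a" "real k"] in auto)
    qed (auto simp: t_def indicator_def)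
    have "(\<lambda>n. ennreal (2 * real k) * (\<integral>\<^sup>+p. ennreal (norm (t k (p + z n) - t k p)) \<partial>lborel)) \<longlonglongrightarrow> ennreal (2 * real k) * 0"
      by (intro ennreal_tendsto_cmult translation_continuous_L1[OF ti z]) auto
    then have "eventually (\<lambda>n. ennreal (2 * real k) * (\<integral>\<^sup>+p. ennreal (norm (t k (p + z n) - t k p)) \<partial>lborel) < ennreal (e / 4)) sequentially"
      using \<open>0 < e\<close> by (auto simp: order_tendsto_iff)
    then show "\<forall>\<^sub>F n in sequentially. sq_norm (\<lambda>p. f (p + z n) - f p) < ennreal e"
    proof eventually_elim
      case (elim n)
      have 1: "sq_norm (\<lambda>p. r (p + z n) - r p) \<le> 2 * sq_norm r + 2 * sq_norm r"
        using sq_norm_add_le[of "\<lambda>p. r (p + z n)" "\<lambda>p. - r p"] sq_norm_translate[of r "z n"] by simp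
      have "sq_norm (\<lambda>p. t k (p + z n) - t k p) \<le> (\<integral>\<^sup>+p. ennreal (2 * real k) * ennreal (norm (t k (p + z n) - t k p)) \<partial>lborel)"
        unfolding sq_norm_def
      proof (rule nn_integral_mono)
        fix p
        have "norm (t k (p + z n) - t k p) \<le> 2 * real k"
          using norm_triangle_ineq4[of "t k (p + z n)" "t k p"] tk[of k "p + z n"] tk[of k p] by simp
        then have "(norm (t k (p + z n) - t k p))\<^sup>2 \<le> 2 * real k * norm (t k (p + z n) - t k p)"
          unfolding power2_eq_square by (rule mult_right_mono) simp
        then show "ennreal ((norm (t k (p + z n) - t k p))\<^sup>2) \<le> ennreal (2 * real k) * ennreal (norm (t k (p + z n) - t k p))"
          by (subst ennreal_mult[symmetric]) (auto intro!: ennreal_leI)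
      qed
      also have "\<dots> < ennreal (e / 4)" using elim by (simp add: nn_integral_cmult)
      finally have 2: "sq_norm (\<lambda>p. t k (p + z n) - t k p) < ennreal (e / 4)" .
      have "sq_norm (\<lambda>p. f (p + z n) - f p) = sq_norm (\<lambda>p. (r (p + z n) - r p) + (t k (p + z n) - t k p))"
        by (simp add: r_def algebra_simps)
      also have "\<dots> \<le> 2 * sq_norm (\<lambda>p. r (p + z n) - r p) + 2 * sq_norm (\<lambda>p. t k (p + z n) - t k p)"
        by (rule sq_norm_add_le) measurable
      also have "\<dots> \<le> 2 * (2 * sq_norm r + 2 * sq_norm r) + 2 * sq_norm (\<lambda>p. t k (p + z n) - t k p)"
        by (intro add_right_mono mult_left_mono 1) auto
      also have "\<dots> = 8 * sq_norm r + 2 * sq_norm (\<lambda>p. t k (p + z n) - t k p)"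
      proof -
        have "2 * (2 * x + 2 * x) = (2 * 2 + 2 * 2) * x" for x :: ennreal
          by (simp only: distrib_left distrib_right mult.assoc)
        then show ?thesis by simp
      qed
      also have "\<dots> \<le> 8 * ennreal (e / 16) + 2 * sq_norm (\<lambda>p. t k (p + z n) - t k p)"
        using k by (intro add_right_mono mult_left_mono) (auto simp: r_def intro: less_imp_le)
      also have "8 * ennreal (e / 16) = ennreal (e / 2)"
        using \<open>0 < e\<close> ennreal_mult[of 8 "e / 16"] by simp
      also have "ennreal (e / 2) + 2 * sq_norm (\<lambda>p. t k (p + z n) - t k p) < ennreal (e / 2) + ennreal (e / 2)"
      proof -
        have "2 * sq_norm (\<lambda>p. t k (p + z n) - t k p) < 2 * ennreal (e / 4)"
          using 2 by (intro ennreal_mult_strict_left_mono) auto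
        also have "\<dots> = ennreal (e / 2)" using \<open>0 < e\<close> ennreal_mult[of 2 "e / 4"] by simp
        finally show ?thesis by (simp add: ennreal_add_left_cancel_less)
      qed
      also have "\<dots> = ennreal e" using \<open>0 < e\<close> by (simp flip: ennreal_plus)
      finally show ?case .
    qed
  qed
qed

section \<open>Plancherel's identity by Gaussian regularisation\<close>

lemma nn_integral_lborel_prod:
  fixes h :: "'a::euclidean_space \<times> 'b::euclidean_space \<Rightarrow> ennreal"
  assumes "h \<in> borel_measurable borel"
  shows "(\<integral>\<^sup>+x. h x \<partial>lborel) = (\<integral>\<^sup>+p. (\<integral>\<^sup>+p'. h (p, p') \<partial>lborel) \<partial>lborel)"
    and "(\<integral>\<^sup>+x. h x \<partial>lborel) = (\<integral>\<^sup>+p'. (\<integral>\<^sup>+p. h (p, p') \<partial>lborel) \<partial>lborel)"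
proof -
  have h: "h \<in> borel_measurable (lborel \<Otimes>\<^sub>M lborel)" using assms by (simp add: lborel_prod)
  show "(\<integral>\<^sup>+x. h x \<partial>lborel) = (\<integral>\<^sup>+p. (\<integral>\<^sup>+p'. h (p, p') \<partial>lborel) \<partial>lborel)"
    using lborel.nn_integral_fst[OF h] by (simp add: lborel_prod)
  show "(\<integral>\<^sup>+x. h x \<partial>lborel) = (\<integral>\<^sup>+p'. (\<integral>\<^sup>+p. h (p, p') \<partial>lborel) \<partial>lborel)"
    using lborel_pair.nn_integral_snd[of h] h by (simp add: lborel_prod)
qed

lemma complex_gaussian_plane:
  fixes p :: "real \<times> real"
  assumes "\<epsilon> > 0"
  shows "integrable lborel (\<lambda>\<zeta>::real \<times> real. exp (- \<epsilon> * (norm \<zeta>)\<^sup>2))" (is ?A)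
    and "(\<integral>\<zeta>. of_real (exp (- \<epsilon> * (norm \<zeta>)\<^sup>2)) * cis (- (p \<bullet> \<zeta>)) \<partial>lborel)
      = complex_of_real (pi / \<epsilon> * exp (- (norm p)\<^sup>2 / (4 * \<epsilon>)))" (is ?B)
proof -
  have g: "integrable lborel (\<lambda>v::real. exp (- \<epsilon> * v\<^sup>2))"
    using has_bochner_integral_gaussian[OF assms] by (rule integrable.intros)
  have split: "exp (- \<epsilon> * (norm (a, b))\<^sup>2) = exp (- \<epsilon> * a\<^sup>2) * exp (- \<epsilon> * b\<^sup>2)" for a b :: real
    by (simp add: norm_Pair algebra_simps flip: exp_add)
  have "integrable (lborel \<Otimes>\<^sub>M lborel) (\<lambda>(a, b). exp (- \<epsilon> * (a::real)\<^sup>2) * exp (- \<epsilon> * (b::real)\<^sup>2))"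
    by (rule integrable_lborel_pair_mult[OF g g])
  also have "(\<lambda>(a, b). exp (- \<epsilon> * (a::real)\<^sup>2) * exp (- \<epsilon> * (b::real)\<^sup>2)) = (\<lambda>\<zeta>. exp (- \<epsilon> * (norm \<zeta>)\<^sup>2))"
  proof (rule ext)
    fix \<zeta> :: "real \<times> real"
    show "(case \<zeta> of (a, b) \<Rightarrow> exp (- \<epsilon> * a\<^sup>2) * exp (- \<epsilon> * b\<^sup>2)) = exp (- \<epsilon> * (norm \<zeta>)\<^sup>2)"
      by (cases \<zeta>) (simp only: prod.case split)
  qed
  finally show A: ?A by (simp only: lborel_prod)
  define E where "E = (\<lambda>y v. exp (- complex_of_real \<epsilon> * (of_real v)\<^sup>2 + \<i> * of_real (y * v)))"
  have EI: "(\<integral>v. E y v \<partial>lborel) = csqrt (of_real pi / of_real \<epsilon>) * exp (- (of_real y)\<^sup>2 / (4 * of_real \<epsilon>))" for y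
    unfolding E_def by (rule complex_gaussian_real[OF assms])
  have E_eq: "E y v = of_real (exp (- \<epsilon> * v\<^sup>2)) * cis (y * v)" for y v
    unfolding E_def gaussian_modulation_split by (simp add: cis_conv_exp)
  obtain a b where p: "p = (a, b)" by (cases p)
  have eq: "of_real (exp (- \<epsilon> * (norm \<zeta>)\<^sup>2)) * cis (- (p \<bullet> \<zeta>)) = (case \<zeta> of (u, v) \<Rightarrow> E (- a) u * E (- b) v)" for \<zeta> :: "real \<times> real"
  proof (cases \<zeta>)
    case (Pair u v)
    have "cis (- (p \<bullet> \<zeta>)) = cis (- a * u) * cis (- b * v)" unfolding Pair p by (simp add: cis_mult)
    moreover have "complex_of_real (exp (- \<epsilon> * (norm \<zeta>)\<^sup>2)) = of_real (exp (- \<epsilon> * u\<^sup>2)) * of_real (exp (- \<epsilon> * v\<^sup>2))"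
      unfolding Pair split by (rule of_real_mult)
    ultimately show ?thesis unfolding Pair E_eq by simp
  qed
  have ei: "integrable (lborel \<Otimes>\<^sub>M lborel) (\<lambda>(u, v). E (- a) u * E (- b) v)"
  proof -
    have "(\<lambda>(u, v). E (- a) u * E (- b) v) = (\<lambda>\<zeta>. of_real (exp (- \<epsilon> * (norm \<zeta>)\<^sup>2)) * cis (- (p \<bullet> \<zeta>)))"
      using eq by (intro ext) (simp only:)
    moreover have "integrable lborel \<dots>"
      by (rule Bochner_Integration.integrable_bound[OF A]) (auto simp: norm_mult)
    ultimately show ?thesis by (simp only: lborel_prod)
  qed
  have "(\<integral>\<zeta>. of_real (exp (- \<epsilon> * (norm \<zeta>)\<^sup>2)) * cis (- (p \<bullet> \<zeta>)) \<partial>lborel) = (\<integral>u. (\<integral>v. E (- a) u * E (- b) v \<partial>lborel) \<partial>lborel)"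
    unfolding eq using lborel_pair.integral_fst[OF ei] by (simp add: lborel_prod)
  also have "\<dots> = (\<integral>u. E (- a) u \<partial>lborel) * (\<integral>v. E (- b) v \<partial>lborel)" by simp
  also have "\<dots> = (csqrt (of_real pi / of_real \<epsilon>))\<^sup>2 * (exp (- (of_real a)\<^sup>2 / (4 * of_real \<epsilon>)) * exp (- (of_real b)\<^sup>2 / (4 * of_real \<epsilon>)))"
    unfolding EI by (simp add: power2_eq_square)
  also have "exp (- (complex_of_real a)\<^sup>2 / (4 * of_real \<epsilon>)) * exp (- (of_real b)\<^sup>2 / (4 * of_real \<epsilon>)) = of_real (exp (- (norm p)\<^sup>2 / (4 * \<epsilon>)))"
  proof -
    have "- (complex_of_real a)\<^sup>2 / (4 * of_real \<epsilon>) + - (of_real b)\<^sup>2 / (4 * of_real \<epsilon>) = of_real (- (norm p)\<^sup>2 / (4 * \<epsilon>))"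
      by (simp add: p norm_Pair add_divide_distrib diff_divide_distrib)
    then show ?thesis by (simp only: exp_add[symmetric] exp_of_real)
  qed
  finally show ?B by simp
qed

lemma fourier_integral_cis: "fourier_integral f \<zeta> = (\<integral>p. cis (- (p \<bullet> \<zeta>)) * f p \<partial>lborel)"
  unfolding fourier_integral_def cis_conv_exp by simp

lemma borel_measurable_fourier_integral [measurable]:
  assumes [measurable]: "f \<in> borel_measurable borel"
  shows "fourier_integral f \<in> borel_measurable borel"
  unfolding fourier_integral_cis[abs_def]
  by (rule lborel.borel_measurable_lebesgue_integral) measurable

lemma norm_fourier_integral_le: "norm (fourier_integral f \<zeta>) \<le> (\<integral>p. norm (f p) \<partial>lborel)"
  unfolding fourier_integral_cis by (rule order_trans[OF integral_norm_bound]) (simp add: norm_mult)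

text \<open>Plancherel with a Gaussian regulariser. Polarising \<open>Re (f p * cnj (f p'))\<close> turns the
  defect into an average of squared \<open>L\<^sup>2\<close> moduli of continuity.\<close>

lemma plancherel_regularised:
  assumes f: "integrable lborel f" and fin: "sq_norm f < \<infinity>" and \<epsilon>: "\<epsilon> > 0"
  shows "(\<integral>\<^sup>+\<zeta>. ennreal (exp (- \<epsilon> * (norm \<zeta>)\<^sup>2) * (norm (fourier_integral f \<zeta>))\<^sup>2) \<partial>lborel)
     + ennreal (1/2) * (\<integral>\<^sup>+z. ennreal (pi / \<epsilon> * exp (- (norm z)\<^sup>2 / (4 * \<epsilon>))) * sq_norm (\<lambda>p. f (p + z) - f p) \<partial>lborel)
     = ennreal (4 * pi\<^sup>2) * sq_norm f"
proof -
  have [measurable]: "f \<in> borel_measurable borel" using borel_measurable_integrable[OF f] by simp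
  \<comment> \<open>\<gamma> is the Fourier transform of the regulariser. It has mass 4 pi^2 for
    every \<epsilon> and concentrates at the origin as \<epsilon> tends to 0.\<close>
  define \<gamma> where "\<gamma> = (\<lambda>z::real \<times> real. pi / \<epsilon> * exp (- (norm z)\<^sup>2 / (4 * \<epsilon>)))"
  have \<gamma>0: "\<gamma> z \<ge> 0" for z using \<epsilon> by (simp add: \<gamma>_def)
  have [measurable]: "\<gamma> \<in> borel_measurable borel" unfolding \<gamma>_def by measurable
  have e4: "1 / (4 * \<epsilon>) > 0" using \<epsilon> by simp
  have ge: "exp (- (norm z)\<^sup>2 / (4 * \<epsilon>)) = exp (- (1 / (4 * \<epsilon>)) * (norm z)\<^sup>2)" for z :: "real \<times> real" by simp
  have \<gamma>i: "integrable lborel \<gamma>"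
    unfolding \<gamma>_def ge by (intro integrable_mult_right complex_gaussian_plane(1) e4)
  have \<gamma>I: "(\<integral>z. \<gamma> z \<partial>lborel) = 4 * pi\<^sup>2"
  proof -
    have "complex_of_real (\<integral>z. exp (- (1 / (4 * \<epsilon>)) * (norm (z::real \<times> real))\<^sup>2) \<partial>lborel)
       = (\<integral>z. of_real (exp (- (1 / (4 * \<epsilon>)) * (norm (z::real \<times> real))\<^sup>2)) * cis (- (0 \<bullet> z)) \<partial>lborel)"
      by simp
    also have "\<dots> = of_real (pi / (1 / (4 * \<epsilon>)))" unfolding complex_gaussian_plane(2)[OF e4] by simp
    finally have "(\<integral>z. exp (- (1 / (4 * \<epsilon>)) * (norm (z::real \<times> real))\<^sup>2) \<partial>lborel) = pi / (1 / (4 * \<epsilon>))"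
      by (simp only: of_real_eq_iff)
    then show ?thesis using \<epsilon> unfolding \<gamma>_def ge by (simp add: power2_eq_square)
  qed
  have \<gamma>N: "(\<integral>\<^sup>+z. ennreal (\<gamma> z) \<partial>lborel) = ennreal (4 * pi\<^sup>2)"
    using nn_integral_eq_integral[OF \<gamma>i] \<gamma>0 by (simp add: \<gamma>I)
  define G where "G = (\<lambda>\<zeta>::real \<times> real. exp (- \<epsilon> * (norm \<zeta>)\<^sup>2))"
  have Gi: "integrable lborel G" unfolding G_def by (rule complex_gaussian_plane(1)[OF \<epsilon>])
  have [measurable]: "G \<in> borel_measurable borel" unfolding G_def by measurable
  define m where "m = (\<integral>p. norm (f p) \<partial>lborel)"
  have Fm: "norm (fourier_integral f \<zeta>) \<le> m" for \<zeta> unfolding m_def by (rule norm_fourier_integral_le)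
  have R_int: "integrable lborel (\<lambda>\<zeta>. G \<zeta> * (norm (fourier_integral f \<zeta>))\<^sup>2)"
  proof (rule Bochner_Integration.integrable_bound[OF integrable_mult_left[OF Gi, of "m\<^sup>2"]])
    show "AE \<zeta> in lborel. norm (G \<zeta> * (norm (fourier_integral f \<zeta>))\<^sup>2) \<le> norm (G \<zeta> * m\<^sup>2)"
      by (intro AE_I2) (auto simp: abs_mult intro!: mult_left_mono power_mono Fm)
  qed measurable
  define R where "R = (\<integral>\<zeta>. G \<zeta> * (norm (fourier_integral f \<zeta>))\<^sup>2 \<partial>lborel)"
  have ff: "integrable lborel (\<lambda>(p, p'). norm (f p) * norm (f p'))"
    using integrable_lborel_pair_mult[OF integrable_norm[OF f] integrable_norm[OF f]] by (simp add: lborel_prod)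
  \<comment> \<open>The squared modulus of the transform as a double integral over p and p'; the
    Gaussian factor is what makes it integrable in \<zeta>, so that Fubini applies.\<close>
  define Q where "Q = (\<lambda>(p, p') \<zeta>. of_real (G \<zeta>) * (f p * cnj (f p') * cis (- ((p - p') \<bullet> \<zeta>))))"
  have Q_int: "integrable (lborel \<Otimes>\<^sub>M lborel) (\<lambda>(x, \<zeta>). Q x \<zeta>)"
  proof (rule Bochner_Integration.integrable_bound[OF integrable_lborel_pair_mult[OF ff Gi]])
    show "(\<lambda>(x, \<zeta>). Q x \<zeta>) \<in> borel_measurable (lborel \<Otimes>\<^sub>M lborel)"
    proof -
      have [measurable]: "(\<lambda>x. fst (fst x)) \<in> borel_measurable (borel :: (((real \<times> real) \<times> (real \<times> real)) \<times> (real \<times> real)) measure)"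
        "(\<lambda>x. snd (fst x)) \<in> borel_measurable (borel :: (((real \<times> real) \<times> (real \<times> real)) \<times> (real \<times> real)) measure)"
        "(\<lambda>x. snd x) \<in> borel_measurable (borel :: (((real \<times> real) \<times> (real \<times> real)) \<times> (real \<times> real)) measure)"
        by (intro borel_measurable_continuous_onI continuous_intros)+
      show ?thesis
        unfolding Q_def split_def lborel_prod by measurable
    qed
    show "AE x in lborel \<Otimes>\<^sub>M lborel. norm (case x of (x, \<zeta>) \<Rightarrow> Q x \<zeta>)
        \<le> norm (case x of (x, \<zeta>) \<Rightarrow> (case x of (p, p') \<Rightarrow> norm (f p) * norm (f p')) * G \<zeta>)"
      by (intro AE_I2) (auto simp: Q_def norm_mult abs_mult G_def split: prod.split)
  qed
  have inner1: "(\<integral>x. Q x \<zeta> \<partial>lborel) = of_real (G \<zeta> * (norm (fourier_integral f \<zeta>))\<^sup>2)" for \<zeta>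
  proof -
    have c: "integrable (lborel \<Otimes>\<^sub>M lborel) (\<lambda>(p, p'). (cis (- (p \<bullet> \<zeta>)) * f p) * cnj (cis (- (p' \<bullet> \<zeta>)) * f p'))"
      by (rule Bochner_Integration.integrable_bound[OF integrable_lborel_pair_mult[OF integrable_norm[OF f] integrable_norm[OF f]]])
        (auto simp: norm_mult abs_mult split: prod.split)
    have "(\<integral>x. (case x of (p, p') \<Rightarrow> (cis (- (p \<bullet> \<zeta>)) * f p) * cnj (cis (- (p' \<bullet> \<zeta>)) * f p')) \<partial>lborel)
        = (\<integral>p. (\<integral>p'. (cis (- (p \<bullet> \<zeta>)) * f p) * cnj (cis (- (p' \<bullet> \<zeta>)) * f p') \<partial>lborel) \<partial>lborel)"
      using lborel_pair.integral_fst[OF c] by (simp add: lborel_prod)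
    also have "\<dots> = fourier_integral f \<zeta> * (\<integral>p'. cnj (cis (- (p' \<bullet> \<zeta>)) * f p') \<partial>lborel)"
      unfolding fourier_integral_cis by (simp del: complex_cnj_mult Bochner_Integration.integral_cnj)
    also have "(\<integral>p'. cnj (cis (- (p' \<bullet> \<zeta>)) * f p') \<partial>lborel) = cnj (fourier_integral f \<zeta>)"
      unfolding fourier_integral_cis by (rule Bochner_Integration.integral_cnj)
    also have "fourier_integral f \<zeta> * cnj (fourier_integral f \<zeta>) = of_real ((norm (fourier_integral f \<zeta>))\<^sup>2)"
      by (simp only: complex_norm_square)
    finally have A: "(\<integral>x. (case x of (p, p') \<Rightarrow> (cis (- (p \<bullet> \<zeta>)) * f p) * cnj (cis (- (p' \<bullet> \<zeta>)) * f p')) \<partial>lborel) = \<dots>" .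
    have "Q x \<zeta> = of_real (G \<zeta>) * (case x of (p, p') \<Rightarrow> (cis (- (p \<bullet> \<zeta>)) * f p) * cnj (cis (- (p' \<bullet> \<zeta>)) * f p'))" for x
    proof -
      obtain p p' where Pair: "x = (p, p')" by (cases x)
      have "cis (- ((p - p') \<bullet> \<zeta>)) = cis (- (p \<bullet> \<zeta>)) * cnj (cis (- (p' \<bullet> \<zeta>)))"
        by (simp add: cis_cnj cis_mult inner_diff_left)
      then show ?thesis by (simp add: Q_def Pair)
    qed
    then show ?thesis by (simp only: integral_mult_right_zero A of_real_mult)
  qed
  have inner2: "(\<integral>\<zeta>. Q x \<zeta> \<partial>lborel) = (case x of (p, p') \<Rightarrow> f p * cnj (f p') * of_real (\<gamma> (p - p')))" for x
  proof -
    obtain p p' where Pair: "x = (p, p')" by (cases x)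
    have "(\<integral>\<zeta>. Q x \<zeta> \<partial>lborel) = (\<integral>\<zeta>. f p * cnj (f p') * (of_real (G \<zeta>) * cis (- ((p - p') \<bullet> \<zeta>))) \<partial>lborel)"
      by (simp add: Q_def Pair mult_ac)
    also have "\<dots> = f p * cnj (f p') * of_real (\<gamma> (p - p'))"
      using complex_gaussian_plane(2)[OF \<epsilon>, of "p - p'"] by (simp add: G_def \<gamma>_def)
    finally show ?thesis by (simp add: Pair)
  qed
  have "complex_of_real R = (\<integral>\<zeta>. (\<integral>x. Q x \<zeta> \<partial>lborel) \<partial>lborel)"
    unfolding inner1 R_def by (rule integral_complex_of_real[symmetric])
  also have "\<dots> = (\<integral>x. (\<integral>\<zeta>. Q x \<zeta> \<partial>lborel) \<partial>lborel)" by (rule lborel_pair.Fubini_integral[OF Q_int])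
  finally have R_eq: "complex_of_real R = (\<integral>x. (\<integral>\<zeta>. Q x \<zeta> \<partial>lborel) \<partial>lborel)" .
  \<comment> \<open>Polarisation: 2 Re (a cnj b) = |a|^2 + |b|^2 - |a - b|^2. The first two weights
    integrate to the full squared norm, the third to the translation defect. The defect is carried
    on the left of the identity so that extended reals are never subtracted.\<close>
  define w1 where "w1 = (\<lambda>(p, p'). (norm (f p))\<^sup>2 * \<gamma> (p - p'))"
  define w2 where "w2 = (\<lambda>(p, p'). (norm (f p'))\<^sup>2 * \<gamma> (p - p'))"
  define w3 where "w3 = (\<lambda>(p, p'). (norm (f p - f p'))\<^sup>2 * \<gamma> (p - p'))"
  have wm [measurable]: "w1 \<in> borel_measurable borel" "w2 \<in> borel_measurable borel" "w3 \<in> borel_measurable borel"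
  proof -
    have [measurable]: "(\<lambda>x. fst x) \<in> borel_measurable (borel :: ((real \<times> real) \<times> (real \<times> real)) measure)"
      "(\<lambda>x. snd x) \<in> borel_measurable (borel :: ((real \<times> real) \<times> (real \<times> real)) measure)"
      by (intro borel_measurable_continuous_onI continuous_intros)+
    show "w1 \<in> borel_measurable borel" "w2 \<in> borel_measurable borel" "w3 \<in> borel_measurable borel"
      unfolding w1_def w2_def w3_def split_def by measurable
  qed
  have w0: "w1 x \<ge> 0" "w2 x \<ge> 0" "w3 x \<ge> 0" for x
    using \<gamma>0 by (auto simp: w1_def w2_def w3_def split: prod.split)
  have trg: "(\<integral>\<^sup>+p'. ennreal (\<gamma> (p - p')) \<partial>lborel) = ennreal (4 * pi\<^sup>2)" for p
  proof -
    have "(\<integral>\<^sup>+p'. ennreal (\<gamma> (p - p')) \<partial>lborel) = (\<integral>\<^sup>+p'. ennreal (\<gamma> (p' + - p)) \<partial>lborel)"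
      by (intro nn_integral_cong) (simp add: \<gamma>_def norm_minus_commute)
    also have "\<dots> = ennreal (4 * pi\<^sup>2)" unfolding \<gamma>N[symmetric] by (rule nn_integral_lborel_translate) measurable
    finally show ?thesis .
  qed
  have trg': "(\<integral>\<^sup>+p. ennreal (\<gamma> (p - p')) \<partial>lborel) = ennreal (4 * pi\<^sup>2)" for p'
    using nn_integral_lborel_translate[of "\<lambda>p. ennreal (\<gamma> p)" "- p'"] by (simp add: \<gamma>N)
  have W1: "(\<integral>\<^sup>+x. ennreal (w1 x) \<partial>lborel) = ennreal (4 * pi\<^sup>2) * sq_norm f"
  proof -
    have "(\<integral>\<^sup>+x. ennreal (w1 x) \<partial>lborel) = (\<integral>\<^sup>+p. (\<integral>\<^sup>+p'. ennreal ((norm (f p))\<^sup>2) * ennreal (\<gamma> (p - p')) \<partial>lborel) \<partial>lborel)"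
      by (subst nn_integral_lborel_prod(1), (measurable)[1]) (simp add: w1_def \<gamma>0 ennreal_mult)
    also have "\<dots> = ennreal (4 * pi\<^sup>2) * sq_norm f"
      by (simp add: nn_integral_cmult trg nn_integral_multc sq_norm_def mult.commute)
    finally show ?thesis .
  qed
  have W2: "(\<integral>\<^sup>+x. ennreal (w2 x) \<partial>lborel) = ennreal (4 * pi\<^sup>2) * sq_norm f"
  proof -
    have "(\<integral>\<^sup>+x. ennreal (w2 x) \<partial>lborel) = (\<integral>\<^sup>+p'. (\<integral>\<^sup>+p. ennreal ((norm (f p'))\<^sup>2) * ennreal (\<gamma> (p - p')) \<partial>lborel) \<partial>lborel)"
      by (subst nn_integral_lborel_prod(2), (measurable)[1]) (simp add: w2_def \<gamma>0 ennreal_mult)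
    also have "\<dots> = ennreal (4 * pi\<^sup>2) * sq_norm f"
      by (simp add: nn_integral_cmult trg' nn_integral_multc sq_norm_def mult.commute)
    finally show ?thesis .
  qed
  have W3: "(\<integral>\<^sup>+x. ennreal (w3 x) \<partial>lborel) = (\<integral>\<^sup>+z. ennreal (\<gamma> z) * sq_norm (\<lambda>p. f (p + z) - f p) \<partial>lborel)"
  proof -
    have "(\<integral>\<^sup>+x. ennreal (w3 x) \<partial>lborel) = (\<integral>\<^sup>+p'. (\<integral>\<^sup>+p. ennreal ((norm (f p - f p'))\<^sup>2) * ennreal (\<gamma> (p - p')) \<partial>lborel) \<partial>lborel)"
      by (subst nn_integral_lborel_prod(2), (measurable)[1]) (simp add: w3_def \<gamma>0 ennreal_mult)
    also have "\<dots> = (\<integral>\<^sup>+p'. (\<integral>\<^sup>+z. ennreal ((norm (f (z + p') - f p'))\<^sup>2) * ennreal (\<gamma> z) \<partial>lborel) \<partial>lborel)"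
    proof (rule nn_integral_cong)
      fix p'
      show "(\<integral>\<^sup>+p. ennreal ((norm (f p - f p'))\<^sup>2) * ennreal (\<gamma> (p - p')) \<partial>lborel)
          = (\<integral>\<^sup>+z. ennreal ((norm (f (z + p') - f p'))\<^sup>2) * ennreal (\<gamma> z) \<partial>lborel)"
        by (subst nn_integral_lborel_translate[where z = p', symmetric]) simp_all
    qed
    also have "\<dots> = (\<integral>\<^sup>+z. (\<integral>\<^sup>+p'. ennreal ((norm (f (z + p') - f p'))\<^sup>2) * ennreal (\<gamma> z) \<partial>lborel) \<partial>lborel)"
      by (rule lborel_pair.Fubini') measurable
    also have "\<dots> = (\<integral>\<^sup>+z. ennreal (\<gamma> z) * sq_norm (\<lambda>p. f (p + z) - f p) \<partial>lborel)"
      by (simp add: nn_integral_multc) (simp add: sq_norm_def mult.commute add.commute)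
    finally show ?thesis .
  qed
  have C: "ennreal (4 * pi\<^sup>2) * sq_norm f < \<infinity>" using fin by (simp add: ennreal_mult_less_top)
  have i1: "integrable lborel w1" and i2: "integrable lborel w2"
    using W1 W2 C w0 by (auto simp: integrable_iff_bounded)
  have i3: "integrable lborel w3"
  proof (rule Bochner_Integration.integrable_bound)
    show "integrable lborel (\<lambda>x. 2 * w1 x + 2 * w2 x)" using i1 i2 by simp
    show "AE x in lborel. norm (w3 x) \<le> norm (2 * w1 x + 2 * w2 x)"
    proof (rule AE_I2)
      fix x :: "(real \<times> real) \<times> (real \<times> real)"
      obtain p p' where x: "x = (p, p')" by (cases x)
      have "(norm (f p - f p'))\<^sup>2 * \<gamma> (p - p') \<le> (2 * (norm (f p))\<^sup>2 + 2 * (norm (f p'))\<^sup>2) * \<gamma> (p - p')"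
        using norm_add_sq_le[of "f p" "- f p'"] \<gamma>0 by (intro mult_right_mono) auto
      also have "\<dots> = 2 * w1 x + 2 * w2 x" by (simp add: x w1_def w2_def algebra_simps)
      finally show "norm (w3 x) \<le> norm (2 * w1 x + 2 * w2 x)" using w0[of x] by (simp add: x w3_def)
    qed
  qed measurable
  have "R = Re (\<integral>x. (\<integral>\<zeta>. Q x \<zeta> \<partial>lborel) \<partial>lborel)" using R_eq by (metis Re_complex_of_real)
  also have "\<dots> = (\<integral>x. Re (\<integral>\<zeta>. Q x \<zeta> \<partial>lborel) \<partial>lborel)"
    using lborel_pair.integrable_fst[OF Q_int] by (intro integral_Re[symmetric]) simp
  also have "\<dots> = (\<integral>x. 1/2 * (w1 x + w2 x - w3 x) \<partial>lborel)"
  proof (intro Bochner_Integration.integral_cong refl)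
    fix x :: "(real \<times> real) \<times> (real \<times> real)"
    obtain p p' where x: "x = (p, p')" by (cases x)
    have "Re (f p * cnj (f p')) = 1/2 * ((norm (f p))\<^sup>2 + (norm (f p'))\<^sup>2 - (norm (f p - f p'))\<^sup>2)"
      unfolding cmod_power2 by (simp add: power2_eq_square algebra_simps)
    then have "Re (f p * cnj (f p') * of_real (\<gamma> (p - p'))) = 1/2 * ((norm (f p))\<^sup>2 + (norm (f p'))\<^sup>2 - (norm (f p - f p'))\<^sup>2) * \<gamma> (p - p')"
      by (simp only: Re_complex_of_real times_complex.sel Im_complex_of_real mult_zero_right diff_zero)
    then show "Re (\<integral>\<zeta>. Q x \<zeta> \<partial>lborel) = 1/2 * (w1 x + w2 x - w3 x)"
      unfolding inner2 by (simp add: x w1_def w2_def w3_def algebra_simps)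
  qed
  also have "\<dots> = 1/2 * ((\<integral>x. w1 x \<partial>lborel) + (\<integral>x. w2 x \<partial>lborel) - (\<integral>x. w3 x \<partial>lborel))"
    using i1 i2 i3 by simp
  finally have "R + 1/2 * (\<integral>x. w3 x \<partial>lborel) = 1/2 * ((\<integral>x. w1 x \<partial>lborel) + (\<integral>x. w2 x \<partial>lborel))" by simp
  moreover have n1: "ennreal (\<integral>x. w1 x \<partial>lborel) = ennreal (4 * pi\<^sup>2) * sq_norm f"
    using nn_integral_eq_integral[OF i1] w0 by (simp add: W1)
  moreover have n2: "ennreal (\<integral>x. w2 x \<partial>lborel) = ennreal (4 * pi\<^sup>2) * sq_norm f"
    using nn_integral_eq_integral[OF i2] w0 by (simp add: W2)
  moreover have "(\<integral>x. w1 x \<partial>lborel) = (\<integral>x. w2 x \<partial>lborel)"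
    using n1 n2 w0 by (metis ennreal_inj Bochner_Integration.integral_nonneg)
  ultimately have "ennreal (R + 1/2 * (\<integral>x. w3 x \<partial>lborel)) = ennreal (4 * pi\<^sup>2) * sq_norm f" by simp
  moreover have "R \<ge> 0" unfolding R_def by (intro Bochner_Integration.integral_nonneg) (simp add: G_def)
  moreover have "(\<integral>x. w3 x \<partial>lborel) \<ge> 0" using w0 by (intro Bochner_Integration.integral_nonneg)
  ultimately have "ennreal R + ennreal (1/2) * ennreal (\<integral>x. w3 x \<partial>lborel) = ennreal (4 * pi\<^sup>2) * sq_norm f"
    by (simp only: ennreal_plus ennreal_mult mult_nonneg_nonneg)
  moreover have "ennreal (\<integral>x. w3 x \<partial>lborel) = (\<integral>\<^sup>+z. ennreal (\<gamma> z) * sq_norm (\<lambda>p. f (p + z) - f p) \<partial>lborel)"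
    using nn_integral_eq_integral[OF i3] w0 by (simp add: W3)
  moreover have "ennreal R = (\<integral>\<^sup>+\<zeta>. ennreal (G \<zeta> * (norm (fourier_integral f \<zeta>))\<^sup>2) \<partial>lborel)"
    unfolding R_def by (rule nn_integral_eq_integral[OF R_int, symmetric]) (simp add: G_def)
  ultimately show ?thesis by (simp only: G_def \<gamma>_def)
qed

lemma nn_integral_plane_scale:
  fixes h :: "real \<times> real \<Rightarrow> ennreal"
  assumes [measurable]: "h \<in> borel_measurable borel" and "c > 0"
  shows "(\<integral>\<^sup>+z. h z \<partial>lborel) = ennreal (c\<^sup>2) * (\<integral>\<^sup>+z. h (c *\<^sub>R z) \<partial>lborel)"
proof -
  have "(\<integral>\<^sup>+z. h z \<partial>lborel) = (\<integral>\<^sup>+z. h z \<partial>density (distr lborel borel (\<lambda>x. 0 + c *\<^sub>R x)) (\<lambda>_. \<bar>c\<bar> ^ DIM(real \<times> real)))"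
    using assms by (subst lborel_affine[of c 0]) auto
  also have "\<dots> = ennreal (c\<^sup>2) * (\<integral>\<^sup>+z. h (c *\<^sub>R z) \<partial>lborel)"
    using assms by (simp add: nn_integral_density nn_integral_distr nn_integral_cmult power2_eq_square)
  finally show ?thesis .
qed

text \<open>The limit \<epsilon> to 0 of the regularised identity. The weighted integrals increase
  to the full one by monotone convergence, while rescaling z by 2 sqrt \<epsilon> turns the defect
  into an average, against a fixed Gaussian, of L^2 translation moduli at shifts tending to
  0.\<close>

lemma plancherel_L1_L2:
  assumes f: "integrable lborel f" and fin: "sq_norm f < \<infinity>"
  shows "sq_norm (fourier_integral f) = ennreal (4 * pi\<^sup>2) * sq_norm f"
proof -
  have [measurable]: "f \<in> borel_measurable borel" using borel_measurable_integrable[OF f] by simp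
  define \<epsilon> where "\<epsilon> = (\<lambda>n::nat. 1 / real (Suc n))"
  \<comment> \<open>Chosen so that |c z|^2 / (4 \<epsilon>) = |z|^2, which makes the Gaussian
    independent of n.\<close>
  define c where "c = (\<lambda>n. 2 * sqrt (\<epsilon> n))"
  have \<epsilon>: "\<epsilon> n > 0" for n by (simp add: \<epsilon>_def)
  have c: "c n > 0" "(c n)\<^sup>2 = 4 * \<epsilon> n" for n using \<epsilon>[of n] by (auto simp: c_def power_mult_distrib)
  have c0: "c \<longlonglongrightarrow> 0"
  proof -
    have "\<epsilon> \<longlonglongrightarrow> 0" unfolding \<epsilon>_def by (rule LIMSEQ_Suc[OF lim_1_over_n])
    then have "(\<lambda>n. 2 * sqrt (\<epsilon> n)) \<longlonglongrightarrow> 2 * sqrt 0" by (intro tendsto_intros)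
    then show ?thesis by (simp add: c_def)
  qed
  define D where "D = (\<lambda>z. sq_norm (\<lambda>p. f (p + z) - f p))"
  have [measurable]: "D \<in> borel_measurable borel"
    unfolding D_def sq_norm_def by measurable
  have D_le: "D z \<le> 4 * sq_norm f" for z
  proof -
    have "D z \<le> 2 * sq_norm (\<lambda>p. f (p + z)) + 2 * sq_norm (\<lambda>p. - f p)"
      unfolding D_def using sq_norm_add_le[of "\<lambda>p. f (p + z)" "\<lambda>p. - f p"] by simp
    also have "\<dots> = (2 + 2) * sq_norm f" by (simp only: sq_norm_translate[OF \<open>f \<in> borel_measurable borel\<close>] sq_norm_uminus distrib_right)
    finally show ?thesis by simp
  qed
  define A where "A = (\<lambda>n. \<integral>\<^sup>+\<zeta>. ennreal (exp (- \<epsilon> n * (norm \<zeta>)\<^sup>2) * (norm (fourier_integral f \<zeta>))\<^sup>2) \<partial>lborel)"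
  define B where "B = (\<lambda>n. \<integral>\<^sup>+z. ennreal (exp (- (norm z)\<^sup>2)) * D (c n *\<^sub>R z) \<partial>lborel)"
  have AB: "A n + ennreal (2 * pi) * B n = ennreal (4 * pi\<^sup>2) * sq_norm f" for n
  proof -
    have "(\<integral>\<^sup>+z. ennreal (pi / \<epsilon> n * exp (- (norm z)\<^sup>2 / (4 * \<epsilon> n))) * D z \<partial>lborel)
       = ennreal ((c n)\<^sup>2) * (\<integral>\<^sup>+z. ennreal (pi / \<epsilon> n * exp (- (norm (c n *\<^sub>R z))\<^sup>2 / (4 * \<epsilon> n))) * D (c n *\<^sub>R z) \<partial>lborel)"
      by (rule nn_integral_plane_scale[OF _ c(1)]) measurable
    also have "(\<integral>\<^sup>+z. ennreal (pi / \<epsilon> n * exp (- (norm (c n *\<^sub>R z))\<^sup>2 / (4 * \<epsilon> n))) * D (c n *\<^sub>R z) \<partial>lborel)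
       = (\<integral>\<^sup>+z. ennreal (pi / \<epsilon> n) * (ennreal (exp (- (norm z)\<^sup>2)) * D (c n *\<^sub>R z)) \<partial>lborel)"
    proof (rule nn_integral_cong)
      fix z :: "real \<times> real"
      have "- (norm (c n *\<^sub>R z))\<^sup>2 / (4 * \<epsilon> n) = - (norm z)\<^sup>2"
        using \<epsilon>[of n] c(2)[of n] by (simp add: power_mult_distrib)
      moreover have "ennreal (pi / \<epsilon> n * exp (- (norm z)\<^sup>2)) = ennreal (pi / \<epsilon> n) * ennreal (exp (- (norm z)\<^sup>2))"
        using \<epsilon>[of n] by (intro ennreal_mult) auto
      ultimately show "ennreal (pi / \<epsilon> n * exp (- (norm (c n *\<^sub>R z))\<^sup>2 / (4 * \<epsilon> n))) * D (c n *\<^sub>R z)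
         = ennreal (pi / \<epsilon> n) * (ennreal (exp (- (norm z)\<^sup>2)) * D (c n *\<^sub>R z))"
        by (simp only: mult.assoc)
    qed
    also have "\<dots> = ennreal (pi / \<epsilon> n) * B n" unfolding B_def by (rule nn_integral_cmult) measurable
    also have "ennreal ((c n)\<^sup>2) * (ennreal (pi / \<epsilon> n) * B n) = ennreal (4 * pi) * B n"
    proof -
      have "ennreal ((c n)\<^sup>2) * ennreal (pi / \<epsilon> n) = ennreal (4 * pi)"
        using \<epsilon>[of n] c(2)[of n] by (simp flip: ennreal_mult)
      then show ?thesis by (simp only: mult.assoc[symmetric])
    qed
    finally have "ennreal (1/2) * (\<integral>\<^sup>+z. ennreal (pi / \<epsilon> n * exp (- (norm z)\<^sup>2 / (4 * \<epsilon> n))) * D z \<partial>lborel)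
       = ennreal (1/2) * ennreal (4 * pi) * B n" by (simp only: mult.assoc)
    also have "ennreal (1/2) * ennreal (4 * pi) = ennreal (2 * pi)" by (subst ennreal_mult[symmetric]) simp_all
    finally show ?thesis
      using plancherel_regularised[OF f fin \<epsilon>[of n]] by (simp only: A_def D_def)
  qed
  have g1: "integrable lborel (\<lambda>z::real \<times> real. exp (- (norm z)\<^sup>2))"
    using complex_gaussian_plane(1)[of 1] by simp
  have "B \<longlonglongrightarrow> (\<integral>\<^sup>+(z::real \<times> real). 0 \<partial>lborel)"
    unfolding B_def
  proof (rule nn_integral_dominated_convergence[where w = "\<lambda>z. ennreal (exp (- (norm z)\<^sup>2)) * (4 * sq_norm f)"])
    show "AE z in lborel. ennreal (exp (- (norm z)\<^sup>2)) * D (c j *\<^sub>R z) \<le> ennreal (exp (- (norm z)\<^sup>2)) * (4 * sq_norm f)" for j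
      by (intro AE_I2 mult_left_mono D_le) simp
    have "(\<integral>\<^sup>+(z::real \<times> real). ennreal (exp (- (norm z)\<^sup>2)) \<partial>lborel) < \<infinity>"
      using g1 by (simp add: integrable_iff_bounded)
    then show "(\<integral>\<^sup>+(z::real \<times> real). ennreal (exp (- (norm z)\<^sup>2)) * (4 * sq_norm f) \<partial>lborel) < \<infinity>"
      using fin by (simp add: nn_integral_multc ennreal_mult_less_top)
    show "AE z in lborel. (\<lambda>i. ennreal (exp (- (norm z)\<^sup>2)) * D (c i *\<^sub>R z)) \<longlonglongrightarrow> 0"
    proof (rule AE_I2)
      fix z :: "real \<times> real"
      have "(\<lambda>i. c i *\<^sub>R z) \<longlonglongrightarrow> 0 *\<^sub>R z" by (intro tendsto_intros c0)
      then have "(\<lambda>i. D (c i *\<^sub>R z)) \<longlonglongrightarrow> 0"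
        unfolding D_def by (intro translation_continuous_L2 fin) simp_all
      then have "(\<lambda>i. ennreal (exp (- (norm z)\<^sup>2)) * D (c i *\<^sub>R z)) \<longlonglongrightarrow> ennreal (exp (- (norm z)\<^sup>2)) * 0"
        by (intro ennreal_tendsto_cmult) auto
      then show "(\<lambda>i. ennreal (exp (- (norm z)\<^sup>2)) * D (c i *\<^sub>R z)) \<longlonglongrightarrow> 0" by simp
    qed
  qed measurable
  then have B0: "B \<longlonglongrightarrow> 0" by simp
  have "(\<lambda>n. \<integral>\<^sup>+\<zeta>. ennreal (exp (- \<epsilon> n * (norm \<zeta>)\<^sup>2) * (norm (fourier_integral f \<zeta>))\<^sup>2) \<partial>lborel)
     \<longlonglongrightarrow> (\<integral>\<^sup>+\<zeta>. (SUP n. ennreal (exp (- \<epsilon> n * (norm \<zeta>)\<^sup>2) * (norm (fourier_integral f \<zeta>))\<^sup>2)) \<partial>lborel)"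
  proof -
    have inc: "incseq (\<lambda>n \<zeta>. ennreal (exp (- \<epsilon> n * (norm \<zeta>)\<^sup>2) * (norm (fourier_integral f \<zeta>))\<^sup>2))"
    proof (intro incseq_SucI le_funI ennreal_leI mult_right_mono)
      fix n and \<zeta> :: "real \<times> real"
      have "\<epsilon> (Suc n) \<le> \<epsilon> n" by (simp add: \<epsilon>_def frac_le)
      then show "exp (- \<epsilon> n * (norm \<zeta>)\<^sup>2) \<le> exp (- \<epsilon> (Suc n) * (norm \<zeta>)\<^sup>2)" by (simp add: mult_right_mono)
    qed auto
    have "incseq (\<lambda>n. \<integral>\<^sup>+\<zeta>. ennreal (exp (- \<epsilon> n * (norm \<zeta>)\<^sup>2) * (norm (fourier_integral f \<zeta>))\<^sup>2) \<partial>lborel)"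
      using inc by (auto simp: incseq_def le_fun_def intro!: nn_integral_mono)
    from LIMSEQ_SUP[OF this] show ?thesis
      by (subst nn_integral_monotone_convergence_SUP[OF inc]) measurable
  qed
  moreover have "(SUP n. ennreal (exp (- \<epsilon> n * (norm \<zeta>)\<^sup>2) * (norm (fourier_integral f \<zeta>))\<^sup>2)) = ennreal ((norm (fourier_integral f \<zeta>))\<^sup>2)" for \<zeta>
  proof (rule LIMSEQ_unique)
    show "(\<lambda>n. ennreal (exp (- \<epsilon> n * (norm \<zeta>)\<^sup>2) * (norm (fourier_integral f \<zeta>))\<^sup>2)) \<longlonglongrightarrow> (SUP n. ennreal (exp (- \<epsilon> n * (norm \<zeta>)\<^sup>2) * (norm (fourier_integral f \<zeta>))\<^sup>2))"
    proof (rule LIMSEQ_SUP, intro incseq_SucI ennreal_leI mult_right_mono)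
      fix n
      have "\<epsilon> (Suc n) \<le> \<epsilon> n" by (simp add: \<epsilon>_def frac_le)
      then show "exp (- \<epsilon> n * (norm \<zeta>)\<^sup>2) \<le> exp (- \<epsilon> (Suc n) * (norm \<zeta>)\<^sup>2)" by (simp add: mult_right_mono)
    qed auto
    have "\<epsilon> \<longlonglongrightarrow> 0" unfolding \<epsilon>_def by (rule LIMSEQ_Suc[OF lim_1_over_n])
    then have "(\<lambda>n. exp (- \<epsilon> n * (norm \<zeta>)\<^sup>2) * (norm (fourier_integral f \<zeta>))\<^sup>2) \<longlonglongrightarrow> exp (- 0 * (norm \<zeta>)\<^sup>2) * (norm (fourier_integral f \<zeta>))\<^sup>2"
      by (intro tendsto_intros)
    then show "(\<lambda>n. ennreal (exp (- \<epsilon> n * (norm \<zeta>)\<^sup>2) * (norm (fourier_integral f \<zeta>))\<^sup>2)) \<longlonglongrightarrow> ennreal ((norm (fourier_integral f \<zeta>))\<^sup>2)"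
      by (intro tendsto_ennrealI) simp
  qed
  ultimately have A0: "A \<longlonglongrightarrow> sq_norm (fourier_integral f)" by (simp add: A_def sq_norm_def)
  have "(\<lambda>n. A n + ennreal (2 * pi) * B n) \<longlonglongrightarrow> sq_norm (fourier_integral f) + ennreal (2 * pi) * 0"
    by (intro tendsto_add A0 ennreal_tendsto_cmult B0) simp
  then have "(\<lambda>n::nat. ennreal (4 * pi\<^sup>2) * sq_norm f) \<longlonglongrightarrow> sq_norm (fourier_integral f)" by (simp add: AB)
  then show ?thesis by (rule LIMSEQ_unique) simp
qed

section \<open>The Fourier transform on square-integrable functions\<close>

lemma ennsqrt_power2 [simp]: "(ennsqrt a)\<^sup>2 = a"
  by (cases a) (auto simp: ennsqrt_def ennreal_power top_power_ennreal)

lemma ennsqrt_less_top_iff [simp]: "ennsqrt a < \<infinity> \<longleftrightarrow> a < \<infinity>"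
  by (cases a) (auto simp: ennsqrt_def)

lemma ennsqrt_mono: "a \<le> b \<Longrightarrow> ennsqrt a \<le> ennsqrt b"
  by (cases a; cases b) (auto simp: ennsqrt_def top_unique)

lemma ennsqrt_ennreal: "x \<ge> 0 \<Longrightarrow> ennsqrt (ennreal x) = ennreal (sqrt x)"
  by (simp add: ennsqrt_def)

lemma ennsqrt_le_mult:
  assumes "A > 0" "X \<le> ennreal (A\<^sup>2) * Y"
  shows "ennsqrt X \<le> ennreal A * ennsqrt Y"
proof (cases Y)
  case (real y)
  have "ennsqrt X \<le> ennsqrt (ennreal (A\<^sup>2 * y))"
    using assms real by (intro ennsqrt_mono) (simp add: ennreal_mult)
  also have "\<dots> = ennreal (A * sqrt y)" using assms real by (simp add: ennsqrt_ennreal real_sqrt_mult)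
  finally show ?thesis using assms real by (simp add: ennreal_mult ennsqrt_ennreal)
next
  case top
  then show ?thesis using assms by (simp add: ennsqrt_def ennreal_mult_top)
qed

lemma tendsto_ennsqrt_0_iff: "((\<lambda>x. ennsqrt (f x)) \<longlongrightarrow> 0) F \<longleftrightarrow> (f \<longlongrightarrow> 0) F"
proof
  assume "((\<lambda>x. ennsqrt (f x)) \<longlongrightarrow> 0) F"
  then have "((\<lambda>x. ennsqrt (f x) * ennsqrt (f x)) \<longlongrightarrow> 0 * 0) F" by (intro tendsto_mult_ennreal) auto
  then show "(f \<longlongrightarrow> 0) F" by (simp flip: power2_eq_square)
next
  assume f: "(f \<longlongrightarrow> 0) F"
  show "((\<lambda>x. ennsqrt (f x)) \<longlongrightarrow> 0) F"
  proof (rule tendsto_zero_ennreal)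
    fix r :: real assume r: "0 < r"
    then have "0 < ennreal (r\<^sup>2)" by simp
    with f have "\<forall>\<^sub>F x in F. f x < ennreal (r\<^sup>2)" by (auto simp: order_tendsto_iff)
    then show "\<forall>\<^sub>F x in F. ennsqrt (f x) < ennreal r"
    proof eventually_elim
      case (elim x)
      then show ?case using r
        by (cases "f x") (auto simp: ennsqrt_ennreal ennreal_less_iff intro: real_less_lsqrt)
    qed
  qed
qed

lemma L2_norm_eq: "L2_norm f = ennsqrt (sq_norm f)"
  by (simp add: L2_norm_def sq_norm_def)

lemma in_L2_iff: "in_L2 f \<longleftrightarrow> f \<in> borel_measurable borel \<and> sq_norm f < \<infinity>"
  by (simp add: in_L2_def L2_norm_eq del: infinity_ennreal_def)

definition trunc :: "real \<Rightarrow> (real \<times> real \<Rightarrow> complex) \<Rightarrow> real \<times> real \<Rightarrow> complex" where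
  "trunc R f = (\<lambda>p. indicator (cball 0 R) p * f p)"

lemma is_fourier_L2_iff:
  "is_fourier_L2 f g \<longleftrightarrow> in_L2 g \<and> ((\<lambda>R. sq_norm (\<lambda>\<zeta>. fourier_integral (trunc R f) \<zeta> - g \<zeta>)) \<longlongrightarrow> 0) at_top"
  by (simp add: is_fourier_L2_def L2_norm_eq tendsto_ennsqrt_0_iff trunc_def)

lemma borel_measurable_trunc [measurable]:
  assumes [measurable]: "f \<in> borel_measurable borel"
  shows "trunc R f \<in> borel_measurable borel"
  unfolding trunc_def by (intro borel_measurable_times borel_measurable_indicator assms) simp

text \<open>Pointwise |f| \<le> |f|^2 + 1, and the 1 is charged only on a set of finite
  measure.\<close>

lemma integrable_of_sq_norm:
  assumes [measurable]: "f \<in> borel_measurable borel" and fin: "sq_norm f < \<infinity>"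
    and A [measurable]: "A \<in> sets borel" "emeasure lborel A < \<infinity>" and supp: "\<And>p. f p \<noteq> 0 \<Longrightarrow> p \<in> A"
  shows "integrable lborel f"
proof -
  have "integrable lborel (\<lambda>p. (norm (f p))\<^sup>2)"
    using fin by (simp add: integrable_iff_bounded sq_norm_def)
  moreover have "integrable lborel (indicator A :: _ \<Rightarrow> real)" using A by (intro integrable_real_indicator) auto
  ultimately have "integrable lborel (\<lambda>p. (norm (f p))\<^sup>2 + indicator A p)" by (rule Bochner_Integration.integrable_add)
  then show ?thesis
  proof (rule Bochner_Integration.integrable_bound)
    show "AE p in lborel. norm (f p) \<le> norm ((norm (f p))\<^sup>2 + indicator A p :: real)"
    proof (rule AE_I2)
      fix p
      have "norm (f p) \<le> (norm (f p))\<^sup>2 + 1" using sum_squares_bound[of "norm (f p)" 1] by (smt (verit) norm_ge_zero power_one)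
      then show "norm (f p) \<le> norm ((norm (f p))\<^sup>2 + indicator A p :: real)"
        using supp[of p] by (cases "f p = 0") auto
    qed
  qed simp
qed

lemma sq_norm_mono: "(\<And>p. norm (f p) \<le> norm (g p)) \<Longrightarrow> sq_norm f \<le> sq_norm g"
  unfolding sq_norm_def by (intro nn_integral_mono ennreal_leI power_mono) auto

lemma trunc_L1_L2:
  assumes [measurable]: "f \<in> borel_measurable borel" and fin: "sq_norm f < \<infinity>"
  shows "integrable lborel (trunc R f)" and "sq_norm (trunc R f) < \<infinity>"
proof -
  show fin': "sq_norm (trunc R f) < \<infinity>"
    by (rule le_less_trans[OF sq_norm_mono fin]) (auto simp: trunc_def indicator_def norm_mult)
  show "integrable lborel (trunc R f)"
    by (rule integrable_of_sq_norm[OF _ fin', of "cball 0 R"])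
      (use emeasure_bounded_finite[OF bounded_cball, of "0 :: real \<times> real" R] in \<open>auto simp: trunc_def indicator_def\<close>)
qed

lemma is_fourier_L2_unique:
  assumes f: "f \<in> borel_measurable borel" and "is_fourier_L2 f g" "is_fourier_L2 f g'"
  shows "AE \<zeta> in lborel. g \<zeta> = g' \<zeta>"
proof -
  have [measurable]: "f \<in> borel_measurable borel" "g \<in> borel_measurable borel" "g' \<in> borel_measurable borel"
    using assms by (auto simp: is_fourier_L2_iff in_L2_iff)
  define F where "F = (\<lambda>R. fourier_integral (trunc R f))"
  have [measurable]: "F R \<in> borel_measurable borel" for R unfolding F_def by measurable
  have lim: "((\<lambda>R. 2 * sq_norm (\<lambda>\<zeta>. F R \<zeta> - g' \<zeta>) + 2 * sq_norm (\<lambda>\<zeta>. F R \<zeta> - g \<zeta>)) \<longlongrightarrow> 2 * 0 + 2 * 0) at_top"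
    using assms unfolding F_def by (intro tendsto_add ennreal_tendsto_cmult) (auto simp: is_fourier_L2_iff)
  have "sq_norm (\<lambda>\<zeta>. g \<zeta> - g' \<zeta>) \<le> 2 * sq_norm (\<lambda>\<zeta>. F R \<zeta> - g' \<zeta>) + 2 * sq_norm (\<lambda>\<zeta>. F R \<zeta> - g \<zeta>)" for R
    using sq_norm_add_le[of "\<lambda>\<zeta>. F R \<zeta> - g' \<zeta>" "\<lambda>\<zeta>. - (F R \<zeta> - g \<zeta>)"]
    unfolding sq_norm_uminus by simp
  then have "sq_norm (\<lambda>\<zeta>. g \<zeta> - g' \<zeta>) \<le> 2 * 0 + 2 * 0"
    by (intro tendsto_lowerbound[OF lim]) auto
  then have "sq_norm (\<lambda>\<zeta>. g \<zeta> - g' \<zeta>) = 0" by simp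
  then have "AE \<zeta> in lborel. ennreal ((norm (g \<zeta> - g' \<zeta>))\<^sup>2) = 0"
    unfolding sq_norm_def by (subst (asm) nn_integral_0_iff_AE) auto
  then show ?thesis by eventually_elim auto
qed

lemma sq_norm_tail:
  assumes [measurable]: "f \<in> borel_measurable borel" and fin: "sq_norm f < \<infinity>"
  shows "((\<lambda>R. sq_norm (\<lambda>p. f p - trunc R f p)) \<longlongrightarrow> 0) at_top"
proof (rule tendsto_at_topI_sequentially)
  fix X :: "nat \<Rightarrow> real" assume X: "filterlim X at_top sequentially"
  have "(\<lambda>n. sq_norm (\<lambda>p. f p - trunc (X n) f p)) \<longlonglongrightarrow> (\<integral>\<^sup>+(p::real \<times> real). 0 \<partial>lborel)"
    unfolding sq_norm_def
  proof (rule nn_integral_dominated_convergence[where w = "\<lambda>p. ennreal ((norm (f p))\<^sup>2)"])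
    show "AE p in lborel. ennreal ((norm (f p - trunc (X j) f p))\<^sup>2) \<le> ennreal ((norm (f p))\<^sup>2)" for j
      by (intro AE_I2 ennreal_leI power_mono) (auto simp: trunc_def indicator_def)
    show "(\<integral>\<^sup>+p. ennreal ((norm (f p))\<^sup>2) \<partial>lborel) < \<infinity>" using fin by (simp add: sq_norm_def)
    show "AE p in lborel. (\<lambda>n. ennreal ((norm (f p - trunc (X n) f p))\<^sup>2)) \<longlonglongrightarrow> 0"
    proof (rule AE_I2)
      fix p :: "real \<times> real"
      have "eventually (\<lambda>n. norm p \<le> X n) sequentially" using X by (auto simp: filterlim_at_top)
      then have "eventually (\<lambda>n. ennreal ((norm (f p - trunc (X n) f p))\<^sup>2) = 0) sequentially"
        by eventually_elim (simp add: trunc_def)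
      then show "(\<lambda>n. ennreal ((norm (f p - trunc (X n) f p))\<^sup>2)) \<longlonglongrightarrow> 0" by (rule tendsto_eventually)
    qed
  qed measurable
  then show "(\<lambda>n. sq_norm (\<lambda>p. f p - trunc (X n) f p)) \<longlonglongrightarrow> 0" by simp
qed

section \<open>The inversion integral\<close>

definition inv_fourier_integral :: "(real \<times> real \<Rightarrow> complex) \<Rightarrow> real \<times> real \<Rightarrow> complex" where
  "inv_fourier_integral g p = complex_of_real (1 / (2 * pi)\<^sup>2) * (\<integral>\<zeta>. cis (p \<bullet> \<zeta>) * g \<zeta> \<partial>lborel)"

lemma inv_fourier_L2_integrable:
  "integrable lborel g \<Longrightarrow> inv_fourier_L2 g = inv_fourier_integral g"
  unfolding inv_fourier_L2_def inv_fourier_integral_def[abs_def] cis_conv_exp by simp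

lemma borel_measurable_inv_fourier_integral [measurable]:
  assumes [measurable]: "g \<in> borel_measurable borel"
  shows "inv_fourier_integral g \<in> borel_measurable borel"
proof -
  have "(\<lambda>p. \<integral>\<zeta>. cis (p \<bullet> \<zeta>) * g \<zeta> \<partial>lborel) \<in> borel_measurable borel"
    by (rule lborel.borel_measurable_lebesgue_integral) measurable
  then show ?thesis unfolding inv_fourier_integral_def[abs_def] by measurable
qed

lemma sq_norm_reflect:
  fixes f :: "real \<times> real \<Rightarrow> complex"
  assumes [measurable]: "f \<in> borel_measurable borel"
  shows "sq_norm (\<lambda>p. f (- p)) = sq_norm f"
proof -
  have "sq_norm f = (\<integral>\<^sup>+p. ennreal ((norm (f p))\<^sup>2) \<partial>density (distr lborel borel (\<lambda>x. 0 + (-1) *\<^sub>R x)) (\<lambda>_. ennreal (\<bar>-1 :: real\<bar> ^ DIM(real \<times> real))))"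
    unfolding sq_norm_def by (subst lborel_affine[of "-1" 0]) auto
  also have "\<dots> = sq_norm (\<lambda>p. f (- p))"
    by (simp add: nn_integral_density nn_integral_distr sq_norm_def)
  finally show ?thesis by simp
qed

lemma sq_norm_cmult:
  assumes [measurable]: "f \<in> borel_measurable borel"
  shows "sq_norm (\<lambda>p. c * f p) = ennreal ((norm c)\<^sup>2) * sq_norm f"
  unfolding sq_norm_def by (subst nn_integral_cmult[symmetric]) (simp_all add: norm_mult power_mult_distrib ennreal_mult)

text \<open>The inversion integral is the forward transform reflected and divided by 4 pi^2, so
  \<open>plancherel_L1_L2\<close> applies to it; the powers of 4 pi^2 then cancel.\<close>

lemma sq_norm_inv_fourier:
  assumes g: "integrable lborel g" and fin: "sq_norm g < \<infinity>"
  shows "sq_norm g = ennreal (4 * pi\<^sup>2) * sq_norm (inv_fourier_integral g)"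
proof -
  have [measurable]: "g \<in> borel_measurable borel" using borel_measurable_integrable[OF g] by simp
  have "inv_fourier_integral g = (\<lambda>p. complex_of_real (1 / (2 * pi)\<^sup>2) * fourier_integral g (- p))"
    by (simp add: fun_eq_iff inv_fourier_integral_def fourier_integral_cis inner_commute)
  then have "sq_norm (inv_fourier_integral g) = sq_norm (\<lambda>p. complex_of_real (1 / (2 * pi)\<^sup>2) * fourier_integral g (- p))"
    by (simp only:)
  also have "\<dots> = ennreal ((norm (complex_of_real (1 / (2 * pi)\<^sup>2)))\<^sup>2) * sq_norm (\<lambda>p. fourier_integral g (- p))"
    by (rule sq_norm_cmult) measurable
  also have "\<dots> = ennreal ((1 / (2 * pi)\<^sup>2)\<^sup>2) * (ennreal (4 * pi\<^sup>2) * sq_norm g)"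
    by (simp only: sq_norm_reflect[OF borel_measurable_fourier_integral[OF \<open>g \<in> borel_measurable borel\<close>]]
      plancherel_L1_L2[OF g fin] norm_of_real power2_abs)
  finally have "ennreal (4 * pi\<^sup>2) * sq_norm (inv_fourier_integral g) = ennreal (4 * pi\<^sup>2) * (ennreal ((1 / (2 * pi)\<^sup>2)\<^sup>2) * (ennreal (4 * pi\<^sup>2) * sq_norm g))"
    by (simp only:)
  also have "\<dots> = (ennreal (4 * pi\<^sup>2) * ennreal ((1 / (2 * pi)\<^sup>2)\<^sup>2) * ennreal (4 * pi\<^sup>2)) * sq_norm g"
    by (simp only: mult.assoc)
  also have "ennreal (4 * pi\<^sup>2) * ennreal ((1 / (2 * pi)\<^sup>2)\<^sup>2) * ennreal (4 * pi\<^sup>2) = 1"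
    by (simp add: ennreal_mult[symmetric] power2_eq_square)
  finally show ?thesis by simp
qed

text \<open>Inversion is extracted from Plancherel alone. Let \<open>h\<close> be a truncation of
  \<open>F\<close> and \<open>K\<close> its transform. By Fubini the cross term of \<open>K\<close>
  and \<open>g\<close> is 4 pi^2 times that of \<open>h\<close> and \<open>F\<close>, so expanding
  |K - g|^2 leaves 4 pi^2 times the squared norm of F - h, a tail that tends to 0.\<close>

lemma is_fourier_inv_fourier:
  assumes g: "integrable lborel g" and fin: "sq_norm g < \<infinity>"
  shows "in_L2 (inv_fourier_integral g)" and "is_fourier_L2 (inv_fourier_integral g) g"
proof -
  have [measurable]: "g \<in> borel_measurable borel" using borel_measurable_integrable[OF g] by simp
  define F where "F = inv_fourier_integral g"
  have [measurable]: "F \<in> borel_measurable borel" unfolding F_def by measurable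
  have gF: "sq_norm g = ennreal (4 * pi\<^sup>2) * sq_norm F" unfolding F_def by (rule sq_norm_inv_fourier[OF g fin])
  have finF: "sq_norm F < \<infinity>"
  proof (rule ccontr)
    assume "\<not> sq_norm F < \<infinity>"
    then have "sq_norm F = \<infinity>" by (simp add: less_top[symmetric])
    with gF fin show False by (simp add: ennreal_mult_top)
  qed
  show L2: "in_L2 (inv_fourier_integral g)" using finF by (simp add: in_L2_iff flip: F_def)
  have sq_int: "integrable lborel (\<lambda>p. (norm (h p))\<^sup>2)" "ennreal (\<integral>p. (norm (h p))\<^sup>2 \<partial>lborel) = sq_norm h"
    if "h \<in> borel_measurable borel" "sq_norm h < \<infinity>" for h :: "real \<times> real \<Rightarrow> complex"
  proof -
    show i: "integrable lborel (\<lambda>p. (norm (h p))\<^sup>2)" using that by (simp add: integrable_iff_bounded sq_norm_def)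
    show "ennreal (\<integral>p. (norm (h p))\<^sup>2 \<partial>lborel) = sq_norm h"
      unfolding sq_norm_def by (rule nn_integral_eq_integral[OF i, symmetric]) simp
  qed
  have key: "sq_norm (\<lambda>\<zeta>. fourier_integral (trunc R F) \<zeta> - g \<zeta>) = ennreal (4 * pi\<^sup>2) * sq_norm (\<lambda>p. F p - trunc R F p)" for R
  proof -
    define h where "h = trunc R F"
    have hL: "integrable lborel h" "sq_norm h < \<infinity>" unfolding h_def using trunc_L1_L2[of F R] finF by auto
    have [measurable]: "h \<in> borel_measurable borel" unfolding h_def by measurable
    define K where "K = fourier_integral h"
    have [measurable]: "K \<in> borel_measurable borel" unfolding K_def by measurable
    have Kh: "sq_norm K = ennreal (4 * pi\<^sup>2) * sq_norm h" unfolding K_def by (rule plancherel_L1_L2[OF hL])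
    then have finK: "sq_norm K < \<infinity>" using hL by (simp add: ennreal_mult_less_top)
    have finFh: "sq_norm (\<lambda>p. F p - h p) < \<infinity>"
      by (rule le_less_trans[OF sq_norm_mono finF]) (auto simp: h_def trunc_def indicator_def)
    have cross: "(\<integral>\<zeta>. K \<zeta> * cnj (g \<zeta>) \<partial>lborel) = of_real (4 * pi\<^sup>2) * (\<integral>p. h p * cnj (F p) \<partial>lborel)"
    proof -
      have Qi: "integrable (lborel \<Otimes>\<^sub>M lborel) (\<lambda>(p, \<zeta>). cis (- (p \<bullet> \<zeta>)) * h p * cnj (g \<zeta>))"
        by (rule Bochner_Integration.integrable_bound[OF integrable_lborel_pair_mult[OF integrable_norm[OF hL(1)] integrable_norm[OF g]]])
          (auto simp: norm_mult abs_mult split: prod.split)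
      have "(\<integral>\<zeta>. K \<zeta> * cnj (g \<zeta>) \<partial>lborel) = (\<integral>\<zeta>. (\<integral>p. cis (- (p \<bullet> \<zeta>)) * h p * cnj (g \<zeta>) \<partial>lborel) \<partial>lborel)"
        by (simp add: K_def fourier_integral_cis)
      also have "\<dots> = (\<integral>p. (\<integral>\<zeta>. cis (- (p \<bullet> \<zeta>)) * h p * cnj (g \<zeta>) \<partial>lborel) \<partial>lborel)"
        by (rule lborel_pair.Fubini_integral[OF Qi])
      also have "\<dots> = (\<integral>p. of_real (4 * pi\<^sup>2) * (h p * cnj (F p)) \<partial>lborel)"
      proof (intro Bochner_Integration.integral_cong refl)
        fix p
        have "(\<integral>\<zeta>. cis (- (p \<bullet> \<zeta>)) * h p * cnj (g \<zeta>) \<partial>lborel) = (\<integral>\<zeta>. h p * cnj (cis (p \<bullet> \<zeta>) * g \<zeta>) \<partial>lborel)"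
          by (intro Bochner_Integration.integral_cong refl) (simp add: cis_cnj)
        also have "\<dots> = h p * cnj (\<integral>\<zeta>. cis (p \<bullet> \<zeta>) * g \<zeta> \<partial>lborel)"
          by (simp only: integral_mult_right_zero Bochner_Integration.integral_cnj)
        also have "(\<integral>\<zeta>. cis (p \<bullet> \<zeta>) * g \<zeta> \<partial>lborel) = of_real (4 * pi\<^sup>2) * F p"
          by (simp add: F_def inv_fourier_integral_def power_mult_distrib)
        finally show "(\<integral>\<zeta>. cis (- (p \<bullet> \<zeta>)) * h p * cnj (g \<zeta>) \<partial>lborel) = of_real (4 * pi\<^sup>2) * (h p * cnj (F p))" by simp
      qed
      finally show ?thesis by simp
    qed
    \<comment> \<open>At each point \<open>h\<close> equals \<open>F\<close> or 0, so the cross term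
      is the squared norm of \<open>h\<close>; this is the orthogonality of \<open>h\<close> and F -
      h.\<close>
    have hF: "h p * cnj (F p) = of_real ((norm (h p))\<^sup>2)" for p
    proof (cases "p \<in> cball 0 R")
      case True
      then have "h p = F p" by (simp add: h_def trunc_def)
      then show ?thesis by (simp only: complex_norm_square)
    qed (simp add: h_def trunc_def)
    have Re_eq: "Re (a * cnj b) = 1/2 * ((norm a)\<^sup>2 + (norm b)\<^sup>2 - (norm (a - b))\<^sup>2)" for a b :: complex
      unfolding cmod_power2 by (simp add: power2_eq_square algebra_simps)
    have finKg: "sq_norm (\<lambda>\<zeta>. K \<zeta> - g \<zeta>) < \<infinity>"
    proof -
      have "sq_norm (\<lambda>\<zeta>. K \<zeta> - g \<zeta>) \<le> 2 * sq_norm K + 2 * sq_norm g"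
        using sq_norm_add_le[of K "\<lambda>\<zeta>. - g \<zeta>"] by simp
      also have "\<dots> < \<infinity>" using finK fin by (simp add: ennreal_mult_less_top)
      finally show ?thesis .
    qed
    have Kgm: "(\<lambda>\<zeta>. K \<zeta> - g \<zeta>) \<in> borel_measurable borel" and Fhm: "(\<lambda>p. F p - h p) \<in> borel_measurable borel" by measurable
    note iK = sq_int[OF \<open>K \<in> borel_measurable borel\<close> finK] and ig = sq_int[OF \<open>g \<in> borel_measurable borel\<close> fin]
      and iKg = sq_int[OF Kgm finKg] and ih = sq_int[OF \<open>h \<in> borel_measurable borel\<close> hL(2)]
      and iF = sq_int[OF \<open>F \<in> borel_measurable borel\<close> finF] and iFh = sq_int[OF Fhm finFh]
    define SK where "SK = (\<integral>p. (norm (K p))\<^sup>2 \<partial>lborel)"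
    define Sg where "Sg = (\<integral>p. (norm (g p))\<^sup>2 \<partial>lborel)"
    define SKg where "SKg = (\<integral>p. (norm (K p - g p))\<^sup>2 \<partial>lborel)"
    define Sh where "Sh = (\<integral>p. (norm (h p))\<^sup>2 \<partial>lborel)"
    define SF where "SF = (\<integral>p. (norm (F p))\<^sup>2 \<partial>lborel)"
    define SFh where "SFh = (\<integral>p. (norm (F p - h p))\<^sup>2 \<partial>lborel)"
    have nonneg: "SK \<ge> 0" "Sg \<ge> 0" "SKg \<ge> 0" "Sh \<ge> 0" "SF \<ge> 0" "SFh \<ge> 0"
      by (simp_all add: SK_def Sg_def SKg_def Sh_def SF_def SFh_def)
    have cint: "integrable lborel (\<lambda>\<zeta>. K \<zeta> * cnj (g \<zeta>))"
    proof (rule Bochner_Integration.integrable_bound)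
      show "integrable lborel (\<lambda>\<zeta>. (norm (K \<zeta>))\<^sup>2 + (norm (g \<zeta>))\<^sup>2)" using iK(1) ig(1) by simp
      show "AE \<zeta> in lborel. norm (K \<zeta> * cnj (g \<zeta>)) \<le> norm ((norm (K \<zeta>))\<^sup>2 + (norm (g \<zeta>))\<^sup>2)"
      proof (rule AE_I2)
        fix \<zeta>
        have "a * b \<le> a\<^sup>2 + b\<^sup>2" for a b :: real
        proof -
          have "0 \<le> (a - b)\<^sup>2 + (a\<^sup>2 + b\<^sup>2)" by simp
          then show ?thesis unfolding power2_diff by linarith
        qed
        from this[of "norm (K \<zeta>)" "norm (g \<zeta>)"]
        show "norm (K \<zeta> * cnj (g \<zeta>)) \<le> norm ((norm (K \<zeta>))\<^sup>2 + (norm (g \<zeta>))\<^sup>2)" by (simp add: norm_mult)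
      qed
    qed measurable
    have "Re (\<integral>\<zeta>. K \<zeta> * cnj (g \<zeta>) \<partial>lborel) = (\<integral>\<zeta>. Re (K \<zeta> * cnj (g \<zeta>)) \<partial>lborel)"
      by (rule integral_Re[OF cint, symmetric])
    also have "\<dots> = 1/2 * (SK + Sg - SKg)"
      unfolding Re_eq SK_def Sg_def SKg_def using iK(1) ig(1) iKg(1) by simp
    also have "Re (\<integral>\<zeta>. K \<zeta> * cnj (g \<zeta>) \<partial>lborel) = 4 * pi\<^sup>2 * Sh"
      unfolding cross hF Sh_def integral_complex_of_real of_real_mult[symmetric] by (rule Re_complex_of_real)
    finally have e1: "SKg = SK + Sg - 2 * (4 * pi\<^sup>2 * Sh)" by simp
    have "ennreal SK = ennreal (4 * pi\<^sup>2 * Sh)" "ennreal Sg = ennreal (4 * pi\<^sup>2 * SF)"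
      using Kh gF nonneg by (simp_all add: iK(2) ih(2) ig(2) iF(2) SK_def Sh_def Sg_def SF_def ennreal_mult)
    then have e2: "SK = 4 * pi\<^sup>2 * Sh" and e3: "Sg = 4 * pi\<^sup>2 * SF" using nonneg by simp_all
    have "SF = (\<integral>p. (norm (F p - h p))\<^sup>2 + (norm (h p))\<^sup>2 \<partial>lborel)"
      unfolding SF_def by (intro Bochner_Integration.integral_cong refl) (auto simp: h_def trunc_def indicator_def)
    also have "\<dots> = SFh + Sh" unfolding SFh_def Sh_def using iFh(1) ih(1) by simp
    finally have "SKg = 4 * pi\<^sup>2 * SFh" using e1 e2 e3 by (simp add: algebra_simps)
    then have "ennreal SKg = ennreal (4 * pi\<^sup>2) * ennreal SFh" using nonneg by (simp add: ennreal_mult)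
    then show ?thesis
      using iKg(2) iFh(2) unfolding SKg_def SFh_def K_def h_def by simp
  qed
  have "((\<lambda>R. ennreal (4 * pi\<^sup>2) * sq_norm (\<lambda>p. F p - trunc R F p)) \<longlongrightarrow> ennreal (4 * pi\<^sup>2) * 0) at_top"
    by (intro ennreal_tendsto_cmult sq_norm_tail finF) simp_all
  then show "is_fourier_L2 (inv_fourier_integral g) g"
    using fin by (simp add: is_fourier_L2_iff in_L2_iff key flip: F_def)
qed

text \<open>The pointwise half of Riesz-Fischer. Weighting the squared increments by 2 ^ k keeps
  their sum integrable and forces increments of order 2^(-k/2) almost everywhere, hence absolute
  convergence.\<close>

lemma exists_L2_limit:
  fixes G :: "nat \<Rightarrow> 'a::euclidean_space \<Rightarrow> complex"
  assumes [measurable]: "\<And>k. G k \<in> borel_measurable borel"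
    and step: "\<And>k. sq_norm (\<lambda>p. G (Suc k) p - G k p) \<le> ennreal (C * (1/4) ^ k)" and C: "C \<ge> 0"
  shows "\<exists>g \<in> borel_measurable borel. AE p in lborel. (\<lambda>k. G k p) \<longlonglongrightarrow> g p"
proof -
  define d where "d = (\<lambda>k p. G (Suc k) p - G k p)"
  have [measurable]: "d k \<in> borel_measurable borel" for k unfolding d_def by measurable
  have "(\<integral>\<^sup>+p. (\<Sum>k. ennreal (2 ^ k * (norm (d k p))\<^sup>2)) \<partial>lborel) = (\<Sum>k. \<integral>\<^sup>+p. ennreal (2 ^ k * (norm (d k p))\<^sup>2) \<partial>lborel)"
    by (rule nn_integral_suminf) measurable
  also have "\<dots> \<le> (\<Sum>k. ennreal (C * (1/2) ^ k))"
  proof (rule suminf_le)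
    fix k
    have "(\<integral>\<^sup>+p. ennreal (2 ^ k * (norm (d k p))\<^sup>2) \<partial>lborel) = ennreal (2 ^ k) * sq_norm (d k)"
      unfolding sq_norm_def by (simp add: ennreal_mult nn_integral_cmult)
    also have "\<dots> \<le> ennreal (2 ^ k) * ennreal (C * (1/4) ^ k)"
      using step[of k] by (intro mult_left_mono) (auto simp: d_def)
    also have "\<dots> = ennreal (C * (1/2) ^ k)"
    proof -
      have "2 ^ k * (C * (1/4) ^ k) = C * (2 * (1/4)) ^ k" unfolding power_mult_distrib by simp
      then show ?thesis using C by (simp add: ennreal_mult[symmetric])
    qed
    finally show "(\<integral>\<^sup>+p. ennreal (2 ^ k * (norm (d k p))\<^sup>2) \<partial>lborel) \<le> ennreal (C * (1/2) ^ k)" .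
  qed auto
  also have "\<dots> = ennreal (\<Sum>k. C * (1/2) ^ k)"
    using C by (intro suminf_ennreal2 summable_mult summable_geometric) auto
  also have "\<dots> < \<infinity>" by simp
  finally have "(\<integral>\<^sup>+p. (\<Sum>k. ennreal (2 ^ k * (norm (d k p))\<^sup>2)) \<partial>lborel) \<noteq> \<infinity>" by simp
  then have "AE p in lborel. (\<Sum>k. ennreal (2 ^ k * (norm (d k p))\<^sup>2)) \<noteq> \<infinity>"
    by (intro nn_integral_noteq_infinite) measurable
  then have conv: "AE p in lborel. convergent (\<lambda>k. G k p)"
  proof eventually_elim
    case (elim p)
    have "\<exists>M. x = ennreal M \<and> M \<ge> 0" if "x \<noteq> \<infinity>" for x :: ennreal using that by (cases x) auto
    from this[OF elim] obtain M where M: "(\<Sum>k. ennreal (2 ^ k * (norm (d k p))\<^sup>2)) = ennreal M" "M \<ge> 0"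
      by blast
    have bd: "norm (d k p) \<le> sqrt M * (sqrt (1/2)) ^ k" for k
    proof -
      have "s k \<le> suminf s" for s :: "nat \<Rightarrow> ennreal"
        using sum_le_suminf[OF summableI, of "{k}" s] by simp
      from this[of "\<lambda>k. ennreal (2 ^ k * (norm (d k p))\<^sup>2)"]
      have "ennreal (2 ^ k * (norm (d k p))\<^sup>2) \<le> ennreal M" unfolding M(1) .
      then have "2 ^ k * (norm (d k p))\<^sup>2 \<le> M" using M(2) by simp
      then have "(norm (d k p))\<^sup>2 \<le> M * (1/2) ^ k" by (simp add: field_simps)
      then have "norm (d k p) \<le> sqrt (M * (1/2) ^ k)" by (rule real_le_rsqrt)
      then show ?thesis by (simp add: real_sqrt_mult real_sqrt_power real_sqrt_divide)
    qed
    have "sqrt (1/2) < sqrt 1" by (rule real_sqrt_less_mono) simp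
    then have "summable (\<lambda>k. sqrt M * (sqrt (1/2)) ^ k)"
      by (intro summable_mult summable_geometric) simp
    then have "summable (\<lambda>k. d k p)" by (rule summable_comparison_test'[OF _ bd])
    then have "convergent (\<lambda>n. \<Sum>k<n. d k p)" by (simp add: summable_iff_convergent)
    then have "convergent (\<lambda>n. G 0 p + (\<Sum>k<n. d k p))" by (intro convergent_add convergent_const)
    moreover have "G 0 p + (\<Sum>k<n. d k p) = G n p" for n
      unfolding d_def using sum_lessThan_telescope[of "\<lambda>k. G k p" n] by simp
    ultimately show ?case by simp
  qed
  have m: "(\<lambda>p. lim (\<lambda>k. G k p)) \<in> borel_measurable borel" by (rule borel_measurable_lim_metric) measurable
  from conv have "AE p in lborel. (\<lambda>k. G k p) \<longlonglongrightarrow> lim (\<lambda>k. G k p)"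
    by eventually_elim (simp add: convergent_LIMSEQ_iff)
  then show ?thesis by (rule bexI[OF _ m])
qed

text \<open>Riesz-Fischer along truncations whose tails decay geometrically; Fatou's lemma then controls
  every truncation.\<close>

lemma is_fourier_L2_exists:
  assumes "in_L2 f"
  shows "\<exists>g. is_fourier_L2 f g"
proof -
  have [measurable]: "f \<in> borel_measurable borel" and fin: "sq_norm f < \<infinity>" using assms by (auto simp: in_L2_iff)
  define tl where "tl = (\<lambda>R. sq_norm (\<lambda>p. f p - trunc R f p))"
  define F where "F = (\<lambda>R. fourier_integral (trunc R f))"
  have [measurable]: "F R \<in> borel_measurable borel" for R unfolding F_def by measurable
  \<comment> \<open>Plancherel for the difference of two truncations: the transforms are Cauchy at
    the rate of the tail of \<open>f\<close>.\<close>
  have diff: "sq_norm (\<lambda>\<zeta>. F R' \<zeta> - F R \<zeta>) \<le> ennreal (4 * pi\<^sup>2) * tl R" if "R \<le> R'" for R R'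
  proof -
    define h where "h = (\<lambda>p. trunc R' f p - trunc R f p)"
    have i: "integrable lborel (trunc R' f)" "integrable lborel (trunc R f)" using fin by (auto intro: trunc_L1_L2)
    have hi: "integrable lborel h" unfolding h_def using i by simp
    have le: "sq_norm h \<le> tl R" unfolding tl_def using that by (intro sq_norm_mono) (auto simp: h_def trunc_def indicator_def)
    have "tl R \<le> sq_norm f" unfolding tl_def by (intro sq_norm_mono) (auto simp: trunc_def indicator_def)
    then have hf: "sq_norm h < \<infinity>" using le fin by (meson le_less_trans order_trans)
    have "F R' \<zeta> - F R \<zeta> = fourier_integral h \<zeta>" for \<zeta>
    proof -
      have c: "integrable lborel (\<lambda>p. cis (- (p \<bullet> \<zeta>)) * k p)" if "integrable lborel k" for k
        by (rule Bochner_Integration.integrable_bound[OF that]) (use borel_measurable_integrable[OF that] in \<open>auto simp: norm_mult\<close>)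
      show ?thesis
        unfolding F_def h_def fourier_integral_cis using c[OF i(1)] c[OF i(2)]
        by (simp add: right_diff_distrib)
    qed
    then have "sq_norm (\<lambda>\<zeta>. F R' \<zeta> - F R \<zeta>) = ennreal (4 * pi\<^sup>2) * sq_norm h"
      using plancherel_L1_L2[OF hi hf] by simp
    also have "\<dots> \<le> ennreal (4 * pi\<^sup>2) * tl R" by (intro mult_left_mono le) simp
    finally show ?thesis .
  qed
  have tl0: "(tl \<longlongrightarrow> 0) at_top" unfolding tl_def by (rule sq_norm_tail[OF _ fin]) simp
  have "\<exists>R\<ge>r. tl R \<le> ennreal ((1/4) ^ k)" for k :: nat and r :: real
  proof -
    have "0 < ennreal ((1/4) ^ k)" by simp
    with tl0 have "eventually (\<lambda>R. tl R < ennreal ((1/4) ^ k)) at_top" by (auto simp: order_tendsto_iff)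
    then have "eventually (\<lambda>R. R \<ge> r \<and> tl R < ennreal ((1/4) ^ k)) at_top"
      using eventually_ge_at_top by eventually_elim auto
    then obtain R where "R \<ge> r \<and> tl R < ennreal ((1/4) ^ k)" by (auto simp: eventually_at_top_linorder)
    then show ?thesis by (auto intro: less_imp_le)
  qed
  \<comment> \<open>Radii are chosen recursively: increasing, so that \<open>diff\<close> compares
    consecutive ones, and with tails at the rate 4^(-k) that \<open>exists_L2_limit\<close> asks
    for.\<close>
  then have "\<exists>r. \<forall>k. tl (r k) \<le> ennreal ((1/4) ^ k) \<and> r k \<le> r (Suc k)"
    by (intro dependent_nat_choice) blast+
  then obtain r where r: "\<And>k. tl (r k) \<le> ennreal ((1/4) ^ k)" "\<And>k. r k \<le> r (Suc k)" by blast
  have r_mono: "r i \<le> r j" if "i \<le> j" for i j using that r(2) by (rule lift_Suc_mono_le[rotated])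
  have "\<exists>g \<in> borel_measurable borel. AE p in lborel. (\<lambda>k. F (r k) p) \<longlonglongrightarrow> g p"
  proof (rule exists_L2_limit)
    fix k
    have "sq_norm (\<lambda>p. F (r (Suc k)) p - F (r k) p) \<le> ennreal (4 * pi\<^sup>2) * tl (r k)" by (rule diff[OF r(2)])
    also have "\<dots> \<le> ennreal (4 * pi\<^sup>2) * ennreal ((1/4) ^ k)" by (intro mult_left_mono r) simp
    also have "\<dots> = ennreal (4 * pi\<^sup>2 * (1/4) ^ k)" by (rule ennreal_mult[symmetric]) auto
    finally show "sq_norm (\<lambda>p. F (r (Suc k)) p - F (r k) p) \<le> ennreal (4 * pi\<^sup>2 * (1/4) ^ k)" .
  qed auto
  then obtain g where g [measurable]: "g \<in> borel_measurable borel" and lim: "AE p in lborel. (\<lambda>k. F (r k) p) \<longlonglongrightarrow> g p" by blast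
  have tail: "sq_norm (\<lambda>p. F (r i) p - g p) \<le> ennreal (4 * pi\<^sup>2) * tl (r i)" for i
  proof -
    have "sq_norm (\<lambda>p. F (r i) p - g p) = (\<integral>\<^sup>+p. liminf (\<lambda>k. ennreal ((norm (F (r i) p - F (r k) p))\<^sup>2)) \<partial>lborel)"
      unfolding sq_norm_def
    proof (rule nn_integral_cong_AE)
      from lim show "AE p in lborel. ennreal ((norm (F (r i) p - g p))\<^sup>2) = liminf (\<lambda>k. ennreal ((norm (F (r i) p - F (r k) p))\<^sup>2))"
      proof eventually_elim
        case (elim p)
        then have "(\<lambda>k. ennreal ((norm (F (r i) p - F (r k) p))\<^sup>2)) \<longlonglongrightarrow> ennreal ((norm (F (r i) p - g p))\<^sup>2)"
          by (intro tendsto_intros)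
        then show ?case by (rule lim_imp_Liminf[rotated, symmetric]) simp
      qed
    qed
    also have "\<dots> \<le> liminf (\<lambda>k. sq_norm (\<lambda>p. F (r i) p - F (r k) p))"
      unfolding sq_norm_def by (rule nn_integral_liminf) measurable
    also have "\<dots> \<le> ennreal (4 * pi\<^sup>2) * tl (r i)"
    proof -
      have "eventually (\<lambda>k. sq_norm (\<lambda>p. F (r i) p - F (r k) p) \<le> ennreal (4 * pi\<^sup>2) * tl (r i)) sequentially"
      proof (rule eventually_sequentiallyI)
        fix k assume "i \<le> k"
        have "sq_norm (\<lambda>p. F (r i) p - F (r k) p) = sq_norm (\<lambda>p. - (F (r k) p - F (r i) p))" by simp
        also have "\<dots> \<le> ennreal (4 * pi\<^sup>2) * tl (r i)"
          unfolding sq_norm_uminus by (rule diff[OF r_mono[OF \<open>i \<le> k\<close>]])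
        finally show "sq_norm (\<lambda>p. F (r i) p - F (r k) p) \<le> ennreal (4 * pi\<^sup>2) * tl (r i)" .
      qed
      then have "liminf (\<lambda>k. sq_norm (\<lambda>p. F (r i) p - F (r k) p)) \<le> liminf (\<lambda>k::nat. ennreal (4 * pi\<^sup>2) * tl (r i))"
        by (rule Liminf_mono)
      then show ?thesis by (simp add: Liminf_const)
    qed
    finally show ?thesis .
  qed
  have p4: "ennreal (4 * pi\<^sup>2) * ennreal ((1/4) ^ i) = ennreal (4 * pi\<^sup>2 * (1/4) ^ i)" for i
    by (rule ennreal_mult[symmetric]) auto
  have "((\<lambda>R. sq_norm (\<lambda>\<zeta>. F R \<zeta> - g \<zeta>)) \<longlongrightarrow> 0) at_top"
  proof (rule tendsto_zero_ennreal)
    fix e :: real assume e: "0 < e"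
    \<comment> \<open>16 pi^2 is twice 4 pi^2 for each of the two terms of
      \<open>sq_norm_add_le\<close>.\<close>
    have "(\<lambda>i. 16 * pi\<^sup>2 * (1/4) ^ i) \<longlonglongrightarrow> 16 * pi\<^sup>2 * (0::real)"
      by (intro tendsto_mult_left LIMSEQ_power_zero) simp
    then have "eventually (\<lambda>i. 16 * pi\<^sup>2 * (1/4) ^ i < e) sequentially"
      using e by (auto simp: order_tendsto_iff)
    then obtain i where i: "16 * pi\<^sup>2 * (1/4) ^ i < e" by (auto simp: eventually_sequentially)
    show "\<forall>\<^sub>F R in at_top. sq_norm (\<lambda>\<zeta>. F R \<zeta> - g \<zeta>) < ennreal e"
      using eventually_ge_at_top[of "r i"]
    proof eventually_elim
      case (elim R)
      have "sq_norm (\<lambda>\<zeta>. F R \<zeta> - g \<zeta>) = sq_norm (\<lambda>\<zeta>. (F R \<zeta> - F (r i) \<zeta>) + (F (r i) \<zeta> - g \<zeta>))" by simp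
      also have "\<dots> \<le> 2 * sq_norm (\<lambda>\<zeta>. F R \<zeta> - F (r i) \<zeta>) + 2 * sq_norm (\<lambda>\<zeta>. F (r i) \<zeta> - g \<zeta>)"
        by (rule sq_norm_add_le) measurable
      also have "\<dots> \<le> 2 * ennreal (4 * pi\<^sup>2 * (1/4) ^ i) + 2 * ennreal (4 * pi\<^sup>2 * (1/4) ^ i)"
      proof (intro add_mono mult_left_mono)
        have b: "ennreal (4 * pi\<^sup>2) * tl (r i) \<le> ennreal (4 * pi\<^sup>2 * (1/4) ^ i)"
          unfolding p4[symmetric] by (intro mult_left_mono r) simp
        show "sq_norm (\<lambda>\<zeta>. F R \<zeta> - F (r i) \<zeta>) \<le> ennreal (4 * pi\<^sup>2 * (1/4) ^ i)"
          using diff[OF elim] b by (rule order_trans)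
        show "sq_norm (\<lambda>\<zeta>. F (r i) \<zeta> - g \<zeta>) \<le> ennreal (4 * pi\<^sup>2 * (1/4) ^ i)"
          using tail[of i] b by (rule order_trans)
      qed auto
      also have "\<dots> = ennreal (16 * pi\<^sup>2 * (1/4) ^ i)"
      proof -
        have "2 * ennreal x + 2 * ennreal x = ennreal (4 * x)" if "x \<ge> 0" for x
        proof -
          have "2 * ennreal x = ennreal (2 * x)" using ennreal_mult[of 2 x] that by simp
          then show ?thesis using that by (simp flip: ennreal_plus)
        qed
        from this[of "4 * pi\<^sup>2 * (1/4) ^ i"] show ?thesis by simp
      qed
      also have "\<dots> < ennreal e" using i e by (simp add: ennreal_less_iff)
      finally show ?case .
    qed
  qed
  moreover have "sq_norm g < \<infinity>"
  proof -
    have "sq_norm g \<le> 2 * sq_norm (F (r 0)) + 2 * sq_norm (\<lambda>p. F (r 0) p - g p)"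
      using sq_norm_add_le[of "F (r 0)" "\<lambda>p. - (F (r 0) p - g p)"] unfolding sq_norm_uminus by simp
    moreover have "sq_norm (F (r 0)) < \<infinity>"
      unfolding F_def using trunc_L1_L2[of f "r 0"] fin by (subst plancherel_L1_L2) (auto simp: ennreal_mult_less_top)
    moreover have "sq_norm (\<lambda>p. F (r 0) p - g p) < \<infinity>"
    proof (rule le_less_trans[OF tail[of 0]])
      have "ennreal (4 * pi\<^sup>2) * tl (r 0) \<le> ennreal (4 * pi\<^sup>2) * ennreal ((1/4) ^ 0)" by (intro mult_left_mono r) simp
      then show "ennreal (4 * pi\<^sup>2) * tl (r 0) < \<infinity>" unfolding p4 by (auto intro: le_less_trans)
    qed
    ultimately show ?thesis by (auto simp: ennreal_mult_less_top intro: le_less_trans)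
  qed
  ultimately show ?thesis
    by (auto simp: is_fourier_L2_iff in_L2_iff F_def intro!: exI[of _ g])
qed

section \<open>The maximal estimate\<close>

text \<open>The break at N^6 is where the quadratic decay, whose constant is a multiple of N^6,
  begins to integrate to O(1); up to there the bound by 1/|X| costs only ln (N^6) = 6 ln N.\<close>

definition kern_majorant :: "real \<Rightarrow> real \<Rightarrow> real" where
  "kern_majorant N X = (if \<bar>X\<bar> \<le> 1 then 16 else if \<bar>X\<bar> \<le> N ^ 6 then 400000 * (1 + ln N) / \<bar>X\<bar>
     else 80000 * N ^ 6 / X\<^sup>2)"

lemma borel_measurable_kern_majorant [measurable]: "kern_majorant N \<in> borel_measurable borel"
  unfolding kern_majorant_def by measurable

lemma norm_kern_le_majorant:
  assumes N: "N \<ge> 1" and \<kappa>: "\<bar>\<kappa>\<bar> \<le> N\<^sup>2"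
  shows "norm (kern X Y \<kappa> (\<kappa> * N)) \<le> kern_majorant N X"
    and "norm (kern X Y \<kappa> (\<kappa> * N)) \<le> kern_majorant N Y"
proof -
  have gen: "a \<le> kern_majorant N Z"
    if "a \<le> 16" "\<bar>Z\<bar> * a \<le> 400000 * (1 + ln N)" "Z\<^sup>2 * a \<le> 80000 * N ^ 6" for a Z
  proof (cases "\<bar>Z\<bar> \<le> 1")
    case False
    then have "\<bar>Z\<bar> > 0" "Z\<^sup>2 > 0" by auto
    then have "a \<le> 400000 * (1 + ln N) / \<bar>Z\<bar>" "a \<le> 80000 * N ^ 6 / Z\<^sup>2"
      using that by (simp_all add: le_divide_eq mult.commute)
    then show ?thesis using False by (simp add: kern_majorant_def)
  qed (use that in \<open>simp add: kern_majorant_def\<close>)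
  show "norm (kern X Y \<kappa> (\<kappa> * N)) \<le> kern_majorant N X"
    by (intro gen norm_kern_le kern_bounds[OF N \<kappa>])
  show "norm (kern X Y \<kappa> (\<kappa> * N)) \<le> kern_majorant N Y"
    by (intro gen norm_kern_le kern_bounds[OF N \<kappa>])
qed

lemma nn_integral_even_le:
  fixes h :: "real \<Rightarrow> ennreal"
  assumes [measurable]: "h \<in> borel_measurable borel" and even: "\<And>x. h (- x) = h x"
  shows "(\<integral>\<^sup>+x. h x \<partial>lborel) \<le> 2 * (\<integral>\<^sup>+x. h x * indicator {0..} x \<partial>lborel)"
proof -
  have "(\<integral>\<^sup>+x. h x \<partial>lborel) \<le> (\<integral>\<^sup>+x. h x * indicator {0..} x + h (- x) * indicator {0..} (- x) \<partial>lborel)"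
    by (intro nn_integral_mono) (auto simp: indicator_def even)
  also have "\<dots> = (\<integral>\<^sup>+x. h x * indicator {0..} x \<partial>lborel) + (\<integral>\<^sup>+x. h (- x) * indicator {0..} (- x) \<partial>lborel)"
    by (rule nn_integral_add) measurable
  also have "(\<integral>\<^sup>+x. h (- x) * indicator {0..} (- x) \<partial>lborel) = (\<integral>\<^sup>+x. h x * indicator {0..} x \<partial>lborel)"
    using nn_integral_real_affine[of "\<lambda>x. h x * indicator {0..} x" "-1" 0] by simp
  finally show ?thesis by (simp add: mult_2)
qed

text \<open>The middle range carries (1 + ln N) ln (N^6): one logarithm from the number of dyadic
  blocks, one from integrating 1/|X|. The other two ranges contribute constants.\<close>

lemma nn_integral_kern_majorant:
  assumes N: "N \<ge> 1"
  shows "(\<integral>\<^sup>+X. ennreal (kern_majorant N X) \<partial>lborel) \<le> ennreal (10000000 * (1 + ln N)\<^sup>2)"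
proof -
  define L where "L = 1 + ln N"
  have L: "L \<ge> 1" using N by (simp add: L_def)
  have R: "N ^ 6 \<ge> 1" using N by simp
  have i1: "(\<integral>\<^sup>+x. ennreal 16 * indicator {0..1::real} x \<partial>lborel) = ennreal 16"
    by (subst nn_integral_cmult) auto
  have i2: "(\<integral>\<^sup>+x. ennreal (400000 * L / x) * indicator {1..N ^ 6} x \<partial>lborel) = ennreal (400000 * L * ln (N ^ 6) - 400000 * L * ln 1)"
  proof (rule nn_integral_FTC_Icc[where F = "\<lambda>x. 400000 * L * ln x"])
    fix x :: real assume x: "x \<in> {1..N ^ 6}"
    then show "((\<lambda>x. 400000 * L * ln x) has_real_derivative 400000 * L / x) (at x)"
      by (auto intro!: derivative_eq_intros)
    show "0 \<le> 400000 * L / x" using L x by simp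
  qed (use R in auto)
  have i3: "(\<integral>\<^sup>+x. ennreal (80000 * N ^ 6 / x\<^sup>2) * indicator {N ^ 6..} x \<partial>lborel) = ennreal (0 - (- (80000 * N ^ 6) / N ^ 6))"
  proof (rule nn_integral_FTC_atLeast[where F = "\<lambda>x. - (80000 * N ^ 6) / x"])
    fix x :: real assume x: "N ^ 6 \<le> x"
    then have "x > 0" using R by linarith
    then show "((\<lambda>x. - (80000 * N ^ 6) / x) has_real_derivative 80000 * N ^ 6 / x\<^sup>2) (at x)"
      by (auto intro!: derivative_eq_intros simp: power2_eq_square)
    show "0 \<le> 80000 * N ^ 6 / x\<^sup>2" using N by simp
  next
    have "((\<lambda>x::real. - (80000 * N ^ 6) * inverse x) \<longlongrightarrow> - (80000 * N ^ 6) * 0) at_top"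
      by (intro tendsto_intros tendsto_inverse_0_at_top filterlim_ident)
    then show "((\<lambda>x. - (80000 * N ^ 6) / x) \<longlongrightarrow> 0) at_top" by (simp add: divide_inverse)
  qed measurable
  have "(\<integral>\<^sup>+X. ennreal (kern_majorant N X) \<partial>lborel) \<le> 2 * (\<integral>\<^sup>+x. ennreal (kern_majorant N x) * indicator {0..} x \<partial>lborel)"
    by (rule nn_integral_even_le) (simp_all add: kern_majorant_def)
  also have "(\<integral>\<^sup>+x. ennreal (kern_majorant N x) * indicator {0..} x \<partial>lborel)
     \<le> (\<integral>\<^sup>+x. ennreal 16 * indicator {0..1} x + (ennreal (400000 * L / x) * indicator {1..N ^ 6} x + ennreal (80000 * N ^ 6 / x\<^sup>2) * indicator {N ^ 6..} x) \<partial>lborel)"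
    by (intro nn_integral_mono) (auto simp: kern_majorant_def indicator_def L_def)
  also have "\<dots> = ennreal 16 + (ennreal (400000 * L * ln (N ^ 6) - 400000 * L * ln 1) + ennreal (0 - (- (80000 * N ^ 6) / N ^ 6)))"
    by (subst nn_integral_add, (measurable)[2], subst nn_integral_add, (measurable)[2]) (simp only: i1 i2 i3)
  also have "\<dots> = ennreal (16 + (2400000 * L * ln N + 80000))"
  proof -
    have "400000 * L * ln (N ^ 6) - 400000 * L * ln 1 = 2400000 * L * ln N" using N by (simp add: ln_realpow)
    moreover have "0 - (- (80000 * N ^ 6) / N ^ 6) = 80000" using N by simp
    moreover have "ennreal (16 + (z + 80000)) = ennreal 16 + (ennreal z + ennreal 80000)" if "z \<ge> 0" for z
    proof -
      have "ennreal (16 + (z + 80000)) = ennreal 16 + ennreal (z + 80000)" using that by (intro ennreal_plus) auto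
      also have "ennreal (z + 80000) = ennreal z + ennreal 80000" using that by (intro ennreal_plus) auto
      finally show ?thesis .
    qed
    moreover have "2400000 * L * ln N \<ge> 0" using L N by simp
    ultimately show ?thesis by (simp only:)
  qed
  also have "2 * \<dots> = ennreal (2 * (16 + (2400000 * L * ln N + 80000)))"
    using N L by (subst ennreal_mult) auto
  also have "\<dots> \<le> ennreal (10000000 * L\<^sup>2)"
  proof (rule ennreal_leI)
    have "L * ln N \<le> L * L" using L by (intro mult_left_mono) (auto simp: L_def)
    moreover have "1 * 1 \<le> L * L" using L by (intro mult_mono) auto
    ultimately show "2 * (16 + (2400000 * L * ln N + 80000)) \<le> 10000000 * L\<^sup>2" by (simp add: power2_eq_square)
  qed
  finally show ?thesis by (simp add: L_def mult_left_mono)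
qed

definition freq_weight :: "real \<Rightarrow> real \<times> real \<Rightarrow> real" where
  "freq_weight N = (\<lambda>(\<xi>, \<eta>). bump (\<xi> / N) * exp (- (\<eta> / N)\<^sup>2))"

lemma integrable_freq_weight:
  assumes "N > 0"
  shows "integrable lborel (freq_weight N)"
proof -
  have "integrable lborel (\<lambda>x. bump (0 + (1/N) * x))" "integrable lborel (\<lambda>x. exp (- (0 + (1/N) * x)\<^sup>2))"
    using assms lborel_integrable_real_affine[OF integrable_bump, of "1/N" 0]
      lborel_integrable_real_affine[OF integrable_gauss_sq, of "1/N" 0] by simp_all
  from integrable_prod_mult[OF this] show ?thesis by (simp add: freq_weight_def)
qed

lemma freq_weight_nonneg: "freq_weight N \<zeta> \<ge> 0"
  by (cases \<zeta>) (simp add: freq_weight_def bump_bounds)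

text \<open>The frequencies reach |\<zeta>| = 2 N while \<open>bump\<close> vanishes only from 4 on,
  so the weight is bounded below there independently of N; this is the constant \<open>c\<close> of
  the duality argument.\<close>

lemma freq_weight_lower:
  assumes "N > 0" "norm \<zeta> \<le> 2 * N"
  shows "bump 2 * exp (- 4) \<le> freq_weight N \<zeta>"
proof -
  obtain \<xi> \<eta> where \<zeta>: "\<zeta> = (\<xi>, \<eta>)" by (cases \<zeta>)
  have "\<bar>\<xi>\<bar> \<le> 2 * N" "\<bar>\<eta>\<bar> \<le> 2 * N"
    using norm_fst_le[of \<xi> \<eta>] norm_snd_le[of \<eta> \<xi>] assms by (auto simp: \<zeta>)
  then have u: "\<bar>\<xi> / N\<bar> \<le> 2" "\<bar>\<eta> / N\<bar> \<le> 2" using assms by (auto simp: abs_divide divide_le_eq)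
  then have "\<bar>\<xi> / N\<bar>\<^sup>2 \<le> 2\<^sup>2" "\<bar>\<eta> / N\<bar>\<^sup>2 \<le> 2\<^sup>2" by (intro power_mono; simp)+
  then have sq: "(\<xi> / N)\<^sup>2 \<le> 2\<^sup>2" "(\<eta> / N)\<^sup>2 \<le> 2\<^sup>2" by (simp_all only: power2_abs)
  have "bump 2 \<le> bump (\<xi> / N)" unfolding bump_def
    using sq(1) by (intro power_mono max.mono order_refl) auto
  moreover have "exp (- 4) \<le> exp (- (\<eta> / N)\<^sup>2)" using sq(2) by simp
  ultimately show ?thesis unfolding \<zeta> freq_weight_def by (auto intro!: mult_mono bump_bounds)
qed

lemma freq_weight_scale: "N > 0 \<Longrightarrow> freq_weight N (N *\<^sub>R (u, v)) = bump u * exp (- v\<^sup>2)"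
  by (simp add: freq_weight_def)

section \<open>Rescaling of the weighted kernel\<close>

lemma lborel_integral_plane_scale:
  fixes h :: "real \<times> real \<Rightarrow> complex"
  assumes [measurable]: "h \<in> borel_measurable borel" and "c > 0"
  shows "(\<integral>z. h z \<partial>lborel) = of_real (c\<^sup>2) * (\<integral>z. h (c *\<^sub>R z) \<partial>lborel)"
proof -
  have "(\<integral>z. h z \<partial>lborel) = (\<integral>z. h z \<partial>density (distr lborel borel (\<lambda>x. 0 + c *\<^sub>R x)) (\<lambda>_. ennreal (\<bar>c\<bar> ^ DIM(real \<times> real))))"
    using assms by (subst lborel_affine[of c 0]) (auto simp: ennreal_power)
  also have "\<dots> = of_real (c\<^sup>2) * (\<integral>z. h (c *\<^sub>R z) \<partial>lborel)"
    using assms by (subst integral_density) (auto simp: integral_distr power2_eq_square scaleR_conv_of_real)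
  finally show ?thesis .
qed

lemma omega_scale: "N > 0 \<Longrightarrow> omega (N *\<^sub>R (u, v)) = N ^ 3 * (u * v\<^sup>2) - N\<^sup>2 * (u * \<bar>u\<bar>)"
  by (simp add: omega_def abs_mult power2_eq_square power3_eq_cube algebra_simps)

lemma borel_measurable_omega [measurable]: "omega \<in> borel_measurable borel"
  unfolding omega_def borel_prod[symmetric] by measurable

lemma weighted_kernel_eq:
  assumes "N > 0"
  shows "(\<integral>\<zeta>. of_real (freq_weight N \<zeta>) * cis (x * fst \<zeta> + y * snd \<zeta> + t * omega \<zeta>) \<partial>lborel)
    = of_real (N\<^sup>2) * kern (N * x) (N * y) (t * N\<^sup>2) (t * N\<^sup>2 * N)"
proof -
  have [measurable]: "freq_weight N \<in> borel_measurable borel"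
    using borel_measurable_integrable[OF integrable_freq_weight[OF assms]] by simp
  have [measurable]: "fst \<in> borel_measurable (borel :: (real \<times> real) measure)" "snd \<in> borel_measurable (borel :: (real \<times> real) measure)"
    by (intro borel_measurable_continuous_onI continuous_intros)+
  have "(\<integral>\<zeta>. of_real (freq_weight N \<zeta>) * cis (x * fst \<zeta> + y * snd \<zeta> + t * omega \<zeta>) \<partial>lborel)
    = of_real (N\<^sup>2) * (\<integral>\<zeta>. of_real (freq_weight N (N *\<^sub>R \<zeta>)) * cis (x * fst (N *\<^sub>R \<zeta>) + y * snd (N *\<^sub>R \<zeta>) + t * omega (N *\<^sub>R \<zeta>)) \<partial>lborel)"
    by (rule lborel_integral_plane_scale[OF _ assms]) measurable
  also have "(\<lambda>\<zeta>. of_real (freq_weight N (N *\<^sub>R \<zeta>)) * cis (x * fst (N *\<^sub>R \<zeta>) + y * snd (N *\<^sub>R \<zeta>) + t * omega (N *\<^sub>R \<zeta>)))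
     = kern_integrand (N * x) (N * y) (t * N\<^sup>2) (t * N\<^sup>2 * N)"
  proof (rule ext)
    fix \<zeta> :: "real \<times> real"
    obtain u v where \<zeta>: "\<zeta> = (u, v)" by (cases \<zeta>)
    have eq: "x * fst (N *\<^sub>R \<zeta>) + y * snd (N *\<^sub>R \<zeta>) + t * omega (N *\<^sub>R \<zeta>)
        = N * x * u + N * y * v + t * N\<^sup>2 * N * u * v\<^sup>2 - t * N\<^sup>2 * u * \<bar>u\<bar>"
      unfolding \<zeta> omega_scale[OF assms] by (simp add: power2_eq_square power3_eq_cube algebra_simps)
    show "of_real (freq_weight N (N *\<^sub>R \<zeta>)) * cis (x * fst (N *\<^sub>R \<zeta>) + y * snd (N *\<^sub>R \<zeta>) + t * omega (N *\<^sub>R \<zeta>))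
       = kern_integrand (N * x) (N * y) (t * N\<^sup>2) (t * N\<^sup>2 * N) \<zeta>"
      unfolding eq unfolding \<zeta> freq_weight_scale[OF assms] kern_integrand_def by simp
  qed
  finally show ?thesis by (simp add: kern_def)
qed

text \<open>The Fourier extension operator of the surface \<tau> = \<omega>(\<xi>, \<eta>). Up to
  the factor (2 pi)^(-2) it is the evolution of the inversion integral of \<open>g\<close>.\<close>

definition extension :: "(real \<times> real \<Rightarrow> complex) \<Rightarrow> real \<Rightarrow> real \<Rightarrow> real \<Rightarrow> complex" where
  "extension g x y t = (\<integral>\<zeta>. cis (x * fst \<zeta> + y * snd \<zeta> + t * omega \<zeta>) * g \<zeta> \<partial>lborel)"

lemma nn_integral_scaled_majorant:
  assumes N: "N \<ge> 1"
  shows "(\<integral>\<^sup>+x. ennreal (N\<^sup>2) * ennreal (kern_majorant N (N * x)) \<partial>lborel) \<le> ennreal (10000000 * N * (1 + ln N)\<^sup>2)"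
proof -
  have "(\<integral>\<^sup>+X. ennreal (kern_majorant N X) \<partial>lborel) = ennreal \<bar>N\<bar> * (\<integral>\<^sup>+x. ennreal (kern_majorant N (0 + N * x)) \<partial>lborel)"
    using N by (intro nn_integral_real_affine) auto
  then have "ennreal N * (\<integral>\<^sup>+X. ennreal (kern_majorant N X) \<partial>lborel) = ennreal (N\<^sup>2) * (\<integral>\<^sup>+x. ennreal (kern_majorant N (N * x)) \<partial>lborel)"
    using N by (simp add: power2_eq_square ennreal_mult mult.assoc)
  then have "(\<integral>\<^sup>+x. ennreal (N\<^sup>2) * ennreal (kern_majorant N (N * x)) \<partial>lborel) = ennreal N * (\<integral>\<^sup>+X. ennreal (kern_majorant N X) \<partial>lborel)"
    by (simp add: nn_integral_cmult)
  also have "\<dots> \<le> ennreal N * ennreal (10000000 * (1 + ln N)\<^sup>2)" by (intro mult_left_mono nn_integral_kern_majorant N) simp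
  also have "\<dots> = ennreal (10000000 * N * (1 + ln N)\<^sup>2)" using N by (simp add: ennreal_mult[symmetric] mult_ac)
  finally show ?thesis .
qed

text \<open>One argument with the two spatial variables exchanged: the parameter \<open>z\<close> is
  (y, t) in the first bound and (x, t) in the second, and the same majorant serves either
  variable.\<close>

lemma maximal_extension:
  assumes N: "N \<ge> 1" and T: "0 < T" "T \<le> 1" and g: "integrable lborel g"
    and supp: "\<And>\<zeta>. g \<zeta> \<noteq> 0 \<Longrightarrow> norm \<zeta> \<le> 2 * N"
  shows "(\<integral>\<^sup>+x. (SUP (y, t) \<in> UNIV \<times> {0..T}. ennreal ((norm (extension g x y t))\<^sup>2)) \<partial>lborel)
      \<le> ennreal (1 / (bump 2 * exp (- 4))) * ennreal (10000000 * N * (1 + ln N)\<^sup>2) * sq_norm g"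
    and "(\<integral>\<^sup>+y. (SUP (x, t) \<in> UNIV \<times> {0..T}. ennreal ((norm (extension g x y t))\<^sup>2)) \<partial>lborel)
      \<le> ennreal (1 / (bump 2 * exp (- 4))) * ennreal (10000000 * N * (1 + ln N)\<^sup>2) * sq_norm g"
proof -
  have N0: "N > 0" using N by simp
  have c: "bump 2 * exp (- 4 :: real) > 0" by (simp add: bump_def)
  have [measurable]: "fst \<in> borel_measurable (borel :: (real \<times> real) measure)" "snd \<in> borel_measurable (borel :: (real \<times> real) measure)"
    by (intro borel_measurable_continuous_onI continuous_intros)+
  have km0: "kern_majorant N z \<ge> 0" for z using N by (auto simp: kern_majorant_def)
  have K: "ennreal (norm (\<integral>\<zeta>. of_real (freq_weight N \<zeta>) * cis (x * fst \<zeta> + y * snd \<zeta> + t * omega \<zeta>) \<partial>lborel))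
       \<le> ennreal (N\<^sup>2) * ennreal (kern_majorant N (N * x))"
    "ennreal (norm (\<integral>\<zeta>. of_real (freq_weight N \<zeta>) * cis (x * fst \<zeta> + y * snd \<zeta> + t * omega \<zeta>) \<partial>lborel))
       \<le> ennreal (N\<^sup>2) * ennreal (kern_majorant N (N * y))" if t: "\<bar>t\<bar> \<le> 1" for x y t
  proof -
    have "\<bar>t * N\<^sup>2\<bar> \<le> 1 * N\<^sup>2" unfolding abs_mult using t by (intro mult_mono) auto
    then have k: "\<bar>t * N\<^sup>2\<bar> \<le> N\<^sup>2" by simp
    show "ennreal (norm (\<integral>\<zeta>. of_real (freq_weight N \<zeta>) * cis (x * fst \<zeta> + y * snd \<zeta> + t * omega \<zeta>) \<partial>lborel))
       \<le> ennreal (N\<^sup>2) * ennreal (kern_majorant N (N * x))"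
      "ennreal (norm (\<integral>\<zeta>. of_real (freq_weight N \<zeta>) * cis (x * fst \<zeta> + y * snd \<zeta> + t * omega \<zeta>) \<partial>lborel))
       \<le> ennreal (N\<^sup>2) * ennreal (kern_majorant N (N * y))"
      unfolding weighted_kernel_eq[OF N0] ennreal_mult[OF zero_le_power2 km0, symmetric] norm_mult norm_of_real abs_power2
      by (intro ennreal_leI mult_left_mono norm_kern_le_majorant[OF N k] zero_le_power2)+
  qed
  \<comment> \<open>The kernel sees only time differences. For T \<le> 1 these meet the restriction
    |\<kappa>| \<le> N^2 of the kernel bounds.\<close>
  have tt: "\<bar>t - t'\<bar> \<le> 1" if "t \<in> {0..T}" "t' \<in> {0..T}" for t t' using that T by auto
  have Hm: "(\<lambda>x. ennreal (N\<^sup>2) * ennreal (kern_majorant N (N * x))) \<in> borel_measurable borel" by measurable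
  have fin: "ennreal (1 / (bump 2 * exp (- 4))) * (\<integral>\<^sup>+x. ennreal (N\<^sup>2) * ennreal (kern_majorant N (N * x)) \<partial>lborel) * (\<integral>\<^sup>+\<zeta>. ennreal ((norm (g \<zeta>))\<^sup>2) \<partial>lborel)
     \<le> ennreal (1 / (bump 2 * exp (- 4))) * ennreal (10000000 * N * (1 + ln N)\<^sup>2) * sq_norm g"
    unfolding sq_norm_def by (intro mult_right_mono mult_left_mono nn_integral_scaled_majorant N) auto
  have "(\<integral>\<^sup>+x. (SUP z \<in> UNIV \<times> {0..T}. ennreal ((norm (\<integral>\<zeta>. cis (x * fst \<zeta> + fst z * snd \<zeta> + snd z * omega \<zeta>) * g \<zeta> \<partial>lborel))\<^sup>2)) \<partial>lborel)
      \<le> ennreal (1 / (bump 2 * exp (- 4))) * (\<integral>\<^sup>+x. ennreal (N\<^sup>2) * ennreal (kern_majorant N (N * x)) \<partial>lborel) * (\<integral>\<^sup>+\<zeta>. ennreal ((norm (g \<zeta>))\<^sup>2) \<partial>lborel)"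
  proof (rule maximal_TT_star[where w = "freq_weight N", OF _ _ _ g integrable_freq_weight[OF N0] freq_weight_nonneg c _ Hm])
    show "(\<lambda>(x, \<zeta>). x * fst \<zeta> + fst z * snd \<zeta> + snd z * omega \<zeta>) \<in> borel_measurable (borel \<Otimes>\<^sub>M borel)" for z :: "real \<times> real"
      by measurable
    show "continuous_on (UNIV \<times> {0..T}) (\<lambda>z. x * fst \<zeta> + fst z * snd \<zeta> + snd z * omega \<zeta>)" for x \<zeta>
      by (intro continuous_intros)
    show "g \<zeta> \<noteq> 0 \<Longrightarrow> bump 2 * exp (- 4) \<le> freq_weight N \<zeta>" for \<zeta> using supp freq_weight_lower[OF N0] by blast
    fix x x' and z z' :: "real \<times> real" assume z: "z \<in> UNIV \<times> {0..T}" "z' \<in> UNIV \<times> {0..T}"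
    have "x * fst \<zeta> + fst z * snd \<zeta> + snd z * omega \<zeta> - (x' * fst \<zeta> + fst z' * snd \<zeta> + snd z' * omega \<zeta>)
        = (x - x') * fst \<zeta> + (fst z - fst z') * snd \<zeta> + (snd z - snd z') * omega \<zeta>" for \<zeta>
      by (simp add: algebra_simps)
    then show "ennreal (norm (\<integral>\<zeta>. of_real (freq_weight N \<zeta>) * cis (x * fst \<zeta> + fst z * snd \<zeta> + snd z * omega \<zeta> - (x' * fst \<zeta> + fst z' * snd \<zeta> + snd z' * omega \<zeta>)) \<partial>lborel))
       \<le> ennreal (N\<^sup>2) * ennreal (kern_majorant N (N * (x - x')))"
      using K(1)[OF tt, of "snd z" "snd z'" "x - x'" "fst z - fst z'"] z by (auto simp: mem_Times_iff)
  qed (use T in auto)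
  also note fin
  finally show "(\<integral>\<^sup>+x. (SUP (y, t) \<in> UNIV \<times> {0..T}. ennreal ((norm (extension g x y t))\<^sup>2)) \<partial>lborel)
      \<le> ennreal (1 / (bump 2 * exp (- 4))) * ennreal (10000000 * N * (1 + ln N)\<^sup>2) * sq_norm g"
    by (simp only: extension_def split_def)
  have "(\<integral>\<^sup>+y. (SUP z \<in> UNIV \<times> {0..T}. ennreal ((norm (\<integral>\<zeta>. cis (fst z * fst \<zeta> + y * snd \<zeta> + snd z * omega \<zeta>) * g \<zeta> \<partial>lborel))\<^sup>2)) \<partial>lborel)
      \<le> ennreal (1 / (bump 2 * exp (- 4))) * (\<integral>\<^sup>+x. ennreal (N\<^sup>2) * ennreal (kern_majorant N (N * x)) \<partial>lborel) * (\<integral>\<^sup>+\<zeta>. ennreal ((norm (g \<zeta>))\<^sup>2) \<partial>lborel)"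
  proof (rule maximal_TT_star[where w = "freq_weight N", OF _ _ _ g integrable_freq_weight[OF N0] freq_weight_nonneg c _ Hm])
    show "(\<lambda>(y, \<zeta>). fst z * fst \<zeta> + y * snd \<zeta> + snd z * omega \<zeta>) \<in> borel_measurable (borel \<Otimes>\<^sub>M borel)" for z :: "real \<times> real"
      by measurable
    show "continuous_on (UNIV \<times> {0..T}) (\<lambda>z. fst z * fst \<zeta> + y * snd \<zeta> + snd z * omega \<zeta>)" for y \<zeta>
      by (intro continuous_intros)
    show "g \<zeta> \<noteq> 0 \<Longrightarrow> bump 2 * exp (- 4) \<le> freq_weight N \<zeta>" for \<zeta> using supp freq_weight_lower[OF N0] by blast
    fix y y' and z z' :: "real \<times> real" assume z: "z \<in> UNIV \<times> {0..T}" "z' \<in> UNIV \<times> {0..T}"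
    have "fst z * fst \<zeta> + y * snd \<zeta> + snd z * omega \<zeta> - (fst z' * fst \<zeta> + y' * snd \<zeta> + snd z' * omega \<zeta>)
        = (fst z - fst z') * fst \<zeta> + (y - y') * snd \<zeta> + (snd z - snd z') * omega \<zeta>" for \<zeta>
      by (simp add: algebra_simps)
    then show "ennreal (norm (\<integral>\<zeta>. of_real (freq_weight N \<zeta>) * cis (fst z * fst \<zeta> + y * snd \<zeta> + snd z * omega \<zeta> - (fst z' * fst \<zeta> + y' * snd \<zeta> + snd z' * omega \<zeta>)) \<partial>lborel))
       \<le> ennreal (N\<^sup>2) * ennreal (kern_majorant N (N * (y - y')))"
      using K(2)[OF tt, of "snd z" "snd z'" "fst z - fst z'" "y - y'"] z by (auto simp: mem_Times_iff)
  qed (use T in auto)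
  also note fin
  finally show "(\<integral>\<^sup>+y. (SUP (x, t) \<in> UNIV \<times> {0..T}. ennreal ((norm (extension g x y t))\<^sup>2)) \<partial>lborel)
      \<le> ennreal (1 / (bump 2 * exp (- 4))) * ennreal (10000000 * N * (1 + ln N)\<^sup>2) * sq_norm g"
    by (simp only: extension_def split_def)
qed

section \<open>The operators \<open>U\<close> and \<open>P\<close> on the frequency side\<close>

lemma integrable_plane_phase:
  assumes g: "integrable lborel g" and [measurable]: "h \<in> borel_measurable borel"
  shows "integrable lborel (\<lambda>\<zeta>. cis (h \<zeta>) * g \<zeta>)"
  by (rule Bochner_Integration.integrable_bound[OF g])
    (use borel_measurable_integrable[OF g] in \<open>auto simp: norm_mult\<close>)

lemma inv_fourier_integral_cong_AE:
  assumes "AE \<zeta> in lborel. g \<zeta> = g' \<zeta>" and [measurable]: "g \<in> borel_measurable borel" "g' \<in> borel_measurable borel"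
  shows "inv_fourier_integral g = inv_fourier_integral g'"
proof (rule ext)
  fix p
  have "(\<integral>\<zeta>. cis (p \<bullet> \<zeta>) * g \<zeta> \<partial>lborel) = (\<integral>\<zeta>. cis (p \<bullet> \<zeta>) * g' \<zeta> \<partial>lborel)"
    using assms(1) by (intro integral_cong_AE) auto
  then show "inv_fourier_integral g p = inv_fourier_integral g' p" by (simp add: inv_fourier_integral_def)
qed

text \<open>\<open>fourier_L2\<close> is an arbitrary choice among representatives of an almost
  everywhere class, so agreement with \<open>g\<close> can only be claimed almost
  everywhere.\<close>

lemma fourier_L2_inv_fourier:
  assumes g: "integrable lborel g" and fin: "sq_norm g < \<infinity>"
  shows "fourier_L2 (inv_fourier_integral g) \<in> borel_measurable borel"
    and "AE \<zeta> in lborel. fourier_L2 (inv_fourier_integral g) \<zeta> = g \<zeta>"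
proof -
  note inv = is_fourier_inv_fourier[OF g fin]
  have "is_fourier_L2 (inv_fourier_integral g) (fourier_L2 (inv_fourier_integral g))"
    unfolding fourier_L2_def by (rule someI[where P = "is_fourier_L2 (inv_fourier_integral g)", OF inv(2)])
  note F = this
  show "fourier_L2 (inv_fourier_integral g) \<in> borel_measurable borel"
    using F unfolding is_fourier_L2_iff in_L2_iff by (elim conjE)
  have "inv_fourier_integral g \<in> borel_measurable borel" using inv(1) unfolding in_L2_iff by (elim conjE)
  then show "AE \<zeta> in lborel. fourier_L2 (inv_fourier_integral g) \<zeta> = g \<zeta>"
    by (rule is_fourier_L2_unique[OF _ F inv(2)])
qed

text \<open>The multiplier only sees \<^term>\<open>fourier_L2\<close> through its almost everywhere class, and the
  inversion integral picks the continuous representative.\<close>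

lemma fourier_multiplier_inv_fourier:
  assumes g: "integrable lborel g" and fin: "sq_norm g < \<infinity>"
    and [measurable]: "m \<in> borel_measurable borel" and mg: "integrable lborel (\<lambda>\<zeta>. m \<zeta> * g \<zeta>)"
  shows "fourier_multiplier m (inv_fourier_integral g) = inv_fourier_integral (\<lambda>\<zeta>. m \<zeta> * g \<zeta>)"
proof -
  define g' where "g' = fourier_L2 (inv_fourier_integral g)"
  have [measurable]: "g' \<in> borel_measurable borel" and ae: "AE \<zeta> in lborel. g' \<zeta> = g \<zeta>"
    using fourier_L2_inv_fourier[OF g fin] by (simp_all add: g'_def)
  have [measurable]: "g \<in> borel_measurable borel" using borel_measurable_integrable[OF g] by simp
  have ae': "AE \<zeta> in lborel. m \<zeta> * g' \<zeta> = m \<zeta> * g \<zeta>" using ae by eventually_elim simp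
  then have "integrable lborel (\<lambda>\<zeta>. m \<zeta> * g' \<zeta>)"
    using mg by (subst integrable_cong_AE[where g = "\<lambda>\<zeta>. m \<zeta> * g \<zeta>"]) auto
  then have "fourier_multiplier m (inv_fourier_integral g) = inv_fourier_integral (\<lambda>\<zeta>. m \<zeta> * g' \<zeta>)"
    by (simp add: fourier_multiplier_def inv_fourier_L2_integrable g'_def)
  also have "\<dots> = inv_fourier_integral (\<lambda>\<zeta>. m \<zeta> * g \<zeta>)"
    by (rule inv_fourier_integral_cong_AE[OF ae']) measurable
  finally show ?thesis .
qed

lemma U_inv_fourier:
  assumes g: "integrable lborel g" and fin: "sq_norm g < \<infinity>"
  shows "U t (inv_fourier_integral g) (x, y) = of_real (1 / (2 * pi)\<^sup>2) * extension g x y t"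
proof -
  have m: "(\<lambda>\<zeta>. exp (\<i> * complex_of_real (t * omega \<zeta>))) = (\<lambda>\<zeta>. cis (t * omega \<zeta>))"
    by (simp add: cis_conv_exp)
  have "U t (inv_fourier_integral g) = inv_fourier_integral (\<lambda>\<zeta>. cis (t * omega \<zeta>) * g \<zeta>)"
    unfolding U_def m by (intro fourier_multiplier_inv_fourier g fin integrable_plane_phase) measurable
  moreover have "cis (((x, y) \<bullet> \<zeta>)) * (cis (t * omega \<zeta>) * g \<zeta>) = cis (x * fst \<zeta> + y * snd \<zeta> + t * omega \<zeta>) * g \<zeta>" for \<zeta>
    by (cases \<zeta>) (simp add: mult.assoc[symmetric] cis_mult)
  ultimately show ?thesis by (simp only: inv_fourier_integral_def extension_def)
qed

lemma cutoff_continuous: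
  assumes "cutoff \<phi>"
  shows "continuous_on UNIV \<phi>"
proof -
  have "\<forall>k. C_k k \<phi>" using assms unfolding cutoff_def smooth_def by (elim conjE)
  from spec[OF this, of 0] show ?thesis by (simp only: C_k.simps(1))
qed

lemma cutoff_measurable: "cutoff \<phi> \<Longrightarrow> \<phi> \<in> borel_measurable borel"
  by (rule borel_measurable_continuous_onI[OF cutoff_continuous])

lemma cutoff_support:
  assumes "cutoff \<phi>" "\<phi> \<zeta> \<noteq> 0"
  shows "norm \<zeta> \<le> 2"
proof -
  have "closure {\<zeta>. \<phi> \<zeta> \<noteq> 0} \<subseteq> {\<zeta>. 1/2 \<le> norm \<zeta> \<and> norm \<zeta> \<le> 2}"
    using assms(1) unfolding cutoff_def by (elim conjE)
  moreover have "\<zeta> \<in> closure {\<zeta>. \<phi> \<zeta> \<noteq> 0}"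
    by (rule subsetD[OF closure_subset]) (rule CollectI, rule assms(2))
  ultimately have "\<zeta> \<in> {\<zeta>. 1/2 \<le> norm \<zeta> \<and> norm \<zeta> \<le> 2}" by (rule subsetD)
  then show ?thesis by (simp only: mem_Collect_eq)
qed

lemma cutoff_bounded:
  assumes "cutoff \<phi>"
  shows "\<exists>B\<ge>0. \<forall>\<zeta>. norm (\<phi> \<zeta>) \<le> B"
proof -
  have "continuous_on (cball 0 2) \<phi>" using cutoff_continuous[OF assms] by (rule continuous_on_subset) (rule subset_UNIV)
  then have "bounded (\<phi> ` cball 0 2)" by (intro compact_imp_bounded compact_continuous_image compact_cball)
  then obtain B where B: "\<forall>z\<in>\<phi> ` cball 0 2. norm z \<le> B" unfolding bounded_iff by (rule exE)
  have "norm (\<phi> \<zeta>) \<le> max 0 B" for \<zeta>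
  proof (cases "\<phi> \<zeta> = 0")
    case False
    then have "\<zeta> \<in> cball 0 2" using cutoff_support[OF assms, of \<zeta>] by simp
    then have "norm (\<phi> \<zeta>) \<le> B" using B by (rule_tac bspec[OF _ imageI])
    then show ?thesis by simp
  qed simp
  then show ?thesis by (intro exI[of _ "max 0 B"]) simp
qed

text \<open>The cutoff confines the transform of \<open>f\<close> to a ball, where square
  integrability implies integrability. Hence the first branch of \<open>inv_fourier_L2\<close>
  applies, and \<open>P \<phi> N f\<close> is the continuous representative.\<close>

lemma P_eq_inv_fourier:
  assumes \<phi>: "cutoff \<phi>" and N: "N > 0" and f: "in_L2 f"
  shows "\<exists>g. integrable lborel g \<and> sq_norm g < \<infinity> \<and> (\<forall>\<zeta>. g \<zeta> \<noteq> 0 \<longrightarrow> norm \<zeta> \<le> 2 * N) \<and>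
    P \<phi> N f = inv_fourier_integral g"
proof -
  define h where "h = fourier_L2 f"
  have "is_fourier_L2 f h" unfolding h_def fourier_L2_def using is_fourier_L2_exists[OF f] by (rule someI_ex)
  then have [measurable]: "h \<in> borel_measurable borel" and h: "sq_norm h < \<infinity>" by (auto simp: is_fourier_L2_iff in_L2_iff)
  note [measurable] = cutoff_measurable[OF \<phi>]
  obtain B where B: "B \<ge> 0" "\<And>\<zeta>. norm (\<phi> \<zeta>) \<le> B" using cutoff_bounded[OF \<phi>] by blast
  define g where "g = (\<lambda>\<zeta>. \<phi> (\<zeta> /\<^sub>R N) * h \<zeta>)"
  have [measurable]: "g \<in> borel_measurable borel" unfolding g_def by measurable
  have "sq_norm g \<le> sq_norm (\<lambda>\<zeta>. of_real B * h \<zeta>)"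
    using B by (intro sq_norm_mono) (auto simp: g_def norm_mult intro!: mult_right_mono)
  also have "\<dots> < \<infinity>" using h by (simp add: sq_norm_cmult ennreal_mult_less_top)
  finally have fin: "sq_norm g < \<infinity>" .
  have supp: "norm \<zeta> \<le> 2 * N" if "g \<zeta> \<noteq> 0" for \<zeta>
  proof -
    have "\<phi> (\<zeta> /\<^sub>R N) \<noteq> 0" using that by (auto simp: g_def)
    then have "norm (\<zeta> /\<^sub>R N) \<le> 2" by (rule cutoff_support[OF \<phi>])
    then show ?thesis using N by (simp add: divide_simps mult.commute)
  qed
  have "emeasure lborel (cball (0 :: real \<times> real) (2 * N)) < \<infinity>" by (rule emeasure_bounded_finite) simp
  then have int: "integrable lborel g"
    using supp by (intro integrable_of_sq_norm[OF _ fin, of "cball 0 (2 * N)"]) simp_all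
  have Pg: "P \<phi> N f = inv_fourier_integral g"
    using int unfolding P_def fourier_multiplier_def g_def h_def by (rule inv_fourier_L2_integrable)
  show ?thesis
  proof (intro exI conjI)
    show "\<forall>\<zeta>. g \<zeta> \<noteq> 0 \<longrightarrow> norm \<zeta> \<le> 2 * N" using supp by blast
  qed (rule int fin Pg)+
qed

lemma maximal_estimate_log:
  assumes \<phi>: "cutoff \<phi>"
  shows "\<exists>C>0. maximal_estimate \<phi> (\<lambda>N. C * N powr (1/2) * (1 + ln N))"
proof -
  define c where "c = bump 2 * exp (- 4 :: real)"
  have c: "c > 0" by (simp add: c_def bump_def)
  \<comment> \<open>10000000 is the constant of \<open>nn_integral_kern_majorant\<close> and
    \<open>c\<close> the lower bound of the weight; the root is taken because the maximal bound is
    for squares.\<close>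
  define B where "B = sqrt (10000000 / c)"
  have B: "B > 0" "B\<^sup>2 = 10000000 / c" using c by (simp_all add: B_def)
  have "maximal_estimate \<phi> (\<lambda>N. (2 * B) * N powr (1/2) * (1 + ln N))"
    unfolding maximal_estimate_def
  proof (intro allI impI, elim conjE)
    fix N T :: real and f
    assume N2: "N \<ge> 2" and T: "0 < T" "T \<le> 1" and f: "in_L2 f"
    have N: "N \<ge> 1" "N > 0" using N2 by auto
    from P_eq_inv_fourier[OF \<phi> N(2) f] obtain g where
      g_conj: "integrable lborel g \<and> sq_norm g < \<infinity> \<and> (\<forall>\<zeta>. g \<zeta> \<noteq> 0 \<longrightarrow> norm \<zeta> \<le> 2 * N)
        \<and> P \<phi> N f = inv_fourier_integral g" by (rule exE)
    then have g: "integrable lborel g" "sq_norm g < \<infinity>" and g_supp: "\<forall>\<zeta>. g \<zeta> \<noteq> 0 \<longrightarrow> norm \<zeta> \<le> 2 * N"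
      and Pf: "P \<phi> N f = inv_fourier_integral g" by simp_all
    \<comment> \<open>The squared prefactor of the inversion integral. Against the 4 pi^2 of
      Plancherel it leaves 1 / (4 pi^2), which is at most 1 and is dropped.\<close>
    define k where "k = (1 / (2 * pi)\<^sup>2)\<^sup>2"
    have k: "k \<ge> 0" "k * (4 * pi\<^sup>2) \<le> 1"
    proof -
      have "pi\<^sup>2 \<ge> 3\<^sup>2" using pi_gt3 by (intro power_mono) auto
      then show "k * (4 * pi\<^sup>2) \<le> 1" by (simp add: k_def power2_eq_square divide_simps)
    qed (simp add: k_def)
    define A where "A = B * N powr (1/2) * (1 + ln N)"
    have lnN: "ln N \<ge> 0" using N by simp
    have A: "A > 0" using B N lnN by (auto simp: A_def intro!: mult_pos_pos add_pos_nonneg)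
    have A2: "A\<^sup>2 = 1 / c * (10000000 * N * (1 + ln N)\<^sup>2)"
    proof -
      have "(N powr (1/2))\<^sup>2 = N" using N by (simp add: powr_half_sqrt)
      then show ?thesis unfolding A_def power_mult_distrib B(2) by simp
    qed
    define r where "r = 1 / (2 * pi)\<^sup>2"
    define g' where "g' = (\<lambda>\<zeta>. complex_of_real r * g \<zeta>)"
    have g'_int: "integrable lborel g'" unfolding g'_def using g(1) by (rule integrable_mult_right)
    have g'_supp: "norm \<zeta> \<le> 2 * N" if "g' \<zeta> \<noteq> 0" for \<zeta>
      using g_supp[rule_format, of \<zeta>] that unfolding g'_def by (metis mult_zero_right)
    note g' = g'_int g'_supp
    have sq_g': "sq_norm g' \<le> sq_norm (P \<phi> N f)"
    proof -
      have "g \<in> borel_measurable borel" using borel_measurable_integrable[OF g(1)] by simp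
      then have "sq_norm g' = ennreal ((norm (complex_of_real r))\<^sup>2) * sq_norm g"
        unfolding g'_def by (rule sq_norm_cmult)
      also have "\<dots> = ennreal k * sq_norm g" by (simp only: norm_of_real power2_abs k_def r_def)
      also have "\<dots> = (ennreal k * ennreal (4 * pi\<^sup>2)) * sq_norm (P \<phi> N f)"
        unfolding Pf sq_norm_inv_fourier[OF g(1,2)] by (rule mult.assoc[symmetric])
      also have "ennreal k * ennreal (4 * pi\<^sup>2) = ennreal (k * (4 * pi\<^sup>2))" using k by (intro ennreal_mult[symmetric]) auto
      also have "\<dots> * sq_norm (P \<phi> N f) \<le> 1 * sq_norm (P \<phi> N f)" using k(2) by (intro mult_right_mono) auto
      finally show ?thesis by simp
    qed
    have Ueq: "U t (P \<phi> N f) (x, y) = extension g' x y t" for t x y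
      unfolding Pf U_inv_fourier[OF g(1,2)] extension_def g'_def r_def
      unfolding mult.left_commute[of _ "complex_of_real (1 / (2 * pi)\<^sup>2)"] integral_mult_right_zero ..
    have M: "ennreal (1 / c) * ennreal (10000000 * N * (1 + ln N)\<^sup>2) * sq_norm g' \<le> ennreal (A\<^sup>2) * sq_norm (P \<phi> N f)"
    proof -
      have "ennreal (1 / c) * ennreal (10000000 * N * (1 + ln N)\<^sup>2) = ennreal (A\<^sup>2)"
        unfolding A2 using c N by (intro ennreal_mult[symmetric]) auto
      then show ?thesis by (simp only: mult_left_mono[OF sq_g' zero_le])
    qed
    have "norm_L2x_Linf_yT T (\<lambda>x y t. U t (P \<phi> N f) (x, y)) \<le> ennreal A * L2_norm (P \<phi> N f)"
      unfolding norm_L2x_Linf_yT_def L2_norm_eq Ueq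
      by (intro ennsqrt_le_mult[OF A] order_trans[OF maximal_extension(1)[OF N(1) T g', folded c_def] M])
    moreover have "norm_L2y_Linf_xT T (\<lambda>x y t. U t (P \<phi> N f) (x, y)) \<le> ennreal A * L2_norm (P \<phi> N f)"
      unfolding norm_L2y_Linf_xT_def L2_norm_eq Ueq
      by (intro ennsqrt_le_mult[OF A] order_trans[OF maximal_extension(2)[OF N(1) T g', folded c_def] M])
    ultimately have "norm_L2x_Linf_yT T (\<lambda>x y t. U t (P \<phi> N f) (x, y)) + norm_L2y_Linf_xT T (\<lambda>x y t. U t (P \<phi> N f) (x, y))
        \<le> (ennreal A + ennreal A) * L2_norm (P \<phi> N f)"
      unfolding distrib_right by (rule add_mono)
    also have "ennreal A + ennreal A = ennreal (2 * B * N powr (1/2) * (1 + ln N))"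
    proof -
      have "ennreal A + ennreal A = ennreal (A + A)" using A by (intro ennreal_plus[symmetric]) auto
      also have "A + A = 2 * B * N powr (1/2) * (1 + ln N)" by (simp add: A_def)
      finally show ?thesis .
    qed
    finally show "norm_L2x_Linf_yT T (\<lambda>x y t. U t (P \<phi> N f) (x, y)) + norm_L2y_Linf_xT T (\<lambda>x y t. U t (P \<phi> N f) (x, y))
        \<le> ennreal (2 * B * N powr (1/2) * (1 + ln N)) * L2_norm (P \<phi> N f)" .
  qed
  moreover have "2 * B > 0" using B(1) by simp
  ultimately show ?thesis by blast
qed

section \<open>Consequences and optimality\<close>

lemma maximal_estimate_mono:
  assumes "maximal_estimate \<phi> A" "\<And>N. N \<ge> 2 \<Longrightarrow> A N \<le> A' N"
  shows "maximal_estimate \<phi> A'"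
  using assms unfolding maximal_estimate_def
  by (meson ennreal_leI mult_right_mono order_trans zero_le)

lemma one_plus_ln_le_powr:
  fixes N \<epsilon> :: real
  assumes "\<epsilon> > 0" "N \<ge> 1"
  shows "1 + ln N \<le> (1 + 1 / \<epsilon>) * N powr \<epsilon>"
proof -
  have "1 \<le> N powr \<epsilon>" using powr_mono[of 0 \<epsilon> N] assms by simp
  moreover have "ln N \<le> N powr \<epsilon> / \<epsilon>" using assms by (intro ln_powr_bound) auto
  ultimately show ?thesis by (simp add: algebra_simps)
qed

text \<open>The extremal datum has the indicator of a box of side \<open>N/5\<close> centred at \<open>(0, N)\<close> as its Fourier
  transform; already the time \<open>t = 0\<close> and the line \<open>y = 0\<close> show the growth \<open>sqrt N\<close>.\<close>

definition freq_box :: "real \<Rightarrow> (real \<times> real) set" where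
  "freq_box N = {- N / 10..N / 10} \<times> {9 * N / 10..11 * N / 10}"

lemma freq_box_measurable [measurable]: "freq_box N \<in> sets borel"
  unfolding freq_box_def borel_prod[symmetric] by measurable

lemma emeasure_freq_box:
  assumes "N > 0"
  shows "emeasure lborel (freq_box N) = ennreal (N\<^sup>2 / 25)"
proof -
  have "emeasure lborel (freq_box N) = emeasure lborel {- N / 10..N / 10} * emeasure lborel {9 * N / 10..11 * N / 10}"
    unfolding freq_box_def lborel_prod[symmetric] by (rule lborel.emeasure_pair_measure_Times) auto
  also have "\<dots> = ennreal (N / 5) * ennreal (N / 5)"
    using assms by (simp add: emeasure_lborel_Icc_eq)
  also have "\<dots> = ennreal (N\<^sup>2 / 25)"
    using assms by (subst ennreal_mult[symmetric]) (auto simp: power2_eq_square)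
  finally show ?thesis .
qed

text \<open>The box lies in the annulus where the rescaled cutoff equals 1, so the projection leaves
  the datum unchanged.\<close>

lemma freq_box_norm:
  assumes "N > 0" "\<zeta> \<in> freq_box N"
  shows "3/4 \<le> norm (\<zeta> /\<^sub>R N)" "norm (\<zeta> /\<^sub>R N) \<le> 3/2"
proof -
  obtain \<xi> \<eta> where \<zeta>: "\<zeta> = (\<xi>, \<eta>)" by (cases \<zeta>)
  have b: "\<bar>\<xi> / N\<bar> \<le> 1/10" "9/10 \<le> \<eta> / N" "\<eta> / N \<le> 11/10"
    using assms by (auto simp: freq_box_def \<zeta> abs_le_iff divide_simps)
  have z: "\<zeta> /\<^sub>R N = (\<xi> / N, \<eta> / N)" by (simp add: \<zeta> divide_inverse mult.commute)
  have "0 \<le> \<eta> / N" using b(2) by linarith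
  then have e: "norm (\<eta> / N) = \<eta> / N" by (simp only: real_norm_def abs_of_nonneg)
  have "9/10 \<le> norm (\<eta> / N)" unfolding e by (rule b(2))
  also have "\<dots> \<le> norm (\<zeta> /\<^sub>R N)" unfolding z by (rule norm_snd_le)
  finally show "3/4 \<le> norm (\<zeta> /\<^sub>R N)" by simp
  have "norm (\<zeta> /\<^sub>R N) \<le> norm (\<xi> / N) + norm (\<eta> / N)" unfolding z by (rule norm_Pair_le)
  also have "\<dots> \<le> 1/10 + 11/10" unfolding e using b(1,3) by (intro add_mono) (simp_all only: real_norm_def)
  finally show "norm (\<zeta> /\<^sub>R N) \<le> 3/2" by simp
qed

text \<open>For |x| \<le> 10 / N the phase x \<xi> stays within [-1, 1], inside [-pi/3, pi/3], so
  the real part of the integrand is at least 1/2 on the box. There is no cancellation, and half of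
  the area N^2 / 25 remains.\<close>

lemma extension_box_lower:
  assumes N: "N > 0" and x: "\<bar>x\<bar> \<le> 10 / N"
  shows "N\<^sup>2 / 50 \<le> norm (extension (\<lambda>\<zeta>. indicator (freq_box N) \<zeta>) x 0 0)"
proof -
  have fin: "emeasure lborel (freq_box N) < \<infinity>" using emeasure_freq_box[OF N] by simp
  have i: "integrable lborel (\<lambda>\<zeta>. indicator (freq_box N) \<zeta> :: real)"
    using fin by (intro integrable_real_indicator) auto
  have ic: "integrable lborel (\<lambda>\<zeta>. cis (x * fst \<zeta>) * indicator (freq_box N) \<zeta>)"
  proof (rule Bochner_Integration.integrable_bound[OF i])
    have [measurable]: "fst \<in> borel_measurable (borel :: (real \<times> real) measure)"
      by (intro borel_measurable_continuous_onI continuous_intros)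
    show "(\<lambda>\<zeta>. cis (x * fst \<zeta>) * indicator (freq_box N) \<zeta>) \<in> borel_measurable lborel" by measurable
  qed (auto simp: norm_mult indicator_def)
  have "N\<^sup>2 / 50 = (\<integral>\<zeta>. 1/2 * indicator (freq_box N) \<zeta> \<partial>lborel)"
    using emeasure_freq_box[OF N] by (simp add: measure_def)
  also have "\<dots> \<le> (\<integral>\<zeta>. Re (cis (x * fst \<zeta>) * indicator (freq_box N) \<zeta>) \<partial>lborel)"
  proof (rule integral_mono)
    show "integrable lborel (\<lambda>\<zeta>. 1/2 * indicator (freq_box N) \<zeta> :: real)" using i by simp
    show "integrable lborel (\<lambda>\<zeta>. Re (cis (x * fst \<zeta>) * indicator (freq_box N) \<zeta>))" using ic by (rule integrable_Re)
    fix \<zeta> :: "real \<times> real"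
    show "1/2 * indicator (freq_box N) \<zeta> \<le> Re (cis (x * fst \<zeta>) * indicator (freq_box N) \<zeta>)"
    proof (cases "\<zeta> \<in> freq_box N")
      case True
      then have "\<bar>fst \<zeta>\<bar> \<le> N / 10" by (auto simp: freq_box_def abs_le_iff)
      then have "\<bar>x\<bar> * \<bar>fst \<zeta>\<bar> \<le> 10 / N * (N / 10)" using x N by (intro mult_mono) auto
      then have le1: "\<bar>x * fst \<zeta>\<bar> \<le> 1" using N by (simp add: abs_mult)
      have "\<bar>x * fst \<zeta>\<bar> \<le> pi / 3" using le1 pi_gt3 by linarith
      then have "cos (pi / 3) \<le> cos \<bar>x * fst \<zeta>\<bar>"
        using pi_gt3 by (intro cos_monotone_0_pi_le) auto
      then show ?thesis using True by (simp add: cos_60)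
    qed simp
  qed
  also have "\<dots> = Re (\<integral>\<zeta>. cis (x * fst \<zeta>) * indicator (freq_box N) \<zeta> \<partial>lborel)" by (rule integral_Re[OF ic])
  also have "\<dots> \<le> norm (\<integral>\<zeta>. cis (x * fst \<zeta>) * indicator (freq_box N) \<zeta> \<partial>lborel)" by (rule complex_Re_le_cmod)
  finally show ?thesis by (simp add: extension_def)
qed

text \<open>The lower bound on an x-interval of length 20 / N makes the squared maximal norm of
  order N^3, while the squared L^2 norm of the datum is of order N^2; the quotient is the factor
  N.\<close>

lemma maximal_estimate_lower:
  assumes \<phi>: "cutoff \<phi>" and est: "maximal_estimate \<phi> A" and N: "dyadic N" "N \<ge> 2" and A: "A N > 0"
  shows "N \<le> 250 * pi\<^sup>2 * (A N)\<^sup>2"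
proof -
  have N0: "N > 0" using N by simp
  define g where "g = (\<lambda>\<zeta>. indicator (freq_box N) \<zeta> :: complex)"
  define f where "f = inv_fourier_integral g"
  have [measurable]: "g \<in> borel_measurable borel" unfolding g_def by measurable
  have sg: "sq_norm g = ennreal (N\<^sup>2 / 25)"
  proof -
    have "sq_norm g = (\<integral>\<^sup>+\<zeta>. indicator (freq_box N) \<zeta> \<partial>lborel)"
      unfolding sq_norm_def by (intro nn_integral_cong) (simp add: g_def indicator_def)
    also have "\<dots> = ennreal (N\<^sup>2 / 25)" using emeasure_freq_box[OF N0] by simp
    finally show ?thesis .
  qed
  then have fin: "sq_norm g < \<infinity>" by simp
  have g: "integrable lborel g"
    by (rule integrable_of_sq_norm[OF _ fin, of "freq_box N"]) (simp_all add: emeasure_freq_box[OF N0] g_def indicator_def split: if_splits)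
  note fL2 = is_fourier_inv_fourier(1)[OF g fin, folded f_def]
  have \<phi>g: "\<phi> (\<zeta> /\<^sub>R N) * g \<zeta> = g \<zeta>" for \<zeta>
  proof (cases "\<zeta> \<in> freq_box N")
    case True
    then have "\<phi> (\<zeta> /\<^sub>R N) = 1" using freq_box_norm[OF N0 True] \<phi> unfolding cutoff_def by blast
    then show ?thesis by simp
  qed (simp add: g_def)
  have Pf: "P \<phi> N f = f"
  proof -
    have "P \<phi> N f = inv_fourier_integral (\<lambda>\<zeta>. \<phi> (\<zeta> /\<^sub>R N) * g \<zeta>)"
      unfolding P_def f_def
    proof (rule fourier_multiplier_inv_fourier[OF g fin])
      note [measurable] = cutoff_measurable[OF \<phi>]
      show "(\<lambda>\<zeta>. \<phi> (\<zeta> /\<^sub>R N)) \<in> borel_measurable borel" by measurable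
      show "integrable lborel (\<lambda>\<zeta>. \<phi> (\<zeta> /\<^sub>R N) * g \<zeta>)" unfolding \<phi>g by (rule g)
    qed
    also have "(\<lambda>\<zeta>. \<phi> (\<zeta> /\<^sub>R N) * g \<zeta>) = g" by (simp only: \<phi>g)
    finally show ?thesis by (simp add: f_def)
  qed
  define k where "k = (1 / (2 * pi)\<^sup>2)\<^sup>2"
  have kpos: "k > 0" by (simp add: k_def)
  define X where "X = (\<integral>\<^sup>+x. (SUP (y, t) \<in> UNIV \<times> {0..1}. ennreal ((norm (U t (P \<phi> N f) (x, y)))\<^sup>2)) \<partial>lborel)"
  have "ennsqrt X \<le> ennreal (A N) * L2_norm (P \<phi> N f)"
  proof -
    have "norm_L2x_Linf_yT 1 (\<lambda>x y t. U t (P \<phi> N f) (x, y)) + norm_L2y_Linf_xT 1 (\<lambda>x y t. U t (P \<phi> N f) (x, y))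
       \<le> ennreal (A N) * L2_norm (P \<phi> N f)"
      using est N fL2 unfolding maximal_estimate_def by simp
    moreover have "a \<le> a + b" for a b :: ennreal by (rule add_increasing2) simp_all
    ultimately show ?thesis unfolding norm_L2x_Linf_yT_def X_def by (rule order_trans[rotated])
  qed
  then have "(ennsqrt X)\<^sup>2 \<le> (ennreal (A N) * L2_norm (P \<phi> N f))\<^sup>2" by (rule power_mono) simp
  then have "X \<le> ennreal ((A N)\<^sup>2) * sq_norm f"
    using A by (simp add: power_mult_distrib Pf L2_norm_eq ennreal_power)
  moreover have "ennreal (20 / N * (k * (N\<^sup>2 / 50)\<^sup>2)) \<le> X"
  proof -
    have pt: "ennreal (k * (N\<^sup>2 / 50)\<^sup>2) * indicator {- 10 / N..10 / N} x \<le> (SUP (y, t) \<in> UNIV \<times> {0..1}. ennreal ((norm (U t (P \<phi> N f) (x, y)))\<^sup>2))" for x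
    proof (cases "x \<in> {- 10 / N..10 / N}")
      case True
      then have "\<bar>x\<bar> \<le> 10 / N" by (auto simp: abs_le_iff)
      from extension_box_lower[OF N0 this] have "(N\<^sup>2 / 50)\<^sup>2 \<le> (norm (extension g x 0 0))\<^sup>2"
        unfolding g_def by (rule power_mono) simp
      then have "k * (N\<^sup>2 / 50)\<^sup>2 \<le> (norm (U 0 (P \<phi> N f) (x, 0)))\<^sup>2"
        unfolding Pf unfolding f_def U_inv_fourier[OF g fin] norm_mult power_mult_distrib norm_of_real power2_abs k_def
        by (intro mult_left_mono) auto
      then have "ennreal (k * (N\<^sup>2 / 50)\<^sup>2) \<le> ennreal ((norm (U 0 (P \<phi> N f) (x, 0)))\<^sup>2)" by (rule ennreal_leI)
      also have "\<dots> \<le> (SUP (y, t) \<in> UNIV \<times> {0..1}. ennreal ((norm (U t (P \<phi> N f) (x, y)))\<^sup>2))"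
        by (rule SUP_upper2[of "(0, 0)"]) auto
      finally show ?thesis using True by simp
    qed simp
    have "ennreal (20 / N * (k * (N\<^sup>2 / 50)\<^sup>2)) = (\<integral>\<^sup>+x. ennreal (k * (N\<^sup>2 / 50)\<^sup>2) * indicator {- 10 / N..10 / N} x \<partial>lborel)"
    proof -
      have "emeasure lborel {- 10 / N..10 / N} = ennreal (20 / N)"
        using N0 by (subst emeasure_lborel_Icc) (auto simp: field_simps)
      then have "(\<integral>\<^sup>+x. ennreal (k * (N\<^sup>2 / 50)\<^sup>2) * indicator {- 10 / N..10 / N} x \<partial>lborel) = ennreal (k * (N\<^sup>2 / 50)\<^sup>2) * ennreal (20 / N)"
        by (subst nn_integral_cmult_indicator) auto
      then show ?thesis using N0 kpos by (simp add: ennreal_mult[symmetric] mult.commute)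
    qed
    also have "\<dots> \<le> X" unfolding X_def by (intro nn_integral_mono pt)
    finally show ?thesis .
  qed
  ultimately have "ennreal (20 / N * (k * (N\<^sup>2 / 50)\<^sup>2)) \<le> ennreal ((A N)\<^sup>2) * sq_norm f" by (rule order_trans[rotated])
  \<comment> \<open>The factor 4 pi^2 trades the squared norm of \<open>f\<close> for that of
    \<open>g\<close>, which is the area of the box.\<close>
  then have "ennreal (4 * pi\<^sup>2) * ennreal (20 / N * (k * (N\<^sup>2 / 50)\<^sup>2)) \<le> ennreal (4 * pi\<^sup>2) * (ennreal ((A N)\<^sup>2) * sq_norm f)"
    by (rule mult_left_mono) simp
  also have "\<dots> = ennreal ((A N)\<^sup>2) * sq_norm g"
    unfolding sq_norm_inv_fourier[OF g fin] f_def by (rule mult.left_commute)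
  also have "\<dots> = ennreal ((A N)\<^sup>2 * (N\<^sup>2 / 25))" unfolding sg by (rule ennreal_mult[symmetric]) auto
  finally have "ennreal (4 * pi\<^sup>2 * (20 / N * (k * (N\<^sup>2 / 50)\<^sup>2))) \<le> ennreal ((A N)\<^sup>2 * (N\<^sup>2 / 25))"
    by (subst ennreal_mult) (use N0 kpos in simp_all)
  then have "4 * pi\<^sup>2 * (20 / N * (k * (N\<^sup>2 / 50)\<^sup>2)) \<le> (A N)\<^sup>2 * (N\<^sup>2 / 25)" by (subst (asm) ennreal_le_iff) auto
  moreover have "4 * pi\<^sup>2 * (20 / N * (k * (N\<^sup>2 / 50)\<^sup>2)) = N * N\<^sup>2 / (500 * pi\<^sup>2)"
    using N0 by (simp add: k_def field_simps power2_eq_square)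
  ultimately have "N * N\<^sup>2 / (500 * pi\<^sup>2) \<le> (A N)\<^sup>2 * (N\<^sup>2 / 25)" by (simp only:)
  then have "N\<^sup>2 * N \<le> N\<^sup>2 * (20 * pi\<^sup>2 * (A N)\<^sup>2)" by (simp add: field_simps)
  then have "N \<le> 20 * pi\<^sup>2 * (A N)\<^sup>2" using N0 by simp
  \<comment> \<open>The computation yields 20 pi^2; for optimality only a constant independent of N
    matters.\<close>
  also have "\<dots> \<le> 250 * pi\<^sup>2 * (A N)\<^sup>2" by (intro mult_right_mono) auto
  finally show ?thesis .
qed

theorem theorem1p2:
  fixes \<phi> :: "real \<times> real \<Rightarrow> complex"
  assumes "cutoff \<phi>"
  shows "(\<exists>C>0. \<exists>C0>0. maximal_estimate \<phi> (\<lambda>N. C * N powr (1/2) * (1 + ln N) powr C0)) \<and>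
         (\<exists>C>0. maximal_estimate \<phi> (\<lambda>N. C * N powr (1/2) * (1 + ln N) powr 1)) \<and>
         (\<forall>\<epsilon>>0. \<exists>C>0. maximal_estimate \<phi> (\<lambda>N. C * N powr (1/2 + \<epsilon>))) \<and>
         (\<forall>\<delta>>0. \<not> (\<exists>C>0. maximal_estimate \<phi> (\<lambda>N. C * N powr (1/2 - \<delta>))))"
proof -
  obtain C where C: "C > 0" and est: "maximal_estimate \<phi> (\<lambda>N. C * N powr (1/2) * (1 + ln N))"
    using maximal_estimate_log[OF assms] by blast
  have est1: "maximal_estimate \<phi> (\<lambda>N. C * N powr (1/2) * (1 + ln N) powr 1)"
  proof (rule maximal_estimate_mono[OF est])
    fix N :: real assume "N \<ge> 2"
    \<comment> \<open>Nonnegativity is what identifies \<open>x powr 1\<close> with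
      \<open>x\<close>.\<close>
    then have "1 + ln N \<ge> 0" by simp
    then show "C * N powr (1/2) * (1 + ln N) \<le> C * N powr (1/2) * (1 + ln N) powr 1" by simp
  qed
  have est\<epsilon>: "\<exists>C>0. maximal_estimate \<phi> (\<lambda>N. C * N powr (1/2 + \<epsilon>))" if \<epsilon>: "\<epsilon> > 0" for \<epsilon>
  proof (intro exI conjI)
    show "C * (1 + 1 / \<epsilon>) > 0" using C \<epsilon> by (intro mult_pos_pos add_pos_pos) auto
    show "maximal_estimate \<phi> (\<lambda>N. C * (1 + 1 / \<epsilon>) * N powr (1/2 + \<epsilon>))"
    proof (rule maximal_estimate_mono[OF est])
      fix N :: real assume N: "N \<ge> 2"
      have "C * N powr (1/2) * (1 + ln N) \<le> C * N powr (1/2) * ((1 + 1 / \<epsilon>) * N powr \<epsilon>)"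
        using C N \<epsilon> by (intro mult_left_mono one_plus_ln_le_powr) auto
      also have "\<dots> = C * (1 + 1 / \<epsilon>) * N powr (1/2 + \<epsilon>)" by (simp add: powr_add)
      finally show "C * N powr (1/2) * (1 + ln N) \<le> C * (1 + 1 / \<epsilon>) * N powr (1/2 + \<epsilon>)" .
    qed
  qed
  have opt: "\<not> (\<exists>C>0. maximal_estimate \<phi> (\<lambda>N. C * N powr (1/2 - \<delta>)))" if \<delta>: "\<delta> > 0" for \<delta>
  proof
    assume "\<exists>C>0. maximal_estimate \<phi> (\<lambda>N. C * N powr (1/2 - \<delta>))"
    then obtain C where C: "C > 0" and e: "maximal_estimate \<phi> (\<lambda>N. C * N powr (1/2 - \<delta>))" by blast
    \<comment> \<open>For N = 2 ^ Suc n the quantity \<open>N powr (2 * \<delta>)\<close> equals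
      \<open>b ^ Suc n\<close>, a geometric sequence that outgrows every constant; the
      \<open>Suc\<close> ensures N \<ge> 2 even when n = 0.\<close>
    define b where "b = 2 powr (2 * \<delta>)"
    have "b > 1" unfolding b_def using \<delta> by simp
    then obtain n where n: "250 * pi\<^sup>2 * C\<^sup>2 < b ^ n" using real_arch_pow by blast
    define N where "N = (2::real) ^ Suc n"
    have N: "dyadic N" "N \<ge> 2" unfolding dyadic_def N_def
      by (auto intro!: exI[of _ "int (Suc n)"] simp: power_int_def nat_add_distrib)
    have "N \<le> 250 * pi\<^sup>2 * (C * N powr (1/2 - \<delta>))\<^sup>2"
      using maximal_estimate_lower[OF assms e N] C N by simp
    also have "(C * N powr (1/2 - \<delta>))\<^sup>2 = C\<^sup>2 * (N * N powr (- 2 * \<delta>))"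
    proof -
      have "(N powr (1/2 - \<delta>))\<^sup>2 = N powr (1 + - 2 * \<delta>)"
        unfolding power2_eq_square powr_add[symmetric] by simp
      also have "\<dots> = N * N powr (- 2 * \<delta>)" unfolding powr_add using N by simp
      finally show ?thesis by (simp add: power_mult_distrib)
    qed
    finally have "N * 1 \<le> N * (250 * pi\<^sup>2 * C\<^sup>2 * N powr (- 2 * \<delta>))" by (simp add: mult_ac)
    then have "1 \<le> 250 * pi\<^sup>2 * C\<^sup>2 * N powr (- 2 * \<delta>)" using N by (subst (asm) mult_le_cancel_left_pos) auto
    then have "N powr (2 * \<delta>) \<le> 250 * pi\<^sup>2 * C\<^sup>2"
      using N by (simp add: powr_minus field_simps)
    moreover have "b ^ n \<le> N powr (2 * \<delta>)"
    proof -
      have "b ^ n \<le> b ^ Suc n" using \<open>b > 1\<close> by simp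
      also have "b ^ Suc n = b powr real (Suc n)" using \<open>b > 1\<close> by (subst powr_realpow) auto
      also have "\<dots> = (2 powr real (Suc n)) powr (2 * \<delta>)" unfolding b_def powr_powr by (simp only: mult.commute)
      also have "2 powr real (Suc n) = N" unfolding N_def by (rule powr_realpow) simp
      finally show ?thesis .
    qed
    ultimately show False using n by linarith
  qed
  have "\<exists>C0>0. maximal_estimate \<phi> (\<lambda>N. C * N powr (1/2) * (1 + ln N) powr C0)"
    by (intro exI[of _ 1] conjI est1) simp
  with C have "\<exists>C>0. \<exists>C0>0. maximal_estimate \<phi> (\<lambda>N. C * N powr (1/2) * (1 + ln N) powr C0)" by blast
  moreover have "\<exists>C>0. maximal_estimate \<phi> (\<lambda>N. C * N powr (1/2) * (1 + ln N) powr 1)" using C est1 by blast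
  ultimately show ?thesis using est\<epsilon> opt by (intro conjI allI impI)
qed

end
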